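(* Let $\mathcal{C}$ be a $k$-linear Krull-Schmidt cyclic category and let $\sigma=(\mathcal{Q},Z,\phi,q)$ be a stability condition on $\mathcal{C}$. Suppose that the Maslov indices of all basic loops in $\mathcal{C}$ are zero. Then there are $\mathbb{Z}$-lifts $\widetilde{\mathcal{C}}$ of $\mathcal{C}$ and $\widetilde{\sigma}$ of $\sigma$ (as constructed in the context): $\widetilde{\mathcal{C}}$, with its shift functor and its class of distinguished triangles, is a triangulated category, and $\widetilde{\sigma}$ is a Bridgeland stability condition on $\widetilde{\mathcal{C}}$.
   Context: **Cyclic categories.** A cyclic category is a triangulated category $\mathcal{C}$ with a canonical isomorphism of functors $\beta:[2]\simeq id$. It is always assumed $k$-linear ($k$ a field), Krull-Schmidt (every object is a finite direct sum of indecomposables, uniquely up to isomorphism, and endomorphism rings of indecomposables are local) and essentially small. **Real decompositions.** A real decomposition of $\mathcal{C}$ is a grading $Hom_{\mathcal{C}}(E,F)=\bigoplus_{a\in\mathbb{R}}Hom_a(E,F)$ for all indecomposable $E,F$ such that: (1) $f\in Hom_a(E,F)$ implies $f[1]\in Hom_a(E[1],F[1])$; (2) $f\in Hom_a(E,F)$, $g\in Hom_b(F,G)$ imply $g\circ f\in Hom_{a+b}(E,G)$; (3) $id_E\in Hom_0(E,E)$ and $\beta_E\in Hom_0(E[2],E)$; (4) elements of $Hom_a(E,F)$ are called homogeneous of degree $a$, and every homogeneous isomorphism has degree $0$. The degree function $q$ sends a nonzero homogeneous morphism to its degree. **Connecting paths and liftable diagrams.** A morphism $f:\bigoplus_i A_i\to\bigoplus_j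 B_j$ ($A_i,B_j$ nontrivial indecomposables) is quasi-homogeneous if all its components $A_i\to B_j$ are homogeneous. A connecting path $l:E_0\dashrightarrow E_n$ is a sequence of indecomposables $E_0,\dots,E_n$ with nonzero homogeneous $f_i$ in $Hom(E_i,E_{i+1})$ (sign $+1$) or in $Hom(E_{i+1},E_i)$ (sign $-1$), $0\le i\le n-1$; $q(l)=\sum_i \mathrm{Sign}(f_i)q(f_i)$. It is a connecting loop if $E_0=E_n$, and simple if it contains no connecting loop. All commutative diagrams have associated directed graphs without self-loops or multiple edges. In a diagram each object is written as a finite direct sum of nontrivial indecomposables; a connecting path is in a diagram $\mathbf{D}$ with quasi-homogeneous morphisms if each $f_i$ is a component of a morphism of $\mathbf{D}$ (summands at different vertices are regarded as different; loops in $\mathbf{D}$ begin and end at the same summand of the same vertex). A commutative diagram $\mathbf{D}$ is liftable if all its morphisms are quasi-homogeneous and $q(l)=0$ for every connecting loop $l$ in $\mathbf{D}$. It is locally liftable if every sub-diagram whose graph is simply connected is liftable. A liftable commutative diagram is connective if any two nontrivial indecomposable summands of objects in it are joined by a connecting path in it. **Pre-liftability.** $\mathcal{C}$ is pre-liftable with respect to a real decomposition if: (1) every liftable quasi-homogeneous morphism $f:A\to B$ can be completed to a distinguished triangle $A\xrightarrow{f}B\xrightarrow{g}C\xrightarrow{h}A[1]$ such that the infinite diagram $\cdots\to A[-1]\xrightarrow{h[-1]}$ $A\xrightarrow{f}B\xrightarrow{g}C\xrightarrow{h}A[1]\xrightarrow{f[1]}B[1]\to\cdots$ (with $h[-1]$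 understood as the shifted connecting map $C[-1]\to A$) is liftable; (2) whenever distinguished triangles $X\xrightarrow{u}Y\xrightarrow{j}Z'\xrightarrow{k}X[1]$, $X\xrightarrow{v\circ u}Z\xrightarrow{m}Y'\xrightarrow{n}X[1]$, $Y\xrightarrow{v}Z\xrightarrow{l}X'\xrightarrow{i}Y[1]$ (with $id_X$, $id_{X[1]}$ joining the first two) form a liftable commutative diagram, it can be completed, by a distinguished triangle $Z'\xrightarrow{f}Y'\xrightarrow{g}X'\xrightarrow{h}Z'[1]$ and the maps $id_{X'}$ and $j[1]:Y[1]\to Z'[1]$, to a liftable commutative diagram (so $f\circ j=m\circ v$, $g\circ m=l$, $h=j[1]\circ i$, $n\circ f=k$). **Stability conditions on $\mathcal{C}$.** A stability condition $\sigma=(\mathcal{Q},Z,\phi,q)$ consists of full subcategories $\mathcal{Q}(\psi)\subset\mathcal{C}$, $\psi\in(0,2]$ (closed under isomorphisms, finite direct sums and direct summands; their objects are called semi-stable), a central charge $Z:K_0(\mathcal{C})\xrightarrow{v}\Lambda\to\mathbb{C}$ (a homomorphism factoring through a fixed homomorphism $v$ to a lattice $\Lambda$ of finite rank), a map $\phi$ from indecomposable objects to $(0,2]$, and the degree function $q$ of a real decomposition with respect to which $\mathcal{C}$ is pre-liftable, such that: (1) $\phi(E[1])\equiv\phi(E)+1 \pmod{2\mathbb{Z}}$; (2) $Z(E)=m(E)e^{i\pi\phi(E)}$ with $m(E)\in\mathbb{R}_{\ge0}$ for indecomposable $E$; (3) $q(f)\equiv\phi(E_2)-\phi(E_1)\pmod{2\mathbb{Z}}$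 for every nonzero homogeneous $f:E_1\to E_2$ between indecomposables; (4) $\mathcal{Q}(\psi)[1]=\mathcal{Q}(\psi')$ for $\psi,\psi'\in(0,2]$, $\psi'\equiv\psi+1\pmod{2\mathbb{Z}}$; (5) if $E\in\mathcal{Q}(\psi)$ (indecomposable) then $m(E)>0$ and $\phi(E)=\psi$; (6) for a nonzero homogeneous $f:E_1\to E_2$ with $E_k\in\mathcal{Q}(\phi_k)$, $k=1,2$, one has $q(f)\ge0$; (7) every indecomposable $E$ has a Harder-Narasimhan filtration: morphisms $0=E_0\xrightarrow{f_1}E_1\xrightarrow{f_2}\cdots\xrightarrow{f_n}E_n=E$ and $p_i:E_i\to Q_i$ with $Q_i\in\mathcal{Q}(\phi_i)$ nontrivial, such that: (a) the diagram with columns $E_{i-1}\xrightarrow{f_i}E_i\xrightarrow{p_i}Q_i$, $1\le i\le n$, and identity arrows from $E_i$ in column $i$ to $E_i$ in column $i+1$ (and $0=E_0\xrightarrow{id}E_0$) is connective and liftable; (b) it can be completed to a liftable diagram (the Harder-Narasimhan diagram of $E$) with columns $\cdots\to E_{i-1}\xrightarrow{f_i}E_i\xrightarrow{p_i}Q_i\xrightarrow{t_i}E_{i-1}[1]\xrightarrow{f_i[1]}E_i[1]\to\cdots$ and identity arrows from $E_i[d]$ in column $i$ to $E_i[d]$ in column $i+1$, where each $E_{i-1}\xrightarrow{f_i}E_i\xrightarrow{p_i}Q_i\xrightarrow{t_i}E_{i-1}[1]$ is a distinguished triangle; (c) for each $2\le i\le n$ there is a real number $c_i<0$ such that any indecomposable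 summands $Q_{i-1,1}$ of $Q_{i-1}$ and $Q_{i,1}$ of $Q_i$ are joined by a simple connecting path from $Q_{i-1,1}$ to $Q_{i,1}$ in the diagram, and every such simple connecting path $l$ has $q(l)=c_i$. **Basic loops and Maslov index.** A fundamental distinguished hexagon is a locally liftable diagram $A\xrightarrow{f}B\xrightarrow{g}C\xrightarrow{h}A[1]\xrightarrow{f[1]}B[1]\xrightarrow{g[1]}C[1]\xrightarrow{\beta_A\circ h[1]}A$, where $A=\bigoplus A_i$, $B=\bigoplus B_j$, $C=\bigoplus C_r$ with indecomposable summands and $A\xrightarrow{f}B\xrightarrow{g}C\xrightarrow{h}A[1]$ is a distinguished triangle. A basic loop is $l=\beta_{A_i}\circ p[1]\circ p$ where $p:A_i\dashrightarrow A_i[1]$ is a connecting path in the diagram of the distinguished triangle; its Maslov index is $M(l)=\frac{q(p)-1}{2}$. **$\mathbb{Z}$-lifts.** $\widetilde{\mathcal{C}}$ is the $k$-linear additive category whose indecomposable objects are pairs $(E,\theta)$ with $E\in\mathcal{C}$ indecomposable, $\theta\in\mathbb{R}$, $\theta\equiv\phi(E)\pmod{2\mathbb{Z}}$ (objects are finite direct sums of these), with $Hom_{\widetilde{\mathcal{C}}}((E_1,\theta_1),(E_2,\theta_2))=Hom_{\theta_2-\theta_1}(E_1,E_2)$ and composition as in $\mathcal{C}$. The functor $\pi:\widetilde{\mathcal{C}}\to\mathcal{C}$ sends $(E,\theta)$ to $E$ and is the inclusion on morphisms. The shift is $(E,\theta)[1]=(E[1],\theta+1)$, acting on morphisms as in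 $\mathcal{C}$. A triangle in $\widetilde{\mathcal{C}}$ is distinguished if and only if its image under $\pi$ is distinguished. The lift $\widetilde{\sigma}=(\mathcal{P},\widetilde{Z})$ has $\widetilde{Z}:K_0(\widetilde{\mathcal{C}})\xrightarrow{\pi_0}K_0(\mathcal{C})\xrightarrow{Z}\mathbb{C}$ ($\pi_0$ induced by $\pi$), and $\mathcal{P}(\theta)$ the full subcategory of (finite direct sums of) objects $(E,\theta)$ with $E\in\mathcal{Q}(\theta')$, $\theta'\equiv\theta\pmod{2\mathbb{Z}}$, $\theta'\in(0,2]$. **Bridgeland stability conditions.** A Bridgeland stability condition on a triangulated category $\mathcal{D}$ is a pair $(\mathcal{P},Z)$ with $Z:K_0(\mathcal{D})\to\mathbb{C}$ a homomorphism factoring through a fixed homomorphism $K_0(\mathcal{D})\to\Lambda$ to a lattice of finite rank, and full subcategories $\mathcal{P}(\theta)$, $\theta\in\mathbb{R}$, such that: (a) nonzero $E\in\mathcal{P}(\theta)$ has $Z(E)=m(E)e^{i\pi\theta}$, $m(E)>0$; (b) $\mathcal{P}(\theta+1)=\mathcal{P}(\theta)[1]$; (c) $Hom(A_1,A_2)=0$ if $A_j\in\mathcal{P}(\theta_j)$, $\theta_1>\theta_2$; (d) every $0\ne E$ has a sequence $0=E_0\to E_1\to\cdots\to E_m=E$ and reals $\theta_1>\cdots>\theta_m$ with the cone of $E_{j-1}\to E_j$ in $\mathcal{P}(\theta_j)$. No support property is required. For $\widetilde{\mathcal{C}}$ the fixed homomorphism is $K_0(\widetilde{\mathcal{C}})\xrightarrow{\pi_0}K_0(\mathcal{C})\xrightarrow{v}\Lambda$.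 *)

theory Defs
  imports Complex_Main "HOL-Algebra.Module" "HOL-Algebra.Generated_Groups"
    "HOL-Algebra.Free_Abelian_Groups" "HOL-Library.Real_Mod"
begin

section \<open>Linear and triangulated categories\<close>

text \<open>
  The shift is a strict action of the integers: \<open>Shift C d X\<close> is \<open>X[d]\<close> and \<open>ShiftM C d f\<close>
  is \<open>f[d]\<close>, i.e. the shift functor is an automorphism with inverse \<open>[-1]\<close>.
  \<open>(X, Y, Z, f, g, h) \<in> Tri C\<close> means that \<open>X \<rightarrow> Y \<rightarrow> Z \<rightarrow> X[1]\<close> with maps \<open>f\<close>, \<open>g\<close>, \<open>h\<close> is
  distinguished.  \<open>Comp C g f\<close> is \<open>g \<circ> f\<close>.  The ground field is a ring \<open>K\<close> of the algebra library
  and each Hom is a module over it.  Hom-sets of different pairs of objects may overlap: this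
  includes all categories with disjoint Hom-sets, and lets a subcategory-like construction
  (the lift below) reuse the morphisms of the original category.
\<close>

record ('o, 'm, 'k) tricat =
  Ob :: "'o set"
  Hom :: "'o \<Rightarrow> 'o \<Rightarrow> ('k, 'm) module"
  Idm :: "'o \<Rightarrow> 'm"
  Comp :: "'m \<Rightarrow> 'm \<Rightarrow> 'm"
  Shift :: "int \<Rightarrow> 'o \<Rightarrow> 'o"
  ShiftM :: "int \<Rightarrow> 'm \<Rightarrow> 'm"
  Tri :: "('o \<times> 'o \<times> 'o \<times> 'm \<times> 'm \<times> 'm) set"

abbreviation mor :: "('o, 'm, 'k) tricat \<Rightarrow> 'o \<Rightarrow> 'o \<Rightarrow> 'm set" where
  "mor C X Y \<equiv> carrier (Hom C X Y)"

abbreviation zerom :: "('o, 'm, 'k) tricat \<Rightarrow> 'o \<Rightarrow> 'o \<Rightarrow> 'm" where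
  "zerom C X Y \<equiv> \<zero>\<^bsub>Hom C X Y\<^esub>"

locale linear_category =
  fixes K :: "'k ring" and C :: "('o, 'm, 'k) tricat"
  assumes field_K: "Ring.field K"
    and Hom_module: "\<lbrakk>X \<in> Ob C; Y \<in> Ob C\<rbrakk> \<Longrightarrow> Module.module K (Hom C X Y)"
    and Idm_closed: "X \<in> Ob C \<Longrightarrow> Idm C X \<in> mor C X X"
    and Comp_closed: "\<lbrakk>X \<in> Ob C; Y \<in> Ob C; Z \<in> Ob C; f \<in> mor C X Y; g \<in> mor C Y Z\<rbrakk>
          \<Longrightarrow> Comp C g f \<in> mor C X Z"
    and Comp_assoc: "\<lbrakk>W \<in> Ob C; X \<in> Ob C; Y \<in> Ob C; Z \<in> Ob C;
            f \<in> mor C W X; g \<in> mor C X Y; h \<in> mor C Y Z\<rbrakk>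
          \<Longrightarrow> Comp C h (Comp C g f) = Comp C (Comp C h g) f"
    and Comp_Idm: "\<lbrakk>X \<in> Ob C; Y \<in> Ob C; f \<in> mor C X Y\<rbrakk> \<Longrightarrow> Comp C f (Idm C X) = f"
    and Idm_Comp: "\<lbrakk>X \<in> Ob C; Y \<in> Ob C; f \<in> mor C X Y\<rbrakk> \<Longrightarrow> Comp C (Idm C Y) f = f"
    and Comp_add_right: "\<lbrakk>X \<in> Ob C; Y \<in> Ob C; Z \<in> Ob C; f \<in> mor C X Y; f' \<in> mor C X Y; g \<in> mor C Y Z\<rbrakk>
          \<Longrightarrow> Comp C g (f \<oplus>\<^bsub>Hom C X Y\<^esub> f') = Comp C g f \<oplus>\<^bsub>Hom C X Z\<^esub> Comp C g f'"
    and Comp_add_left: "\<lbrakk>X \<in> Ob C; Y \<in> Ob C; Z \<in> Ob C; f \<in> mor C X Y; g \<in> mor C Y Z; g' \<in> mor C Y Z\<rbrakk>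
          \<Longrightarrow> Comp C (g \<oplus>\<^bsub>Hom C Y Z\<^esub> g') f = Comp C g f \<oplus>\<^bsub>Hom C X Z\<^esub> Comp C g' f"
    and Comp_smult_right: "\<lbrakk>X \<in> Ob C; Y \<in> Ob C; Z \<in> Ob C; a \<in> carrier K; f \<in> mor C X Y; g \<in> mor C Y Z\<rbrakk>
          \<Longrightarrow> Comp C g (a \<odot>\<^bsub>Hom C X Y\<^esub> f) = a \<odot>\<^bsub>Hom C X Z\<^esub> Comp C g f"
    and Comp_smult_left: "\<lbrakk>X \<in> Ob C; Y \<in> Ob C; Z \<in> Ob C; a \<in> carrier K; f \<in> mor C X Y; g \<in> mor C Y Z\<rbrakk>
          \<Longrightarrow> Comp C (a \<odot>\<^bsub>Hom C Y Z\<^esub> g) f = a \<odot>\<^bsub>Hom C X Z\<^esub> Comp C g f"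

definition is_isom :: "('o, 'm, 'k) tricat \<Rightarrow> 'o \<Rightarrow> 'o \<Rightarrow> 'm \<Rightarrow> bool" where
  "is_isom C X Y f \<longleftrightarrow> f \<in> mor C X Y \<and>
     (\<exists>g \<in> mor C Y X. Comp C g f = Idm C X \<and> Comp C f g = Idm C Y)"

definition isomorphic :: "('o, 'm, 'k) tricat \<Rightarrow> 'o \<Rightarrow> 'o \<Rightarrow> bool" where
  "isomorphic C X Y \<longleftrightarrow> (\<exists>f. is_isom C X Y f)"

definition zero_obj :: "('o, 'm, 'k) tricat \<Rightarrow> 'o \<Rightarrow> bool" where
  "zero_obj C X \<longleftrightarrow> X \<in> Ob C \<and>
     (\<forall>Y \<in> Ob C. mor C X Y = {zerom C X Y} \<and> mor C Y X = {zerom C Y X})"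

definition biproduct ::
    "('o, 'm, 'k) tricat \<Rightarrow> 'o \<Rightarrow> 'o \<Rightarrow> 'o \<Rightarrow> 'm \<Rightarrow> 'm \<Rightarrow> 'm \<Rightarrow> 'm \<Rightarrow> bool" where
  "biproduct C A B X i1 i2 p1 p2 \<longleftrightarrow>
     A \<in> Ob C \<and> B \<in> Ob C \<and> X \<in> Ob C \<and>
     i1 \<in> mor C A X \<and> i2 \<in> mor C B X \<and> p1 \<in> mor C X A \<and> p2 \<in> mor C X B \<and>
     Comp C p1 i1 = Idm C A \<and> Comp C p2 i2 = Idm C B \<and>
     Comp C p2 i1 = zerom C A B \<and> Comp C p1 i2 = zerom C B A \<and>
     Comp C i1 p1 \<oplus>\<^bsub>Hom C X X\<^esub> Comp C i2 p2 = Idm C X"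

definition direct_sum :: "('o, 'm, 'k) tricat \<Rightarrow> 'o \<Rightarrow> 'o \<Rightarrow> 'o \<Rightarrow> bool" where
  "direct_sum C A B X \<longleftrightarrow> (\<exists>i1 i2 p1 p2. biproduct C A B X i1 i2 p1 p2)"

locale additive_category = linear_category +
  assumes ex_zero_obj: "\<exists>X. zero_obj C X"
    and ex_direct_sum: "\<lbrakk>A \<in> Ob C; B \<in> Ob C\<rbrakk> \<Longrightarrow> \<exists>X. direct_sum C A B X"

locale category_with_shift = additive_category +
  assumes Shift_closed: "X \<in> Ob C \<Longrightarrow> Shift C d X \<in> Ob C"
    and Shift_0: "X \<in> Ob C \<Longrightarrow> Shift C 0 X = X"
    and Shift_add: "X \<in> Ob C \<Longrightarrow> Shift C (a + b) X = Shift C a (Shift C b X)"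
    and ShiftM_closed: "\<lbrakk>X \<in> Ob C; Y \<in> Ob C; f \<in> mor C X Y\<rbrakk>
          \<Longrightarrow> ShiftM C d f \<in> mor C (Shift C d X) (Shift C d Y)"
    and ShiftM_0: "\<lbrakk>X \<in> Ob C; Y \<in> Ob C; f \<in> mor C X Y\<rbrakk> \<Longrightarrow> ShiftM C 0 f = f"
    and ShiftM_add: "\<lbrakk>X \<in> Ob C; Y \<in> Ob C; f \<in> mor C X Y\<rbrakk>
          \<Longrightarrow> ShiftM C (a + b) f = ShiftM C a (ShiftM C b f)"
    and ShiftM_Idm: "X \<in> Ob C \<Longrightarrow> ShiftM C d (Idm C X) = Idm C (Shift C d X)"
    and ShiftM_Comp: "\<lbrakk>X \<in> Ob C; Y \<in> Ob C; Z \<in> Ob C; f \<in> mor C X Y; g \<in> mor C Y Z\<rbrakk>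
          \<Longrightarrow> ShiftM C d (Comp C g f) = Comp C (ShiftM C d g) (ShiftM C d f)"
    and ShiftM_plus: "\<lbrakk>X \<in> Ob C; Y \<in> Ob C; f \<in> mor C X Y; g \<in> mor C X Y\<rbrakk>
          \<Longrightarrow> ShiftM C d (f \<oplus>\<^bsub>Hom C X Y\<^esub> g)
            = ShiftM C d f \<oplus>\<^bsub>Hom C (Shift C d X) (Shift C d Y)\<^esub> ShiftM C d g"
    and ShiftM_smult: "\<lbrakk>X \<in> Ob C; Y \<in> Ob C; c \<in> carrier K; f \<in> mor C X Y\<rbrakk>
          \<Longrightarrow> ShiftM C d (c \<odot>\<^bsub>Hom C X Y\<^esub> f)
            = c \<odot>\<^bsub>Hom C (Shift C d X) (Shift C d Y)\<^esub> ShiftM C d f"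

locale triangulated_category = category_with_shift +
  assumes Tri_typed: "(X, Y, Z, f, g, h) \<in> Tri C \<Longrightarrow>
          X \<in> Ob C \<and> Y \<in> Ob C \<and> Z \<in> Ob C \<and>
          f \<in> mor C X Y \<and> g \<in> mor C Y Z \<and> h \<in> mor C Z (Shift C 1 X)"
    and TR1_iso: "\<lbrakk>(X, Y, Z, f, g, h) \<in> Tri C;
            X' \<in> Ob C; Y' \<in> Ob C; Z' \<in> Ob C;
            f' \<in> mor C X' Y'; g' \<in> mor C Y' Z'; h' \<in> mor C Z' (Shift C 1 X');
            is_isom C X X' a; is_isom C Y Y' b; is_isom C Z Z' c;
            Comp C b f = Comp C f' a; Comp C c g = Comp C g' b;
            Comp C (ShiftM C 1 a) h = Comp C h' c\<rbrakk>
          \<Longrightarrow> (X', Y', Z', f', g', h') \<in> Tri C"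
    and TR1_id: "\<lbrakk>X \<in> Ob C; zero_obj C N\<rbrakk>
          \<Longrightarrow> (X, X, N, Idm C X, zerom C X N, zerom C N (Shift C 1 X)) \<in> Tri C"
    and TR1_cone: "\<lbrakk>X \<in> Ob C; Y \<in> Ob C; f \<in> mor C X Y\<rbrakk>
          \<Longrightarrow> \<exists>Z g h. (X, Y, Z, f, g, h) \<in> Tri C"
    and TR2: "\<lbrakk>X \<in> Ob C; Y \<in> Ob C; Z \<in> Ob C;
            f \<in> mor C X Y; g \<in> mor C Y Z; h \<in> mor C Z (Shift C 1 X)\<rbrakk>
          \<Longrightarrow> (X, Y, Z, f, g, h) \<in> Tri C \<longleftrightarrow>
              (Y, Z, Shift C 1 X, g, h,
                 \<ominus>\<^bsub>Hom C (Shift C 1 X) (Shift C 1 Y)\<^esub> ShiftM C 1 f) \<in> Tri C"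
    and TR3: "\<lbrakk>(X, Y, Z, f, g, h) \<in> Tri C; (X', Y', Z', f', g', h') \<in> Tri C;
            a \<in> mor C X X'; b \<in> mor C Y Y'; Comp C b f = Comp C f' a\<rbrakk>
          \<Longrightarrow> \<exists>c \<in> mor C Z Z'. Comp C c g = Comp C g' b \<and>
                 Comp C (ShiftM C 1 a) h = Comp C h' c"
    and TR4: "\<lbrakk>(X, Y, Z', u, j, k) \<in> Tri C; (X, Z, Y', Comp C v u, m, n) \<in> Tri C;
            (Y, Z, X', v, l, i) \<in> Tri C\<rbrakk>
          \<Longrightarrow> \<exists>f g. (Z', Y', X', f, g, Comp C (ShiftM C 1 j) i) \<in> Tri C \<and>
                 Comp C f j = Comp C m v \<and> Comp C g m = l \<and>
                 Comp C n f = k \<and> Comp C i g = Comp C (ShiftM C 1 u) n"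

section \<open>Direct sum decompositions and Krull-Schmidt categories\<close>

definition indecomposable :: "('o, 'm, 'k) tricat \<Rightarrow> 'o \<Rightarrow> bool" where
  "indecomposable C X \<longleftrightarrow> X \<in> Ob C \<and> \<not> zero_obj C X \<and>
     (\<forall>A B. direct_sum C A B X \<longrightarrow> zero_obj C A \<or> zero_obj C B)"

text \<open>
  A decomposed object is an object together with the list of its indecomposable summands
  \<open>(E\<^sub>i, \<iota>\<^sub>i, p\<^sub>i)\<close>, where \<open>\<iota>\<^sub>i : E\<^sub>i \<rightarrow> X\<close> and \<open>p\<^sub>i : X \<rightarrow> E\<^sub>i\<close> are the structure maps of the direct sum.
  The empty list is a decomposition of a zero object.
\<close>

type_synonym ('o, 'm) dec = "'o \<times> ('o \<times> 'm \<times> 'm) list"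

abbreviation tot :: "('o, 'm) dec \<Rightarrow> 'o" where
  "tot D \<equiv> fst D"

abbreviation nsum :: "('o, 'm) dec \<Rightarrow> nat" where
  "nsum D \<equiv> length (snd D)"

definition smd :: "('o, 'm) dec \<Rightarrow> nat \<Rightarrow> 'o" where
  "smd D i = fst (snd D ! i)"

definition incl :: "('o, 'm) dec \<Rightarrow> nat \<Rightarrow> 'm" where
  "incl D i = fst (snd (snd D ! i))"

definition proj :: "('o, 'm) dec \<Rightarrow> nat \<Rightarrow> 'm" where
  "proj D i = snd (snd (snd D ! i))"

definition is_dec :: "('o, 'm, 'k) tricat \<Rightarrow> ('o, 'm) dec \<Rightarrow> bool" where
  "is_dec C D \<longleftrightarrow> tot D \<in> Ob C \<and>
     (\<forall>i < nsum D. indecomposable C (smd D i) \<and>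
        incl D i \<in> mor C (smd D i) (tot D) \<and> proj D i \<in> mor C (tot D) (smd D i)) \<and>
     (\<forall>i < nsum D. \<forall>j < nsum D. Comp C (proj D j) (incl D i) =
        (if i = j then Idm C (smd D i) else zerom C (smd D i) (smd D j))) \<and>
     finsum (Hom C (tot D) (tot D)) (\<lambda>i. Comp C (incl D i) (proj D i)) {..<nsum D} = Idm C (tot D)"

definition single_dec :: "('o, 'm, 'k) tricat \<Rightarrow> 'o \<Rightarrow> ('o, 'm) dec" where
  "single_dec C E = (E, [(E, Idm C E, Idm C E)])"

definition shift_dec :: "('o, 'm, 'k) tricat \<Rightarrow> int \<Rightarrow> ('o, 'm) dec \<Rightarrow> ('o, 'm) dec" where
  "shift_dec C d D =
     (Shift C d (tot D), map (\<lambda>(E, i, p). (Shift C d E, ShiftM C d i, ShiftM C d p)) (snd D))"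

definition component ::
    "('o, 'm, 'k) tricat \<Rightarrow> ('o, 'm) dec \<Rightarrow> ('o, 'm) dec \<Rightarrow> 'm \<Rightarrow> nat \<Rightarrow> nat \<Rightarrow> 'm" where
  "component C A B f i j = Comp C (Comp C (proj B j) f) (incl A i)"

locale krull_schmidt_category = additive_category +
  assumes ex_dec: "X \<in> Ob C \<Longrightarrow> \<exists>D. is_dec C D \<and> tot D = X"
    and dec_unique: "\<lbrakk>is_dec C D; is_dec C D'; tot D = tot D'\<rbrakk> \<Longrightarrow>
          \<exists>\<tau>. bij_betw \<tau> {..<nsum D} {..<nsum D'} \<and>
              (\<forall>i < nsum D. isomorphic C (smd D i) (smd D' (\<tau> i)))"
    and End_local: "\<lbrakk>indecomposable C E; f \<in> mor C E E; g \<in> mor C E E;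
            \<not> is_isom C E E f; \<not> is_isom C E E g\<rbrakk>
          \<Longrightarrow> \<not> is_isom C E E (f \<oplus>\<^bsub>Hom C E E\<^esub> g)"

text \<open>Every category in this encoding is small, so essential smallness needs no assumption.\<close>

locale cyclic_category = triangulated_category + krull_schmidt_category +
  fixes \<beta> :: "'b \<Rightarrow> 'c"
  assumes beta_iso: "X \<in> Ob C \<Longrightarrow> is_isom C (Shift C 2 X) X (\<beta> X)"
    and beta_natural: "\<lbrakk>X \<in> Ob C; Y \<in> Ob C; f \<in> mor C X Y\<rbrakk>
          \<Longrightarrow> Comp C f (\<beta> X) = Comp C (\<beta> Y) (ShiftM C 2 f)"

section \<open>Real decompositions\<close>

text \<open>\<open>G a E F\<close> is the set of homogeneous morphisms \<open>E \<rightarrow> F\<close> of degree \<open>a\<close>; only its values at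
  indecomposable objects are relevant.\<close>

locale real_decomposition =
  fixes K :: "'k ring" and C :: "('o, 'm, 'k) tricat" and \<beta> :: "'o \<Rightarrow> 'm"
    and G :: "real \<Rightarrow> 'o \<Rightarrow> 'o \<Rightarrow> 'm set"
  assumes G_submodule: "\<lbrakk>indecomposable C E; indecomposable C F\<rbrakk>
          \<Longrightarrow> Module.submodule (G a E F) K (Hom C E F)"
    and G_direct_sum: "\<lbrakk>indecomposable C E; indecomposable C F; f \<in> mor C E F\<rbrakk> \<Longrightarrow>
          \<exists>!c. (\<forall>a. c a \<in> G a E F) \<and> finite {a. c a \<noteq> zerom C E F} \<and>
               f = finsum (Hom C E F) c {a. c a \<noteq> zerom C E F}"
    and G_shift: "\<lbrakk>indecomposable C E; indecomposable C F; f \<in> G a E F\<rbrakk>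
          \<Longrightarrow> ShiftM C 1 f \<in> G a (Shift C 1 E) (Shift C 1 F)"
    and G_Comp: "\<lbrakk>indecomposable C E; indecomposable C F; indecomposable C H;
            f \<in> G a E F; g \<in> G b F H\<rbrakk> \<Longrightarrow> Comp C g f \<in> G (a + b) E H"
    and G_Idm: "indecomposable C E \<Longrightarrow> Idm C E \<in> G 0 E E"
    and G_beta: "indecomposable C E \<Longrightarrow> \<beta> E \<in> G 0 (Shift C 2 E) E"
    and G_isom: "\<lbrakk>indecomposable C E; indecomposable C F; f \<in> G a E F; is_isom C E F f\<rbrakk> \<Longrightarrow> a = 0"

definition homogeneous :: "(real \<Rightarrow> 'o \<Rightarrow> 'o \<Rightarrow> 'm set) \<Rightarrow> 'o \<Rightarrow> 'o \<Rightarrow> 'm \<Rightarrow> bool" where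
  "homogeneous G E F f \<longleftrightarrow> (\<exists>a. f \<in> G a E F)"

text \<open>The degree function \<open>q\<close>; it is meaningful on nonzero homogeneous morphisms.\<close>

definition deg :: "(real \<Rightarrow> 'o \<Rightarrow> 'o \<Rightarrow> 'm set) \<Rightarrow> 'o \<Rightarrow> 'o \<Rightarrow> 'm \<Rightarrow> real" where
  "deg G E F f = (THE a. f \<in> G a E F)"

definition quasi_homogeneous ::
    "('o, 'm, 'k) tricat \<Rightarrow> (real \<Rightarrow> 'o \<Rightarrow> 'o \<Rightarrow> 'm set) \<Rightarrow>
     ('o, 'm) dec \<Rightarrow> ('o, 'm) dec \<Rightarrow> 'm \<Rightarrow> bool" where
  "quasi_homogeneous C G A B f \<longleftrightarrow> f \<in> mor C (tot A) (tot B) \<and>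
     (\<forall>i < nsum A. \<forall>j < nsum B. homogeneous G (smd A i) (smd B j) (component C A B f i j))"

section \<open>Connecting paths and liftable diagrams\<close>

text \<open>
  A connecting path starting at \<open>E\<close> is given by its list of steps \<open>(s, f, F)\<close>, where \<open>F\<close> is the
  next object and \<open>f\<close> goes forward to \<open>F\<close> if \<open>s\<close> (sign \<open>+1\<close>) and backward from \<open>F\<close> if not \<open>s\<close>
  (sign \<open>-1\<close>).
\<close>

fun conn_path ::
    "('o, 'm, 'k) tricat \<Rightarrow> (real \<Rightarrow> 'o \<Rightarrow> 'o \<Rightarrow> 'm set) \<Rightarrow>
     'o \<Rightarrow> (bool \<times> 'm \<times> 'o) list \<Rightarrow> 'o \<Rightarrow> bool" where
  "conn_path C G E [] E' \<longleftrightarrow> indecomposable C E \<and> E = E'"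
| "conn_path C G E ((s, f, F) # ps) E' \<longleftrightarrow>
     indecomposable C E \<and>
     (if s then homogeneous G E F f \<and> f \<noteq> zerom C E F
           else homogeneous G F E f \<and> f \<noteq> zerom C F E) \<and>
     conn_path C G F ps E'"

fun qpath :: "(real \<Rightarrow> 'o \<Rightarrow> 'o \<Rightarrow> 'm set) \<Rightarrow> 'o \<Rightarrow> (bool \<times> 'm \<times> 'o) list \<Rightarrow> real" where
  "qpath G E [] = 0"
| "qpath G E ((s, f, F) # ps) = (if s then deg G E F f else - deg G F E f) + qpath G F ps"

definition shift_path ::
    "('o, 'm, 'k) tricat \<Rightarrow> int \<Rightarrow> (bool \<times> 'm \<times> 'o) list \<Rightarrow> (bool \<times> 'm \<times> 'o) list" where
  "shift_path C d ps = map (\<lambda>(s, f, F). (s, ShiftM C d f, Shift C d F)) ps"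

record ('v, 'o, 'm) diagram =
  verts :: "'v set"
  edges :: "('v \<times> 'v) set"
  vobj :: "'v \<Rightarrow> ('o, 'm) dec"
  arr :: "'v \<times> 'v \<Rightarrow> 'm"

definition is_diagram :: "('o, 'm, 'k) tricat \<Rightarrow> ('v, 'o, 'm) diagram \<Rightarrow> bool" where
  "is_diagram C D \<longleftrightarrow> edges D \<subseteq> verts D \<times> verts D \<and> irrefl (edges D) \<and>
     (\<forall>x \<in> verts D. is_dec C (vobj D x)) \<and>
     (\<forall>(x, y) \<in> edges D. arr D (x, y) \<in> mor C (tot (vobj D x)) (tot (vobj D y)))"

definition directed_path :: "('v, 'o, 'm) diagram \<Rightarrow> 'v list \<Rightarrow> bool" where
  "directed_path D xs \<longleftrightarrow> xs \<noteq> [] \<and> set xs \<subseteq> verts D \<and> distinct xs \<and>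
     successively (\<lambda>x y. (x, y) \<in> edges D) xs"

fun composite :: "('o, 'm, 'k) tricat \<Rightarrow> ('v, 'o, 'm) diagram \<Rightarrow> 'v list \<Rightarrow> 'm" where
  "composite C D [] = undefined"
| "composite C D [x] = Idm C (tot (vobj D x))"
| "composite C D (x # y # xs) = Comp C (composite C D (y # xs)) (arr D (x, y))"

text \<open>
  Directed paths are taken without repeated vertices.  In graphs without directed cycles this is no
  restriction; in the cyclic hexagon below it prevents going round the cycle (which composes to
  zero) from being compared with an identity or with a single arrow.
\<close>

definition commutative_diagram :: "('o, 'm, 'k) tricat \<Rightarrow> ('v, 'o, 'm) diagram \<Rightarrow> bool" where
  "commutative_diagram C D \<longleftrightarrow> is_diagram C D \<and>
     (\<forall>xs ys. directed_path D xs \<and> directed_path D ys \<and> hd xs = hd ys \<and> last xs = last ys \<longrightarrow>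
        composite C D xs = composite C D ys)"

text \<open>
  A node \<open>(x, i)\<close> is the \<open>i\<close>-th indecomposable summand of the object at the vertex \<open>x\<close>.
  A path in a diagram is given by its start node and the list of its steps \<open>(sign, next node)\<close>;
  \<open>realise\<close> turns it into a connecting path of the category.
\<close>

definition nodes :: "('v, 'o, 'm) diagram \<Rightarrow> ('v \<times> nat) set" where
  "nodes D = {(x, i). x \<in> verts D \<and> i < nsum (vobj D x)}"

definition node_obj :: "('v, 'o, 'm) diagram \<Rightarrow> 'v \<times> nat \<Rightarrow> 'o" where
  "node_obj D a = smd (vobj D (fst a)) (snd a)"

definition arr_comp :: "('o, 'm, 'k) tricat \<Rightarrow> ('v, 'o, 'm) diagram \<Rightarrow> 'v \<times> nat \<Rightarrow> 'v \<times> nat \<Rightarrow> 'm" where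
  "arr_comp C D a b =
     component C (vobj D (fst a)) (vobj D (fst b)) (arr D (fst a, fst b)) (snd a) (snd b)"

fun walk :: "('v, 'o, 'm) diagram \<Rightarrow> 'v \<times> nat \<Rightarrow> (bool \<times> 'v \<times> nat) list \<Rightarrow> 'v \<times> nat \<Rightarrow> bool" where
  "walk D a [] b \<longleftrightarrow> a \<in> nodes D \<and> a = b"
| "walk D a ((s, c) # ps) b \<longleftrightarrow> a \<in> nodes D \<and>
     (if s then (fst a, fst c) \<in> edges D else (fst c, fst a) \<in> edges D) \<and> walk D c ps b"

fun realise ::
    "('o, 'm, 'k) tricat \<Rightarrow> ('v, 'o, 'm) diagram \<Rightarrow> 'v \<times> nat \<Rightarrow> (bool \<times> 'v \<times> nat) list \<Rightarrow>
     (bool \<times> 'm \<times> 'o) list" where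
  "realise C D a [] = []"
| "realise C D a ((s, c) # ps) =
     (s, if s then arr_comp C D a c else arr_comp C D c a, node_obj D c) # realise C D c ps"

definition path_in ::
    "('o, 'm, 'k) tricat \<Rightarrow> (real \<Rightarrow> 'o \<Rightarrow> 'o \<Rightarrow> 'm set) \<Rightarrow> ('v, 'o, 'm) diagram \<Rightarrow>
     'v \<times> nat \<Rightarrow> (bool \<times> 'v \<times> nat) list \<Rightarrow> 'v \<times> nat \<Rightarrow> bool" where
  "path_in C G D a ps b \<longleftrightarrow>
     walk D a ps b \<and> conn_path C G (node_obj D a) (realise C D a ps) (node_obj D b)"

definition simple_path_in ::
    "('o, 'm, 'k) tricat \<Rightarrow> (real \<Rightarrow> 'o \<Rightarrow> 'o \<Rightarrow> 'm set) \<Rightarrow> ('v, 'o, 'm) diagram \<Rightarrow>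
     'v \<times> nat \<Rightarrow> (bool \<times> 'v \<times> nat) list \<Rightarrow> 'v \<times> nat \<Rightarrow> bool" where
  "simple_path_in C G D a ps b \<longleftrightarrow> path_in C G D a ps b \<and> distinct (a # map snd ps)"

definition q_in ::
    "('o, 'm, 'k) tricat \<Rightarrow> (real \<Rightarrow> 'o \<Rightarrow> 'o \<Rightarrow> 'm set) \<Rightarrow> ('v, 'o, 'm) diagram \<Rightarrow>
     'v \<times> nat \<Rightarrow> (bool \<times> 'v \<times> nat) list \<Rightarrow> real" where
  "q_in C G D a ps = qpath G (node_obj D a) (realise C D a ps)"

definition liftable ::
    "('o, 'm, 'k) tricat \<Rightarrow> (real \<Rightarrow> 'o \<Rightarrow> 'o \<Rightarrow> 'm set) \<Rightarrow> ('v, 'o, 'm) diagram \<Rightarrow> bool" where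
  "liftable C G D \<longleftrightarrow> commutative_diagram C D \<and>
     (\<forall>(x, y) \<in> edges D. quasi_homogeneous C G (vobj D x) (vobj D y) (arr D (x, y))) \<and>
     (\<forall>a ps. path_in C G D a ps a \<longrightarrow> q_in C G D a ps = 0)"

text \<open>A graph is simply connected (as a topological space) iff it is connected and has no cycles,
  directions of the edges being ignored; a pair of opposite edges is a cycle of length two.\<close>

definition simply_connected :: "'v set \<Rightarrow> ('v \<times> 'v) set \<Rightarrow> bool" where
  "simply_connected V E \<longleftrightarrow> V \<noteq> {} \<and>
     (\<forall>x \<in> V. \<forall>y \<in> V. (x, y) \<in> (E \<union> E\<inverse>)\<^sup>*) \<and>
     E \<inter> E\<inverse> = {} \<and>
     \<not> (\<exists>xs. 3 \<le> length xs \<and> distinct xs \<and>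
          successively (\<lambda>x y. (x, y) \<in> E \<union> E\<inverse>) xs \<and> (last xs, hd xs) \<in> E \<union> E\<inverse>)"

definition locally_liftable ::
    "('o, 'm, 'k) tricat \<Rightarrow> (real \<Rightarrow> 'o \<Rightarrow> 'o \<Rightarrow> 'm set) \<Rightarrow> ('v, 'o, 'm) diagram \<Rightarrow> bool" where
  "locally_liftable C G D \<longleftrightarrow> commutative_diagram C D \<and>
     (\<forall>V E. V \<subseteq> verts D \<and> E \<subseteq> edges D \<inter> V \<times> V \<and> simply_connected V E \<longrightarrow>
        liftable C G (D\<lparr>verts := V, edges := E\<rparr>))"

definition connective ::
    "('o, 'm, 'k) tricat \<Rightarrow> (real \<Rightarrow> 'o \<Rightarrow> 'o \<Rightarrow> 'm set) \<Rightarrow> ('v, 'o, 'm) diagram \<Rightarrow> bool" where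
  "connective C G D \<longleftrightarrow> liftable C G D \<and> (\<forall>a \<in> nodes D. \<forall>b \<in> nodes D. \<exists>ps. path_in C G D a ps b)"

section \<open>Triangle diagrams and pre-liftability\<close>

definition arrow_diagram :: "('o, 'm) dec \<Rightarrow> ('o, 'm) dec \<Rightarrow> 'm \<Rightarrow> (bool, 'o, 'm) diagram" where
  "arrow_diagram A B f =
     \<lparr>verts = UNIV, edges = {(False, True)}, vobj = (\<lambda>x. if x then B else A), arr = (\<lambda>_. f)\<rparr>"

text \<open>
  The vertices of the infinite diagram of a triangle \<open>A \<rightarrow> B \<rightarrow> Q \<rightarrow> A[1]\<close> are numbered by the
  integers: \<open>A[d]\<close>, \<open>B[d]\<close>, \<open>Q[d]\<close> sit at \<open>3d\<close>, \<open>3d + 1\<close>, \<open>3d + 2\<close>.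
\<close>

definition tri_obj ::
    "('o, 'm, 'k) tricat \<Rightarrow> ('o, 'm) dec \<Rightarrow> ('o, 'm) dec \<Rightarrow> ('o, 'm) dec \<Rightarrow> int \<Rightarrow> ('o, 'm) dec" where
  "tri_obj C A B Q x =
     shift_dec C (x div 3) (if x mod 3 = 0 then A else if x mod 3 = 1 then B else Q)"

definition tri_arr :: "('o, 'm, 'k) tricat \<Rightarrow> 'm \<Rightarrow> 'm \<Rightarrow> 'm \<Rightarrow> int \<Rightarrow> 'm" where
  "tri_arr C f g h x =
     ShiftM C (x div 3) (if x mod 3 = 0 then f else if x mod 3 = 1 then g else h)"

definition tri_diagram ::
    "('o, 'm, 'k) tricat \<Rightarrow> ('o, 'm) dec \<Rightarrow> ('o, 'm) dec \<Rightarrow> ('o, 'm) dec \<Rightarrow> 'm \<Rightarrow> 'm \<Rightarrow> 'm \<Rightarrow>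
     int set \<Rightarrow> (int, 'o, 'm) diagram" where
  "tri_diagram C A B Q f g h V =
     \<lparr>verts = V, edges = {(x, x + 1) | x. x \<in> V \<and> x + 1 \<in> V},
      vobj = tri_obj C A B Q, arr = (\<lambda>(x, y). tri_arr C f g h x)\<rparr>"

text \<open>
  The octahedral diagram.  \<open>VX\<close>, \<open>VX1\<close> and \<open>WX\<close>, \<open>WX1\<close> are the copies of \<open>X\<close>, \<open>X[1]\<close> in the first
  and second triangle; \<open>VX'\<close> and \<open>WX'\<close> are the copies of \<open>X'\<close> in the third and fourth triangle.
  The given part lacks \<open>WX'\<close> and \<open>VZ1'\<close>.
\<close>

datatype oct_vertex = VX | VY | VZ' | VX1 | WX | VZ | VY' | WX1 | VX' | VY1 | WX' | VZ1'

definition diagram_of ::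
    "('v \<Rightarrow> ('o, 'm) dec) \<Rightarrow> 'v set \<Rightarrow> (('v \<times> 'v) \<times> 'm) list \<Rightarrow> ('v, 'o, 'm) diagram" where
  "diagram_of ob V es =
     \<lparr>verts = V, edges = fst ` set es, vobj = ob, arr = (\<lambda>e. the (map_of es e))\<rparr>"

definition oct_obj ::
    "('o, 'm, 'k) tricat \<Rightarrow> ('o, 'm) dec \<Rightarrow> ('o, 'm) dec \<Rightarrow> ('o, 'm) dec \<Rightarrow>
     ('o, 'm) dec \<Rightarrow> ('o, 'm) dec \<Rightarrow> ('o, 'm) dec \<Rightarrow> oct_vertex \<Rightarrow> ('o, 'm) dec" where
  "oct_obj C X Y Z X' Y' Z' x = (case x of
      VX \<Rightarrow> X | VY \<Rightarrow> Y | VZ' \<Rightarrow> Z' | VX1 \<Rightarrow> shift_dec C 1 X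
    | WX \<Rightarrow> X | VZ \<Rightarrow> Z | VY' \<Rightarrow> Y' | WX1 \<Rightarrow> shift_dec C 1 X
    | VX' \<Rightarrow> X' | VY1 \<Rightarrow> shift_dec C 1 Y | WX' \<Rightarrow> X' | VZ1' \<Rightarrow> shift_dec C 1 Z')"

definition oct_given_edges ::
    "('o, 'm, 'k) tricat \<Rightarrow> ('o, 'm) dec \<Rightarrow> 'm \<Rightarrow> 'm \<Rightarrow> 'm \<Rightarrow> 'm \<Rightarrow> 'm \<Rightarrow> 'm \<Rightarrow> 'm \<Rightarrow> 'm \<Rightarrow>
     ((oct_vertex \<times> oct_vertex) \<times> 'm) list" where
  "oct_given_edges C X u j k v m n l i =
     [((VX, VY), u), ((VY, VZ'), j), ((VZ', VX1), k),
      ((WX, VZ), Comp C v u), ((VZ, VY'), m), ((VY', WX1), n),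
      ((VY, VZ), v), ((VZ, VX'), l), ((VX', VY1), i),
      ((VX, WX), Idm C (tot X)), ((VX1, WX1), Idm C (Shift C 1 (tot X)))]"

definition oct_new_edges ::
    "('o, 'm, 'k) tricat \<Rightarrow> ('o, 'm) dec \<Rightarrow> 'm \<Rightarrow> 'm \<Rightarrow> 'm \<Rightarrow> 'm \<Rightarrow>
     ((oct_vertex \<times> oct_vertex) \<times> 'm) list" where
  "oct_new_edges C X' j f g h =
     [((VZ', VY'), f), ((VY', WX'), g), ((WX', VZ1'), h),
      ((VX', WX'), Idm C (tot X')), ((VY1, VZ1'), ShiftM C 1 j)]"

locale pre_liftable =
  fixes C :: "('o, 'm, 'k) tricat" and G :: "real \<Rightarrow> 'o \<Rightarrow> 'o \<Rightarrow> 'm set"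
  assumes pre_lift_cone:
      "\<lbrakk>is_dec C A; is_dec C B; f \<in> mor C (tot A) (tot B); liftable C G (arrow_diagram A B f)\<rbrakk> \<Longrightarrow>
       \<exists>Q g h. is_dec C Q \<and> (tot A, tot B, tot Q, f, g, h) \<in> Tri C \<and>
               liftable C G (tri_diagram C A B Q f g h UNIV)"
    and pre_lift_oct:
      "\<lbrakk>is_dec C X; is_dec C Y; is_dec C Z; is_dec C X'; is_dec C Y'; is_dec C Z';
        (tot X, tot Y, tot Z', u, j, k) \<in> Tri C;
        (tot X, tot Z, tot Y', Comp C v u, m, n) \<in> Tri C;
        (tot Y, tot Z, tot X', v, l, i) \<in> Tri C;
        liftable C G (diagram_of (oct_obj C X Y Z X' Y' Z') (UNIV - {WX', VZ1'})
          (oct_given_edges C X u j k v m n l i))\<rbrakk> \<Longrightarrow>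
       \<exists>f g h. (tot Z', tot Y', tot X', f, g, h) \<in> Tri C \<and>
         liftable C G (diagram_of (oct_obj C X Y Z X' Y' Z') UNIV
           (oct_given_edges C X u j k v m n l i @ oct_new_edges C X' j f g h))"

section \<open>The Grothendieck group\<close>

definition K0_relations :: "('o, 'm, 'k) tricat \<Rightarrow> ('o \<Rightarrow>\<^sub>0 int) set" where
  "K0_relations C = {frag_of Y - frag_of X - frag_of Z | X Y Z f g h. (X, Y, Z, f, g, h) \<in> Tri C}"

definition K0_kernel :: "('o, 'm, 'k) tricat \<Rightarrow> ('o \<Rightarrow>\<^sub>0 int) set" where
  "K0_kernel C = generate (free_Abelian_group (Ob C)) (K0_relations C)"

definition K0 :: "('o, 'm, 'k) tricat \<Rightarrow> ('o \<Rightarrow>\<^sub>0 int) set monoid" where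
  "K0 C = free_Abelian_group (Ob C) Mod K0_kernel C"

definition K0_class :: "('o, 'm, 'k) tricat \<Rightarrow> 'o \<Rightarrow> ('o \<Rightarrow>\<^sub>0 int) set" where
  "K0_class C X = K0_kernel C #>\<^bsub>free_Abelian_group (Ob C)\<^esub> frag_of X"

definition complex_group :: "complex monoid" where
  "complex_group = \<lparr>carrier = UNIV, mult = (+), one = 0\<rparr>"

definition finite_rank_lattice :: "'l monoid \<Rightarrow> bool" where
  "finite_rank_lattice \<Lambda> \<longleftrightarrow> group \<Lambda> \<and> (\<exists>r :: nat. \<Lambda> \<cong> free_Abelian_group {..<r})"

text \<open>\<open>Z\<close> is a homomorphism on the Grothendieck group that factors through \<open>w\<close>.\<close>

definition central_charge ::
    "('o, 'm, 'k) tricat \<Rightarrow> 'l monoid \<Rightarrow> (('o \<Rightarrow>\<^sub>0 int) set \<Rightarrow> 'l) \<Rightarrow>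
     (('o \<Rightarrow>\<^sub>0 int) set \<Rightarrow> complex) \<Rightarrow> bool" where
  "central_charge C \<Lambda> w Z \<longleftrightarrow> Z \<in> hom (K0 C) complex_group \<and>
     (\<exists>Z' \<in> hom \<Lambda> complex_group. \<forall>x \<in> carrier (K0 C). Z x = Z' (w x))"

section \<open>Stability conditions on cyclic categories\<close>

text \<open>The degree function of a stability condition is recorded by the real decomposition it
  belongs to.\<close>

record ('o, 'm) stability =
  slice :: "real \<Rightarrow> 'o set"
  charge :: "('o \<Rightarrow>\<^sub>0 int) set \<Rightarrow> complex"
  phase :: "'o \<Rightarrow> real"
  grading :: "real \<Rightarrow> 'o \<Rightarrow> 'o \<Rightarrow> 'm set"

text \<open>
  The Harder-Narasimhan diagram.  The vertex \<open>(i, x)\<close> with \<open>1 \<le> i \<le> n\<close> is the vertex \<open>x\<close> of the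
  infinite diagram of \<open>E\<^sub>i\<^sub>-\<^sub>1 \<rightarrow> E\<^sub>i \<rightarrow> Q\<^sub>i \<rightarrow> E\<^sub>i\<^sub>-\<^sub>1[1]\<close>, the \<open>i\<close>-th column.  Column \<open>0\<close> consists of the
  zero objects \<open>E\<^sub>0[d]\<close> at \<open>(0, 3d + 1)\<close> and contributes no summands.  \<open>V\<close> selects the rows:
  \<open>{0, 1, 2}\<close> for the filtration itself, where \<open>t\<close> does not occur, and \<open>UNIV\<close> for the
  full diagram.
\<close>

definition HN_diagram ::
    "('o, 'm, 'k) tricat \<Rightarrow> nat \<Rightarrow> (nat \<Rightarrow> ('o, 'm) dec) \<Rightarrow> (nat \<Rightarrow> ('o, 'm) dec) \<Rightarrow>
     (nat \<Rightarrow> 'm) \<Rightarrow> (nat \<Rightarrow> 'm) \<Rightarrow> (nat \<Rightarrow> 'm) \<Rightarrow> int set \<Rightarrow> (nat \<times> int, 'o, 'm) diagram" where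
  "HN_diagram C n E Q f p t V =
     \<lparr>verts = {(i, x). x \<in> V \<and> (1 \<le> i \<and> i \<le> n \<or> i = 0 \<and> x mod 3 = 1)},
      edges = {((i, x), (i, x + 1)) | i x. 1 \<le> i \<and> i \<le> n \<and> x \<in> V \<and> x + 1 \<in> V} \<union>
              {((i, x), (i + 1, x - 1)) | i x. i < n \<and> x mod 3 = 1 \<and> x \<in> V \<and> x - 1 \<in> V},
      vobj = (\<lambda>(i, x). if i = 0 then shift_dec C (x div 3) (E 0)
                       else tri_obj C (E (i - 1)) (E i) (Q i) x),
      arr = (\<lambda>((i, x), (j, y)). if i = j then tri_arr C (f i) (p i) (t i) x
                                else Idm C (Shift C (x div 3) (tot (E i))))\<rparr>"

definition HN_filtration ::
    "('o, 'm, 'k) tricat \<Rightarrow> ('o, 'm) stability \<Rightarrow> 'o \<Rightarrow> nat \<Rightarrow> (nat \<Rightarrow> ('o, 'm) dec) \<Rightarrow>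
     (nat \<Rightarrow> ('o, 'm) dec) \<Rightarrow> (nat \<Rightarrow> 'm) \<Rightarrow> (nat \<Rightarrow> 'm) \<Rightarrow> (nat \<Rightarrow> 'm) \<Rightarrow> bool" where
  "HN_filtration C \<sigma> X n E Q f p t \<longleftrightarrow>
     (\<forall>i \<le> n. is_dec C (E i)) \<and> (\<forall>i \<in> {1..n}. is_dec C (Q i)) \<and>
     zero_obj C (tot (E 0)) \<and> E n = single_dec C X \<and>
     (\<forall>i \<in> {1..n}. \<not> zero_obj C (tot (Q i)) \<and> (\<exists>\<psi> \<in> {0<..2}. tot (Q i) \<in> slice \<sigma> \<psi>)) \<and>
     connective C (grading \<sigma>) (HN_diagram C n E Q f p t {0, 1, 2}) \<and>
     (\<forall>i \<in> {1..n}. (tot (E (i - 1)), tot (E i), tot (Q i), f i, p i, t i) \<in> Tri C) \<and>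
     liftable C (grading \<sigma>) (HN_diagram C n E Q f p t UNIV) \<and>
     (\<forall>i \<in> {2..n}. \<exists>c < 0. \<forall>a < nsum (Q (i - 1)). \<forall>b < nsum (Q i).
        (\<exists>ps. simple_path_in C (grading \<sigma>) (HN_diagram C n E Q f p t {0, 1, 2})
                 ((i - 1, 2), a) ps ((i, 2), b)) \<and>
        (\<forall>ps. simple_path_in C (grading \<sigma>) (HN_diagram C n E Q f p t {0, 1, 2})
                 ((i - 1, 2), a) ps ((i, 2), b) \<longrightarrow>
              q_in C (grading \<sigma>) (HN_diagram C n E Q f p t {0, 1, 2}) ((i - 1, 2), a) ps = c))"

text \<open>If \<open>Z(E) = m(E) exp (i \<pi> \<phi>(E))\<close> with \<open>m(E) \<ge> 0\<close>, then necessarily \<open>m(E) = |Z(E)|\<close>.\<close>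

definition mass :: "('o, 'm, 'k) tricat \<Rightarrow> ('o, 'm) stability \<Rightarrow> 'o \<Rightarrow> real" where
  "mass C \<sigma> E = cmod (charge \<sigma> (K0_class C E))"

locale stability_condition =
  real_decomposition K C \<beta> "grading \<sigma>" + pre_liftable C "grading \<sigma>"
  for K :: "'k ring" and C :: "('o, 'm, 'k) tricat" and \<beta> :: "'o \<Rightarrow> 'm"
    and \<Lambda> :: "'l monoid" and v :: "('o \<Rightarrow>\<^sub>0 int) set \<Rightarrow> 'l" and \<sigma> :: "('o, 'm) stability" +
  assumes charge: "central_charge C \<Lambda> v (charge \<sigma>)"
    and slice_Ob: "\<psi> \<in> {0<..2} \<Longrightarrow> slice \<sigma> \<psi> \<subseteq> Ob C"
    and slice_iso: "\<lbrakk>\<psi> \<in> {0<..2}; X \<in> slice \<sigma> \<psi>; Y \<in> Ob C; isomorphic C X Y\<rbrakk> \<Longrightarrow> Y \<in> slice \<sigma> \<psi>"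
    and slice_zero: "\<lbrakk>\<psi> \<in> {0<..2}; zero_obj C X\<rbrakk> \<Longrightarrow> X \<in> slice \<sigma> \<psi>"
    and slice_sum: "\<lbrakk>\<psi> \<in> {0<..2}; direct_sum C A B X; A \<in> slice \<sigma> \<psi>; B \<in> slice \<sigma> \<psi>\<rbrakk>
          \<Longrightarrow> X \<in> slice \<sigma> \<psi>"
    and slice_summand: "\<lbrakk>\<psi> \<in> {0<..2}; direct_sum C A B X; X \<in> slice \<sigma> \<psi>\<rbrakk>
          \<Longrightarrow> A \<in> slice \<sigma> \<psi> \<and> B \<in> slice \<sigma> \<psi>"
    and phase_range: "indecomposable C E \<Longrightarrow> phase \<sigma> E \<in> {0<..2}"
    and phase_shift: "indecomposable C E \<Longrightarrow> [phase \<sigma> (Shift C 1 E) = phase \<sigma> E + 1] (rmod 2)"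
    and charge_phase: "indecomposable C E \<Longrightarrow>
          charge \<sigma> (K0_class C E) = of_real (mass C \<sigma> E) * exp (\<i> * of_real pi * of_real (phase \<sigma> E))"
    and deg_phase: "\<lbrakk>indecomposable C E; indecomposable C F; homogeneous (grading \<sigma>) E F f;
            f \<noteq> zerom C E F\<rbrakk>
          \<Longrightarrow> [deg (grading \<sigma>) E F f = phase \<sigma> F - phase \<sigma> E] (rmod 2)"
    and slice_shift: "\<lbrakk>\<psi> \<in> {0<..2}; \<psi>' \<in> {0<..2}; [\<psi>' = \<psi> + 1] (rmod 2)\<rbrakk>
          \<Longrightarrow> Shift C 1 ` slice \<sigma> \<psi> = slice \<sigma> \<psi>'"
    and slice_phase: "\<lbrakk>\<psi> \<in> {0<..2}; indecomposable C E; E \<in> slice \<sigma> \<psi>\<rbrakk>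
          \<Longrightarrow> mass C \<sigma> E > 0 \<and> phase \<sigma> E = \<psi>"
    and deg_nonneg: "\<lbrakk>\<psi>1 \<in> {0<..2}; \<psi>2 \<in> {0<..2}; indecomposable C E; indecomposable C F;
            E \<in> slice \<sigma> \<psi>1; F \<in> slice \<sigma> \<psi>2; homogeneous (grading \<sigma>) E F f; f \<noteq> zerom C E F\<rbrakk>
          \<Longrightarrow> deg (grading \<sigma>) E F f \<ge> 0"
    and ex_HN: "indecomposable C X \<Longrightarrow> \<exists>n E Q f p t. HN_filtration C \<sigma> X n E Q f p t"

section \<open>Basic loops and the Maslov index\<close>

text \<open>The hexagon has vertices \<open>0, \<dots>, 5\<close> carrying \<open>A, B, Q, A[1], B[1], Q[1]\<close>.\<close>

definition hexagon ::
    "('o, 'm, 'k) tricat \<Rightarrow> ('o \<Rightarrow> 'm) \<Rightarrow> ('o, 'm) dec \<Rightarrow> ('o, 'm) dec \<Rightarrow> ('o, 'm) dec \<Rightarrow>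
     'm \<Rightarrow> 'm \<Rightarrow> 'm \<Rightarrow> (int, 'o, 'm) diagram" where
  "hexagon C \<beta> A B Q f g h =
     \<lparr>verts = {0..5}, edges = {(x, x + 1) | x. 0 \<le> x \<and> x < 5} \<union> {(5, 0)},
      vobj = tri_obj C A B Q,
      arr = (\<lambda>(x, y). if x = 5 then Comp C (\<beta> (tot A)) (ShiftM C 1 h) else tri_arr C f g h x)\<rparr>"

definition fundamental_hexagon ::
    "('o, 'm, 'k) tricat \<Rightarrow> ('o \<Rightarrow> 'm) \<Rightarrow> (real \<Rightarrow> 'o \<Rightarrow> 'o \<Rightarrow> 'm set) \<Rightarrow>
     ('o, 'm) dec \<Rightarrow> ('o, 'm) dec \<Rightarrow> ('o, 'm) dec \<Rightarrow> 'm \<Rightarrow> 'm \<Rightarrow> 'm \<Rightarrow> bool" where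
  "fundamental_hexagon C \<beta> G A B Q f g h \<longleftrightarrow>
     is_dec C A \<and> is_dec C B \<and> is_dec C Q \<and> (tot A, tot B, tot Q, f, g, h) \<in> Tri C \<and>
     locally_liftable C G (hexagon C \<beta> A B Q f g h)"

text \<open>\<open>l\<close> is the basic loop at \<open>E\<close>, a summand of \<open>A\<close>, defined by the connecting path \<open>p\<close> from
  \<open>E\<close> to \<open>E[1]\<close>.\<close>

definition basic_loop ::
    "('o, 'm, 'k) tricat \<Rightarrow> ('o \<Rightarrow> 'm) \<Rightarrow> (real \<Rightarrow> 'o \<Rightarrow> 'o \<Rightarrow> 'm set) \<Rightarrow>
     'o \<Rightarrow> (bool \<times> 'm \<times> 'o) list \<Rightarrow> (bool \<times> 'm \<times> 'o) list \<Rightarrow> bool" where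
  "basic_loop C \<beta> G E p l \<longleftrightarrow>
     (\<exists>A B Q f g h r ps. fundamental_hexagon C \<beta> G A B Q f g h \<and> r < nsum A \<and> E = smd A r \<and>
        path_in C G (tri_diagram C A B Q f g h {0..3}) (0, r) ps (3, r) \<and>
        p = realise C (tri_diagram C A B Q f g h {0..3}) (0, r) ps \<and>
        l = p @ shift_path C 1 p @ [(True, \<beta> E, E)])"

definition maslov_index ::
    "(real \<Rightarrow> 'o \<Rightarrow> 'o \<Rightarrow> 'm set) \<Rightarrow> 'o \<Rightarrow> (bool \<times> 'm \<times> 'o) list \<Rightarrow> real" where
  "maslov_index G E p = (qpath G E p - 1) / 2"

section \<open>The lifts\<close>

text \<open>
  An object of the lift is a finite direct sum of pairs \<open>(E\<^sub>i, \<theta>\<^sub>i)\<close>.  It is represented by a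
  decomposed object \<open>D\<close> with summands \<open>E\<^sub>i\<close> and the list of the phases \<open>\<theta>\<^sub>i\<close>, so the pair
  \<open>(E, \<theta>)\<close> itself is \<open>(single_dec C E, [\<theta>])\<close>.  Carrying the direct sum \<open>tot D\<close> along makes the
  functor \<open>\<pi>\<close> to the original category a projection on objects and an inclusion on morphisms: a
  morphism of the lift is a morphism of the original category whose components
  \<open>E\<^sub>i \<rightarrow> F\<^sub>j\<close> are homogeneous of degree \<open>\<theta>'\<^sub>j - \<theta>\<^sub>i\<close>.
\<close>

type_synonym ('o, 'm) lobj = "('o, 'm) dec \<times> real list"

definition lift_proj :: "('o, 'm) lobj \<Rightarrow> 'o" where
  "lift_proj X = tot (fst X)"

definition lift_Ob :: "('o, 'm, 'k) tricat \<Rightarrow> ('o \<Rightarrow> real) \<Rightarrow> ('o, 'm) lobj set" where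
  "lift_Ob C \<phi> = {(D, \<theta>s). is_dec C D \<and> length \<theta>s = nsum D \<and>
     (\<forall>i < nsum D. [\<theta>s ! i = \<phi> (smd D i)] (rmod 2))}"

definition lift_mor ::
    "('o, 'm, 'k) tricat \<Rightarrow> (real \<Rightarrow> 'o \<Rightarrow> 'o \<Rightarrow> 'm set) \<Rightarrow> ('o, 'm) lobj \<Rightarrow> ('o, 'm) lobj \<Rightarrow> 'm set" where
  "lift_mor C G X Y = {f \<in> mor C (lift_proj X) (lift_proj Y).
     \<forall>i < nsum (fst X). \<forall>j < nsum (fst Y).
       component C (fst X) (fst Y) f i j
         \<in> G (snd Y ! j - snd X ! i) (smd (fst X) i) (smd (fst Y) j)}"

definition lift_shift :: "('o, 'm, 'k) tricat \<Rightarrow> int \<Rightarrow> ('o, 'm) lobj \<Rightarrow> ('o, 'm) lobj" where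
  "lift_shift C d X = (shift_dec C d (fst X), map (\<lambda>\<theta>. \<theta> + of_int d) (snd X))"

definition lift_category ::
    "('o, 'm, 'k) tricat \<Rightarrow> ('o \<Rightarrow> real) \<Rightarrow> (real \<Rightarrow> 'o \<Rightarrow> 'o \<Rightarrow> 'm set) \<Rightarrow>
     (('o, 'm) lobj, 'm, 'k) tricat" where
  "lift_category C \<phi> G =
     \<lparr>Ob = lift_Ob C \<phi>,
      Hom = (\<lambda>X Y. (Hom C (lift_proj X) (lift_proj Y))\<lparr>carrier := lift_mor C G X Y\<rparr>),
      Idm = (\<lambda>X. Idm C (lift_proj X)),
      Comp = Comp C,
      Shift = lift_shift C,
      ShiftM = ShiftM C,
      Tri = {(X, Y, Z, f, g, h). X \<in> lift_Ob C \<phi> \<and> Y \<in> lift_Ob C \<phi> \<and> Z \<in> lift_Ob C \<phi> \<and>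
               f \<in> lift_mor C G X Y \<and> g \<in> lift_mor C G Y Z \<and> h \<in> lift_mor C G Z (lift_shift C 1 X) \<and>
               (lift_proj X, lift_proj Y, lift_proj Z, f, g, h) \<in> Tri C}\<rparr>"

definition lift_slice ::
    "('o, 'm, 'k) tricat \<Rightarrow> ('o, 'm) stability \<Rightarrow> real \<Rightarrow> ('o, 'm) lobj set" where
  "lift_slice C \<sigma> \<theta> = {X \<in> lift_Ob C (phase \<sigma>). \<forall>i < nsum (fst X). snd X ! i = \<theta> \<and>
     (\<exists>\<psi> \<in> {0<..2}. [\<psi> = \<theta>] (rmod 2) \<and> smd (fst X) i \<in> slice \<sigma> \<psi>)}"

text \<open>\<open>\<pi>\<^sub>0\<close> is the homomorphism of Grothendieck groups induced by \<open>\<pi>\<close>.\<close>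

definition induced_by_lift_proj ::
    "('o, 'm, 'k) tricat \<Rightarrow> ('o, 'm) stability \<Rightarrow>
     ((('o, 'm) lobj \<Rightarrow>\<^sub>0 int) set \<Rightarrow> ('o \<Rightarrow>\<^sub>0 int) set) \<Rightarrow> bool" where
  "induced_by_lift_proj C \<sigma> \<pi>\<^sub>0 \<longleftrightarrow>
     \<pi>\<^sub>0 \<in> hom (K0 (lift_category C (phase \<sigma>) (grading \<sigma>))) (K0 C) \<and>
     (\<forall>X \<in> lift_Ob C (phase \<sigma>).
        \<pi>\<^sub>0 (K0_class (lift_category C (phase \<sigma>) (grading \<sigma>)) X) = K0_class C (lift_proj X))"

section \<open>Bridgeland stability conditions\<close>

definition bridgeland_HN ::
    "('o, 'm, 'k) tricat \<Rightarrow> (real \<Rightarrow> 'o set) \<Rightarrow> 'o \<Rightarrow> nat \<Rightarrow> (nat \<Rightarrow> 'o) \<Rightarrow> (nat \<Rightarrow> real) \<Rightarrow> bool" where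
  "bridgeland_HN T P X n E \<theta> \<longleftrightarrow> zero_obj T (E 0) \<and> E n = X \<and>
     (\<forall>j \<in> {1..n}. \<exists>A \<in> P (\<theta> j). \<exists>f g h. (E (j - 1), E j, A, f, g, h) \<in> Tri T) \<and>
     (\<forall>j \<in> {1..n}. \<forall>j' \<in> {1..n}. j < j' \<longrightarrow> \<theta> j > \<theta> j')"

locale bridgeland_stability_condition =
  fixes T :: "('o, 'm, 'k) tricat" and \<Lambda> :: "'l monoid"
    and w :: "('o \<Rightarrow>\<^sub>0 int) set \<Rightarrow> 'l"
    and P :: "real \<Rightarrow> 'o set" and Z :: "('o \<Rightarrow>\<^sub>0 int) set \<Rightarrow> complex"
  assumes w_hom: "w \<in> hom (K0 T) \<Lambda>"
    and Z_charge: "central_charge T \<Lambda> w Z"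
    and P_Ob: "P \<theta> \<subseteq> Ob T"
    and P_charge: "\<lbrakk>X \<in> P \<theta>; \<not> zero_obj T X\<rbrakk> \<Longrightarrow>
          \<exists>m > 0. Z (K0_class T X) = of_real m * exp (\<i> * of_real pi * of_real \<theta>)"
    and P_shift: "P (\<theta> + 1) = Shift T 1 ` P \<theta>"
    and P_Hom: "\<lbrakk>A1 \<in> P \<theta>1; A2 \<in> P \<theta>2; \<theta>1 > \<theta>2\<rbrakk> \<Longrightarrow> mor T A1 A2 = {zerom T A1 A2}"
    and P_HN: "\<lbrakk>X \<in> Ob T; \<not> zero_obj T X\<rbrakk> \<Longrightarrow> \<exists>n E \<theta>. bridgeland_HN T P X n E \<theta>"

end

theory Submission
  imports Defs "HOL-Library.Sublist"
begin

text \<open>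
  A diagram of quasi-homogeneous morphisms has only connecting loops of degree zero iff there is a
  potential: a real function on the summands whose increments along nonzero components are their
  degrees.  Potentials that are congruent to the phases are lifts of the diagram.  Along a
  distinguished triangle the potential of a summand of \<open>A[1]\<close> exceeds that of the same summand of
  \<open>A\<close> by the degree of a connecting path between them, if there is one, and the vanishing of the
  Maslov indices says that this excess is \<open>1\<close>.

  This lifts cones: a morphism is first split into parts none of whose summands are separated from the
  others, and the potential on the cone of such a part, normalised on the source and target, has the
  right values there.  The octahedral axiom of the lift is not obtained from lifted octahedra; it
  follows from cones.  The octahedron of \<open>C\<close> is a homotopy pushout square, the pushout is a
  cone that can be formed in the lift, and the degree \<open>0\<close> parts of the maps out of it still form
  distinguished triangles, because they differ from the original ones by nilpotent endomorphisms.

  For an indecomposable object, the Harder-Narasimhan diagram carries a potential.  By connectivity,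
  the shift by \<open>[1]\<close> changes it by one and the same constant everywhere; this constant is seen
  to be \<open>1\<close> on the last column, where the components of \<open>f\<close>, \<open>p\<close> and \<open>t\<close> form a connecting path
  \<open>E \<rightarrow> E[1]\<close>.  So the diagram lifts, the lifted factors are semistable, and the strictly negative
  degrees between consecutive factors make the phases decrease.
\<close>

text \<open>Taking degree \<open>0\<close> parts of matrices is additive and commutes with
  composition, on either side, with a morphism of the lift. Hence an equation that is linear in one
  unknown morphism, all other maps lying in the lift, is solvable in the lift once it is solvable in
  \<open>C\<close>. This gives \<open>TR3\<close>, inverses of isomorphisms and the commutation
  relations of \<open>TR4\<close>. Being distinguished is not an equation, however, and a triangle
  might be destroyed when one of its maps is replaced by its degree \<open>0\<close> part; this is
  the obstacle behind the octahedral axiom.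

  For cones the obstacle is that a potential is unique only up to a constant on each connected
  component. If no connecting path runs through the cone from a summand of the source to its shift,
  the Maslov hypothesis is silent and the excess may be any real number. In that case no summand of
  the cone is seen both from the target, by the second map, and from the shifted source, by the
  third, so that the two kinds of summands can be renormalised independently.\<close>

lemma (in abelian_group) finsum_single:
  assumes "finite A" "a \<in> A" "x \<in> carrier G"
  shows "finsum G (\<lambda>i. if i = a then x else \<zero>) A = x"
proof -
  have "finsum G (\<lambda>i. if i = a then x else \<zero>) A = finsum G (\<lambda>i. if a = i then (\<lambda>_. x) i else \<zero>) A"
    by (intro add.finprod_cong') (use assms in auto)
  also have "\<dots> = x" using add.finprod_singleton[of a A "\<lambda>_. x"] assms by simp
  finally show ?thesis .
qed

section \<open>Sums, signs, zero objects and isomorphisms in a linear category\<close>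

context linear_category
begin

lemma Hom_abelian: "X \<in> Ob C \<Longrightarrow> Y \<in> Ob C \<Longrightarrow> abelian_group (Hom C X Y)"
  using Hom_module by (auto dest: Module.module.axioms)

lemma Comp_mor: "\<lbrakk>f \<in> mor C X Y; g \<in> mor C Y Z; X \<in> Ob C; Y \<in> Ob C; Z \<in> Ob C\<rbrakk> \<Longrightarrow> Comp C g f \<in> mor C X Z"
  using Comp_closed by blast

lemma zero_mor [simp, intro]: "X \<in> Ob C \<Longrightarrow> Y \<in> Ob C \<Longrightarrow> zerom C X Y \<in> mor C X Y"
  by (simp add: Hom_abelian abelian_monoid.zero_closed abelian_group.axioms)

lemma add_mor [simp, intro]:
  "\<lbrakk>X \<in> Ob C; Y \<in> Ob C; f \<in> mor C X Y; g \<in> mor C X Y\<rbrakk> \<Longrightarrow> f \<oplus>\<^bsub>Hom C X Y\<^esub> g \<in> mor C X Y"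
  by (meson Hom_abelian abelian_monoid.a_closed abelian_group.axioms(1))

lemma neg_mor [simp, intro]:
  "\<lbrakk>X \<in> Ob C; Y \<in> Ob C; f \<in> mor C X Y\<rbrakk> \<Longrightarrow> \<ominus>\<^bsub>Hom C X Y\<^esub> f \<in> mor C X Y"
  by (meson Hom_abelian abelian_group.a_inv_closed)

lemma diff_mor [simp, intro]:
  "\<lbrakk>X \<in> Ob C; Y \<in> Ob C; f \<in> mor C X Y; g \<in> mor C X Y\<rbrakk> \<Longrightarrow> f \<ominus>\<^bsub>Hom C X Y\<^esub> g \<in> mor C X Y"
  by (meson Hom_abelian abelian_group.minus_closed)

lemma add_zero [simp]:
  assumes "X \<in> Ob C" "Y \<in> Ob C" "f \<in> mor C X Y"
  shows "f \<oplus>\<^bsub>Hom C X Y\<^esub> zerom C X Y = f" "zerom C X Y \<oplus>\<^bsub>Hom C X Y\<^esub> f = f"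
    "f \<ominus>\<^bsub>Hom C X Y\<^esub> zerom C X Y = f" "f \<ominus>\<^bsub>Hom C X Y\<^esub> f = zerom C X Y"
proof -
  interpret abelian_group "Hom C X Y" using assms Hom_abelian by blast
  show "f \<oplus>\<^bsub>Hom C X Y\<^esub> zerom C X Y = f" "zerom C X Y \<oplus>\<^bsub>Hom C X Y\<^esub> f = f"
    using assms by auto
  show "f \<ominus>\<^bsub>Hom C X Y\<^esub> zerom C X Y = f" "f \<ominus>\<^bsub>Hom C X Y\<^esub> f = zerom C X Y"
    using assms by (auto simp: a_minus_def r_neg)
qed

lemma diff_eq_zero_iff:
  assumes "X \<in> Ob C" "Y \<in> Ob C" "f \<in> mor C X Y" "g \<in> mor C X Y"
  shows "f \<ominus>\<^bsub>Hom C X Y\<^esub> g = zerom C X Y \<longleftrightarrow> f = g"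
proof -
  interpret abelian_group "Hom C X Y" using assms Hom_abelian by blast
  show ?thesis
  proof
    assume "f \<ominus>\<^bsub>Hom C X Y\<^esub> g = zerom C X Y"
    then have "f = \<ominus>\<^bsub>Hom C X Y\<^esub> (\<ominus>\<^bsub>Hom C X Y\<^esub> g)"
      using assms by (intro minus_equality[symmetric]) (auto simp: a_minus_def)
    then show "f = g" using assms by simp
  qed (use assms in auto)
qed

lemma diff_add_cancel:
  assumes "X \<in> Ob C" "Y \<in> Ob C" "f \<in> mor C X Y" "g \<in> mor C X Y"
  shows "(f \<ominus>\<^bsub>Hom C X Y\<^esub> g) \<oplus>\<^bsub>Hom C X Y\<^esub> g = f"
    "g \<oplus>\<^bsub>Hom C X Y\<^esub> (f \<ominus>\<^bsub>Hom C X Y\<^esub> g) = f"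
proof -
  interpret abelian_group "Hom C X Y" using assms Hom_abelian by blast
  show "(f \<ominus>\<^bsub>Hom C X Y\<^esub> g) \<oplus>\<^bsub>Hom C X Y\<^esub> g = f"
    using assms by (simp add: a_minus_def a_assoc l_neg)
  then show "g \<oplus>\<^bsub>Hom C X Y\<^esub> (f \<ominus>\<^bsub>Hom C X Y\<^esub> g) = f"
    using assms by (simp add: a_comm)
qed

lemma Comp_zero [simp]:
  assumes "X \<in> Ob C" "Y \<in> Ob C" "Z \<in> Ob C"
  shows "g \<in> mor C Y Z \<Longrightarrow> Comp C g (zerom C X Y) = zerom C X Z"
    and "f \<in> mor C X Y \<Longrightarrow> Comp C (zerom C Y Z) f = zerom C X Z"
proof -
  interpret H: abelian_group "Hom C X Z" using assms Hom_abelian by blast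
  { assume g: "g \<in> mor C Y Z"
    have "Comp C g (zerom C X Y) \<oplus>\<^bsub>Hom C X Z\<^esub> Comp C g (zerom C X Y) = Comp C g (zerom C X Y)"
      using assms g by (simp flip: Comp_add_right)
    then show "Comp C g (zerom C X Y) = zerom C X Z"
      using H.add.l_cancel_one[of "Comp C g (zerom C X Y)"] Comp_closed[OF assms _ g] assms by auto }
  { assume f: "f \<in> mor C X Y"
    have "Comp C (zerom C Y Z) f \<oplus>\<^bsub>Hom C X Z\<^esub> Comp C (zerom C Y Z) f = Comp C (zerom C Y Z) f"
      using assms f by (simp flip: Comp_add_left)
    then show "Comp C (zerom C Y Z) f = zerom C X Z"
      using H.add.l_cancel_one[of "Comp C (zerom C Y Z) f"] Comp_closed[OF assms f] assms by auto }
qed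

lemma Comp_neg:
  assumes "X \<in> Ob C" "Y \<in> Ob C" "Z \<in> Ob C" "f \<in> mor C X Y" "g \<in> mor C Y Z"
  shows "Comp C g (\<ominus>\<^bsub>Hom C X Y\<^esub> f) = \<ominus>\<^bsub>Hom C X Z\<^esub> Comp C g f"
    and "Comp C (\<ominus>\<^bsub>Hom C Y Z\<^esub> g) f = \<ominus>\<^bsub>Hom C X Z\<^esub> Comp C g f"
proof -
  interpret H: abelian_group "Hom C X Z" using assms Hom_abelian by blast
  interpret XY: abelian_group "Hom C X Y" using assms Hom_abelian by blast
  interpret YZ: abelian_group "Hom C Y Z" using assms Hom_abelian by blast
  have gf: "Comp C g f \<in> mor C X Z" using assms Comp_closed by blast
  have "Comp C g (\<ominus>\<^bsub>Hom C X Y\<^esub> f) \<oplus>\<^bsub>Hom C X Z\<^esub> Comp C g f = zerom C X Z"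
    using assms by (simp flip: Comp_add_right add: XY.l_neg)
  then show "Comp C g (\<ominus>\<^bsub>Hom C X Y\<^esub> f) = \<ominus>\<^bsub>Hom C X Z\<^esub> Comp C g f"
    using H.minus_equality gf assms Comp_closed by (metis neg_mor)
  have "Comp C (\<ominus>\<^bsub>Hom C Y Z\<^esub> g) f \<oplus>\<^bsub>Hom C X Z\<^esub> Comp C g f = zerom C X Z"
    using assms by (simp flip: Comp_add_left add: YZ.l_neg)
  then show "Comp C (\<ominus>\<^bsub>Hom C Y Z\<^esub> g) f = \<ominus>\<^bsub>Hom C X Z\<^esub> Comp C g f"
    using H.minus_equality gf assms Comp_closed by (metis neg_mor)
qed

lemma Comp_diff:
  assumes "X \<in> Ob C" "Y \<in> Ob C" "Z \<in> Ob C"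
  shows "\<lbrakk>f \<in> mor C X Y; f' \<in> mor C X Y; g \<in> mor C Y Z\<rbrakk> \<Longrightarrow>
      Comp C g (f \<ominus>\<^bsub>Hom C X Y\<^esub> f') = Comp C g f \<ominus>\<^bsub>Hom C X Z\<^esub> Comp C g f'"
    and "\<lbrakk>f \<in> mor C X Y; g \<in> mor C Y Z; g' \<in> mor C Y Z\<rbrakk> \<Longrightarrow>
      Comp C (g \<ominus>\<^bsub>Hom C Y Z\<^esub> g') f = Comp C g f \<ominus>\<^bsub>Hom C X Z\<^esub> Comp C g' f"
  using assms by (simp_all add: a_minus_def Comp_add_right Comp_add_left Comp_neg)

lemma finsum_mor [intro]:
  assumes "X \<in> Ob C" "Y \<in> Ob C" "\<And>i. i \<in> I \<Longrightarrow> F i \<in> mor C X Y"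
  shows "finsum (Hom C X Y) F I \<in> mor C X Y"
proof -
  interpret H: abelian_group "Hom C X Y" using assms Hom_abelian by blast
  show ?thesis using assms by (auto intro!: H.finsum_closed)
qed

lemma Comp_finsum_right:
  assumes "X \<in> Ob C" "Y \<in> Ob C" "Z \<in> Ob C" "\<And>i. i \<in> I \<Longrightarrow> F i \<in> mor C X Y" "g \<in> mor C Y Z" "finite I"
  shows "Comp C g (finsum (Hom C X Y) F I) = finsum (Hom C X Z) (\<lambda>i. Comp C g (F i)) I"
proof -
  interpret H: abelian_group "Hom C X Z" using assms Hom_abelian by blast
  interpret XY: abelian_group "Hom C X Y" using assms Hom_abelian by blast
  show ?thesis using assms(6,4)
  proof (induction I rule: finite_induct)
    case empty then show ?case using assms by simp
  next
    case (insert i I)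
    have "F i \<in> mor C X Y" "finsum (Hom C X Y) F I \<in> mor C X Y" using insert assms by auto
    then show ?case using insert assms
      by (subst XY.finsum_insert, auto simp: Comp_add_right, subst H.finsum_insert, auto intro: Comp_closed[of X Y Z])
  qed
qed

lemma Comp_finsum_left:
  assumes "X \<in> Ob C" "Y \<in> Ob C" "Z \<in> Ob C" "\<And>i. i \<in> I \<Longrightarrow> F i \<in> mor C Y Z" "f \<in> mor C X Y" "finite I"
  shows "Comp C (finsum (Hom C Y Z) F I) f = finsum (Hom C X Z) (\<lambda>i. Comp C (F i) f) I"
proof -
  interpret H: abelian_group "Hom C X Z" using assms Hom_abelian by blast
  interpret YZ: abelian_group "Hom C Y Z" using assms Hom_abelian by blast
  show ?thesis using assms(6,4)
  proof (induction I rule: finite_induct)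
    case empty then show ?case using assms by simp
  next
    case (insert i I)
    have "F i \<in> mor C Y Z" "finsum (Hom C Y Z) F I \<in> mor C Y Z" using insert assms by auto
    then show ?case using insert assms
      by (subst YZ.finsum_insert, auto simp: Comp_add_left, subst H.finsum_insert, auto intro: Comp_closed[of X Y Z])
  qed
qed

lemma finsum_mor_cong:
  assumes "X \<in> Ob C" "Y \<in> Ob C" "I = J" "\<And>i. i \<in> J \<Longrightarrow> F i = F' i" "\<And>i. i \<in> J \<Longrightarrow> F' i \<in> mor C X Y"
  shows "finsum (Hom C X Y) F I = finsum (Hom C X Y) F' J"
proof -
  interpret H: abelian_group "Hom C X Y" using assms Hom_abelian by blast
  show ?thesis using assms by (intro H.finsum_cong') auto
qed

lemma finsum_mor_zero:
  assumes "X \<in> Ob C" "Y \<in> Ob C" "\<And>i. i \<in> I \<Longrightarrow> F i = zerom C X Y"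
  shows "finsum (Hom C X Y) F I = zerom C X Y"
proof -
  interpret H: abelian_group "Hom C X Y" using assms Hom_abelian by blast
  show ?thesis using assms by (intro H.add.finprod_one_eqI) auto
qed

lemma finsum_mor_single:
  assumes "X \<in> Ob C" "Y \<in> Ob C" "finite I" "a \<in> I" "F a \<in> mor C X Y"
    "\<And>i. i \<in> I \<Longrightarrow> i \<noteq> a \<Longrightarrow> F i = zerom C X Y"
  shows "finsum (Hom C X Y) F I = F a"
proof -
  interpret H: abelian_group "Hom C X Y" using assms Hom_abelian by blast
  have "finsum (Hom C X Y) F I = finsum (Hom C X Y) (\<lambda>i. if i = a then F a else zerom C X Y) I"
    using assms by (intro finsum_mor_cong) auto
  then show ?thesis using H.finsum_single assms by simp
qed

lemma zero_obj_iff: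
  assumes "X \<in> Ob C"
  shows "zero_obj C X \<longleftrightarrow> Idm C X = zerom C X X"
proof
  assume "zero_obj C X"
  then show "Idm C X = zerom C X X"
    using assms Idm_closed[of X] by (auto simp: zero_obj_def)
next
  assume 1: "Idm C X = zerom C X X"
  have "f = zerom C X Y" if "Y \<in> Ob C" "f \<in> mor C X Y" for Y f
    using Comp_Idm[of X Y f] that assms 1 by simp
  moreover have "f = zerom C Y X" if "Y \<in> Ob C" "f \<in> mor C Y X" for Y f
    using Idm_Comp[of Y X f] that assms 1 by simp
  ultimately show "zero_obj C X"
    using assms unfolding zero_obj_def by auto
qed

lemma zero_obj_mor:
  assumes "zero_obj C N" "Y \<in> Ob C"
  shows "f \<in> mor C N Y \<Longrightarrow> f = zerom C N Y" "f \<in> mor C Y N \<Longrightarrow> f = zerom C Y N"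
  using assms by (auto simp: zero_obj_def)

lemma is_isom_mor: "is_isom C X Y f \<Longrightarrow> f \<in> mor C X Y"
  by (simp add: is_isom_def)

lemma is_isom_Idm: "X \<in> Ob C \<Longrightarrow> is_isom C X X (Idm C X)"
  unfolding is_isom_def using Idm_closed Comp_Idm by metis

lemma is_isom_neg_Idm:
  assumes "X \<in> Ob C" shows "is_isom C X X (\<ominus>\<^bsub>Hom C X X\<^esub> Idm C X)"
proof -
  interpret H: abelian_group "Hom C X X" using assms Hom_abelian by blast
  have "Comp C (\<ominus>\<^bsub>Hom C X X\<^esub> Idm C X) (\<ominus>\<^bsub>Hom C X X\<^esub> Idm C X) = Idm C X"
    using assms by (simp add: Comp_neg Idm_closed Comp_Idm)
  then show ?thesis unfolding is_isom_def using assms Idm_closed by auto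
qed

lemma is_isom_Comp:
  assumes "X \<in> Ob C" "Y \<in> Ob C" "Z \<in> Ob C" "is_isom C X Y f" "is_isom C Y Z g"
  shows "is_isom C X Z (Comp C g f)"
proof -
  obtain f' g' where f: "f \<in> mor C X Y" "f' \<in> mor C Y X" "Comp C f' f = Idm C X" "Comp C f f' = Idm C Y"
    and g: "g \<in> mor C Y Z" "g' \<in> mor C Z Y" "Comp C g' g = Idm C Y" "Comp C g g' = Idm C Z"
    using assms unfolding is_isom_def by blast
  have gf: "Comp C g f \<in> mor C X Z" "Comp C f' g' \<in> mor C Z X" using f g assms Comp_closed by blast+
  have "Comp C (Comp C f' g') (Comp C g f) = Comp C f' (Comp C g' (Comp C g f))"
    using Comp_assoc[of X Z Y X] f g gf assms by simp
  also have "\<dots> = Comp C f' (Comp C (Comp C g' g) f)"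
    using Comp_assoc[of X Y Z Y] f g assms by simp
  also have "\<dots> = Idm C X" using f g assms Idm_Comp by simp
  finally have 1: "Comp C (Comp C f' g') (Comp C g f) = Idm C X" .
  have "Comp C (Comp C g f) (Comp C f' g') = Comp C g (Comp C f (Comp C f' g'))"
    using Comp_assoc[of Z X Y Z] f g gf assms by simp
  also have "\<dots> = Comp C g (Comp C (Comp C f f') g')"
    using Comp_assoc[of Z Y X Y] f g assms by simp
  also have "\<dots> = Idm C Z" using f g assms Idm_Comp by simp
  finally show ?thesis using 1 gf unfolding is_isom_def by blast
qed

lemma is_isom_inverse:
  assumes "is_isom C X Y f"
  obtains g where "is_isom C Y X g" "Comp C g f = Idm C X" "Comp C f g = Idm C Y"
  using assms unfolding is_isom_def by blast

lemma biproduct_sym: "biproduct C A B X i1 i2 p1 p2 \<Longrightarrow> biproduct C B A X i2 i1 p2 p1"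
  unfolding biproduct_def
  by (metis Comp_closed Hom_abelian abelian_group.axioms(1) abelian_monoid.a_comm)

lemma biproduct_zero:
  assumes "B \<in> Ob C" "zero_obj C N"
  shows "biproduct C B N B (Idm C B) (zerom C N B) (Idm C B) (zerom C B N)"
    "biproduct C N B B (zerom C N B) (Idm C B) (zerom C B N) (Idm C B)"
proof -
  have N: "N \<in> Ob C" "Idm C N = zerom C N N" using assms zero_obj_iff unfolding zero_obj_def by auto
  show "biproduct C B N B (Idm C B) (zerom C N B) (Idm C B) (zerom C B N)"
    unfolding biproduct_def using assms N by (simp add: Idm_closed Comp_Idm)
  from biproduct_sym[OF this]
  show "biproduct C N B B (zerom C N B) (Idm C B) (zerom C B N) (Idm C B)" .
qed

end

section \<open>Matrices of morphisms\<close>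

text \<open>The entry \<open>M i j\<close> goes from the \<open>i\<close>-th summand of the source
  to the \<open>j\<close>-th summand of the target. This is the index order of
  \<open>component\<close> and the transpose of the usual matrix convention.\<close>

definition of_mat ::
    "('o, 'm, 'k) tricat \<Rightarrow> ('o, 'm) dec \<Rightarrow> ('o, 'm) dec \<Rightarrow> (nat \<Rightarrow> nat \<Rightarrow> 'm) \<Rightarrow> 'm" where
  "of_mat C A B M = finsum (Hom C (tot A) (tot B))
     (\<lambda>(i, j). Comp C (incl B j) (Comp C (M i j) (proj A i))) ({..<nsum A} \<times> {..<nsum B})"

lemma indecomposable_Ob: "indecomposable C E \<Longrightarrow> E \<in> Ob C"
  by (simp add: indecomposable_def)

lemma is_dec_tot: "is_dec C D \<Longrightarrow> tot D \<in> Ob C"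
  by (simp add: is_dec_def)

lemma is_dec_smd: "is_dec C D \<Longrightarrow> i < nsum D \<Longrightarrow> indecomposable C (smd D i)"
  by (simp add: is_dec_def)

lemma is_dec_smd_Ob: "is_dec C D \<Longrightarrow> i < nsum D \<Longrightarrow> smd D i \<in> Ob C"
  by (simp add: is_dec_def indecomposable_def)

lemma is_dec_incl: "is_dec C D \<Longrightarrow> i < nsum D \<Longrightarrow> incl D i \<in> mor C (smd D i) (tot D)"
  by (simp add: is_dec_def)

lemma is_dec_proj: "is_dec C D \<Longrightarrow> i < nsum D \<Longrightarrow> proj D i \<in> mor C (tot D) (smd D i)"
  by (simp add: is_dec_def)

lemma is_dec_proj_incl: "is_dec C D \<Longrightarrow> i < nsum D \<Longrightarrow> j < nsum D \<Longrightarrow>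
    Comp C (proj D j) (incl D i) = (if i = j then Idm C (smd D i) else zerom C (smd D i) (smd D j))"
  by (simp add: is_dec_def)

lemma is_dec_sum: "is_dec C D \<Longrightarrow>
    finsum (Hom C (tot D) (tot D)) (\<lambda>i. Comp C (incl D i) (proj D i)) {..<nsum D} = Idm C (tot D)"
  by (simp add: is_dec_def)

lemmas is_dec_simps = is_dec_tot is_dec_smd is_dec_smd_Ob is_dec_incl is_dec_proj

context linear_category
begin

lemma component_mor:
  assumes "is_dec C A" "is_dec C B" "f \<in> mor C (tot A) (tot B)" "i < nsum A" "j < nsum B"
  shows "component C A B f i j \<in> mor C (smd A i) (smd B j)"
  unfolding component_def using assms
  by (meson Comp_closed is_dec_simps)

lemma component_zero:
  assumes "is_dec C A" "is_dec C B" "i < nsum A" "j < nsum B"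
  shows "component C A B (zerom C (tot A) (tot B)) i j = zerom C (smd A i) (smd B j)"
proof -
  note t = is_dec_simps[OF assms(1)] is_dec_simps[OF assms(2)]
  show ?thesis unfolding component_def using assms t
    by (simp add: Comp_zero(1)[of "tot A" "tot B" "smd B j"] Comp_zero(2)[of "smd A i" "tot A" "smd B j"])
qed

lemma component_add:
  assumes "is_dec C A" "is_dec C B" "f \<in> mor C (tot A) (tot B)" "g \<in> mor C (tot A) (tot B)"
    "i < nsum A" "j < nsum B"
  shows "component C A B (f \<oplus>\<^bsub>Hom C (tot A) (tot B)\<^esub> g) i j =
    component C A B f i j \<oplus>\<^bsub>Hom C (smd A i) (smd B j)\<^esub> component C A B g i j"
proof -
  note t = is_dec_simps[OF assms(1)] is_dec_simps[OF assms(2)]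
  have "Comp C (proj B j) f \<in> mor C (tot A) (smd B j)" "Comp C (proj B j) g \<in> mor C (tot A) (smd B j)"
    using assms t by (meson Comp_closed)+
  then show ?thesis
    unfolding component_def using assms t
    by (simp add: Comp_add_right[of "tot A" "tot B" "smd B j"] Comp_add_left[of "smd A i" "tot A" "smd B j"])
qed

lemma component_smult:
  assumes "is_dec C A" "is_dec C B" "f \<in> mor C (tot A) (tot B)" "a \<in> carrier K"
    "i < nsum A" "j < nsum B"
  shows "component C A B (a \<odot>\<^bsub>Hom C (tot A) (tot B)\<^esub> f) i j =
    a \<odot>\<^bsub>Hom C (smd A i) (smd B j)\<^esub> component C A B f i j"
proof -
  note t = is_dec_simps[OF assms(1)] is_dec_simps[OF assms(2)]
  have "Comp C (proj B j) f \<in> mor C (tot A) (smd B j)"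
    using assms t by (meson Comp_closed)
  then show ?thesis
    unfolding component_def using assms t
    by (simp add: Comp_smult_right[of "tot A" "tot B" "smd B j"] Comp_smult_left[of "smd A i" "tot A" "smd B j"])
qed

lemma component_Idm:
  assumes "is_dec C A" "i < nsum A" "j < nsum A"
  shows "component C A A (Idm C (tot A)) i j = (if i = j then Idm C (smd A i) else zerom C (smd A i) (smd A j))"
  unfolding component_def using assms is_dec_proj_incl[OF assms]
  by (simp add: Comp_Idm[of "tot A" "smd A j"] is_dec_simps)

text \<open>The identity of the target, written as the sum of \<open>incl\<close> after
  \<open>proj\<close>, recovers the restriction of a morphism to each source summand from its
  components; the identity of the source recovers the morphism from these restrictions.\<close>

lemma mor_ext:
  assumes A: "is_dec C A" and B: "is_dec C B"
    and f: "f \<in> mor C (tot A) (tot B)" and g: "g \<in> mor C (tot A) (tot B)"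
    and eq: "\<And>i j. i < nsum A \<Longrightarrow> j < nsum B \<Longrightarrow> component C A B f i j = component C A B g i j"
  shows "f = g"
proof -
  note t = is_dec_simps[OF A] is_dec_simps[OF B]
  have 1: "Comp C f (incl A i) = Comp C g (incl A i)" if i: "i < nsum A" for i
  proof -
    have "Comp C h (incl A i) = finsum (Hom C (smd A i) (tot B)) (\<lambda>j. Comp C (incl B j) (component C A B h i j)) {..<nsum B}"
      if h: "h \<in> mor C (tot A) (tot B)" for h
    proof -
      have hi: "Comp C h (incl A i) \<in> mor C (smd A i) (tot B)" using h t i by (meson Comp_closed)
      have "Comp C h (incl A i) = Comp C (finsum (Hom C (tot B) (tot B)) (\<lambda>i. Comp C (incl B i) (proj B i)) {..<nsum B}) (Comp C h (incl A i))"
        using is_dec_sum[OF B] Idm_Comp[OF _ _ hi] t i by simp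
      also have "\<dots> = finsum (Hom C (smd A i) (tot B)) (\<lambda>j. Comp C (Comp C (incl B j) (proj B j)) (Comp C h (incl A i))) {..<nsum B}"
        by (rule Comp_finsum_left) (use t i hi in \<open>simp_all add: Comp_mor[OF is_dec_proj[OF B] is_dec_incl[OF B]]\<close>)
      also have "\<dots> = finsum (Hom C (smd A i) (tot B)) (\<lambda>j. Comp C (incl B j) (component C A B h i j)) {..<nsum B}"
      proof (rule finsum_mor_cong)
        fix j assume j: "j \<in> {..<nsum B}"
        show "Comp C (Comp C (incl B j) (proj B j)) (Comp C h (incl A i)) = Comp C (incl B j) (component C A B h i j)"
          unfolding component_def using t i j hi h
          by (simp add: Comp_assoc[of "smd A i" "tot B" "smd B j" "tot B", symmetric] Comp_assoc[of "smd A i" "tot A" "tot B" "smd B j"])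
        show "Comp C (incl B j) (component C A B h i j) \<in> mor C (smd A i) (tot B)"
          using t i j component_mor[OF A B h i] by (meson Comp_closed lessThan_iff)
      qed (use t i in auto)
      finally show ?thesis .
    qed
    moreover have "finsum (Hom C (smd A i) (tot B)) (\<lambda>j. Comp C (incl B j) (component C A B f i j)) {..<nsum B} =
        finsum (Hom C (smd A i) (tot B)) (\<lambda>j. Comp C (incl B j) (component C A B g i j)) {..<nsum B}"
      using i t component_mor[OF A B g i] eq[OF i]
      by (intro finsum_mor_cong) (simp_all add: Comp_mor[OF _ is_dec_incl[OF B]])
    ultimately show ?thesis using f g by simp
  qed
  have "h = finsum (Hom C (tot A) (tot B)) (\<lambda>i. Comp C (Comp C h (incl A i)) (proj A i)) {..<nsum A}"
    if h: "h \<in> mor C (tot A) (tot B)" for h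
  proof -
    have "h = Comp C h (finsum (Hom C (tot A) (tot A)) (\<lambda>i. Comp C (incl A i) (proj A i)) {..<nsum A})"
      using is_dec_sum[OF A] h t by (simp add: Comp_Idm)
    also have "\<dots> = finsum (Hom C (tot A) (tot B)) (\<lambda>i. Comp C h (Comp C (incl A i) (proj A i))) {..<nsum A}"
      by (rule Comp_finsum_right) (use t h in \<open>simp_all add: Comp_mor[OF is_dec_proj[OF A] is_dec_incl[OF A]]\<close>)
    also have "\<dots> = finsum (Hom C (tot A) (tot B)) (\<lambda>i. Comp C (Comp C h (incl A i)) (proj A i)) {..<nsum A}"
    proof (rule finsum_mor_cong)
      fix i assume i: "i \<in> {..<nsum A}"
      show "Comp C h (Comp C (incl A i) (proj A i)) = Comp C (Comp C h (incl A i)) (proj A i)"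
        using i t h by (intro Comp_assoc[of "tot A" "smd A i" "tot A" "tot B"]) auto
      show "Comp C (Comp C h (incl A i)) (proj A i) \<in> mor C (tot A) (tot B)"
        using i t h by (simp add: Comp_mor[OF is_dec_proj[OF A] Comp_mor[OF is_dec_incl[OF A]]])
    qed (use t in auto)
    finally show ?thesis .
  qed
  note exp = this
  have "finsum (Hom C (tot A) (tot B)) (\<lambda>i. Comp C (Comp C f (incl A i)) (proj A i)) {..<nsum A} =
      finsum (Hom C (tot A) (tot B)) (\<lambda>i. Comp C (Comp C g (incl A i)) (proj A i)) {..<nsum A}"
    using 1 t g by (intro finsum_mor_cong) (simp_all add: Comp_mor[OF is_dec_proj[OF A] Comp_mor[OF is_dec_incl[OF A]]])
  then show ?thesis using exp[OF f] exp[OF g] by simp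
qed

lemma of_mat_mor:
  assumes A: "is_dec C A" and B: "is_dec C B"
    and M: "\<And>i j. i < nsum A \<Longrightarrow> j < nsum B \<Longrightarrow> M i j \<in> mor C (smd A i) (smd B j)"
  shows "of_mat C A B M \<in> mor C (tot A) (tot B)"
proof -
  note t = is_dec_simps[OF A] is_dec_simps[OF B]
  show ?thesis unfolding of_mat_def
  proof (rule finsum_mor)
    fix p assume p: "p \<in> {..<nsum A} \<times> {..<nsum B}"
    obtain i j where "p = (i, j)" by force
    with p have ij: "p = (i, j)" "i < nsum A" "j < nsum B" by auto
    have "Comp C (M i j) (proj A i) \<in> mor C (tot A) (smd B j)"
      by (rule Comp_mor[where Y = "smd A i"]) (simp_all add: t M ij)
    then show "(case p of (i, j) \<Rightarrow> Comp C (incl B j) (Comp C (M i j) (proj A i))) \<in> mor C (tot A) (tot B)"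
      unfolding ij(1) prod.case by (rule Comp_mor[where Y = "smd B j"]) (use ij in \<open>simp_all add: t\<close>)
  qed (use t in auto)
qed

text \<open>Orthogonality of the structure maps, used once on each side of the sum, kills every term
  except the one at \<open>(i, j)\<close>.\<close>

lemma component_of_mat:
  assumes A: "is_dec C A" and B: "is_dec C B"
    and M: "\<And>i j. i < nsum A \<Longrightarrow> j < nsum B \<Longrightarrow> M i j \<in> mor C (smd A i) (smd B j)"
    and i: "i < nsum A" and j: "j < nsum B"
  shows "component C A B (of_mat C A B M) i j = M i j"
proof -
  note t = is_dec_simps[OF A] is_dec_simps[OF B]
  let ?F = "\<lambda>(i', j'). Comp C (incl B j') (Comp C (M i' j') (proj A i'))"
  let ?S = "{..<nsum A} \<times> {..<nsum B}"
  have m: "Comp C (M i' j') (proj A i') \<in> mor C (tot A) (smd B j')" if "i' < nsum A" "j' < nsum B" for i' j'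
    by (rule Comp_mor[where Y = "smd A i'"]) (simp_all add: t M that)
  have F: "?F p \<in> mor C (tot A) (tot B)" if p: "p \<in> ?S" for p
  proof -
    obtain i j where "p = (i, j)" by force
    with p have ij: "p = (i, j)" "i < nsum A" "j < nsum B" by auto
    show ?thesis
      unfolding ij(1) prod.case by (rule Comp_mor[where Y = "smd B j"]) (use ij in \<open>simp_all add: t m\<close>)
  qed
  have pF: "Comp C (proj B j) (?F p) \<in> mor C (tot A) (smd B j)" if p: "p \<in> ?S" for p
    by (rule Comp_mor[where Y = "tot B"]) (use t j F[OF p] in simp_all)
  have "component C A B (of_mat C A B M) i j =
      Comp C (finsum (Hom C (tot A) (smd B j)) (\<lambda>p. Comp C (proj B j) (?F p)) ?S) (incl A i)"
    unfolding component_def of_mat_def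
    by (subst Comp_finsum_right[OF _ _ _ F is_dec_proj[OF B j]]) (use t j in simp_all)
  also have "\<dots> = finsum (Hom C (smd A i) (smd B j)) (\<lambda>p. Comp C (Comp C (proj B j) (?F p)) (incl A i)) ?S"
    by (intro Comp_finsum_left) (use t i j pF in simp_all)
  also have "\<dots> = finsum (Hom C (smd A i) (smd B j)) (\<lambda>p. if p = (i, j) then M i j else zerom C (smd A i) (smd B j)) ?S"
  proof (rule finsum_mor_cong)
    fix p assume p: "p \<in> ?S"
    obtain i' j' where ij: "p = (i', j')" "i' < nsum A" "j' < nsum B" using p by auto
    have "Comp C (proj B j) (?F p) = Comp C (Comp C (proj B j) (incl B j')) (Comp C (M i' j') (proj A i'))"
      using ij t m j by (simp add: Comp_assoc[of "tot A" "smd B j'" "tot B" "smd B j"])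
    also have "\<dots> = (if j' = j then Comp C (M i' j') (proj A i') else zerom C (tot A) (smd B j))"
      using is_dec_proj_incl[OF B ij(3) j] Idm_Comp[OF _ _ m[OF ij(2,3)]] m[OF ij(2,3)] t(1) t(8)[OF j] t(8)[OF ij(3)] by auto
    finally have 1: "Comp C (proj B j) (?F p) = \<dots>" .
    have "Comp C (Comp C (M i' j') (proj A i')) (incl A i) = Comp C (M i' j') (Comp C (proj A i') (incl A i))"
      using ij t M i by (simp add: Comp_assoc[of "smd A i" "tot A" "smd A i'" "smd B j'"])
    also have "\<dots> = (if i' = i then M i' j' else zerom C (smd A i) (smd B j'))"
      using is_dec_proj_incl[OF A i ij(2)] Comp_Idm[OF _ _ M[OF ij(2,3)]] M[OF ij(2,3)] t(3) i ij(2,3) t(8)[OF ij(3)] by auto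
    finally show "Comp C (Comp C (proj B j) (?F p)) (incl A i) =
        (if p = (i, j) then M i j else zerom C (smd A i) (smd B j))"
      using 1 ij i j t by auto
  qed (use t i j M in auto)
  also have "\<dots> = M i j"
    using t i j M finsum_mor_single[of "smd A i" "smd B j" ?S "(i, j)" "\<lambda>p. if p = (i, j) then M i j else zerom C (smd A i) (smd B j)"]
    by auto
  finally show ?thesis .
qed

text \<open>Matrix multiplication: the expansion of the identity of \<open>tot B\<close> over its
  summands is inserted between the two factors.\<close>

lemma component_Comp:
  assumes A: "is_dec C A" and B: "is_dec C B" and D: "is_dec C D"
    and f: "f \<in> mor C (tot A) (tot B)" and g: "g \<in> mor C (tot B) (tot D)"
    and i: "i < nsum A" and l: "l < nsum D"
  shows "component C A D (Comp C g f) i l = finsum (Hom C (smd A i) (smd D l))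
    (\<lambda>j. Comp C (component C B D g j l) (component C A B f i j)) {..<nsum B}"
proof -
  note t = is_dec_simps[OF A] is_dec_simps[OF B] is_dec_simps[OF D]
  define F where "F = Comp C f (incl A i)"
  define G where "G = Comp C (proj D l) g"
  have F: "F \<in> mor C (smd A i) (tot B)" unfolding F_def using t i f by (meson Comp_closed)
  have G: "G \<in> mor C (tot B) (smd D l)" unfolding G_def using t l g by (meson Comp_closed)
  have pF: "Comp C (proj B j) F \<in> mor C (smd A i) (smd B j)" if "j < nsum B" for j
    using that t F i by (meson Comp_closed)
  have Gi: "Comp C G (incl B j) \<in> mor C (smd B j) (smd D l)" if "j < nsum B" for j
    using that t G l by (meson Comp_closed)
  have "component C A D (Comp C g f) i l = Comp C (Comp C G f) (incl A i)"
    unfolding component_def G_def using t f g l by (simp add: Comp_assoc[of "tot A" "tot B" "tot D" "smd D l"])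
  also have "\<dots> = Comp C G F" unfolding F_def using t f G i l by (simp add: Comp_assoc[of "smd A i" "tot A" "tot B" "smd D l"])
  also have "\<dots> = Comp C G (Comp C (finsum (Hom C (tot B) (tot B)) (\<lambda>j. Comp C (incl B j) (proj B j)) {..<nsum B}) F)"
    using is_dec_sum[OF B] Idm_Comp[OF _ _ F] t i by simp
  also have "Comp C (finsum (Hom C (tot B) (tot B)) (\<lambda>j. Comp C (incl B j) (proj B j)) {..<nsum B}) F =
      finsum (Hom C (smd A i) (tot B)) (\<lambda>j. Comp C (incl B j) (Comp C (proj B j) F)) {..<nsum B}"
  proof -
    have "Comp C (finsum (Hom C (tot B) (tot B)) (\<lambda>j. Comp C (incl B j) (proj B j)) {..<nsum B}) F =
       finsum (Hom C (smd A i) (tot B)) (\<lambda>j. Comp C (Comp C (incl B j) (proj B j)) F) {..<nsum B}"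
      by (rule Comp_finsum_left) (use t i F in \<open>simp_all add: Comp_mor[OF is_dec_proj[OF B] is_dec_incl[OF B]]\<close>)
    also have "\<dots> = finsum (Hom C (smd A i) (tot B)) (\<lambda>j. Comp C (incl B j) (Comp C (proj B j) F)) {..<nsum B}"
    proof (rule finsum_mor_cong)
      fix j assume j: "j \<in> {..<nsum B}"
      show "Comp C (Comp C (incl B j) (proj B j)) F = Comp C (incl B j) (Comp C (proj B j) F)"
        using i j t F by (intro Comp_assoc[of "smd A i" "tot B" "smd B j" "tot B", symmetric]) auto
      show "Comp C (incl B j) (Comp C (proj B j) F) \<in> mor C (smd A i) (tot B)"
        using i j t pF by (simp add: Comp_mor[OF _ is_dec_incl[OF B]])
    qed (use t i in auto)
    finally show ?thesis .
  qed
  also have "Comp C G \<dots> = finsum (Hom C (smd A i) (smd D l))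
    (\<lambda>j. Comp C G (Comp C (incl B j) (Comp C (proj B j) F))) {..<nsum B}"
    by (rule Comp_finsum_right) (use t i l G in \<open>simp_all add: Comp_mor[OF pF is_dec_incl[OF B]]\<close>)
  also have "\<dots> = finsum (Hom C (smd A i) (smd D l))
    (\<lambda>j. Comp C (component C B D g j l) (component C A B f i j)) {..<nsum B}"
  proof (rule finsum_mor_cong)
    fix j assume j: "j \<in> {..<nsum B}"
    have "component C A B f i j = Comp C (proj B j) F" unfolding component_def F_def
      using t i j f by (simp add: Comp_assoc[of "smd A i" "tot A" "tot B" "smd B j"])
    moreover have "component C B D g j l = Comp C G (incl B j)" unfolding component_def G_def ..
    moreover have "Comp C G (Comp C (incl B j) (Comp C (proj B j) F)) = Comp C (Comp C G (incl B j)) (Comp C (proj B j) F)"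
      using t i j l pF G by (simp add: Comp_assoc[of "smd A i" "smd B j" "tot B" "smd D l"])
    ultimately show "Comp C G (Comp C (incl B j) (Comp C (proj B j) F)) = Comp C (component C B D g j l) (component C A B f i j)"
      by simp
    show "Comp C (component C B D g j l) (component C A B f i j) \<in> mor C (smd A i) (smd D l)"
      using component_mor[OF A B f i] component_mor[OF B D g _ l] j i l t by (meson Comp_closed lessThan_iff)
  qed (use t i l in auto)
  finally show ?thesis .
qed

lemma single_dec_sel [simp]:
  "nsum (single_dec C E) = 1" "tot (single_dec C E) = E" "smd (single_dec C E) 0 = E"
  "incl (single_dec C E) 0 = Idm C E" "proj (single_dec C E) 0 = Idm C E"
  by (auto simp: single_dec_def smd_def incl_def proj_def)

lemma is_dec_iso:
  assumes "indecomposable C E" "X \<in> Ob C" "i \<in> mor C E X" "p \<in> mor C X E"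
    "Comp C p i = Idm C E" "Comp C i p = Idm C X"
  shows "is_dec C (X, [(E, i, p)])"
proof -
  interpret H: abelian_group "Hom C X X" using assms Hom_abelian by blast
  show ?thesis unfolding is_dec_def smd_def incl_def proj_def using assms Idm_closed
    by (simp add: lessThan_Suc)
qed

lemma is_dec_single: "indecomposable C E \<Longrightarrow> is_dec C (single_dec C E)"
  unfolding single_dec_def
  by (rule is_dec_iso) (auto simp: indecomposable_Ob Idm_closed Comp_Idm[OF _ _ Idm_closed])

lemma is_dec_zero:
  assumes "zero_obj C N" shows "is_dec C (N, [])"
proof -
  have N: "N \<in> Ob C" "Idm C N = zerom C N N" using assms zero_obj_iff unfolding zero_obj_def by auto
  interpret H: abelian_group "Hom C N N" using N Hom_abelian by blast
  show ?thesis unfolding is_dec_def using N by simp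
qed

text \<open>A summand of a zero object would have an identity that factors through zero, whereas
  indecomposable objects are nonzero by definition.\<close>

lemma is_dec_nsum_0:
  assumes "is_dec C D" shows "nsum D = 0 \<longleftrightarrow> zero_obj C (tot D)"
proof
  assume 0: "nsum D = 0"
  interpret H: abelian_group "Hom C (tot D) (tot D)" using assms is_dec_tot Hom_abelian by blast
  show "zero_obj C (tot D)"
    using is_dec_sum[OF assms] 0 zero_obj_iff[OF is_dec_tot[OF assms]] by simp
next
  assume z: "zero_obj C (tot D)"
  show "nsum D = 0"
  proof (rule ccontr)
    assume "nsum D \<noteq> 0"
    then have i: "0 < nsum D" by simp
    note t = is_dec_simps[OF assms]
    have "incl D 0 = zerom C (smd D 0) (tot D)" using z i t by (intro zero_obj_mor) auto
    then have "Idm C (smd D 0) = zerom C (smd D 0) (smd D 0)"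
      using is_dec_proj_incl[OF assms i i] t i Comp_zero(1)[of "smd D 0" "tot D" "smd D 0" "proj D 0"] by simp
    then show False using zero_obj_iff t i unfolding indecomposable_def by blast
  qed
qed

text \<open>The matrix product collapses to one term when the row or the column involved has at most
  one nonzero entry. Products with inclusions and projections of blocks are computed in this
  way.\<close>

lemma component_delta_Comp:
  assumes A: "is_dec C A" and B: "is_dec C B" and D: "is_dec C D"
    and f: "f \<in> mor C (tot A) (tot B)" and g: "g \<in> mor C (tot B) (tot D)"
    and i: "i < nsum A" and l: "l < nsum D" and j: "j < nsum B"
    and z: "\<And>j'. j' < nsum B \<Longrightarrow> j' \<noteq> j \<Longrightarrow> component C A B f i j' = zerom C (smd A i) (smd B j') \<or>
        component C B D g j' l = zerom C (smd B j') (smd D l)"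
  shows "component C A D (Comp C g f) i l = Comp C (component C B D g j l) (component C A B f i j)"
proof -
  note t = is_dec_simps[OF A] is_dec_simps[OF B] is_dec_simps[OF D]
  note m = component_mor[OF A B f i] component_mor[OF B D g _ l]
  show ?thesis unfolding component_Comp[OF A B D f g i l]
  proof (rule finsum_mor_single)
    show "Comp C (component C B D g j l) (component C A B f i j) \<in> mor C (smd A i) (smd D l)"
      using m[OF j] t i j l by (meson Comp_closed)
    fix j' assume "j' \<in> {..<nsum B}" "j' \<noteq> j"
    then show "Comp C (component C B D g j' l) (component C A B f i j') = zerom C (smd A i) (smd D l)"
      using z[of j'] t i l m[of j'] by auto
  qed (use t i l j in auto)
qed

text \<open>The index maps \<open>s\<close> and \<open>s'\<close> partition the summands of
  \<open>B\<close>, and the four structure maps are the corresponding 0-1 matrices. The summands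
  agree as objects and not just up to isomorphism, so identities can serve as entries. The facts
  \<open>pi\<close> and \<open>ip\<close> compute projection after inclusion and inclusion after
  projection for an arbitrary index map; the five biproduct equations are instances.\<close>

lemma block_biproduct:
  assumes A: "is_dec C A" and A': "is_dec C A'" and B: "is_dec C B"
    and s: "\<And>i. i < nsum A \<Longrightarrow> s i < nsum B \<and> smd B (s i) = smd A i"
    and s': "\<And>i. i < nsum A' \<Longrightarrow> s' i < nsum B \<and> smd B (s' i) = smd A' i"
    and inj: "inj_on s {..<nsum A}" "inj_on s' {..<nsum A'}"
    and cover: "s ` {..<nsum A} \<inter> s' ` {..<nsum A'} = {}" "s ` {..<nsum A} \<union> s' ` {..<nsum A'} = {..<nsum B}"
  defines "M \<equiv> \<lambda>A (s :: nat \<Rightarrow> nat) i j. if j = s i then Idm C (smd A i) else zerom C (smd A i) (smd B j)"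
    and "N \<equiv> \<lambda>A (s :: nat \<Rightarrow> nat) j i. if j = s i then Idm C (smd A i) else zerom C (smd B j) (smd A i)"
  shows "biproduct C (tot A) (tot A') (tot B) (of_mat C A B (M A s)) (of_mat C A' B (M A' s'))
      (of_mat C B A (N A s)) (of_mat C B A' (N A' s'))"
proof -
  have M_mor: "M X r i j \<in> mor C (smd X i) (smd B j)"
    and N_mor: "N X r j i \<in> mor C (smd B j) (smd X i)"
    if "is_dec C X" "i < nsum X" "j < nsum B" "i < nsum X \<Longrightarrow> smd B (r i) = smd X i" for X r i j
    using that is_dec_simps[OF B] is_dec_simps[OF that(1)] Idm_closed[of "smd X i"] unfolding M_def N_def
    by auto
  have mm: "of_mat C X B (M X r) \<in> mor C (tot X) (tot B)"
      "of_mat C B X (N X r) \<in> mor C (tot B) (tot X)"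
      "i < nsum X \<Longrightarrow> j < nsum B \<Longrightarrow> component C X B (of_mat C X B (M X r)) i j = M X r i j"
      "i < nsum X \<Longrightarrow> j < nsum B \<Longrightarrow> component C B X (of_mat C B X (N X r)) j i = N X r j i"
    if "is_dec C X" "\<And>i. i < nsum X \<Longrightarrow> smd B (r i) = smd X i" for X r i j
  proof -
    have M: "M X r i j \<in> mor C (smd X i) (smd B j)" and N: "N X r j i \<in> mor C (smd B j) (smd X i)"
      if "i < nsum X" "j < nsum B" for i j
      using M_mor[OF \<open>is_dec C X\<close>, of i j r] N_mor[OF \<open>is_dec C X\<close>, of i j r] that \<open>\<And>i. i < nsum X \<Longrightarrow> smd B (r i) = smd X i\<close>
      by simp_all
    show "of_mat C X B (M X r) \<in> mor C (tot X) (tot B)" by (rule of_mat_mor[OF that(1) B M])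
    show "of_mat C B X (N X r) \<in> mor C (tot B) (tot X)" by (rule of_mat_mor[OF B that(1) N])
    show "component C X B (of_mat C X B (M X r)) i j = M X r i j" if "i < nsum X" "j < nsum B"
      by (rule component_of_mat[OF \<open>is_dec C X\<close> B M that])
    show "component C B X (of_mat C B X (N X r)) j i = N X r j i" if "i < nsum X" "j < nsum B"
      by (rule component_of_mat[OF B \<open>is_dec C X\<close> N that(2,1)])
  qed
  have pi: "component C X X' (Comp C (of_mat C B X' (N X' r')) (of_mat C X B (M X r))) i l
      = (if r' l = r i then Idm C (smd X i) else zerom C (smd X i) (smd X' l))"
    if X: "is_dec C X" and r: "\<And>i. i < nsum X \<Longrightarrow> r i < nsum B \<and> smd B (r i) = smd X i"
    and X': "is_dec C X'" and r': "\<And>i. i < nsum X' \<Longrightarrow> r' i < nsum B \<and> smd B (r' i) = smd X' i"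
    and i: "i < nsum X" "l < nsum X'" for X X' r r' i l
  proof -
    have ri: "r i < nsum B" "smd B (r i) = smd X i" using r i by auto
    note m = mm[OF X conjunct2[OF r]] and m' = mm[OF X' conjunct2[OF r']]
    have "component C X X' (Comp C (of_mat C B X' (N X' r')) (of_mat C X B (M X r))) i l
      = Comp C (component C B X' (of_mat C B X' (N X' r')) (r i) l) (component C X B (of_mat C X B (M X r)) i (r i))"
    proof (rule component_delta_Comp[OF X B X' m(1) m'(2) i ri(1)])
      fix j' assume "j' < nsum B" "j' \<noteq> r i"
      then have "component C X B (of_mat C X B (M X r)) i j' = zerom C (smd X i) (smd B j')"
        using m(3)[OF _ i(1), of j'] by (simp add: M_def)
      then show "component C X B (of_mat C X B (M X r)) i j' = zerom C (smd X i) (smd B j') \<or>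
        component C B X' (of_mat C B X' (N X' r')) j' l = zerom C (smd B j') (smd X' l)" ..
    qed
    also have "\<dots> = Comp C (N X' r' (r i) l) (Idm C (smd X i))"
      using m(3)[OF _ i(1) ri(1)] m'(4)[OF _ i(2) ri(1)] by (simp add: M_def)
    also have "\<dots> = N X' r' (r i) l"
      using N_mor[OF X' i(2) ri(1), of r'] r' ri i is_dec_smd_Ob[OF X] is_dec_smd_Ob[OF X']
      by (intro Comp_Idm) auto
    finally show ?thesis using r'[OF i(2)] ri by (cases "r' l = r i") (simp_all add: N_def)
  qed
  have ip: "component C B B (Comp C (of_mat C X B (M X r)) (of_mat C B X (N X r))) j l
      = (if j = l \<and> j \<in> r ` {..<nsum X} then Idm C (smd B j) else zerom C (smd B j) (smd B l))"
    if X: "is_dec C X" and r: "\<And>i. i < nsum X \<Longrightarrow> r i < nsum B \<and> smd B (r i) = smd X i" and inj: "inj_on r {..<nsum X}"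
    and j: "j < nsum B" "l < nsum B" for X r j l
  proof -
    note m = mm[OF X conjunct2[OF r]]
    note tX = is_dec_smd_Ob[OF X]
    show ?thesis
    proof (cases "j \<in> r ` {..<nsum X}")
      case True
      then obtain i where i: "i < nsum X" "j = r i" by auto
      have "component C B B (Comp C (of_mat C X B (M X r)) (of_mat C B X (N X r))) j l
        = Comp C (component C X B (of_mat C X B (M X r)) i l) (component C B X (of_mat C B X (N X r)) j i)"
      proof (rule component_delta_Comp[OF B X B m(2) m(1) j i(1)])
        fix i' assume i': "i' < nsum X" "i' \<noteq> i"
        then have "j \<noteq> r i'" using inj_onD[OF inj, of i i'] i by auto
        then have "component C B X (of_mat C B X (N X r)) j i' = zerom C (smd B j) (smd X i')"
          using m(4)[OF _ i'(1) j(1)] by (simp add: N_def)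
        then show "component C B X (of_mat C B X (N X r)) j i' = zerom C (smd B j) (smd X i') \<or>
          component C X B (of_mat C X B (M X r)) i' l = zerom C (smd X i') (smd B l)" ..
      qed
      also have "\<dots> = Comp C (M X r i l) (Idm C (smd X i))"
        using m(3)[OF _ i(1) j(2)] m(4)[OF _ i(1) j(1)] i by (simp add: N_def)
      also have "\<dots> = M X r i l"
        using M_mor[OF X i(1) j(2), of r] r[OF i(1)] tX[OF i(1)] is_dec_smd_Ob[OF B j(2)] by (intro Comp_Idm) auto
      finally show ?thesis using r[OF i(1)] i j True by (auto simp: M_def)
    next
      case False
      have z: "component C B X (of_mat C B X (N X r)) j i = zerom C (smd B j) (smd X i)" if "i < nsum X" for i
        using False m(4)[OF _ that j(1)] that by (auto simp: N_def)
      have "component C B B (Comp C (of_mat C X B (M X r)) (of_mat C B X (N X r))) j l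
          = finsum (Hom C (smd B j) (smd B l)) (\<lambda>i. Comp C (component C X B (of_mat C X B (M X r)) i l) (component C B X (of_mat C B X (N X r)) j i)) {..<nsum X}"
        by (rule component_Comp[OF B X B m(2) m(1) j])
      also have "\<dots> = zerom C (smd B j) (smd B l)"
      proof (rule finsum_mor_zero)
        fix i assume "i \<in> {..<nsum X}"
        then have i: "i < nsum X" by simp
        show "Comp C (component C X B (of_mat C X B (M X r)) i l) (component C B X (of_mat C B X (N X r)) j i) = zerom C (smd B j) (smd B l)"
          unfolding z[OF i]
          by (rule Comp_zero(1)[OF _ _ _ component_mor[OF X B m(1) i j(2)]]) (use i j tX is_dec_smd_Ob[OF B] in simp_all)
      qed (use j is_dec_smd_Ob[OF B] in simp_all)
      finally show ?thesis using False by simp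
    qed
  qed
  note t = is_dec_simps[OF A] is_dec_simps[OF A'] is_dec_simps[OF B]
  note o = mm(1,2)[OF A conjunct2[OF s]] mm(1,2)[OF A' conjunct2[OF s']]
  have e1: "Comp C (of_mat C B A (N A s)) (of_mat C A B (M A s)) = Idm C (tot A)"
    by (rule mor_ext[OF A A Comp_mor[OF o(1,2)]])
      (use pi[OF A s A s] inj_on_eq_iff[OF inj(1)] t in \<open>auto simp: component_Idm[OF A] Idm_closed\<close>)
  have e2: "Comp C (of_mat C B A' (N A' s')) (of_mat C A' B (M A' s')) = Idm C (tot A')"
    by (rule mor_ext[OF A' A' Comp_mor[OF o(3,4)]])
      (use pi[OF A' s' A' s'] inj_on_eq_iff[OF inj(2)] t in \<open>auto simp: component_Idm[OF A'] Idm_closed\<close>)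
  have ne: "s i \<noteq> s' l" if "i < nsum A" "l < nsum A'" for i l using cover(1) that by auto
  have e3: "Comp C (of_mat C B A' (N A' s')) (of_mat C A B (M A s)) = zerom C (tot A) (tot A')"
    by (rule mor_ext[OF A A' Comp_mor[OF o(1,4)]])
      (use pi[OF A s A' s'] ne[THEN not_sym] t in \<open>simp_all add: component_zero[OF A A']\<close>)
  have e4: "Comp C (of_mat C B A (N A s)) (of_mat C A' B (M A' s')) = zerom C (tot A') (tot A)"
    by (rule mor_ext[OF A' A Comp_mor[OF o(3,2)]])
      (use pi[OF A' s' A s] ne t in \<open>simp_all add: component_zero[OF A' A]\<close>)
  have c: "Comp C (of_mat C A B (M A s)) (of_mat C B A (N A s)) \<in> mor C (tot B) (tot B)"
    "Comp C (of_mat C A' B (M A' s')) (of_mat C B A' (N A' s')) \<in> mor C (tot B) (tot B)"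
    using Comp_mor[OF o(2,1)] Comp_mor[OF o(4,3)] t(1,6,11) by simp_all
  have "Comp C (of_mat C A B (M A s)) (of_mat C B A (N A s)) \<oplus>\<^bsub>Hom C (tot B) (tot B)\<^esub>
      Comp C (of_mat C A' B (M A' s')) (of_mat C B A' (N A' s')) = Idm C (tot B)"
  proof (rule mor_ext[OF B B])
    fix j l assume j: "j < nsum B" "l < nsum B"
    have "j \<in> s ` {..<nsum A} \<union> s' ` {..<nsum A'}" using j by (subst cover(2)) simp
    \<comment> \<open>Each summand of \<open>B\<close> lies in exactly one block, so exactly one of
      the two idempotents contributes to a diagonal entry.\<close>
    then have j': "j \<in> s ` {..<nsum A} \<longleftrightarrow> j \<notin> s' ` {..<nsum A'}"
      using cover(1) by (metis IntI Un_iff empty_iff)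
    show "component C B B (Comp C (of_mat C A B (M A s)) (of_mat C B A (N A s)) \<oplus>\<^bsub>Hom C (tot B) (tot B)\<^esub>
      Comp C (of_mat C A' B (M A' s')) (of_mat C B A' (N A' s'))) j l = component C B B (Idm C (tot B)) j l"
      using component_add[OF B B c j] ip[OF A s inj(1) j] ip[OF A' s' inj(2) j] component_Idm[OF B j]
        is_dec_smd_Ob[OF B j(1)] is_dec_smd_Ob[OF B j(2)]
      by (cases "j \<in> s' ` {..<nsum A'}") (simp_all only: j' if_True if_False simp_thms, simp_all add: Idm_closed)
  qed (use c t(11) in \<open>simp_all add: Idm_closed\<close>)
  then show ?thesis unfolding biproduct_def using e1 e2 e3 e4 o t(1,6,11) by simp
qed

end

text \<open>Only binary sums are available, so the new summand \<open>E\<close> is added to the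
  total object of the rest and the old structure maps are composed with \<open>i2\<close> and
  \<open>p2\<close>. The summands are literally those of the list; objects of the lift with
  prescribed summands and phases are built from this.\<close>

lemma (in additive_category) ex_dec_of_list:
  "(\<And>E. E \<in> set Es \<Longrightarrow> indecomposable C E) \<Longrightarrow> \<exists>D. is_dec C D \<and> map fst (snd D) = Es"
proof (induction Es)
  case Nil
  then show ?case using ex_zero_obj is_dec_zero by fastforce
next
  case (Cons E Es)
  then obtain D where D: "is_dec C D" "map fst (snd D) = Es" by auto
  have E: "indecomposable C E" using Cons(2) by simp
  then have E: "indecomposable C E" "E \<in> Ob C" by (simp_all add: indecomposable_Ob)
  note t = is_dec_simps[OF D(1)]
  obtain S i1 i2 p1 p2 where "biproduct C E (tot D) S i1 i2 p1 p2"
    using ex_direct_sum[OF E(2) t(1)] unfolding direct_sum_def by blast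
  then have S: "S \<in> Ob C" "i1 \<in> mor C E S" "i2 \<in> mor C (tot D) S" "p1 \<in> mor C S E" "p2 \<in> mor C S (tot D)"
    "Comp C p1 i1 = Idm C E" "Comp C p2 i2 = Idm C (tot D)" "Comp C p2 i1 = zerom C E (tot D)"
    "Comp C p1 i2 = zerom C (tot D) E" "Comp C i1 p1 \<oplus>\<^bsub>Hom C S S\<^esub> Comp C i2 p2 = Idm C S"
    by (auto simp: biproduct_def)
  define D' where "D' = (S, (E, i1, p1) # map (\<lambda>(F, i, p). (F, Comp C i2 i, Comp C p p2)) (snd D))"
  have n: "nsum D' = Suc (nsum D)" "tot D' = S" by (auto simp: D'_def)
  have z: "smd D' 0 = E" "incl D' 0 = i1" "proj D' 0 = p1" by (auto simp: D'_def smd_def incl_def proj_def)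
  have s: "smd D' (Suc i) = smd D i \<and> incl D' (Suc i) = Comp C i2 (incl D i) \<and> proj D' (Suc i) = Comp C (proj D i) p2"
    if "i < nsum D" for i
    using that by (auto simp: D'_def smd_def incl_def proj_def split: prod.splits)
  have m: "Comp C i2 (incl D i) \<in> mor C (smd D i) S" "Comp C (proj D i) p2 \<in> mor C S (smd D i)" if "i < nsum D" for i
    using Comp_mor[OF _ S(3)] Comp_mor[OF S(5)] that S(1) t by simp_all
  \<comment> \<open>The index \<open>0\<close> belongs to the new summand. From the other terms
    \<open>i2\<close> and \<open>p2\<close> are pulled out of the sum, which leaves the identity of
    \<open>tot D\<close> between them.\<close>
  have sum: "finsum (Hom C S S) (\<lambda>i. Comp C (incl D' i) (proj D' i)) {..<Suc (nsum D)} = Idm C S"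
  proof -
    interpret H: abelian_group "Hom C S S" using S Hom_abelian by blast
    have c: "Comp C (incl D' i) (proj D' i) \<in> mor C S S" if "i < Suc (nsum D)" for i
      using that Comp_mor[OF S(4,2)] E S(1) Comp_mor[OF m(2) m(1)] t by (cases i) (simp_all add: z s)
    have "finsum (Hom C S S) (\<lambda>i. Comp C (incl D' i) (proj D' i)) {..<Suc (nsum D)} =
      Comp C i1 p1 \<oplus>\<^bsub>Hom C S S\<^esub> finsum (Hom C S S) (\<lambda>i. Comp C (incl D' i) (proj D' i)) (Suc ` {..<nsum D})"
      unfolding lessThan_Suc_eq_insert_0 using c z by (subst H.finsum_insert) auto
    also have "finsum (Hom C S S) (\<lambda>i. Comp C (incl D' i) (proj D' i)) (Suc ` {..<nsum D}) =
       finsum (Hom C S S) (\<lambda>i. Comp C (incl D' (Suc i)) (proj D' (Suc i))) {..<nsum D}"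
      using c by (subst H.add.finprod_reindex) auto
    also have "\<dots> = finsum (Hom C S S) (\<lambda>i. Comp C (Comp C i2 (Comp C (incl D i) (proj D i))) p2) {..<nsum D}"
    proof (rule finsum_mor_cong)
      fix i assume i: "i \<in> {..<nsum D}"
      have ip: "Comp C (incl D i) (proj D i) \<in> mor C (tot D) (tot D)" using i t Comp_mor[of "proj D i" "tot D" "smd D i" "incl D i" "tot D"] by simp
      show "Comp C (incl D' (Suc i)) (proj D' (Suc i)) = Comp C (Comp C i2 (Comp C (incl D i) (proj D i))) p2"
        using i s m t S ip Comp_assoc[of S "tot D" "smd D i" S "p2" "proj D i" "Comp C i2 (incl D i)"]
          Comp_assoc[of "tot D" "smd D i" "tot D" S "proj D i" "incl D i" i2] by simp
      show "Comp C (Comp C i2 (Comp C (incl D i) (proj D i))) p2 \<in> mor C S S"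
        using Comp_mor[OF S(5) Comp_mor[OF ip S(3)]] S(1) t(1) by simp
    qed (use S in auto)
    also have "\<dots> = Comp C (finsum (Hom C (tot D) S) (\<lambda>i. Comp C i2 (Comp C (incl D i) (proj D i))) {..<nsum D}) p2"
      by (rule Comp_finsum_left[symmetric]) (use S t in \<open>simp_all add: Comp_mor[OF Comp_mor[OF is_dec_proj[OF D(1)] is_dec_incl[OF D(1)]] S(3)]\<close>)
    also have "finsum (Hom C (tot D) S) (\<lambda>i. Comp C i2 (Comp C (incl D i) (proj D i))) {..<nsum D} =
        Comp C i2 (finsum (Hom C (tot D) (tot D)) (\<lambda>i. Comp C (incl D i) (proj D i)) {..<nsum D})"
      by (rule Comp_finsum_right[symmetric]) (use S t in \<open>simp_all add: Comp_mor[OF is_dec_proj[OF D(1)] is_dec_incl[OF D(1)]]\<close>)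
    also have "\<dots> = i2" using is_dec_sum[OF D(1)] S t by (simp add: Comp_Idm[OF _ _ S(3)])
    finally show ?thesis using S by simp
  qed
  have orth: "Comp C (proj D' j) (incl D' i) = (if i = j then Idm C (smd D' i) else zerom C (smd D' i) (smd D' j))"
    if ij: "i < nsum D'" "j < nsum D'" for i j
  proof -
    have a: "Comp C (Comp C (proj D b) p2) i1 = zerom C E (smd D b)" if "b < nsum D" for b
      using that S t E Comp_zero(1)[of E "tot D" "smd D b"] by (simp add: Comp_assoc[of E S "tot D" "smd D b", symmetric])
    have b: "Comp C p1 (Comp C i2 (incl D b)) = zerom C (smd D b) E" if "b < nsum D" for b
      using that S t E Comp_zero(2)[of "smd D b" "tot D" E] by (simp add: Comp_assoc[of "smd D b" "tot D" S E])
    have "Comp C (Comp C (proj D a) p2) (Comp C i2 (incl D b)) = Comp C (proj D a) (incl D b)" if "a < nsum D" "b < nsum D" for a b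
    proof -
      have "Comp C (Comp C (proj D a) p2) (Comp C i2 (incl D b)) = Comp C (proj D a) (Comp C p2 (Comp C i2 (incl D b)))"
        using that S t m by (simp add: Comp_assoc[of "smd D b" S "tot D" "smd D a", symmetric])
      also have "Comp C p2 (Comp C i2 (incl D b)) = incl D b"
        using that S t Idm_Comp[of "smd D b" "tot D"] by (simp add: Comp_assoc[of "smd D b" "tot D" S "tot D"])
      finally show ?thesis .
    qed
    note c = this is_dec_proj_incl[OF D(1)]
    show ?thesis
    proof (cases i)
      case 0
      then show ?thesis using a S(6) ij(2) n(1) z s by (cases j) simp_all
    next
      case (Suc i')
      then have i': "i' < nsum D" using ij(1) n(1) by simp
      show ?thesis
      proof (cases j)
        case 0
        then show ?thesis using b[OF i'] s[OF i'] z Suc by simp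
      next
        case j: (Suc j')
        then have j': "j' < nsum D" using ij(2) n(1) by simp
        show ?thesis using c(1)[OF j' i'] c(2)[OF i' j'] s[OF i'] s[OF j'] Suc j by simp
      qed
    qed
  qed
  have "is_dec C D'" unfolding is_dec_def
  proof (intro conjI allI impI)
    fix i assume "i < nsum D'"
    then have "indecomposable C (smd D' i) \<and> incl D' i \<in> mor C (smd D' i) (tot D') \<and> proj D' i \<in> mor C (tot D') (smd D' i)"
      using m S(2,4) E t(2) by (cases i) (simp_all add: n z s)
    then show "indecomposable C (smd D' i)" "incl D' i \<in> mor C (smd D' i) (tot D')" "proj D' i \<in> mor C (tot D') (smd D' i)"
      by simp_all
  qed (use S(1) n sum orth in simp_all)
  moreover have "map fst (snd D') = E # Es" using D(2) by (auto simp: D'_def)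
  ultimately show ?case by (intro exI[of _ D'] conjI)
qed

text \<open>Exactness in the middle of the Hom groups from every \<open>W\<close>; in other words,
  \<open>f\<close> is a weak kernel of \<open>g\<close>. A direct sum of triangles visibly has this
  property before it is known to be distinguished, and the five lemma asks for nothing more.\<close>

definition exact_at :: "('o, 'm, 'k) tricat \<Rightarrow> 'o \<Rightarrow> 'o \<Rightarrow> 'o \<Rightarrow> 'm \<Rightarrow> 'm \<Rightarrow> bool" where
  "exact_at C X Y Z f g \<longleftrightarrow> Comp C g f = zerom C X Z \<and>
     (\<forall>W \<in> Ob C. \<forall>x \<in> mor C W Y. Comp C g x = zerom C W Z \<longrightarrow> (\<exists>x' \<in> mor C W X. x = Comp C f x'))"

definition sum_mor :: "('o, 'm, 'k) tricat \<Rightarrow> 'o \<Rightarrow> 'o \<Rightarrow> 'm \<Rightarrow> 'm \<Rightarrow> 'm \<Rightarrow> 'm \<Rightarrow> 'm \<Rightarrow> 'm \<Rightarrow> 'm" where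
  "sum_mor C X Y j1 f1 p1 j2 f2 p2 =
     Comp C j1 (Comp C f1 p1) \<oplus>\<^bsub>Hom C X Y\<^esub> Comp C j2 (Comp C f2 p2)"

context linear_category
begin

declare Comp_zero [simp del]

lemma Comp_assoc': "\<lbrakk>f \<in> mor C W X; g \<in> mor C X Y; h \<in> mor C Y Z; W \<in> Ob C; X \<in> Ob C; Y \<in> Ob C; Z \<in> Ob C\<rbrakk>
    \<Longrightarrow> Comp C h (Comp C g f) = Comp C (Comp C h g) f"
  using Comp_assoc by blast

lemma Comp_Idm': "\<lbrakk>f \<in> mor C X Y; X \<in> Ob C; Y \<in> Ob C\<rbrakk> \<Longrightarrow> Comp C f (Idm C X) = f"
  using Comp_Idm by blast

lemma Idm_Comp': "\<lbrakk>f \<in> mor C X Y; X \<in> Ob C; Y \<in> Ob C\<rbrakk> \<Longrightarrow> Comp C (Idm C Y) f = f"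
  using Idm_Comp by blast

lemma Comp_zero_right: "\<lbrakk>g \<in> mor C Y Z; X \<in> Ob C; Y \<in> Ob C; Z \<in> Ob C\<rbrakk> \<Longrightarrow> Comp C g (zerom C X Y) = zerom C X Z"
  using Comp_zero by blast

lemma Comp_zero_left: "\<lbrakk>f \<in> mor C X Y; X \<in> Ob C; Y \<in> Ob C; Z \<in> Ob C\<rbrakk> \<Longrightarrow> Comp C (zerom C Y Z) f = zerom C X Z"
  using Comp_zero by blast

lemma exact_atD: "\<lbrakk>exact_at C X Y Z f g; x \<in> mor C W Y; W \<in> Ob C; Comp C g x = zerom C W Z\<rbrakk>
    \<Longrightarrow> \<exists>x' \<in> mor C W X. x = Comp C f x'"
  unfolding exact_at_def by blast

text \<open>Geometric series: \<open>S\<close>, the sum of the identity, \<open>N\<close> and the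
  square of \<open>N\<close>, is the inverse.\<close>

lemma nilpotent_iso:
  assumes X: "X \<in> Ob C" and N: "N \<in> mor C X X" and "Comp C N (Comp C N N) = zerom C X X"
  shows "is_isom C X X (Idm C X \<ominus>\<^bsub>Hom C X X\<^esub> N)"
proof -
  interpret H: abelian_group "Hom C X X" using assms Hom_abelian by blast
  define N2 where "N2 = Comp C N N"
  have N2: "N2 \<in> mor C X X" "Comp C N N2 = zerom C X X" "Comp C N2 N = zerom C X X"
    unfolding N2_def using assms Comp_mor[OF N N] Comp_assoc'[OF N N N] by simp_all
  define S where "S = (Idm C X \<oplus>\<^bsub>Hom C X X\<^esub> N) \<oplus>\<^bsub>Hom C X X\<^esub> N2"
  have I: "Idm C X \<in> mor C X X" using X Idm_closed by blast
  have S: "S \<in> mor C X X" unfolding S_def using N N2 I X by simp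
  have NS: "Comp C N S = N \<oplus>\<^bsub>Hom C X X\<^esub> N2" "Comp C S N = N \<oplus>\<^bsub>Hom C X X\<^esub> N2"
    unfolding S_def using N N2 I X N2_def
    by (simp_all add: Comp_add_right[of X X X] Comp_add_left[of X X X] Comp_Idm'[OF N] Idm_Comp'[OF N])
  have *: "S \<ominus>\<^bsub>Hom C X X\<^esub> (N \<oplus>\<^bsub>Hom C X X\<^esub> N2) = Idm C X"
    unfolding S_def using N N2(1) I by (simp add: H.a_assoc a_minus_def H.r_neg)
  have "Comp C (Idm C X \<ominus>\<^bsub>Hom C X X\<^esub> N) S = Idm C X" "Comp C S (Idm C X \<ominus>\<^bsub>Hom C X X\<^esub> N) = Idm C X"
    using * NS S N I X by (simp_all add: Comp_diff[of X X X] Comp_Idm'[OF S] Idm_Comp'[OF S])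
  then show ?thesis unfolding is_isom_def using S N I X by auto
qed

lemma biproductD:
  assumes "biproduct C A B X i1 i2 p1 p2"
  shows "A \<in> Ob C" "B \<in> Ob C" "X \<in> Ob C"
    "i1 \<in> mor C A X" "i2 \<in> mor C B X" "p1 \<in> mor C X A" "p2 \<in> mor C X B"
    "Comp C p1 i1 = Idm C A" "Comp C p2 i2 = Idm C B"
    "Comp C p2 i1 = zerom C A B" "Comp C p1 i2 = zerom C B A"
    "Comp C i1 p1 \<oplus>\<^bsub>Hom C X X\<^esub> Comp C i2 p2 = Idm C X"
  using assms unfolding biproduct_def by auto

lemma biproduct_decomp:
  assumes "biproduct C A B X i1 i2 p1 p2" "W \<in> Ob C"
  shows "x \<in> mor C W X \<Longrightarrow> Comp C i1 (Comp C p1 x) \<oplus>\<^bsub>Hom C W X\<^esub> Comp C i2 (Comp C p2 x) = x"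
    "y \<in> mor C X W \<Longrightarrow> Comp C (Comp C y i1) p1 \<oplus>\<^bsub>Hom C X W\<^esub> Comp C (Comp C y i2) p2 = y"
proof -
  note b = biproductD[OF assms(1)]
  have m: "Comp C i1 p1 \<in> mor C X X" "Comp C i2 p2 \<in> mor C X X"
    using Comp_mor[OF b(6,4)] Comp_mor[OF b(7,5)] b by auto
  { assume x: "x \<in> mor C W X"
    have "Comp C i1 (Comp C p1 x) \<oplus>\<^bsub>Hom C W X\<^esub> Comp C i2 (Comp C p2 x) =
        Comp C (Comp C i1 p1 \<oplus>\<^bsub>Hom C X X\<^esub> Comp C i2 p2) x"
      using b(1-3) assms(2) m x by (simp add: Comp_assoc'[OF x b(6,4)] Comp_assoc'[OF x b(7,5)] Comp_add_left[of W X X])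
    then show "Comp C i1 (Comp C p1 x) \<oplus>\<^bsub>Hom C W X\<^esub> Comp C i2 (Comp C p2 x) = x"
      using b assms Idm_Comp'[OF x] by simp }
  { assume y: "y \<in> mor C X W"
    have "Comp C (Comp C y i1) p1 \<oplus>\<^bsub>Hom C X W\<^esub> Comp C (Comp C y i2) p2 =
        Comp C y (Comp C i1 p1 \<oplus>\<^bsub>Hom C X X\<^esub> Comp C i2 p2)"
      using b(1-3) assms(2) m y by (simp add: Comp_assoc'[OF b(6,4) y] Comp_assoc'[OF b(7,5) y] Comp_add_right[of X X W])
    then show "Comp C (Comp C y i1) p1 \<oplus>\<^bsub>Hom C X W\<^esub> Comp C (Comp C y i2) p2 = y"
      using b assms Comp_Idm'[OF y] by simp }
qed

lemma sum_mor_mor: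
  assumes "biproduct C X1 X2 X i1 i2 p1 p2" "biproduct C Y1 Y2 Y j1 j2 q1 q2"
    and f: "f1 \<in> mor C X1 Y1" "f2 \<in> mor C X2 Y2"
  shows "sum_mor C X Y j1 f1 p1 j2 f2 p2 \<in> mor C X Y"
proof -
  note b = biproductD[OF assms(1)] and d = biproductD[OF assms(2)]
  show ?thesis unfolding sum_mor_def
    using Comp_mor[OF Comp_mor[OF b(6) f(1)] d(4)] Comp_mor[OF Comp_mor[OF b(7) f(2)] d(5)] b(1-3) d(1-3) by auto
qed

lemma sum_mor_Comp_incl:
  assumes "biproduct C X1 X2 X i1 i2 p1 p2" "biproduct C Y1 Y2 Y j1 j2 q1 q2"
    and f: "f1 \<in> mor C X1 Y1" "f2 \<in> mor C X2 Y2"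
  shows "Comp C (sum_mor C X Y j1 f1 p1 j2 f2 p2) i1 = Comp C j1 f1"
    "Comp C (sum_mor C X Y j1 f1 p1 j2 f2 p2) i2 = Comp C j2 f2"
    "Comp C q1 (sum_mor C X Y j1 f1 p1 j2 f2 p2) = Comp C f1 p1"
    "Comp C q2 (sum_mor C X Y j1 f1 p1 j2 f2 p2) = Comp C f2 p2"
proof -
  note b = biproductD[OF assms(1)] and d = biproductD[OF assms(2)]
  have fp: "Comp C f1 p1 \<in> mor C X Y1" "Comp C f2 p2 \<in> mor C X Y2"
    using Comp_mor[OF b(6) f(1)] Comp_mor[OF b(7) f(2)] b(1-3) d(1-3) by auto
  have jfp: "Comp C j1 (Comp C f1 p1) \<in> mor C X Y" "Comp C j2 (Comp C f2 p2) \<in> mor C X Y"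
    using Comp_mor[OF fp(1) d(4)] Comp_mor[OF fp(2) d(5)] b(1-3) d(1-3) by auto
  have jf: "Comp C j1 f1 \<in> mor C X1 Y" "Comp C j2 f2 \<in> mor C X2 Y"
    using Comp_mor[OF f(1) d(4)] Comp_mor[OF f(2) d(5)] b(1-3) d(1-3) by auto
  note o = b(1-3) d(1-3)
  have a: "Comp C (Comp C j1 (Comp C f1 p1)) i = Comp C j1 (Comp C f1 (Comp C p1 i))"
     "Comp C (Comp C j2 (Comp C f2 p2)) i = Comp C j2 (Comp C f2 (Comp C p2 i))"
    if i: "i \<in> mor C W X" "W \<in> Ob C" for i W
    using o i Comp_assoc'[OF i(1) fp(1) d(4)] Comp_assoc'[OF i(1) fp(2) d(5)]
      Comp_assoc'[OF i(1) b(6) f(1)] Comp_assoc'[OF i(1) b(7) f(2)] by simp_all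
  have "Comp C (Comp C j1 (Comp C f1 p1)) i1 = Comp C j1 f1"
    by (simp only: a[OF b(4) o(1)] b(8) Comp_Idm'[OF f(1) o(1) o(4)])
  moreover have "Comp C (Comp C j2 (Comp C f2 p2)) i1 = zerom C X1 Y"
    by (simp only: a[OF b(4) o(1)] b(10) Comp_zero_right[OF f(2) o(1) o(2) o(5)] Comp_zero_right[OF d(5) o(1) o(5) o(6)])
  moreover note Comp_add_left[OF o(1) o(3) o(6) b(4) jfp(1) jfp(2)]
  ultimately show "Comp C (sum_mor C X Y j1 f1 p1 j2 f2 p2) i1 = Comp C j1 f1"
    unfolding sum_mor_def using add_zero[OF o(1) o(6) jf(1)] by simp
  have "Comp C (Comp C j2 (Comp C f2 p2)) i2 = Comp C j2 f2"
    by (simp only: a[OF b(5) o(2)] b(9) Comp_Idm'[OF f(2) o(2) o(5)])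
  moreover have "Comp C (Comp C j1 (Comp C f1 p1)) i2 = zerom C X2 Y"
    by (simp only: a[OF b(5) o(2)] b(11) Comp_zero_right[OF f(1) o(2) o(1) o(4)] Comp_zero_right[OF d(4) o(2) o(4) o(6)])
  moreover note Comp_add_left[OF o(2) o(3) o(6) b(5) jfp(1) jfp(2)]
  ultimately show "Comp C (sum_mor C X Y j1 f1 p1 j2 f2 p2) i2 = Comp C j2 f2"
    unfolding sum_mor_def using add_zero[OF o(2) o(6) jf(2)] by simp
  have "Comp C q1 (Comp C j1 (Comp C f1 p1)) = Comp C f1 p1"
    by (simp only: Comp_assoc'[OF fp(1) d(4) d(6) o(3) o(4) o(6) o(4)] d(8) Idm_Comp'[OF fp(1) o(3) o(4)])
  moreover have "Comp C q1 (Comp C j2 (Comp C f2 p2)) = zerom C X Y1"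
    by (simp only: Comp_assoc'[OF fp(2) d(5) d(6) o(3) o(5) o(6) o(4)] d(11) Comp_zero_left[OF fp(2) o(3) o(5) o(4)])
  moreover note Comp_add_right[OF o(3) o(6) o(4) jfp(1) jfp(2) d(6)]
  ultimately show "Comp C q1 (sum_mor C X Y j1 f1 p1 j2 f2 p2) = Comp C f1 p1"
    unfolding sum_mor_def using add_zero[OF o(3) o(4) fp(1)] by simp
  have "Comp C q2 (Comp C j2 (Comp C f2 p2)) = Comp C f2 p2"
    by (simp only: Comp_assoc'[OF fp(2) d(5) d(7) o(3) o(5) o(6) o(5)] d(9) Idm_Comp'[OF fp(2) o(3) o(5)])
  moreover have "Comp C q2 (Comp C j1 (Comp C f1 p1)) = zerom C X Y2"
    by (simp only: Comp_assoc'[OF fp(1) d(4) d(7) o(3) o(4) o(6) o(5)] d(10) Comp_zero_left[OF fp(1) o(3) o(4) o(5)])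
  moreover note Comp_add_right[OF o(3) o(6) o(5) jfp(1) jfp(2) d(7)]
  ultimately show "Comp C q2 (sum_mor C X Y j1 f1 p1 j2 f2 p2) = Comp C f2 p2"
    unfolding sum_mor_def using add_zero[OF o(3) o(5) fp(2)] by simp
qed

lemma biproduct_ext:
  assumes b: "biproduct C Y1 Y2 Y j1 j2 q1 q2" and W: "W \<in> Ob C" and x: "x \<in> mor C W Y" "x' \<in> mor C W Y"
    and "Comp C q1 x = Comp C q1 x'" "Comp C q2 x = Comp C q2 x'"
  shows "x = x'"
  by (rule trans[OF biproduct_decomp(1)[OF b W x(1), symmetric, unfolded assms(5,6)] biproduct_decomp(1)[OF b W x(2)]])

lemma biproduct_coext:
  assumes b: "biproduct C Y1 Y2 Y j1 j2 q1 q2" and W: "W \<in> Ob C" and x: "x \<in> mor C Y W" "x' \<in> mor C Y W"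
    and "Comp C x j1 = Comp C x' j1" "Comp C x j2 = Comp C x' j2"
  shows "x = x'"
  by (rule trans[OF biproduct_decomp(2)[OF b W x(1), symmetric, unfolded assms(5,6)] biproduct_decomp(2)[OF b W x(2)]])

text \<open>Equations are tested after projection to the two summands, and a preimage is assembled
  from the preimages found in each of them.\<close>

lemma exact_at_sum:
  assumes bX: "biproduct C X1 X2 X i1 i2 p1 p2" and bY: "biproduct C Y1 Y2 Y j1 j2 q1 q2"
    and bZ: "biproduct C Z1 Z2 Z l1 l2 r1 r2"
    and f: "f1 \<in> mor C X1 Y1" "f2 \<in> mor C X2 Y2" and g: "g1 \<in> mor C Y1 Z1" "g2 \<in> mor C Y2 Z2"
    and e: "exact_at C X1 Y1 Z1 f1 g1" "exact_at C X2 Y2 Z2 f2 g2"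
  shows "exact_at C X Y Z (sum_mor C X Y j1 f1 p1 j2 f2 p2) (sum_mor C Y Z l1 g1 q1 l2 g2 q2)"
proof -
  note b = biproductD[OF bX] and d = biproductD[OF bY] and z = biproductD[OF bZ]
  note o = b(1-3) d(1-3) z(1-3)
  let ?f = "sum_mor C X Y j1 f1 p1 j2 f2 p2" and ?g = "sum_mor C Y Z l1 g1 q1 l2 g2 q2"
  note F = sum_mor_mor[OF bX bY f] and G = sum_mor_mor[OF bY bZ g]
  note fi = sum_mor_Comp_incl[OF bX bY f] and gi = sum_mor_Comp_incl[OF bY bZ g]
  have gf0: "Comp C g1 f1 = zerom C X1 Z1" "Comp C g2 f2 = zerom C X2 Z2" using e unfolding exact_at_def by auto
  have 0: "Comp C ?g ?f = zerom C X Z"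
  proof (rule biproduct_ext[OF bZ b(3) Comp_mor[OF F G]])
    have "Comp C r1 (Comp C ?g ?f) = Comp C g1 (Comp C f1 p1)"
      by (simp only: Comp_assoc'[OF F G z(6) o(3,6,9,7)] gi fi Comp_assoc'[OF F d(6) g(1) o(3,6,4,7), symmetric])
    also have "\<dots> = zerom C X Z1" using Comp_assoc'[OF b(6) f(1) g(1)] o gf0 Comp_zero_left[OF b(6)] by simp
    finally show "Comp C r1 (Comp C ?g ?f) = Comp C r1 (zerom C X Z)" using o Comp_zero_right[OF z(6)] by simp
    have "Comp C r2 (Comp C ?g ?f) = Comp C g2 (Comp C f2 p2)"
      by (simp only: Comp_assoc'[OF F G z(7) o(3,6,9,8)] gi fi Comp_assoc'[OF F d(7) g(2) o(3,6,5,8), symmetric])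
    also have "\<dots> = zerom C X Z2" using Comp_assoc'[OF b(7) f(2) g(2)] o gf0 Comp_zero_left[OF b(7)] by simp
    finally show "Comp C r2 (Comp C ?g ?f) = Comp C r2 (zerom C X Z)" using o Comp_zero_right[OF z(7)] by simp
  qed (use o in simp_all)
  have "\<exists>x' \<in> mor C W X. x = Comp C ?f x'"
    if W: "W \<in> Ob C" and x: "x \<in> mor C W Y" and gx: "Comp C ?g x = zerom C W Z" for W x
  proof -
    have qx: "Comp C q1 x \<in> mor C W Y1" "Comp C q2 x \<in> mor C W Y2"
      using Comp_mor[OF x d(6)] Comp_mor[OF x d(7)] W o by auto
    have "Comp C g1 (Comp C q1 x) = Comp C r1 (Comp C ?g x)"
      by (simp only: Comp_assoc'[OF x G z(6) W o(6,9,7)] gi Comp_assoc'[OF x d(6) g(1) W o(6,4,7), symmetric])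
    then have "Comp C g1 (Comp C q1 x) = zerom C W Z1" using gx o W Comp_zero_right[OF z(6)] by simp
    then obtain x1 where x1: "x1 \<in> mor C W X1" "Comp C q1 x = Comp C f1 x1"
      using exact_atD[OF e(1) qx(1) W] by blast
    have "Comp C g2 (Comp C q2 x) = Comp C r2 (Comp C ?g x)"
      by (simp only: Comp_assoc'[OF x G z(7) W o(6,9,8)] gi Comp_assoc'[OF x d(7) g(2) W o(6,5,8), symmetric])
    then have "Comp C g2 (Comp C q2 x) = zerom C W Z2" using gx o W Comp_zero_right[OF z(7)] by simp
    then obtain x2 where x2: "x2 \<in> mor C W X2" "Comp C q2 x = Comp C f2 x2"
      using exact_atD[OF e(2) qx(2) W] by blast
    let ?x' = "Comp C i1 x1 \<oplus>\<^bsub>Hom C W X\<^esub> Comp C i2 x2"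
    have m: "Comp C i1 x1 \<in> mor C W X" "Comp C i2 x2 \<in> mor C W X"
      using Comp_mor[OF x1(1) b(4)] Comp_mor[OF x2(1) b(5)] o W by auto
    have "Comp C ?f ?x' = Comp C ?f (Comp C i1 x1) \<oplus>\<^bsub>Hom C W Y\<^esub> Comp C ?f (Comp C i2 x2)"
      by (rule Comp_add_right) (use m W o F in auto)
    also have "\<dots> = Comp C j1 (Comp C q1 x) \<oplus>\<^bsub>Hom C W Y\<^esub> Comp C j2 (Comp C q2 x)"
      by (simp only: Comp_assoc'[OF x1(1) b(4) F W o(1,3,6)] Comp_assoc'[OF x2(1) b(5) F W o(2,3,6)] fi x1(2) x2(2)
        Comp_assoc'[OF x1(1) f(1) d(4) W o(1,4,6), symmetric] Comp_assoc'[OF x2(1) f(2) d(5) W o(2,5,6), symmetric])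
    also have "\<dots> = x" by (rule biproduct_decomp(1)[OF bY W x])
    finally show ?thesis using m W o by (intro bexI[of _ ?x']) auto
  qed
  then show ?thesis unfolding exact_at_def using 0 by blast
qed

end

section \<open>Shifts of zero objects, biproducts and diagonal morphisms\<close>

context category_with_shift
begin

lemma ShiftM_zero:
  assumes "X \<in> Ob C" "Y \<in> Ob C"
  shows "ShiftM C d (zerom C X Y) = zerom C (Shift C d X) (Shift C d Y)"
proof -
  have o: "Shift C d X \<in> Ob C" "Shift C d Y \<in> Ob C" using assms Shift_closed by auto
  interpret H: abelian_group "Hom C (Shift C d X) (Shift C d Y)" using o Hom_abelian by blast
  have s: "ShiftM C d (zerom C X Y) \<in> mor C (Shift C d X) (Shift C d Y)" using assms by (simp add: ShiftM_closed)
  have "ShiftM C d (zerom C X Y) \<oplus>\<^bsub>Hom C (Shift C d X) (Shift C d Y)\<^esub> ShiftM C d (zerom C X Y) = ShiftM C d (zerom C X Y)"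
    using assms by (simp flip: ShiftM_plus)
  then show ?thesis using H.add.l_cancel_one[OF s s] by simp
qed

lemma ShiftM_neg:
  assumes "X \<in> Ob C" "Y \<in> Ob C" "f \<in> mor C X Y"
  shows "ShiftM C d (\<ominus>\<^bsub>Hom C X Y\<^esub> f) = \<ominus>\<^bsub>Hom C (Shift C d X) (Shift C d Y)\<^esub> ShiftM C d f"
proof -
  have o: "Shift C d X \<in> Ob C" "Shift C d Y \<in> Ob C" using assms Shift_closed by auto
  interpret H: abelian_group "Hom C (Shift C d X) (Shift C d Y)" using o Hom_abelian by blast
  interpret XY: abelian_group "Hom C X Y" using assms Hom_abelian by blast
  have "ShiftM C d (\<ominus>\<^bsub>Hom C X Y\<^esub> f) \<oplus>\<^bsub>Hom C (Shift C d X) (Shift C d Y)\<^esub> ShiftM C d f = zerom C (Shift C d X) (Shift C d Y)"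
    using assms by (simp flip: ShiftM_plus add: XY.l_neg ShiftM_zero)
  then show ?thesis using H.minus_equality ShiftM_closed assms by (metis neg_mor)
qed

lemma Shift_neg_cancel:
  assumes "X \<in> Ob C" shows "Shift C d (Shift C (-d) X) = X" "Shift C (-d) (Shift C d X) = X"
  using assms Shift_0 Shift_add[of X d "-d"] Shift_add[of X "-d" d] by simp_all

lemma ShiftM_neg_cancel:
  assumes "f \<in> mor C X Y" "X \<in> Ob C" "Y \<in> Ob C"
  shows "ShiftM C d (ShiftM C (-d) f) = f" "ShiftM C (-d) (ShiftM C d f) = f"
  using assms ShiftM_0 ShiftM_add[of X Y f d "-d"] ShiftM_add[of X Y f "-d" d] by simp_all

lemma ShiftM_inj:
  assumes "f \<in> mor C X Y" "g \<in> mor C X Y" "X \<in> Ob C" "Y \<in> Ob C" "ShiftM C d f = ShiftM C d g"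
  shows "f = g"
  using ShiftM_neg_cancel(2)[of f X Y d] ShiftM_neg_cancel(2)[of g X Y d] assms by metis

lemma zero_obj_Shift: "zero_obj C N \<Longrightarrow> zero_obj C (Shift C d N)"
proof -
  assume z: "zero_obj C N"
  then have N: "N \<in> Ob C" by (simp add: zero_obj_def)
  then have "Idm C (Shift C d N) = zerom C (Shift C d N) (Shift C d N)"
    using z zero_obj_iff[OF N] ShiftM_Idm[of N d] ShiftM_zero[of N N d] by simp
  then show ?thesis using zero_obj_iff Shift_closed N by blast
qed

lemma biproduct_Shift:
  assumes "biproduct C A B X i1 i2 p1 p2"
  shows "biproduct C (Shift C d A) (Shift C d B) (Shift C d X)
    (ShiftM C d i1) (ShiftM C d i2) (ShiftM C d p1) (ShiftM C d p2)"
proof -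
  note b = biproductD[OF assms]
  have m: "Comp C i1 p1 \<in> mor C X X" "Comp C i2 p2 \<in> mor C X X"
    using Comp_mor[OF b(6,4)] Comp_mor[OF b(7,5)] b by auto
  show ?thesis unfolding biproduct_def
    using b(1-7) b(8-12)[THEN arg_cong[where f = "ShiftM C d"]] m
    by (simp add: Shift_closed ShiftM_closed ShiftM_zero ShiftM_Idm ShiftM_plus
        ShiftM_Comp[of A X A] ShiftM_Comp[of B X B] ShiftM_Comp[of A X B] ShiftM_Comp[of B X A]
        ShiftM_Comp[of X A X] ShiftM_Comp[of X B X])
qed

lemma ShiftM_sum_mor:
  assumes "biproduct C X1 X2 X i1 i2 p1 p2" "biproduct C Y1 Y2 Y j1 j2 q1 q2"
    and f: "f1 \<in> mor C X1 Y1" "f2 \<in> mor C X2 Y2"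
  shows "ShiftM C d (sum_mor C X Y j1 f1 p1 j2 f2 p2) =
    sum_mor C (Shift C d X) (Shift C d Y) (ShiftM C d j1) (ShiftM C d f1) (ShiftM C d p1)
      (ShiftM C d j2) (ShiftM C d f2) (ShiftM C d p2)"
proof -
  note b = biproductD[OF assms(1)] and d = biproductD[OF assms(2)]
  have fp: "Comp C f1 p1 \<in> mor C X Y1" "Comp C f2 p2 \<in> mor C X Y2"
    using Comp_mor[OF b(6) f(1)] Comp_mor[OF b(7) f(2)] b(1-3) d(1-3) by auto
  have jfp: "Comp C j1 (Comp C f1 p1) \<in> mor C X Y" "Comp C j2 (Comp C f2 p2) \<in> mor C X Y"
    using Comp_mor[OF fp(1) d(4)] Comp_mor[OF fp(2) d(5)] b(1-3) d(1-3) by auto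
  show ?thesis unfolding sum_mor_def using b(1-7) d(1-7) f fp jfp
    by (simp add: ShiftM_plus ShiftM_Comp[of X Y1 Y] ShiftM_Comp[of X Y2 Y] ShiftM_Comp[of X X1 Y1] ShiftM_Comp[of X X2 Y2])
qed

end

section \<open>Triangulated categories\<close>

context triangulated_category
begin

lemma TriD:
  assumes "(X, Y, Z, f, g, h) \<in> Tri C"
  shows "X \<in> Ob C" "Y \<in> Ob C" "Z \<in> Ob C" "Shift C 1 X \<in> Ob C" "Shift C 1 Y \<in> Ob C"
    "f \<in> mor C X Y" "g \<in> mor C Y Z" "h \<in> mor C Z (Shift C 1 X)"
  using Tri_typed[OF assms] Shift_closed by blast+

lemma zero_shift_obj: "zero_obj C N \<Longrightarrow> N \<in> Ob C \<and> Shift C d N \<in> Ob C \<and> zero_obj C (Shift C d N)"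
  using zero_obj_Shift by (auto simp: zero_obj_def)

text \<open>One rotation turns this triangle into the identity triangle of \<open>A\<close> with
  third object \<open>N[1]\<close>. The sign of the rotation is invisible, because the map that
  carries it starts in a zero object.\<close>

lemma Tri_zero_left:
  assumes A: "A \<in> Ob C" and N: "zero_obj C N"
  shows "(N, A, A, zerom C N A, Idm C A, zerom C A (Shift C 1 N)) \<in> Tri C"
proof -
  note n = zero_shift_obj[OF N, of 1]
  have o: "N \<in> Ob C" "Shift C 1 N \<in> Ob C" "zero_obj C (Shift C 1 N)" "Shift C 1 A \<in> Ob C"
    using n Shift_closed[OF A] by auto
  have "\<ominus>\<^bsub>Hom C (Shift C 1 N) (Shift C 1 A)\<^esub> ShiftM C 1 (zerom C N A) = zerom C (Shift C 1 N) (Shift C 1 A)"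
    using o by (intro zero_obj_mor(1)) (simp_all add: A ShiftM_closed[OF o(1) A])
  then show ?thesis
    using TR2[OF o(1) A A zero_mor[OF o(1) A] Idm_closed[OF A] zero_mor[OF A o(2)]] TR1_id[OF A o(3)]
    by simp
qed

lemma Tri_rotate:
  assumes "(X, Y, Z, f, g, h) \<in> Tri C"
  shows "(Y, Z, Shift C 1 X, g, h, \<ominus>\<^bsub>Hom C (Shift C 1 X) (Shift C 1 Y)\<^esub> ShiftM C 1 f) \<in> Tri C"
  using TR2 TriD[OF assms] assms by blast

text \<open>The identity triangle of \<open>X\<close> maps to the given one by the identity on
  \<open>X\<close> and by \<open>f\<close> on the second object; commutativity on the third object
  makes \<open>g\<close> after \<open>f\<close> factor through zero.\<close>

lemma Tri_comp_zero:
  assumes T: "(X, Y, Z, f, g, h) \<in> Tri C"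
  shows "Comp C g f = zerom C X Z"
proof -
  note t = TriD[OF T]
  obtain N where N: "zero_obj C N" using ex_zero_obj by blast
  have n: "N \<in> Ob C" using zero_shift_obj[OF N] by blast
  obtain c where c: "c \<in> mor C N Z" "Comp C c (zerom C X N) = Comp C g f"
    using TR3[OF TR1_id[OF t(1) N] T Idm_closed[OF t(1)] t(6) refl] by blast
  then show ?thesis using Comp_zero_right[OF c(1) t(1) n t(3)] by simp
qed

lemma Tri_comp_zero':
  assumes T: "(X, Y, Z, f, g, h) \<in> Tri C"
  shows "Comp C h g = zerom C Y (Shift C 1 X)"
    "Comp C (ShiftM C 1 f) h = zerom C Z (Shift C 1 Y)"
proof -
  note t = TriD[OF T]
  have s: "ShiftM C 1 f \<in> mor C (Shift C 1 X) (Shift C 1 Y)" using ShiftM_closed t by blast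
  show "Comp C h g = zerom C Y (Shift C 1 X)" by (rule Tri_comp_zero[OF Tri_rotate[OF T]])
  have "Comp C (\<ominus>\<^bsub>Hom C (Shift C 1 X) (Shift C 1 Y)\<^esub> ShiftM C 1 f) h = zerom C Z (Shift C 1 Y)"
    by (rule Tri_comp_zero[OF Tri_rotate[OF Tri_rotate[OF T]]])
  then have 1: "\<ominus>\<^bsub>Hom C Z (Shift C 1 Y)\<^esub> Comp C (ShiftM C 1 f) h = zerom C Z (Shift C 1 Y)"
    by (simp only: Comp_neg(2)[OF t(3,4,5,8) s])
  interpret H: abelian_group "Hom C Z (Shift C 1 Y)" using t Hom_abelian by blast
  show "Comp C (ShiftM C 1 f) h = zerom C Z (Shift C 1 Y)"
    using 1 H.add.inv_eq_1_iff[OF Comp_mor[OF t(8) s t(3,4,5)]] by simp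
qed

text \<open>The map \<open>e\<close> and the zero map form the first two parts of a map to the
  triangle from \<open>N\<close> over \<open>W\<close> to \<open>W\<close>; \<open>TR3\<close>
  supplies the factor.\<close>

lemma Tri_weak_cokernel:
  assumes T: "(X, Y, Z, f, g, h) \<in> Tri C" and W: "W \<in> Ob C" and e: "e \<in> mor C Y W" "Comp C e f = zerom C X W"
  shows "\<exists>e' \<in> mor C Z W. e = Comp C e' g"
proof -
  note t = TriD[OF T]
  obtain N where N: "zero_obj C N" using ex_zero_obj by blast
  have n: "N \<in> Ob C" using zero_shift_obj[OF N] by blast
  have "Comp C e f = Comp C (zerom C N W) (zerom C X N)"
    using Comp_zero_right[OF zero_mor[OF n W] t(1) n W] e by simp
  then obtain c where "c \<in> mor C Z W" "Comp C c g = Comp C (Idm C W) e"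
    using TR3[OF T Tri_zero_left[OF W N] zero_mor[OF t(1) n] e(1)] by blast
  then show ?thesis using Idm_Comp'[OF e(1) t(2) W] by auto
qed

text \<open>\<open>TR3\<close> only produces a map between third objects, so both triangles are
  rotated until the wanted map sits there: the rotation of the identity triangle of \<open>W\<close>
  is mapped to the rotation of the given one, and the resulting map from \<open>W[1]\<close> to
  \<open>X[1]\<close> is shifted back. The signs of the two rotations cancel.\<close>

lemma Tri_weak_kernel:
  assumes T: "(X, Y, Z, f, g, h) \<in> Tri C" and W: "W \<in> Ob C" and x: "x \<in> mor C W Y" "Comp C g x = zerom C W Z"
  shows "\<exists>x' \<in> mor C W X. x = Comp C f x'"
proof -
  note t = TriD[OF T]
  obtain N where N: "zero_obj C N" using ex_zero_obj by blast
  have n: "N \<in> Ob C" using zero_shift_obj[OF N] by blast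
  let ?S = "Shift C 1"
  have sW: "?S W \<in> Ob C" using Shift_closed W by blast
  have s: "ShiftM C 1 f \<in> mor C (?S X) (?S Y)" "ShiftM C 1 x \<in> mor C (?S W) (?S Y)"
    using ShiftM_closed t x W by blast+
  have T1: "(W, N, ?S W, zerom C W N, zerom C N (?S W), \<ominus>\<^bsub>Hom C (?S W) (?S W)\<^esub> ShiftM C 1 (Idm C W)) \<in> Tri C"
    by (rule Tri_rotate[OF TR1_id[OF W N]])
  have "Comp C (zerom C N Z) (zerom C W N) = Comp C g x"
    using Comp_zero_right[OF zero_mor[OF n t(3)] W n t(3)] x by simp
  then obtain c where c: "c \<in> mor C (?S W) (?S X)"
    "Comp C (ShiftM C 1 x) (\<ominus>\<^bsub>Hom C (?S W) (?S W)\<^esub> ShiftM C 1 (Idm C W)) =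
     Comp C (\<ominus>\<^bsub>Hom C (?S X) (?S Y)\<^esub> ShiftM C 1 f) c"
    using TR3[OF T1 Tri_rotate[OF T] x(1) zero_mor[OF n t(3)]] by metis
  interpret H: abelian_group "Hom C (?S W) (?S Y)" using t sW Hom_abelian by blast
  have "\<ominus>\<^bsub>Hom C (?S W) (?S Y)\<^esub> ShiftM C 1 x = \<ominus>\<^bsub>Hom C (?S W) (?S Y)\<^esub> Comp C (ShiftM C 1 f) c"
    using c(2) unfolding ShiftM_Idm[OF W]
      Comp_neg(1)[OF sW sW t(5) Idm_closed[OF sW] s(2)] Comp_neg(2)[OF sW t(4,5) c(1) s(1)]
      Comp_Idm'[OF s(2) sW t(5)] .
  then have *: "ShiftM C 1 x = Comp C (ShiftM C 1 f) c"
    using H.minus_minus[OF s(2)] H.minus_minus[OF Comp_mor[OF c(1) s(1) sW t(4,5)]] by metis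
  define x' where "x' = ShiftM C (-1) c"
  have x': "x' \<in> mor C W X"
    using ShiftM_closed[OF sW t(4) c(1), of "-1"] Shift_neg_cancel(2)[OF W, of 1] Shift_neg_cancel(2)[OF t(1), of 1]
    unfolding x'_def by simp
  have "ShiftM C 1 x = ShiftM C 1 (Comp C f x')"
    unfolding ShiftM_Comp[OF W t(1,2) x' t(6)] * using ShiftM_neg_cancel(1)[OF c(1) sW t(4), of 1, folded x'_def] by simp
  then have "x = Comp C f x'" using ShiftM_inj[OF x(1) Comp_mor[OF x' t(6) W t(1,2)] W t(2)] by simp
  then show ?thesis using x' by blast
qed

text \<open>Each place is the first place of a rotation. The sign that the second rotation puts on
  \<open>f[1]\<close> does not affect exactness.\<close>

lemma Tri_exact:
  assumes T: "(X, Y, Z, f, g, h) \<in> Tri C"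
  shows "exact_at C X Y Z f g" "exact_at C Y Z (Shift C 1 X) g h"
    "exact_at C Z (Shift C 1 X) (Shift C 1 Y) h (ShiftM C 1 f)"
proof -
  note t = TriD[OF T]
  show "exact_at C X Y Z f g" unfolding exact_at_def using Tri_comp_zero[OF T] Tri_weak_kernel[OF T] by blast
  note T1 = Tri_rotate[OF T]
  show "exact_at C Y Z (Shift C 1 X) g h" unfolding exact_at_def using Tri_comp_zero[OF T1] Tri_weak_kernel[OF T1] by blast
  note T2 = Tri_rotate[OF T1]
  have s: "ShiftM C 1 f \<in> mor C (Shift C 1 X) (Shift C 1 Y)" using ShiftM_closed t by blast
  have "Comp C (\<ominus>\<^bsub>Hom C (Shift C 1 X) (Shift C 1 Y)\<^esub> ShiftM C 1 f) x = zerom C W (Shift C 1 Y)"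
    if W: "W \<in> Ob C" and x: "x \<in> mor C W (Shift C 1 X)" and z: "Comp C (ShiftM C 1 f) x = zerom C W (Shift C 1 Y)" for W x
  proof -
    interpret H: abelian_group "Hom C W (Shift C 1 Y)" using t W Hom_abelian by blast
    show ?thesis unfolding Comp_neg(2)[OF W t(4,5) x s] z by simp
  qed
  then show "exact_at C Z (Shift C 1 X) (Shift C 1 Y) h (ShiftM C 1 f)"
    unfolding exact_at_def using Tri_comp_zero'(2)[OF T] Tri_weak_kernel[OF T2] by blast
qed

text \<open>It is stated for exact sequences with the same \<open>f\<close>, so that one of them may
  be a candidate triangle that is not yet known to be distinguished. The facts \<open>surj\<close>
  and \<open>inj\<close> are the two halves of the chase on generalised elements. The former, at the
  identity of \<open>Z'\<close>, gives a right inverse \<open>r\<close> of \<open>c\<close>; the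
  latter, at the difference of \<open>r\<close> after \<open>c\<close> and the identity, shows that
  \<open>r\<close> is a left inverse as well.\<close>

lemma five_lemma:
  assumes o: "X \<in> Ob C" "Y \<in> Ob C" "Z \<in> Ob C" "Z' \<in> Ob C"
    and m: "f \<in> mor C X Y" "g \<in> mor C Y Z" "h \<in> mor C Z (Shift C 1 X)"
      "g' \<in> mor C Y Z'" "h' \<in> mor C Z' (Shift C 1 X)"
    and e: "exact_at C X Y Z f g" "exact_at C Y Z (Shift C 1 X) g h"
      "exact_at C Z (Shift C 1 X) (Shift C 1 Y) h (ShiftM C 1 f)"
    and e': "exact_at C X Y Z' f g'" "exact_at C Y Z' (Shift C 1 X) g' h'"
      "exact_at C Z' (Shift C 1 X) (Shift C 1 Y) h' (ShiftM C 1 f)"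
    and c: "c \<in> mor C Z Z'" "Comp C c g = g'" "Comp C h' c = h"
  shows "is_isom C Z Z' c"
proof -
  have s: "Shift C 1 X \<in> Ob C" "Shift C 1 Y \<in> Ob C" "ShiftM C 1 f \<in> mor C (Shift C 1 X) (Shift C 1 Y)"
    using o m Shift_closed ShiftM_closed by blast+
  have surj: "\<exists>r \<in> mor C W Z. t = Comp C c r" if W: "W \<in> Ob C" and t: "t \<in> mor C W Z'" for W t
  proof -
    have h't: "Comp C h' t \<in> mor C W (Shift C 1 X)" using Comp_mor[OF t m(5) W o(4) s(1)] .
    have "Comp C (ShiftM C 1 f) (Comp C h' t) = zerom C W (Shift C 1 Y)"
      unfolding Comp_assoc'[OF t m(5) s(3) W o(4) s(1,2)] using e'(3) Comp_zero_left[OF t W o(4) s(2)]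
      by (simp add: exact_at_def)
    then obtain z where z: "z \<in> mor C W Z" "Comp C h' t = Comp C h z" using exact_atD[OF e(3) h't W] by blast
    have cz: "Comp C c z \<in> mor C W Z'" using Comp_mor[OF z(1) c(1) W o(3,4)] .
    define d where "d = t \<ominus>\<^bsub>Hom C W Z'\<^esub> Comp C c z"
    have d: "d \<in> mor C W Z'" unfolding d_def using t cz W o by simp
    have "Comp C h' d = zerom C W (Shift C 1 X)"
      unfolding d_def Comp_diff(1)[OF W o(4) s(1) t cz m(5)] Comp_assoc'[OF z(1) c(1) m(5) W o(3,4) s(1)] c(3) z(2)
      using add_zero(4)[OF W s(1)] h't z(2) by simp
    then obtain y where y: "y \<in> mor C W Y" "d = Comp C g' y" using exact_atD[OF e'(2) d W] by blast
    have gy: "Comp C g y \<in> mor C W Z" using Comp_mor[OF y(1) m(2) W o(2,3)] .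
    have "t = d \<oplus>\<^bsub>Hom C W Z'\<^esub> Comp C c z" unfolding d_def using diff_add_cancel(1)[OF W o(4) t cz] by simp
    also have "d = Comp C c (Comp C g y)" unfolding y(2) Comp_assoc'[OF y(1) m(2) c(1) W o(2,3,4)] c(2) ..
    also have "Comp C c (Comp C g y) \<oplus>\<^bsub>Hom C W Z'\<^esub> Comp C c z = Comp C c (Comp C g y \<oplus>\<^bsub>Hom C W Z\<^esub> z)"
      using Comp_add_right[OF W o(3,4) gy z(1) c(1)] by simp
    finally show ?thesis using gy z W o by blast
  qed
  have inj: "r = zerom C W Z" if W: "W \<in> Ob C" and r: "r \<in> mor C W Z" and z: "Comp C c r = zerom C W Z'" for W r
  proof -
    have "Comp C h r = zerom C W (Shift C 1 X)"
      unfolding c(3)[symmetric] Comp_assoc'[OF r c(1) m(5) W o(3,4) s(1), symmetric] z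
      using Comp_zero_right[OF m(5) W o(4) s(1)] .
    then obtain y where y: "y \<in> mor C W Y" "r = Comp C g y" using exact_atD[OF e(2) r W] by blast
    have "Comp C g' y = zerom C W Z'"
      unfolding c(2)[symmetric] Comp_assoc'[OF y(1) m(2) c(1) W o(2,3,4), symmetric] y(2)[symmetric] z ..
    then obtain x where x: "x \<in> mor C W X" "y = Comp C f x" using exact_atD[OF e'(1) y(1) W] by blast
    show ?thesis unfolding y(2) x(2) Comp_assoc'[OF x(1) m(1,2) W o(1,2,3)]
      using e(1) Comp_zero_left[OF x(1) W o(1,3)] by (simp add: exact_at_def)
  qed
  obtain r where r: "r \<in> mor C Z' Z" "Idm C Z' = Comp C c r" using surj[OF o(4) Idm_closed[OF o(4)]] by blast
  have rc: "Comp C r c \<in> mor C Z Z" using Comp_mor[OF c(1) r(1) o(3,4,3)] .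
  have "Comp C c (Comp C r c \<ominus>\<^bsub>Hom C Z Z\<^esub> Idm C Z) = zerom C Z Z'"
    unfolding Comp_diff(1)[OF o(3,3,4) rc Idm_closed[OF o(3)] c(1)] Comp_assoc'[OF c(1) r(1) c(1) o(3,4,3,4)]
      r(2)[symmetric] Comp_Idm'[OF c(1) o(3,4)] Idm_Comp'[OF c(1) o(3,4)]
    using add_zero(4)[OF o(3,4) c(1)] .
  then have "Comp C r c \<ominus>\<^bsub>Hom C Z Z\<^esub> Idm C Z = zerom C Z Z"
    using inj[OF o(3)] rc Idm_closed[OF o(3)] o by simp
  then have "Comp C r c = Idm C Z" using diff_eq_zero_iff[OF o(3,3) rc Idm_closed[OF o(3)]] by simp
  then show ?thesis unfolding is_isom_def using r c by auto
qed

lemma Tri_cong_iso: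
  assumes T: "(X, Y, Z, f, g, h) \<in> Tri C" and c: "is_isom C Z Z' c" "Z' \<in> Ob C"
    and h': "h' \<in> mor C Z' (Shift C 1 X)" "Comp C h' c = h"
  shows "(X, Y, Z', f, Comp C c g, h') \<in> Tri C"
proof -
  note t = TriD[OF T] and cm = is_isom_mor[OF c(1)]
  show ?thesis
    by (rule TR1_iso[OF T t(1,2) c(2) t(6) Comp_mor[OF t(7) cm t(2,3) c(2)] h'(1)
        is_isom_Idm[OF t(1)] is_isom_Idm[OF t(2)] c(1)])
     (simp_all only: Comp_Idm'[OF t(6) t(1,2)] Idm_Comp'[OF t(6) t(1,2)] Comp_Idm'[OF Comp_mor[OF t(7) cm t(2,3) c(2)] t(2) c(2)]
        ShiftM_Idm[OF t(1)] Idm_Comp'[OF t(8) t(3,4)] h'(2))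
qed

lemma Tri_iso_unique:
  assumes T: "(X, Y, Z, f, g, h) \<in> Tri C" and T': "(X, Y, Z', f, g', h') \<in> Tri C"
    and c: "c \<in> mor C Z Z'" "Comp C c g = g'" "Comp C h' c = h"
  shows "is_isom C Z Z' c"
  using five_lemma[OF TriD(1,2,3)[OF T] TriD(3)[OF T'] TriD(6-8)[OF T] TriD(7,8)[OF T'] Tri_exact[OF T] Tri_exact[OF T'] c] .

text \<open>\<open>TR3\<close> gives a map of triangles that is the identity at two places, and the
  five lemma makes it invertible.\<close>

lemma Tri_map_id:
  assumes T: "(X, Y, Z, f, g, h) \<in> Tri C" and T': "(X, Y, Z', f, g', h') \<in> Tri C"
  shows "\<exists>c. is_isom C Z Z' c \<and> Comp C c g = g' \<and> Comp C h' c = h"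
proof -
  note t = TriD[OF T] and t' = TriD[OF T']
  have "Comp C (Idm C Y) f = Comp C f (Idm C X)"
    by (simp only: Comp_Idm'[OF t(6) t(1,2)] Idm_Comp'[OF t(6) t(1,2)])
  then obtain c where c: "c \<in> mor C Z Z'" "Comp C c g = Comp C g' (Idm C Y)"
      "Comp C (ShiftM C 1 (Idm C X)) h = Comp C h' c"
    using TR3[OF T T' Idm_closed[OF t(1)] Idm_closed[OF t(2)]] by blast
  have "Comp C c g = g'" "Comp C h' c = h"
    using c(2,3) unfolding Comp_Idm'[OF t'(7) t'(2,3)] ShiftM_Idm[OF t(1)] Idm_Comp'[OF t(8) t(3,4)] by simp_all
  then show ?thesis using Tri_iso_unique[OF T T' c(1)] by blast
qed

text \<open>The sum is exact but not yet known to be distinguished. It is compared with a cone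
  \<open>Q\<close> of the diagonal map: the maps \<open>c1\<close> and \<open>c2\<close>, obtained
  by \<open>TR3\<close> from the two given triangles, assemble to \<open>c\<close>, which is
  invertible by the five lemma, and the cone is carried back along the inverse of
  \<open>c\<close>.\<close>

lemma Tri_sum:
  assumes T1: "(X1, Y1, Z1, f1, g1, h1) \<in> Tri C" and T2: "(X2, Y2, Z2, f2, g2, h2) \<in> Tri C"
    and bX: "biproduct C X1 X2 X i1 i2 p1 p2" and bY: "biproduct C Y1 Y2 Y j1 j2 q1 q2"
    and bZ: "biproduct C Z1 Z2 Z l1 l2 r1 r2"
  shows "(X, Y, Z, sum_mor C X Y j1 f1 p1 j2 f2 p2, sum_mor C Y Z l1 g1 q1 l2 g2 q2,
    sum_mor C Z (Shift C 1 X) (ShiftM C 1 i1) h1 r1 (ShiftM C 1 i2) h2 r2) \<in> Tri C"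
proof -
  note t1 = TriD[OF T1] and t2 = TriD[OF T2]
  note bX1 = biproduct_Shift[OF bX, of 1] and bY1 = biproduct_Shift[OF bY, of 1]
  note x = biproductD[OF bX] and y = biproductD[OF bY] and z = biproductD[OF bZ] and x1 = biproductD[OF bX1]
  let ?f = "sum_mor C X Y j1 f1 p1 j2 f2 p2" and ?g = "sum_mor C Y Z l1 g1 q1 l2 g2 q2"
    and ?h = "sum_mor C Z (Shift C 1 X) (ShiftM C 1 i1) h1 r1 (ShiftM C 1 i2) h2 r2"
  note F = sum_mor_mor[OF bX bY t1(6) t2(6)] and fi = sum_mor_Comp_incl[OF bX bY t1(6) t2(6)]
  note G = sum_mor_mor[OF bY bZ t1(7) t2(7)] and gi = sum_mor_Comp_incl[OF bY bZ t1(7) t2(7)]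
  note H = sum_mor_mor[OF bZ bX1 t1(8) t2(8)] and hi = sum_mor_Comp_incl[OF bZ bX1 t1(8) t2(8)]
  have s: "ShiftM C 1 f1 \<in> mor C (Shift C 1 X1) (Shift C 1 Y1)" "ShiftM C 1 f2 \<in> mor C (Shift C 1 X2) (Shift C 1 Y2)"
    using ShiftM_closed t1 t2 by blast+
  have E: "exact_at C X Y Z ?f ?g" "exact_at C Y Z (Shift C 1 X) ?g ?h"
    "exact_at C Z (Shift C 1 X) (Shift C 1 Y) ?h (ShiftM C 1 ?f)"
    unfolding ShiftM_sum_mor[OF bX bY t1(6) t2(6)]
    by (rule exact_at_sum[OF bX bY bZ t1(6) t2(6) t1(7) t2(7) Tri_exact(1)[OF T1] Tri_exact(1)[OF T2]]
      exact_at_sum[OF bY bZ bX1 t1(7) t2(7) t1(8) t2(8) Tri_exact(2)[OF T1] Tri_exact(2)[OF T2]]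
      exact_at_sum[OF bZ bX1 bY1 t1(8) t2(8) s Tri_exact(3)[OF T1] Tri_exact(3)[OF T2]])+
  obtain Q g h where T: "(X, Y, Q, ?f, g, h) \<in> Tri C" using TR1_cone[OF x(3) y(3) F] by blast
  note t = TriD[OF T]
  obtain c1 where c1: "c1 \<in> mor C Z1 Q" "Comp C c1 g1 = Comp C g j1" "Comp C (ShiftM C 1 i1) h1 = Comp C h c1"
    using TR3[OF T1 T x(4) y(4) fi(1)[symmetric]] by blast
  obtain c2 where c2: "c2 \<in> mor C Z2 Q" "Comp C c2 g2 = Comp C g j2" "Comp C (ShiftM C 1 i2) h2 = Comp C h c2"
    using TR3[OF T2 T x(5) y(5) fi(2)[symmetric]] by blast
  define c where "c = Comp C c1 r1 \<oplus>\<^bsub>Hom C Z Q\<^esub> Comp C c2 r2"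
  have m: "Comp C c1 r1 \<in> mor C Z Q" "Comp C c2 r2 \<in> mor C Z Q"
    using Comp_mor[OF z(6) c1(1) z(3,1) t(3)] Comp_mor[OF z(7) c2(1) z(3,2) t(3)] by simp_all
  have c: "c \<in> mor C Z Q" unfolding c_def using m z(3) t(3) by simp
  have "Comp C (Comp C c1 r1) ?g = Comp C (Comp C g j1) q1" "Comp C (Comp C c2 r2) ?g = Comp C (Comp C g j2) q2"
    unfolding Comp_assoc'[OF G z(6) c1(1) y(3) z(3,1) t(3), symmetric] Comp_assoc'[OF G z(7) c2(1) y(3) z(3,2) t(3), symmetric] gi
      Comp_assoc'[OF y(6) t1(7) c1(1) y(3,1) z(1) t(3)] Comp_assoc'[OF y(7) t2(7) c2(1) y(3,2) z(2) t(3)] c1(2) c2(2) by simp_all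
  then have cg: "Comp C c ?g = g"
    unfolding c_def Comp_add_left[OF y(3) z(3) t(3) G m] using biproduct_decomp(2)[OF bY t(3) t(7)] by simp
  have hc: "Comp C h c = ?h"
    unfolding c_def Comp_add_right[OF z(3) t(3,4) m t(8)] sum_mor_def
      Comp_assoc'[OF z(6) c1(1) t(8) z(3,1) t(3,4)] Comp_assoc'[OF z(7) c2(1) t(8) z(3,2) t(3,4)]
      Comp_assoc'[OF z(6) t1(8) x1(4) z(3,1) x1(1,3)] Comp_assoc'[OF z(7) t2(8) x1(5) z(3,2) x1(2,3)] c1(3) c2(3) ..
  have iso: "is_isom C Z Q c"
    by (rule five_lemma[OF x(3) y(3) z(3) t(3) F G H t(7,8) E Tri_exact[OF T] c cg hc])
  then obtain d where d: "is_isom C Q Z d" "Comp C d c = Idm C Z" "Comp C c d = Idm C Q" by (rule is_isom_inverse)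
  note dm = is_isom_mor[OF d(1)]
  have "Comp C ?h d = h"
    unfolding hc[symmetric] Comp_assoc'[OF dm c t(8) t(3) z(3) t(3,4), symmetric] d(3) Comp_Idm'[OF t(8) t(3,4)] ..
  from Tri_cong_iso[OF T d(1) z(3) H this]
  have "(X, Y, Z, ?f, Comp C d g, ?h) \<in> Tri C" .
  moreover have "Comp C d g = ?g"
    unfolding cg[symmetric] Comp_assoc'[OF G c dm y(3) z(3) t(3) z(3)] d(2) Idm_Comp'[OF G y(3) z(3)] ..
  ultimately show ?thesis by simp
qed

text \<open>This is the sum of the identity triangle of \<open>B\<close> and the triangle from zero
  over \<open>A\<close> to \<open>A\<close>.\<close>

lemma Tri_split:
  assumes b: "biproduct C B A S iB iA pB pA"
  shows "(B, S, A, iB, pA, zerom C A (Shift C 1 B)) \<in> Tri C"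
proof -
  note x = biproductD[OF b]
  obtain N where N: "zero_obj C N" using ex_zero_obj by blast
  have n: "N \<in> Ob C" "Shift C 1 N \<in> Ob C" "Shift C 1 B \<in> Ob C" "zero_obj C (Shift C 1 N)" using zero_shift_obj[OF N] Shift_closed x by blast+
  note T = Tri_sum[OF TR1_id[OF x(1) N] Tri_zero_left[OF x(2) N] biproduct_zero(1)[OF x(1) N] b biproduct_zero(2)[OF x(2) N]]
  have "sum_mor C B S iB (Idm C B) (Idm C B) iA (zerom C N A) (zerom C B N) = iB"
    unfolding sum_mor_def Idm_Comp'[OF Idm_closed[OF x(1)] x(1,1)] Comp_Idm'[OF x(4) x(1,3)]
      Comp_zero_right[OF zero_mor[OF n(1) x(2)] x(1) n(1) x(2)] Comp_zero_right[OF x(5) x(1,2,3)]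
    using add_zero(1)[OF x(1,3,4)] .
  moreover have "sum_mor C S A (zerom C N A) (zerom C B N) pB (Idm C A) (Idm C A) pA = pA"
    unfolding sum_mor_def Idm_Comp'[OF x(7) x(3,2)] 
      Comp_zero_left[OF x(6) x(3,1) n(1)] Comp_zero_right[OF zero_mor[OF n(1) x(2)] x(3) n(1) x(2)]
    using add_zero(2)[OF x(3,2,7)] .
  moreover have "sum_mor C A (Shift C 1 B) (ShiftM C 1 (Idm C B)) (zerom C N (Shift C 1 B)) (zerom C A N)
      (ShiftM C 1 (zerom C N B)) (zerom C A (Shift C 1 N)) (Idm C A) = zerom C A (Shift C 1 B)"
    unfolding sum_mor_def ShiftM_Idm[OF x(1)] ShiftM_zero[OF n(1) x(1)] 
      Comp_zero_right[OF zero_mor[OF n(1,3)] x(2) n(1,3)] Comp_zero_right[OF Idm_closed[OF n(3)] x(2) n(3,3)]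
      Comp_Idm'[OF zero_mor[OF x(2) n(2)] x(2) n(2)] Comp_zero_right[OF zero_mor[OF n(2,3)] x(2) n(2,3)]
    using add_zero(1)[OF x(2) n(3) zero_mor[OF x(2) n(3)]] .
  ultimately show ?thesis using T by simp
qed

end

section \<open>Sign changes in triangles and homotopy pushouts\<close>

context linear_category
begin

lemma neg_neg: "\<lbrakk>f \<in> mor C X Y; X \<in> Ob C; Y \<in> Ob C\<rbrakk> \<Longrightarrow> \<ominus>\<^bsub>Hom C X Y\<^esub> (\<ominus>\<^bsub>Hom C X Y\<^esub> f) = f"
  by (meson Hom_abelian abelian_group.minus_minus)

lemma neg_Idm_Comp:
  "\<lbrakk>f \<in> mor C X Y; X \<in> Ob C; Y \<in> Ob C\<rbrakk> \<Longrightarrow> Comp C (\<ominus>\<^bsub>Hom C Y Y\<^esub> Idm C Y) f = \<ominus>\<^bsub>Hom C X Y\<^esub> f"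
  "\<lbrakk>f \<in> mor C X Y; X \<in> Ob C; Y \<in> Ob C\<rbrakk> \<Longrightarrow> Comp C f (\<ominus>\<^bsub>Hom C X X\<^esub> Idm C X) = \<ominus>\<^bsub>Hom C X Y\<^esub> f"
  by (simp_all add: Comp_neg(2)[of X Y Y] Comp_neg(1)[of X X Y] Idm_closed Comp_Idm' Idm_Comp')

end

context triangulated_category
begin

text \<open>Conjugation by minus the identity at the first object flips exactly the two maps that
  touch it; the next lemma does the same at the third object.\<close>

lemma Tri_neg_left:
  assumes T: "(X, Y, Z, f, g, h) \<in> Tri C"
  shows "(X, Y, Z, \<ominus>\<^bsub>Hom C X Y\<^esub> f, g, \<ominus>\<^bsub>Hom C Z (Shift C 1 X)\<^esub> h) \<in> Tri C"
proof -
  note t = TriD[OF T]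
  have m: "\<ominus>\<^bsub>Hom C X Y\<^esub> f \<in> mor C X Y" "\<ominus>\<^bsub>Hom C Z (Shift C 1 X)\<^esub> h \<in> mor C Z (Shift C 1 X)" using t by simp_all
  have s: "ShiftM C 1 (\<ominus>\<^bsub>Hom C X X\<^esub> Idm C X) = \<ominus>\<^bsub>Hom C (Shift C 1 X) (Shift C 1 X)\<^esub> Idm C (Shift C 1 X)"
    using ShiftM_neg[OF t(1,1) Idm_closed[OF t(1)]] ShiftM_Idm[OF t(1)] by simp
  show ?thesis
    by (rule TR1_iso[OF T t(1,2,3) m(1) t(7) m(2) is_isom_neg_Idm[OF t(1)] is_isom_Idm[OF t(2)] is_isom_Idm[OF t(3)]])
      (simp_all only: Idm_Comp'[OF t(6) t(1,2)] neg_Idm_Comp(2)[OF m(1) t(1,2)] neg_neg[OF t(6) t(1,2)] Idm_Comp'[OF t(7) t(2,3)]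
        Comp_Idm'[OF t(7) t(2,3)] s neg_Idm_Comp(1)[OF t(8) t(3,4)] Comp_Idm'[OF m(2) t(3,4)])
qed

lemma Tri_neg_right:
  assumes T: "(X, Y, Z, f, g, h) \<in> Tri C"
  shows "(X, Y, Z, f, \<ominus>\<^bsub>Hom C Y Z\<^esub> g, \<ominus>\<^bsub>Hom C Z (Shift C 1 X)\<^esub> h) \<in> Tri C"
proof -
  note t = TriD[OF T]
  have m: "\<ominus>\<^bsub>Hom C Z (Shift C 1 X)\<^esub> h \<in> mor C Z (Shift C 1 X)" using t by simp
  have "Comp C (\<ominus>\<^bsub>Hom C Z (Shift C 1 X)\<^esub> h) (\<ominus>\<^bsub>Hom C Z Z\<^esub> Idm C Z) = h"
    using neg_Idm_Comp(2)[OF m t(3,4)] neg_neg[OF t(8) t(3,4)] by simp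
  from Tri_cong_iso[OF T is_isom_neg_Idm[OF t(3)] t(3) m this] show ?thesis
    using neg_Idm_Comp(1)[OF t(7) t(2,3)] by simp
qed

text \<open>\<open>P\<close>, the cone of the map \<open>u\<close> with entries \<open>a\<close> and
  \<open>b\<close>, is the homotopy pushout of \<open>a\<close> and \<open>b\<close>, and the
  conclusion is the cobase change along \<open>b\<close> of the triangle on \<open>a\<close>. The
  proof applies \<open>TR4\<close> to \<open>u\<close> followed by the projection \<open>pA\<close>,
  whose composite is \<open>a\<close>: the three cones are \<open>P\<close>, \<open>A'\<close> and
  \<open>B[1]\<close>. Both entries of \<open>u\<close> have sign plus, so the square
  anticommutes.\<close>

lemma homotopy_pushout:
  assumes TA: "(Y, A, A', a, a', a'') \<in> Tri C" and b: "b \<in> mor C Y B"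
    and bS: "biproduct C A B S iA iB pA pB"
    and u: "u \<in> mor C Y S" "Comp C pA u = a" "Comp C pB u = b"
    and TP: "(Y, S, P, u, p, c) \<in> Tri C"
  shows "\<exists>n \<in> mor C P A'. Comp C n (Comp C p iA) = a' \<and> Comp C n (Comp C p iB) = zerom C B A' \<and>
    Comp C a'' n = c \<and>
    (B, P, A', Comp C p iB, n, \<ominus>\<^bsub>Hom C A' (Shift C 1 B)\<^esub> Comp C (ShiftM C 1 b) a'') \<in> Tri C"
proof -
  note s = biproductD[OF bS] and t = TriD[OF TA] and q = TriD[OF TP]
  let ?S = "Shift C 1"
  have B1: "?S B \<in> Ob C" "?S S \<in> Ob C" "?S P \<in> Ob C" using Shift_closed s q by blast+
  have iB1: "ShiftM C 1 iB \<in> mor C (?S B) (?S S)" "ShiftM C 1 pB \<in> mor C (?S S) (?S B)"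
    "ShiftM C 1 u \<in> mor C (?S Y) (?S S)" "ShiftM C 1 p \<in> mor C (?S S) (?S P)" "ShiftM C 1 b \<in> mor C (?S Y) (?S B)"
    using ShiftM_closed s u q b by blast+
  let ?i = "\<ominus>\<^bsub>Hom C (?S B) (?S S)\<^esub> ShiftM C 1 iB"
  \<comment> \<open>The cone of the projection \<open>pA\<close> is \<open>B[1]\<close>. The sign
    comes from rotating the split triangle, and it reappears in the connecting map of the
    conclusion.\<close>
  have TS: "(S, A, ?S B, pA, zerom C A (?S B), ?i) \<in> Tri C"
    by (rule Tri_rotate[OF Tri_split[OF biproduct_sym[OF bS]]])
  have TA': "(Y, A, A', Comp C pA u, a', a'') \<in> Tri C" using TA u by simp
  obtain n g where n: "(P, A', ?S B, n, g, Comp C (ShiftM C 1 p) ?i) \<in> Tri C"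
    "Comp C n p = Comp C a' pA" "Comp C a'' n = c" "Comp C ?i g = Comp C (ShiftM C 1 u) a''"
    using TR4[OF TP TA' TS] by metis
  note tn = TriD[OF n(1)]
  have n_iA: "Comp C n (Comp C p iA) = a'"
    unfolding Comp_assoc'[OF s(4) q(7) tn(6) s(1,3) q(3) t(3)] n(2)
      Comp_assoc'[OF s(4) s(6) t(7) s(1,3,1) t(3), symmetric] s(8) Comp_Idm'[OF t(7) t(2,3)] ..
  have n_iB: "Comp C n (Comp C p iB) = zerom C B A'"
    unfolding Comp_assoc'[OF s(5) q(7) tn(6) s(2,3) q(3) t(3)] n(2)
      Comp_assoc'[OF s(5) s(6) t(7) s(2,3,1) t(3), symmetric] s(11) Comp_zero_right[OF t(7) s(2,1) t(3)] ..
  have "Comp C (ShiftM C 1 pB) (ShiftM C 1 iB) = Idm C (?S B)"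
    using ShiftM_Comp[OF s(2,3,2,5,7), of 1] s(9) ShiftM_Idm[OF s(2), of 1] by simp
  then have 1: "Comp C (ShiftM C 1 pB) (Comp C ?i g) = \<ominus>\<^bsub>Hom C A' (?S B)\<^esub> g"
    unfolding Comp_neg(2)[OF t(3) B1(1,2) tn(7) iB1(1)]
      Comp_neg(1)[OF t(3) B1(2,1) Comp_mor[OF tn(7) iB1(1) t(3) B1(1,2)] iB1(2)]
      Comp_assoc'[OF tn(7) iB1(1,2) t(3) B1(1,2,1)]
    using Idm_Comp'[OF tn(7) t(3) B1(1)] by simp
  have 2: "Comp C (ShiftM C 1 pB) (Comp C (ShiftM C 1 u) a'') = Comp C (ShiftM C 1 b) a''"
    unfolding Comp_assoc'[OF t(8) iB1(3,2) t(3,4) B1(2,1)] ShiftM_Comp[OF q(1,2) s(2) u(1) s(7), symmetric] u(3) ..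
  \<comment> \<open>\<open>TR4\<close> describes \<open>g\<close> only after composition with
    \<open>?i\<close>; since \<open>pB[1]\<close> splits \<open>?i\<close> up to sign, this
    determines \<open>g\<close>.\<close>
  have g: "g = \<ominus>\<^bsub>Hom C A' (?S B)\<^esub> Comp C (ShiftM C 1 b) a''"
    using 1 2 n(4) neg_neg[OF tn(7) t(3) B1(1)] by simp
  have "Comp C (ShiftM C 1 p) ?i = \<ominus>\<^bsub>Hom C (?S B) (?S P)\<^esub> ShiftM C 1 (Comp C p iB)"
    unfolding Comp_neg(1)[OF B1(1,2,3) iB1(1,4)] ShiftM_Comp[OF s(2,3) q(3) s(5) q(7)] ..
  then have "(B, P, A', Comp C p iB, n, g) \<in> Tri C"
    using n(1) TR2[OF s(2) q(3) t(3) Comp_mor[OF s(5) q(7) s(2,3) q(3)] tn(6,7)] by simp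
  then show ?thesis using n_iA n_iB n(3) tn(6) g by blast
qed

text \<open>
  The endomorphism \<open>N = id - b\<^sub>0 \<circ> b\<^sup>-\<^sup>1\<close> of \<open>A\<close> satisfies \<open>w \<circ> N = 0\<close>; it agrees with \<open>y \<circ> u\<close> up to maps
  factoring through \<open>w\<close>, and \<open>u \<circ> N\<close> factors through \<open>w\<close>.  Hence \<open>N\<^sup>3 = 0\<close> and \<open>b\<^sub>0\<close> is an isomorphism.
\<close>
lemma Tri_replace_middle:
  assumes T: "(Z, P, A, m, n, w) \<in> Tri C" and T': "(Z, P, A', m, n', w') \<in> Tri C"
    and b: "is_isom C A' A b" "Comp C b n' = n" "Comp C w b = w'"
    and b0: "b\<^sub>0 \<in> mor C A' A" "Comp C b\<^sub>0 n' = n\<^sub>0" "Comp C w b\<^sub>0 = w'"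
    and u: "U \<in> Ob C" "u \<in> mor C A U" "y \<in> mor C U A"
    and n: "n \<ominus>\<^bsub>Hom C P A\<^esub> n\<^sub>0 = Comp C y (Comp C u n)" "Comp C u n = Comp C u n\<^sub>0"
  shows "(Z, P, A, m, n\<^sub>0, w) \<in> Tri C"
proof -
  note t = TriD[OF T] and t' = TriD[OF T']
  obtain bi where bi: "is_isom C A A' bi" "Comp C bi b = Idm C A'" "Comp C b bi = Idm C A"
    using is_isom_inverse[OF b(1)] by blast
  note bm = is_isom_mor[OF b(1)] and bim = is_isom_mor[OF bi(1)]
  let ?I = "Idm C A" and ?H = "Hom C A A"
  have I: "?I \<in> mor C A A" using Idm_closed t by blast
  define e where "e = Comp C b\<^sub>0 bi"
  have e: "e \<in> mor C A A" unfolding e_def using Comp_mor[OF bim b0(1) t(3) t'(3) t(3)] .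
  define N where "N = ?I \<ominus>\<^bsub>?H\<^esub> e"
  have N: "N \<in> mor C A A" unfolding N_def using I e t by simp
  have n0: "n\<^sub>0 \<in> mor C P A" using Comp_mor[OF t'(7) b0(1) t(2) t'(3) t(3)] b0(2) by simp
  have en: "Comp C e n = n\<^sub>0"
    unfolding e_def b(2)[symmetric] Comp_assoc'[OF Comp_mor[OF t'(7) bm t(2) t'(3) t(3)] bim b0(1) t(2,3) t'(3) t(3), symmetric]
      Comp_assoc'[OF t'(7) bm bim t(2) t'(3) t(3) t'(3)] bi(2) Idm_Comp'[OF t'(7) t(2) t'(3)] b0(2) ..
  have we: "Comp C w e = w"
    unfolding e_def Comp_assoc'[OF bim b0(1) t(8) t(3) t'(3) t(3,4)] b0(3) b(3)[symmetric]
      Comp_assoc'[OF bim bm t(8) t(3) t'(3) t(3,4), symmetric] bi(3) Comp_Idm'[OF t(8) t(3,4)] ..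
  have Nn: "Comp C N n = n \<ominus>\<^bsub>Hom C P A\<^esub> n\<^sub>0"
    unfolding N_def Comp_diff(2)[OF t(2,3,3) t(7) I e] en Idm_Comp'[OF t(7) t(2,3)] ..
  have wN: "Comp C w N = zerom C A (Shift C 1 Z)"
    unfolding N_def Comp_diff(1)[OF t(3,3,4) I e t(8)] we Comp_Idm'[OF t(8) t(3,4)] using add_zero(4)[OF t(3,4,8)] .
  note Tr = Tri_rotate[OF T]
  have yu: "Comp C y u \<in> mor C A A" using Comp_mor[OF u(2,3) t(3) u(1) t(3)] .
  have nn0: "n \<ominus>\<^bsub>Hom C P A\<^esub> n\<^sub>0 \<in> mor C P A" using t(2,3,7) n0 by simp
  have "Comp C (N \<ominus>\<^bsub>?H\<^esub> Comp C y u) n = zerom C P A"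
    unfolding Comp_diff(2)[OF t(2,3,3) t(7) N yu] Nn Comp_assoc'[OF t(7) u(2,3) t(2,3) u(1) t(3), symmetric] n(1)[symmetric]
    using add_zero(4)[OF t(2,3) nn0] .
  then obtain s where s: "s \<in> mor C (Shift C 1 Z) A" "N \<ominus>\<^bsub>?H\<^esub> Comp C y u = Comp C s w"
    using Tri_weak_cokernel[OF Tr t(3) diff_mor[OF t(3,3) N yu]] by blast
  have uN: "Comp C u N \<in> mor C A U" using Comp_mor[OF N u(2) t(3,3) u(1)] .
  have "Comp C (Comp C u N) n = zerom C P U"
    unfolding Comp_assoc'[OF t(7) N u(2) t(2,3,3) u(1), symmetric] Nn Comp_diff(1)[OF t(2,3) u(1) t(7) n0 u(2)] n(2)
    using add_zero(4)[OF t(2) u(1) Comp_mor[OF n0 u(2) t(2,3) u(1)]] .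
  then obtain r where r: "r \<in> mor C (Shift C 1 Z) U" "Comp C u N = Comp C r w"
    using Tri_weak_cokernel[OF Tr u(1) uN] by blast
  have NN: "Comp C N N \<in> mor C A A" using Comp_mor[OF N N t(3,3,3)] .
  have sw: "Comp C s w \<in> mor C A A" using Comp_mor[OF t(8) s(1) t(3,4,3)] .
  have wNN: "Comp C w (Comp C N N) = zerom C A (Shift C 1 Z)"
    unfolding Comp_assoc'[OF N N t(8) t(3,3,3,4)] wN Comp_zero_left[OF N t(3,3,4)] ..
  have a: "Comp C (Comp C s w) (Comp C N N) = zerom C A A"
    unfolding Comp_assoc'[OF NN t(8) s(1) t(3,3,4,3), symmetric] wNN Comp_zero_right[OF s(1) t(3,4,3)] ..
  have c: "Comp C (Comp C y u) (Comp C N N) = zerom C A A"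
    unfolding Comp_assoc'[OF NN u(2,3) t(3,3) u(1) t(3), symmetric] Comp_assoc'[OF N N u(2) t(3,3,3) u(1)] r(2)
      Comp_assoc'[OF N t(8) r(1) t(3,3,4) u(1), symmetric] wN Comp_zero_right[OF r(1) t(3,4) u(1)] Comp_zero_right[OF u(3) t(3) u(1) t(3)] ..
  have "Comp C N (Comp C N N) = Comp C (Comp C s w \<oplus>\<^bsub>?H\<^esub> Comp C y u) (Comp C N N)"
    unfolding s(2)[symmetric] diff_add_cancel(1)[OF t(3,3) N yu] ..
  also have "\<dots> = zerom C A A"
    unfolding Comp_add_left[OF t(3,3,3) NN sw yu] a c using add_zero(1)[OF t(3,3) zero_mor[OF t(3,3)]] .
  finally have iso: "is_isom C A A (?I \<ominus>\<^bsub>?H\<^esub> N)" by (rule nilpotent_iso[OF t(3) N])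
  have "?I \<ominus>\<^bsub>?H\<^esub> N = e"
  proof -
    interpret H: abelian_group ?H using t Hom_abelian by blast
    have "(?I \<ominus>\<^bsub>?H\<^esub> N) \<oplus>\<^bsub>?H\<^esub> N = e \<oplus>\<^bsub>?H\<^esub> N"
      unfolding diff_add_cancel(1)[OF t(3,3) I N] unfolding N_def diff_add_cancel(2)[OF t(3,3) I e] ..
    then show ?thesis using H.add.right_cancel[OF N diff_mor[OF t(3,3) I N] e] by blast
  qed
  moreover have "Comp C e b = b\<^sub>0"
    unfolding e_def Comp_assoc'[OF bm bim b0(1) t'(3) t(3) t'(3) t(3), symmetric] bi(2) Comp_Idm'[OF b0(1) t'(3) t(3)] ..
  ultimately have "is_isom C A' A b\<^sub>0"
    using is_isom_Comp[OF t'(3) t(3,3) b(1) iso] by simp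
  from Tri_cong_iso[OF T' this t(3,8) b0(3)] show ?thesis unfolding b0(2) .
qed

end

section \<open>Homogeneous parts\<close>

text \<open>The described family \<open>c\<close> consists of all homogeneous parts of
  \<open>f\<close>; it is unique by \<open>G_direct_sum\<close>, so the values are meaningful at
  indecomposable objects.\<close>

definition hpart ::
    "('o, 'm, 'k) tricat \<Rightarrow> (real \<Rightarrow> 'o \<Rightarrow> 'o \<Rightarrow> 'm set) \<Rightarrow> real \<Rightarrow> 'o \<Rightarrow> 'o \<Rightarrow> 'm \<Rightarrow> 'm" where
  "hpart C G a E F f = (THE c. (\<forall>a. c a \<in> G a E F) \<and> finite {a. c a \<noteq> zerom C E F} \<and>
               f = finsum (Hom C E F) c {a. c a \<noteq> zerom C E F}) a"

text \<open>Decompositions of different morphisms can be compared over a common finite set of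
  degrees instead of over their exact supports.\<close>

lemma (in linear_category) finsum_support:
  assumes o: "E \<in> Ob C" "F \<in> Ob C" and S: "finite S" "\<And>a. a \<notin> S \<Longrightarrow> c a = zerom C E F" "\<And>a. c a \<in> mor C E F"
  shows "finsum (Hom C E F) c S = finsum (Hom C E F) c {a. c a \<noteq> zerom C E F}"
proof -
  interpret H: abelian_group "Hom C E F" by (rule Hom_abelian[OF o])
  have sub: "{a. c a \<noteq> zerom C E F} \<subseteq> S" using S by auto
  show ?thesis
    by (rule H.add.finprod_mono_neutral_cong_left[OF S(1) sub, symmetric]) (use S(3) in simp_all)
qed

lemma (in category_with_shift) ShiftM_finsum:
  assumes o: "X \<in> Ob C" "Y \<in> Ob C" and I: "finite I" "\<And>i. i \<in> I \<Longrightarrow> F i \<in> mor C X Y"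
  shows "ShiftM C d (finsum (Hom C X Y) F I) = finsum (Hom C (Shift C d X) (Shift C d Y)) (\<lambda>i. ShiftM C d (F i)) I"
proof -
  have s: "Shift C d X \<in> Ob C" "Shift C d Y \<in> Ob C" using o Shift_closed by auto
  interpret H: abelian_group "Hom C (Shift C d X) (Shift C d Y)" using s Hom_abelian by blast
  interpret XY: abelian_group "Hom C X Y" using o Hom_abelian by blast
  show ?thesis using I
  proof (induction I rule: finite_induct)
    case empty then show ?case using o ShiftM_zero by simp
  next
    case (insert i I)
    have m: "F i \<in> mor C X Y" "finsum (Hom C X Y) F I \<in> mor C X Y" using insert(4) o by auto
    have sm: "ShiftM C d (F j) \<in> mor C (Shift C d X) (Shift C d Y)" if "j \<in> insert i I" for j
      by (rule ShiftM_closed[OF o insert(4)[OF that]])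
    have "finsum (Hom C X Y) F (insert i I) = F i \<oplus>\<^bsub>Hom C X Y\<^esub> finsum (Hom C X Y) F I"
      using insert(1,2,4) by (intro XY.finsum_insert) (simp_all add: Pi_def)
    moreover have "finsum (Hom C (Shift C d X) (Shift C d Y)) (\<lambda>i. ShiftM C d (F i)) (insert i I) =
        ShiftM C d (F i) \<oplus>\<^bsub>Hom C (Shift C d X) (Shift C d Y)\<^esub> finsum (Hom C (Shift C d X) (Shift C d Y)) (\<lambda>i. ShiftM C d (F i)) I"
      using insert(1,2) sm by (intro H.finsum_insert) (simp_all add: Pi_def)
    ultimately show ?case using insert(3,4) ShiftM_plus[OF o m] by simp
  qed
qed

lemma shift_dec_sel [simp]:
  "nsum (shift_dec C d D) = nsum D" "tot (shift_dec C d D) = Shift C d (tot D)"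
  by (auto simp: shift_dec_def)

lemma shift_dec_nth:
  assumes "i < nsum D"
  shows "smd (shift_dec C d D) i = Shift C d (smd D i)" "incl (shift_dec C d D) i = ShiftM C d (incl D i)"
    "proj (shift_dec C d D) i = ShiftM C d (proj D i)"
  using assms by (auto simp: shift_dec_def smd_def incl_def proj_def split: prod.splits)

section \<open>Shifts of indecomposable and of decomposed objects\<close>

context category_with_shift
begin

lemma indecomposable_Shift: assumes "indecomposable C E" shows "indecomposable C (Shift C d E)"
proof -
  have E: "E \<in> Ob C" by (rule indecomposable_Ob[OF assms])
  have 1: "\<not> zero_obj C (Shift C d E)"
    using zero_obj_Shift[of "Shift C d E" "-d"] Shift_neg_cancel(2)[OF E, of d] assms
    by (auto simp: indecomposable_def)
  have "zero_obj C A \<or> zero_obj C B" if ds: "direct_sum C A B (Shift C d E)" for A B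
  proof -
    obtain i1 i2 p1 p2 where b: "biproduct C A B (Shift C d E) i1 i2 p1 p2" using ds unfolding direct_sum_def by blast
    have "direct_sum C (Shift C (-d) A) (Shift C (-d) B) E"
      unfolding direct_sum_def using biproduct_Shift[OF b, of "-d"] Shift_neg_cancel(2)[OF E, of d] by auto
    then have "zero_obj C (Shift C (-d) A) \<or> zero_obj C (Shift C (-d) B)" using assms by (auto simp: indecomposable_def)
    then show ?thesis
      using zero_obj_Shift[of "Shift C (-d) A" d] zero_obj_Shift[of "Shift C (-d) B" d]
        Shift_neg_cancel(1)[OF biproductD(1)[OF b], of d] Shift_neg_cancel(1)[OF biproductD(2)[OF b], of d] by auto
  qed
  then show ?thesis using 1 Shift_closed[OF E] unfolding indecomposable_def by blast
qed

lemma is_dec_shift: assumes D: "is_dec C D" shows "is_dec C (shift_dec C d D)"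
proof -
  note t = is_dec_simps[OF D]
  have m: "Comp C (incl D i) (proj D i) \<in> mor C (tot D) (tot D)" if "i < nsum D" for i
    using Comp_mor[OF t(5,4)] that t by simp
  have m': "Comp C (ShiftM C d (incl D i)) (ShiftM C d (proj D i)) \<in> mor C (Shift C d (tot D)) (Shift C d (tot D))"
    if "i < nsum D" for i
    using ShiftM_closed[OF t(1,1) m[OF that], of d] ShiftM_Comp[OF t(1) t(3)[OF that] t(1) t(5)[OF that] t(4)[OF that], of d] by simp
  have "finsum (Hom C (Shift C d (tot D)) (Shift C d (tot D)))
      (\<lambda>i. Comp C (incl (shift_dec C d D) i) (proj (shift_dec C d D) i)) {..<nsum D} =
    finsum (Hom C (Shift C d (tot D)) (Shift C d (tot D))) (\<lambda>i. ShiftM C d (Comp C (incl D i) (proj D i))) {..<nsum D}"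
    by (rule finsum_mor_cong)
      (simp_all add: Shift_closed[OF t(1)] shift_dec_nth ShiftM_Comp[OF t(1) t(3) t(1) t(5,4)] m')
  also have "\<dots> = Idm C (Shift C d (tot D))"
    using ShiftM_finsum[OF t(1,1), of "{..<nsum D}" "\<lambda>i. Comp C (incl D i) (proj D i)" d] m is_dec_sum[OF D] ShiftM_Idm[OF t(1)] by simp
  finally have 1: "finsum (Hom C (Shift C d (tot D)) (Shift C d (tot D)))
      (\<lambda>i. Comp C (incl (shift_dec C d D) i) (proj (shift_dec C d D) i)) {..<nsum D} = Idm C (Shift C d (tot D))" .
  have 2: "Comp C (ShiftM C d (proj D j)) (ShiftM C d (incl D i)) =
      (if i = j then Idm C (Shift C d (smd D i)) else zerom C (Shift C d (smd D i)) (Shift C d (smd D j)))"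
    if ij: "i < nsum D" "j < nsum D" for i j
    using ShiftM_Comp[OF t(3)[OF ij(1)] t(1) t(3)[OF ij(2)] t(4)[OF ij(1)] t(5)[OF ij(2)], of d]
      is_dec_proj_incl[OF D ij] ShiftM_Idm[OF t(3)[OF ij(1)], of d] ShiftM_zero[OF t(3)[OF ij(1)] t(3)[OF ij(2)], of d]
    by (auto split: if_splits)
  show ?thesis unfolding is_dec_def
    using 1 2 t indecomposable_Shift ShiftM_closed Shift_closed by (simp add: shift_dec_nth)
qed

lemma component_shift:
  assumes "is_dec C A" "is_dec C B" "f \<in> mor C (tot A) (tot B)" "i < nsum A" "j < nsum B"
  shows "component C (shift_dec C d A) (shift_dec C d B) (ShiftM C d f) i j = ShiftM C d (component C A B f i j)"
proof -
  note t = is_dec_simps[OF assms(1)] is_dec_simps[OF assms(2)]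
  note o = t(1) t(6) t(3)[OF assms(4)] t(8)[OF assms(5)]
  note m = Comp_mor[OF assms(3) t(10)[OF assms(5)] o(1,2,4)]
  show ?thesis unfolding component_def shift_dec_nth(2)[OF assms(4)] shift_dec_nth(3)[OF assms(5)]
    using ShiftM_Comp[OF o(3,1,4) t(4)[OF assms(4)] m, of d] ShiftM_Comp[OF o(1,2,4) assms(3) t(10)[OF assms(5)], of d] by simp
qed

end

locale graded_category = cyclic_category K C \<beta> + real_decomposition K C \<beta> G
  for K :: "'k ring" and C :: "('o, 'm, 'k) tricat" and \<beta> :: "'o \<Rightarrow> 'm" and G :: "real \<Rightarrow> 'o \<Rightarrow> 'o \<Rightarrow> 'm set"
begin

lemma G_mor:
  assumes "f \<in> G a E F" "indecomposable C E" "indecomposable C F"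
  shows "f \<in> mor C E F"
proof -
  have "G a E F \<subseteq> mor C E F"
    by (rule module.submoduleE(1)[OF Hom_module G_submodule]) (rule indecomposable_Ob assms)+
  then show ?thesis using assms(1) by (rule subsetD)
qed

lemma G_sub:
  assumes E: "indecomposable C E" "indecomposable C F"
  shows "zerom C E F \<in> G a E F"
    "f \<in> G a E F \<Longrightarrow> g \<in> G a E F \<Longrightarrow> f \<oplus>\<^bsub>Hom C E F\<^esub> g \<in> G a E F"
    "f \<in> G a E F \<Longrightarrow> \<ominus>\<^bsub>Hom C E F\<^esub> f \<in> G a E F"
    "c \<in> carrier K \<Longrightarrow> f \<in> G a E F \<Longrightarrow> c \<odot>\<^bsub>Hom C E F\<^esub> f \<in> G a E F"
proof -
  note s = module.submoduleE[OF Hom_module[OF E[THEN indecomposable_Ob]] G_submodule[OF E, of a]]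
  show "f \<in> G a E F \<Longrightarrow> g \<in> G a E F \<Longrightarrow> f \<oplus>\<^bsub>Hom C E F\<^esub> g \<in> G a E F" by (rule s(5))
  show "f \<in> G a E F \<Longrightarrow> \<ominus>\<^bsub>Hom C E F\<^esub> f \<in> G a E F" by (rule s(3))
  show "c \<in> carrier K \<Longrightarrow> f \<in> G a E F \<Longrightarrow> c \<odot>\<^bsub>Hom C E F\<^esub> f \<in> G a E F" by (rule s(4))
  have "subgroup (G a E F) (add_monoid (Hom C E F))" by (rule submodule.axioms(1)[OF G_submodule[OF E]])
  from subgroup.one_closed[OF this] show "zerom C E F \<in> G a E F" by simp
qed

lemma G_finsum:
  assumes E: "indecomposable C E" "indecomposable C F" and I: "finite I" "\<And>i. i \<in> I \<Longrightarrow> f i \<in> G a E F"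
  shows "finsum (Hom C E F) f I \<in> G a E F"
proof -
  interpret H: abelian_group "Hom C E F" by (rule Hom_abelian[OF E[THEN indecomposable_Ob]])
  show ?thesis using I
  proof (induction I rule: finite_induct)
    case empty then show ?case using G_sub[OF E] by simp
  next
    case (insert i I)
    have "finsum (Hom C E F) f (insert i I) = f i \<oplus>\<^bsub>Hom C E F\<^esub> finsum (Hom C E F) f I"
      using insert(1,2) G_mor[OF insert(4) E] by (intro H.finsum_insert) (simp_all add: Pi_def)
    then show ?case using G_sub(2)[OF E insert(4)[of i] insert(3)] insert(4) by simp
  qed
qed

text \<open>Uniqueness of the decomposition, with any finite set of degrees in place of the exact
  support. Homogeneous parts are computed below by exhibiting a family \<open>c\<close>.\<close>

lemma hpart_eqI:
  assumes E: "indecomposable C E" "indecomposable C F"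
    and c: "\<And>a. c a \<in> G a E F" "finite S" "\<And>a. a \<notin> S \<Longrightarrow> c a = zerom C E F"
    and f: "f = finsum (Hom C E F) c S"
  shows "hpart C G a E F f = c a"
proof -
  note o = E[THEN indecomposable_Ob]
  have cm: "c a \<in> mor C E F" for a by (rule G_mor[OF c(1) E])
  have 1: "f = finsum (Hom C E F) c {a. c a \<noteq> zerom C E F}"
    unfolding f by (rule finsum_support[OF o c(2,3) cm])
  have 2: "finite {a. c a \<noteq> zerom C E F}"
  proof (rule finite_subset[OF _ c(2)])
    show "{a. c a \<noteq> zerom C E F} \<subseteq> S" using c(3) by blast
  qed
  have 3: "f \<in> mor C E F" unfolding f by (rule finsum_mor[OF o cm])
  have "(THE c. (\<forall>a. c a \<in> G a E F) \<and> finite {a. c a \<noteq> zerom C E F} \<and>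
               f = finsum (Hom C E F) c {a. c a \<noteq> zerom C E F}) = c"
    by (rule the1_equality[OF G_direct_sum[OF E 3]]) (intro conjI allI c(1) 1 2)
  then show ?thesis unfolding hpart_def by simp
qed

lemma hpart_decomp:
  assumes E: "indecomposable C E" "indecomposable C F" and f: "f \<in> mor C E F"
  shows "hpart C G a E F f \<in> G a E F" "finite {a. hpart C G a E F f \<noteq> zerom C E F}"
    "f = finsum (Hom C E F) (\<lambda>a. hpart C G a E F f) {a. hpart C G a E F f \<noteq> zerom C E F}"
proof -
  obtain c where c0: "(\<forall>a. c a \<in> G a E F) \<and> finite {a. c a \<noteq> zerom C E F} \<and>
      f = finsum (Hom C E F) c {a. c a \<noteq> zerom C E F}"
    using ex1_implies_ex[OF G_direct_sum[OF E f]] by (rule exE)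
  note c = c0[THEN conjunct1, rule_format] c0[THEN conjunct2, THEN conjunct1] c0[THEN conjunct2, THEN conjunct2]
  have eq: "hpart C G a E F f = c a" for a
    by (rule hpart_eqI[OF E c(1,2) _ c(3)]) simp
  show "hpart C G a E F f \<in> G a E F" "finite {a. hpart C G a E F f \<noteq> zerom C E F}"
    "f = finsum (Hom C E F) (\<lambda>a. hpart C G a E F f) {a. hpart C G a E F f \<noteq> zerom C E F}"
    unfolding eq by (rule c)+
qed

lemma hpart_mor:
  assumes "indecomposable C E" "indecomposable C F" "f \<in> mor C E F"
  shows "hpart C G a E F f \<in> mor C E F"
  by (rule G_mor[OF hpart_decomp(1)[OF assms] assms(1,2)])

lemma hpart_homogeneous:
  assumes E: "indecomposable C E" "indecomposable C F" and f: "f \<in> G b E F"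
  shows "hpart C G a E F f = (if a = b then f else zerom C E F)"
proof -
  note o = E[THEN indecomposable_Ob]
  interpret H: abelian_group "Hom C E F" by (rule Hom_abelian[OF o])
  have fm: "f \<in> mor C E F" using f G_mor E by blast
  show ?thesis
    by (rule hpart_eqI[OF E, where S = "{b}" and c = "\<lambda>a. if a = b then f else zerom C E F"]) (use f fm G_sub(1)[OF E] in simp_all)
qed

lemma G_unique:
  assumes E: "indecomposable C E" "indecomposable C F" and f: "f \<in> G a E F" "f \<in> G b E F" "f \<noteq> zerom C E F"
  shows "a = b"
  using hpart_homogeneous[OF E f(1), of a] hpart_homogeneous[OF E f(2), of a] f by (auto split: if_splits)

lemma deg_eq:
  assumes E: "indecomposable C E" "indecomposable C F" and f: "f \<in> G a E F" "f \<noteq> zerom C E F"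
  shows "deg G E F f = a"
  unfolding deg_def
proof (rule the_equality)
  show "b = a" if "f \<in> G b E F" for b by (rule G_unique[OF E that f])
qed (rule f)

lemma hpart_add:
  assumes E: "indecomposable C E" "indecomposable C F" and f: "f \<in> mor C E F" "g \<in> mor C E F"
  shows "hpart C G a E F (f \<oplus>\<^bsub>Hom C E F\<^esub> g) = hpart C G a E F f \<oplus>\<^bsub>Hom C E F\<^esub> hpart C G a E F g"
proof -
  note o = E[THEN indecomposable_Ob]
  interpret H: abelian_group "Hom C E F" by (rule Hom_abelian[OF o])
  let ?S = "{a. hpart C G a E F f \<noteq> zerom C E F} \<union> {a. hpart C G a E F g \<noteq> zerom C E F}"
  note fd = hpart_decomp[OF E f(1)] and gd = hpart_decomp[OF E f(2)]
  note fm = hpart_mor[OF E f(1)] and gm = hpart_mor[OF E f(2)]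
  have S: "finite ?S" using fd gd by simp
  have "finsum (Hom C E F) (\<lambda>a. hpart C G a E F f) ?S = f"
    by (rule trans[OF finsum_support[OF o S _ fm] fd(3)[symmetric]]) simp
  moreover have "finsum (Hom C E F) (\<lambda>a. hpart C G a E F g) ?S = g"
    by (rule trans[OF finsum_support[OF o S _ gm] gd(3)[symmetric]]) simp
  ultimately have fg: "f \<oplus>\<^bsub>Hom C E F\<^esub> g = finsum (Hom C E F) (\<lambda>a. hpart C G a E F f \<oplus>\<^bsub>Hom C E F\<^esub> hpart C G a E F g) ?S"
    using H.finsum_addf[of "\<lambda>a. hpart C G a E F f" ?S "\<lambda>a. hpart C G a E F g"] fm gm by (simp add: Pi_def)
  show ?thesis
    by (rule hpart_eqI[where c = "\<lambda>a. hpart C G a E F f \<oplus>\<^bsub>Hom C E F\<^esub> hpart C G a E F g" and S = ?S, OF E _ S _ fg]) (use fd(1) gd(1) G_sub(2)[OF E] o in simp_all)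
qed

lemma hpart_finsum:
  assumes E: "indecomposable C E" "indecomposable C F" and I: "finite I" "\<And>i. i \<in> I \<Longrightarrow> f i \<in> mor C E F"
  shows "hpart C G a E F (finsum (Hom C E F) f I) = finsum (Hom C E F) (\<lambda>i. hpart C G a E F (f i)) I"
proof -
  note o = E[THEN indecomposable_Ob]
  interpret H: abelian_group "Hom C E F" by (rule Hom_abelian[OF o])
  show ?thesis using I
  proof (induction I rule: finite_induct)
    case empty
    then show ?case using hpart_homogeneous[OF E G_sub(1)[OF E], of a a] by simp
  next
    case (insert i I)
    have m: "f i \<in> mor C E F" "finsum (Hom C E F) f I \<in> mor C E F" using insert(4) o by auto
    have "finsum (Hom C E F) f (insert i I) = f i \<oplus>\<^bsub>Hom C E F\<^esub> finsum (Hom C E F) f I"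
      using insert(1,2,4) by (intro H.finsum_insert) (simp_all add: Pi_def)
    moreover have "finsum (Hom C E F) (\<lambda>i. hpart C G a E F (f i)) (insert i I) =
        hpart C G a E F (f i) \<oplus>\<^bsub>Hom C E F\<^esub> finsum (Hom C E F) (\<lambda>i. hpart C G a E F (f i)) I"
      using insert(1,2) hpart_mor[OF E insert(4)] by (intro H.finsum_insert) (simp_all add: Pi_def)
    ultimately show ?case using insert(3,4) hpart_add[OF E m] by simp
  qed
qed

text \<open>Composition with \<open>g\<close> raises every degree by \<open>b\<close>, so the parts
  of the composite are those of \<open>f\<close> reindexed along the translation by
  \<open>b\<close>; this is why the family has \<open>x - b\<close> in it.\<close>

lemma hpart_Comp_left:
  assumes E: "indecomposable C E" "indecomposable C F" "indecomposable C H"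
    and f: "f \<in> mor C E F" and g: "g \<in> G b F H"
  shows "hpart C G (a + b) E H (Comp C g f) = Comp C g (hpart C G a E F f)"
proof -
  note o = E[THEN indecomposable_Ob]
  let ?S = "{a. hpart C G a E F f \<noteq> zerom C E F}"
  have gm: "g \<in> mor C F H" using G_mor[OF g E(2,3)] .
  note fd = hpart_decomp[OF E(1,2) f] and fm = hpart_mor[OF E(1,2) f]
  interpret H: abelian_group "Hom C E H" by (rule Hom_abelian[OF o(1,3)])
  have m: "Comp C g (hpart C G a E F f) \<in> mor C E H" for a using Comp_mor[OF fm gm o] .
  have 1: "Comp C g f = finsum (Hom C E H) (\<lambda>a. Comp C g (hpart C G a E F f)) ?S"
    by (subst fd(3), rule Comp_finsum_right) (use o fm gm fd(2) in simp_all)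
  also have "\<dots> = finsum (Hom C E H) (\<lambda>x. Comp C g (hpart C G (x - b) E F f)) ((\<lambda>a. a + b) ` ?S)"
    by (subst H.add.finprod_reindex) (simp_all add: inj_on_def Pi_def m)
  finally have "hpart C G (a + b) E H (Comp C g f) = Comp C g (hpart C G (a + b - b) E F f)"
  proof (intro hpart_eqI[OF E(1,3), where c = "\<lambda>x. Comp C g (hpart C G (x - b) E F f)"])
    fix x show "Comp C g (hpart C G (x - b) E F f) \<in> G x E H"
      using G_Comp[OF E fd(1) g, of "x - b"] by simp
    assume "x \<notin> (\<lambda>a. a + b) ` ?S"
    then have "hpart C G (x - b) E F f = zerom C E F" by (force simp: image_iff)
    then show "Comp C g (hpart C G (x - b) E F f) = zerom C E H" using Comp_zero_right[OF gm o] by simp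
  qed (use fd(2) in simp_all)
  then show ?thesis by simp
qed

lemma hpart_Comp_right:
  assumes E: "indecomposable C E" "indecomposable C F" "indecomposable C H"
    and f: "f \<in> G b E F" and g: "g \<in> mor C F H"
  shows "hpart C G (a + b) E H (Comp C g f) = Comp C (hpart C G a F H g) f"
proof -
  note o = E[THEN indecomposable_Ob]
  let ?S = "{a. hpart C G a F H g \<noteq> zerom C F H}"
  have fm: "f \<in> mor C E F" using G_mor[OF f E(1,2)] .
  note gd = hpart_decomp[OF E(2,3) g] and gm = hpart_mor[OF E(2,3) g]
  interpret H: abelian_group "Hom C E H" by (rule Hom_abelian[OF o(1,3)])
  have m: "Comp C (hpart C G a F H g) f \<in> mor C E H" for a using Comp_mor[OF fm gm o] .
  have 1: "Comp C g f = finsum (Hom C E H) (\<lambda>a. Comp C (hpart C G a F H g) f) ?S"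
    by (subst gd(3), rule Comp_finsum_left) (use o fm gm gd(2) in simp_all)
  also have "\<dots> = finsum (Hom C E H) (\<lambda>x. Comp C (hpart C G (x - b) F H g) f) ((\<lambda>a. a + b) ` ?S)"
    by (subst H.add.finprod_reindex) (simp_all add: inj_on_def Pi_def m)
  finally have "hpart C G (a + b) E H (Comp C g f) = Comp C (hpart C G (a + b - b) F H g) f"
  proof (intro hpart_eqI[OF E(1,3), where c = "\<lambda>x. Comp C (hpart C G (x - b) F H g) f"])
    fix x show "Comp C (hpart C G (x - b) F H g) f \<in> G x E H"
      using G_Comp[OF E f gd(1), of "x - b"] by simp
    assume "x \<notin> (\<lambda>a. a + b) ` ?S"
    then have "hpart C G (x - b) F H g = zerom C F H" by (force simp: image_iff)
    then show "Comp C (hpart C G (x - b) F H g) f = zerom C E H" using Comp_zero_left[OF fm o] by simp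
  qed (use gd(2) in simp_all)
  then show ?thesis by simp
qed

text \<open>The axioms only say that \<open>[1]\<close> preserves degrees. The parts of
  \<open>h\<close>, which is \<open>f[-1]\<close>, become under \<open>[1]\<close> a family of
  homogeneous morphisms with sum \<open>f\<close>, hence the parts of \<open>f\<close>. All but the
  one of degree \<open>a\<close> vanish, and since \<open>[1]\<close> is injective the same holds
  for the parts of \<open>h\<close>.\<close>

lemma G_shift_neg:
  assumes E: "indecomposable C E" "indecomposable C F" and f: "f \<in> G a E F"
  shows "ShiftM C (-1) f \<in> G a (Shift C (-1) E) (Shift C (-1) F)"
proof -
  note o = E[THEN indecomposable_Ob]
  note E' = indecomposable_Shift[OF E(1), of "-1"] indecomposable_Shift[OF E(2), of "-1"]
  note o' = E'[THEN indecomposable_Ob]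
  have fm: "f \<in> mor C E F" using G_mor[OF f E] .
  define h where "h = ShiftM C (-1) f"
  have h: "h \<in> mor C (Shift C (-1) E) (Shift C (-1) F)" unfolding h_def using ShiftM_closed[OF o fm] .
  let ?h = "\<lambda>b. hpart C G b (Shift C (-1) E) (Shift C (-1) F) h"
  let ?S = "{b. ?h b \<noteq> zerom C (Shift C (-1) E) (Shift C (-1) F)}"
  note hd = hpart_decomp[OF E' h] and hm = hpart_mor[OF E' h]
  have s1: "Shift C 1 (Shift C (-1) E) = E" "Shift C 1 (Shift C (-1) F) = F" "ShiftM C 1 h = f"
    unfolding h_def using Shift_neg_cancel(1)[OF o(1), of 1] Shift_neg_cancel(1)[OF o(2), of 1] ShiftM_neg_cancel(1)[OF fm o, of 1] by simp_all
  have zero: "ShiftM C 1 (zerom C (Shift C (-1) E) (Shift C (-1) F)) = zerom C E F"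
    using ShiftM_zero[OF o', of 1] s1 by simp
  have "f = finsum (Hom C E F) (\<lambda>b. ShiftM C 1 (?h b)) ?S"
    using ShiftM_finsum[OF o' hd(2), of ?h 1, OF hm] unfolding hd(3)[symmetric] s1 .
  from this have "hpart C G b E F f = ShiftM C 1 (?h b)" for b
  proof (intro hpart_eqI[OF E _ hd(2), where c = "\<lambda>b. ShiftM C 1 (?h b)"])
    fix b show "ShiftM C 1 (?h b) \<in> G b E F" using G_shift[OF E' hd(1), of b] s1 by simp
    assume "b \<notin> ?S" then show "ShiftM C 1 (?h b) = zerom C E F" using zero by simp
  qed
  then have "ShiftM C 1 (?h b) = ShiftM C 1 (zerom C (Shift C (-1) E) (Shift C (-1) F))" if "b \<noteq> a" for b
    using hpart_homogeneous[OF E f, of b] that zero by simp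
  then have z: "?h b = zerom C (Shift C (-1) E) (Shift C (-1) F)" if "b \<noteq> a" for b
    using ShiftM_inj[OF hm zero_mor[OF o'] o'] that by blast
  interpret H: abelian_group "Hom C (Shift C (-1) E) (Shift C (-1) F)" using o' Hom_abelian by blast
  have "h = finsum (Hom C (Shift C (-1) E) (Shift C (-1) F)) ?h {a}"
    by (rule trans[OF hd(3) finsum_support[OF o' _ _ hm, symmetric]]) (simp_all add: z)
  moreover have "finsum (Hom C (Shift C (-1) E) (Shift C (-1) F)) ?h {a} = ?h a" using hm by simp
  ultimately have "h = ?h a" by (rule trans)
  then have "h \<in> G a (Shift C (-1) E) (Shift C (-1) F)" by (rule ssubst) (rule hd(1))
  then show ?thesis unfolding h_def .
qed

lemma G_shift_int:
  assumes E: "indecomposable C E" "indecomposable C F" and f: "f \<in> G a E F"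
  shows "ShiftM C d f \<in> G a (Shift C d E) (Shift C d F)"
proof -
  note o = E[THEN indecomposable_Ob]
  have fm: "f \<in> mor C E F" using G_mor[OF f E] .
  show ?thesis
  proof (induction d rule: int_induct[where k = 0])
    case base
    show ?case unfolding Shift_0[OF o(1)] Shift_0[OF o(2)] ShiftM_0[OF o fm] by (rule f)
  next
    case (step1 i)
    have i: "i + 1 = 1 + i" by simp
    show ?case unfolding i Shift_add[OF o(1), of 1 i] Shift_add[OF o(2), of 1 i] ShiftM_add[OF o fm, of 1 i]
      by (rule G_shift[OF indecomposable_Shift[OF E(1)] indecomposable_Shift[OF E(2)] step1(2)])
  next
    case (step2 i)
    have i: "i - 1 = -1 + i" by simp
    show ?case unfolding i Shift_add[OF o(1), of "-1" i] Shift_add[OF o(2), of "-1" i] ShiftM_add[OF o fm, of "-1" i]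
      by (rule G_shift_neg[OF indecomposable_Shift[OF E(1)] indecomposable_Shift[OF E(2)] step2(2)])
  qed
qed

end

context triangulated_category
begin

text \<open>\<open>P\<close> is a model of the third object \<open>Y'\<close> for which the
  octahedral relations hold up to sign, and \<open>d\<close> carries it to \<open>Y'\<close>. The
  sign put on \<open>pA\<close> in \<open>f\<close> turns the anticommuting square \<open>z\<close>
  into a commuting one; in the relation between \<open>n\<close> and \<open>k\<close> it meets the
  sign of \<open>n0\<close> and cancels.\<close>

lemma octahedron_transport:
  assumes T1: "(X, Y, Z', u, j, k) \<in> Tri C" and T2: "(X, Z, Y', Comp C v u, m, n) \<in> Tri C"
    and T3: "(Y, Z, X', v, l, i) \<in> Tri C"
    and P: "P \<in> Ob C" "pA \<in> mor C Z' P" "pB \<in> mor C Z P" "n0 \<in> mor C P (Shift C 1 X)" "g0 \<in> mor C P X'"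
    and z: "Comp C pA j \<oplus>\<^bsub>Hom C Y P\<^esub> Comp C pB v = zerom C Y P"
    and r: "Comp C n0 pA = k" "Comp C g0 pB = l" "Comp C i g0 = \<ominus>\<^bsub>Hom C P (Shift C 1 Y)\<^esub> Comp C (ShiftM C 1 u) n0"
    and T4: "(Z', P, X', pA, g0, \<ominus>\<^bsub>Hom C X' (Shift C 1 Z')\<^esub> Comp C (ShiftM C 1 j) i) \<in> Tri C"
    and d: "d \<in> mor C P Y'" "Comp C d pB = m" "Comp C n d = \<ominus>\<^bsub>Hom C P (Shift C 1 X)\<^esub> n0"
    and e: "e \<in> mor C Y' P" "Comp C e d = Idm C P" "Comp C d e = Idm C Y'"
  defines "f \<equiv> Comp C d (\<ominus>\<^bsub>Hom C Z' P\<^esub> pA)" and "g \<equiv> Comp C g0 e"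
  shows "(Z', Y', X', f, g, Comp C (ShiftM C 1 j) i) \<in> Tri C" "Comp C f j = Comp C m v" "Comp C g m = l"
    "Comp C n f = k" "Comp C i g = Comp C (ShiftM C 1 u) n"
proof -
  note t1 = TriD[OF T1] and t2 = TriD[OF T2] and t3 = TriD[OF T3]
  note o = t1(1,2) t2(2) t3(3) t2(3) t1(3) t1(4,5) P(1)
  let ?S = "Shift C 1"
  have Z1: "?S Z' \<in> Ob C" using Shift_closed t1 by blast
  have s: "ShiftM C 1 j \<in> mor C (?S Y) (?S Z')" "ShiftM C 1 u \<in> mor C (?S X) (?S Y)"
    using ShiftM_closed t1 by blast+
  note ji = Comp_mor[OF t3(8) s(1) o(4,8) Z1]
  let ?pA = "\<ominus>\<^bsub>Hom C Z' P\<^esub> pA"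
  have npA: "?pA \<in> mor C Z' P" using P o by simp
  have f: "f \<in> mor C Z' Y'" unfolding f_def by (rule Comp_mor[OF npA d(1) o(6,9,5)])
  have g: "g \<in> mor C Y' X'" unfolding g_def by (rule Comp_mor[OF e(1) P(5) o(5,9,4)])
  have ge: "Comp C g d = g0"
    unfolding g_def Comp_assoc'[OF d(1) e(1) P(5) o(9,5,9,4), symmetric] e(2) Comp_Idm'[OF P(5) o(9,4)] ..
  have iso: "is_isom C P Y' d" unfolding is_isom_def using d e by blast
  have T4': "(Z', P, X', ?pA, g0, Comp C (ShiftM C 1 j) i) \<in> Tri C"
    using Tri_neg_left[OF T4] neg_neg[OF ji o(4) Z1] by simp
  show "(Z', Y', X', f, g, Comp C (ShiftM C 1 j) i) \<in> Tri C"
    by (rule TR1_iso[OF T4' o(6,5,4) f g ji is_isom_Idm[OF o(6)] iso is_isom_Idm[OF o(4)]])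
      (simp_all only: f_def[symmetric] Comp_Idm'[OF f o(6,5)] Idm_Comp'[OF P(5) o(9,4)] ge ShiftM_Idm[OF o(6)]
        Idm_Comp'[OF ji o(4) Z1] Comp_Idm'[OF ji o(4) Z1])
  interpret H: abelian_group "Hom C Y P" by (rule Hom_abelian[OF o(2,9)])
  have pj: "Comp C pA j \<in> mor C Y P" "Comp C pB v \<in> mor C Y P"
    using Comp_mor[OF t1(7) P(2) o(2,6,9)] Comp_mor[OF t3(6) P(3) o(2,3,9)] by simp_all
  have "\<ominus>\<^bsub>Hom C Y P\<^esub> Comp C pA j = Comp C pB v"
    by (rule H.minus_equality) (use pj z H.a_comm in simp_all)
  then have pj': "Comp C ?pA j = Comp C pB v"
    using Comp_neg(2)[OF o(2,6,9) t1(7) P(2)] by simp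
  show "Comp C f j = Comp C m v"
    unfolding f_def Comp_assoc'[OF t1(7) npA d(1) o(2,6,9,5), symmetric] pj' d(2)[symmetric]
      Comp_assoc'[OF t3(6) P(3) d(1) o(2,3,9,5)] ..
  have em: "Comp C e m = pB"
    unfolding d(2)[symmetric] Comp_assoc'[OF P(3) d(1) e(1) o(3,9,5,9)] e(2) Idm_Comp'[OF P(3) o(3,9)] ..
  show "Comp C g m = l"
    unfolding g_def Comp_assoc'[OF t2(7) e(1) P(5) o(3,5,9,4), symmetric] em r(2) ..
  have nn0: "\<ominus>\<^bsub>Hom C P (?S X)\<^esub> n0 \<in> mor C P (?S X)" using P o by simp
  have k: "k \<in> mor C Z' (?S X)" by (rule t1(8))
  have "Comp C n f = Comp C (\<ominus>\<^bsub>Hom C P (?S X)\<^esub> n0) ?pA"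
    unfolding f_def Comp_assoc'[OF npA d(1) t2(8) o(6,9,5,7)] d(3) ..
  also have "\<dots> = k"
    unfolding Comp_neg(2)[OF o(6,9,7) npA P(4)] Comp_neg(1)[OF o(6,9,7) P(2,4)] r(1) neg_neg[OF k o(6,7)] ..
  finally show "Comp C n f = k" .
  have ne: "Comp C (\<ominus>\<^bsub>Hom C P (?S X)\<^esub> n0) e = n"
    unfolding d(3)[symmetric] Comp_assoc'[OF e(1) d(1) t2(8) o(5,9,5,7), symmetric] e(3) Comp_Idm'[OF t2(8) o(5,7)] ..
  have "Comp C i g = Comp C (Comp C i g0) e"
    unfolding g_def by (rule Comp_assoc'[OF e(1) P(5) t3(8) o(5,9,4,8)])
  also have "Comp C i g0 = Comp C (ShiftM C 1 u) (\<ominus>\<^bsub>Hom C P (?S X)\<^esub> n0)"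
    unfolding r(3) Comp_neg(1)[OF o(9,7,8) P(4) s(2)] ..
  also have "Comp C \<dots> e = Comp C (ShiftM C 1 u) n"
    unfolding Comp_assoc'[OF e(1) nn0 s(2) o(5,9,7,8), symmetric] ne ..
  finally show "Comp C i g = Comp C (ShiftM C 1 u) n" .
qed

end

lemma rcong2_iff: "[x = y] (rmod 2) \<longleftrightarrow> (\<exists>n :: int. x - y = 2 * of_int n)"
proof -
  have "[x = y] (rmod 2) \<longleftrightarrow> (\<exists>n :: int. y = x + of_int n * 2)" by (rule rcong_altdef)
  also have "\<dots> \<longleftrightarrow> (\<exists>n :: int. x - y = 2 * of_int n)"
  proof
    assume "\<exists>n :: int. y = x + of_int n * 2"
    then obtain n :: int where "y = x + of_int n * 2" ..
    then have "x - y = 2 * of_int (- n)" by simp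
    then show "\<exists>n :: int. x - y = 2 * of_int n" ..
  next
    assume "\<exists>n :: int. x - y = 2 * of_int n"
    then obtain n :: int where "x - y = 2 * of_int n" ..
    then have "y = x + of_int (- n) * 2" by simp
    then show "\<exists>n :: int. y = x + of_int n * 2" ..
  qed
  finally show ?thesis .
qed

section \<open>The lift as a triangulated category\<close>

text \<open>The projection of all morphisms of \<open>C\<close> between two objects of the lift onto
  those that belong to the lift.\<close>

definition lift_part ::
    "('o, 'm, 'k) tricat \<Rightarrow> (real \<Rightarrow> 'o \<Rightarrow> 'o \<Rightarrow> 'm set) \<Rightarrow> ('o, 'm) lobj \<Rightarrow> ('o, 'm) lobj \<Rightarrow> 'm \<Rightarrow> 'm" where
  "lift_part C G X Y f = of_mat C (fst X) (fst Y)
     (\<lambda>i j. hpart C G (snd Y ! j - snd X ! i) (smd (fst X) i) (smd (fst Y) j) (component C (fst X) (fst Y) f i j))"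

text \<open>The data from which the lift obtains its additive structure and its shift:
  \<open>phi_shift\<close> keeps shifted objects inside \<open>lift_Ob\<close>.\<close>

locale phased_category = graded_category K C \<beta> G
  for K :: "'k ring" and C :: "('o, 'm, 'k) tricat" and \<beta> :: "'o \<Rightarrow> 'm" and G :: "real \<Rightarrow> 'o \<Rightarrow> 'o \<Rightarrow> 'm set" +
  fixes \<phi> :: "'o \<Rightarrow> real"
  assumes phi_shift: "indecomposable C E \<Longrightarrow> [\<phi> (Shift C 1 E) = \<phi> E + 1] (rmod 2)"
begin

abbreviation T where "T \<equiv> lift_category C \<phi> G"

lemma T_sel:
  "Ob T = lift_Ob C \<phi>" "mor T X Y = lift_mor C G X Y" "Idm T X = Idm C (lift_proj X)" "Comp T = Comp C"
  "Shift T = lift_shift C" "ShiftM T = ShiftM C" "zerom T X Y = zerom C (lift_proj X) (lift_proj Y)"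
  "f \<oplus>\<^bsub>Hom T X Y\<^esub> g = f \<oplus>\<^bsub>Hom C (lift_proj X) (lift_proj Y)\<^esub> g"
  "c \<odot>\<^bsub>Hom T X Y\<^esub> f = c \<odot>\<^bsub>Hom C (lift_proj X) (lift_proj Y)\<^esub> f"
  "lift_proj (lift_shift C d X) = Shift C d (lift_proj X)"
  by (simp_all add: lift_category_def lift_proj_def lift_shift_def)

lemma Tri_T: "(X, Y, Z, f, g, h) \<in> Tri T \<longleftrightarrow> X \<in> lift_Ob C \<phi> \<and> Y \<in> lift_Ob C \<phi> \<and> Z \<in> lift_Ob C \<phi> \<and>
   f \<in> lift_mor C G X Y \<and> g \<in> lift_mor C G Y Z \<and> h \<in> lift_mor C G Z (lift_shift C 1 X) \<and>
   (lift_proj X, lift_proj Y, lift_proj Z, f, g, h) \<in> Tri C"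
  by (simp add: lift_category_def)

lemma lift_ObD:
  assumes "X \<in> lift_Ob C \<phi>"
  shows "is_dec C (fst X)" "length (snd X) = nsum (fst X)"
    "i < nsum (fst X) \<Longrightarrow> [snd X ! i = \<phi> (smd (fst X) i)] (rmod 2)" "lift_proj X \<in> Ob C"
    "i < nsum (fst X) \<Longrightarrow> indecomposable C (smd (fst X) i)"
proof -
  have 1: "is_dec C (fst X) \<and> length (snd X) = nsum (fst X) \<and> (\<forall>i < nsum (fst X). [snd X ! i = \<phi> (smd (fst X) i)] (rmod 2))"
    using assms unfolding lift_Ob_def by (cases X) simp
  then show "is_dec C (fst X)" "length (snd X) = nsum (fst X)"
    "i < nsum (fst X) \<Longrightarrow> [snd X ! i = \<phi> (smd (fst X) i)] (rmod 2)" by simp_all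
  show "lift_proj X \<in> Ob C" unfolding lift_proj_def using 1 is_dec_tot by blast
  show "i < nsum (fst X) \<Longrightarrow> indecomposable C (smd (fst X) i)" using 1 is_dec_smd by blast
qed

lemma lift_morI:
  assumes "f \<in> mor C (lift_proj X) (lift_proj Y)"
    "\<And>i j. i < nsum (fst X) \<Longrightarrow> j < nsum (fst Y) \<Longrightarrow>
      component C (fst X) (fst Y) f i j \<in> G (snd Y ! j - snd X ! i) (smd (fst X) i) (smd (fst Y) j)"
  shows "f \<in> lift_mor C G X Y"
  using assms unfolding lift_mor_def by simp

lemma lift_morD:
  assumes "f \<in> lift_mor C G X Y"
  shows "f \<in> mor C (lift_proj X) (lift_proj Y)"
    "i < nsum (fst X) \<Longrightarrow> j < nsum (fst Y) \<Longrightarrow>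
      component C (fst X) (fst Y) f i j \<in> G (snd Y ! j - snd X ! i) (smd (fst X) i) (smd (fst Y) j)"
  using assms unfolding lift_mor_def by simp_all

lemma lift_mor_zero:
  assumes X: "X \<in> lift_Ob C \<phi>" and Y: "Y \<in> lift_Ob C \<phi>"
  shows "zerom C (lift_proj X) (lift_proj Y) \<in> lift_mor C G X Y"
  by (rule lift_morI) (simp_all add: lift_ObD[OF X] lift_ObD[OF Y] G_sub(1)
    component_zero[OF lift_ObD(1)[OF X] lift_ObD(1)[OF Y]] lift_proj_def is_dec_tot[OF lift_ObD(1)[OF X]] is_dec_tot[OF lift_ObD(1)[OF Y]])

lemma lift_mor_add:
  assumes X: "X \<in> lift_Ob C \<phi>" and Y: "Y \<in> lift_Ob C \<phi>" and f: "f \<in> lift_mor C G X Y" "g \<in> lift_mor C G X Y"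
  shows "f \<oplus>\<^bsub>Hom C (lift_proj X) (lift_proj Y)\<^esub> g \<in> lift_mor C G X Y"
proof (rule lift_morI)
  note x = lift_ObD[OF X] and y = lift_ObD[OF Y] and fd = lift_morD[OF f(1)] and gd = lift_morD[OF f(2)]
  show "f \<oplus>\<^bsub>Hom C (lift_proj X) (lift_proj Y)\<^esub> g \<in> mor C (lift_proj X) (lift_proj Y)"
    by (rule add_mor[OF x(4) y(4) fd(1) gd(1)])
  fix i j assume ij: "i < nsum (fst X)" "j < nsum (fst Y)"
  show "component C (fst X) (fst Y) (f \<oplus>\<^bsub>Hom C (lift_proj X) (lift_proj Y)\<^esub> g) i j
      \<in> G (snd Y ! j - snd X ! i) (smd (fst X) i) (smd (fst Y) j)"
    unfolding lift_proj_def component_add[OF x(1) y(1) fd(1)[unfolded lift_proj_def] gd(1)[unfolded lift_proj_def] ij]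
    by (rule G_sub(2)[OF x(5)[OF ij(1)] y(5)[OF ij(2)] fd(2)[OF ij] gd(2)[OF ij]])
qed

lemma lift_mor_smult:
  assumes X: "X \<in> lift_Ob C \<phi>" and Y: "Y \<in> lift_Ob C \<phi>" and f: "f \<in> lift_mor C G X Y" and c: "c \<in> carrier K"
  shows "c \<odot>\<^bsub>Hom C (lift_proj X) (lift_proj Y)\<^esub> f \<in> lift_mor C G X Y"
proof (rule lift_morI)
  note x = lift_ObD[OF X] and y = lift_ObD[OF Y] and fd = lift_morD[OF f]
  show "c \<odot>\<^bsub>Hom C (lift_proj X) (lift_proj Y)\<^esub> f \<in> mor C (lift_proj X) (lift_proj Y)"
    by (rule module.smult_closed[OF Hom_module[OF x(4) y(4)] c fd(1)])
  fix i j assume ij: "i < nsum (fst X)" "j < nsum (fst Y)"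
  show "component C (fst X) (fst Y) (c \<odot>\<^bsub>Hom C (lift_proj X) (lift_proj Y)\<^esub> f) i j
      \<in> G (snd Y ! j - snd X ! i) (smd (fst X) i) (smd (fst Y) j)"
    unfolding lift_proj_def component_smult[OF x(1) y(1) fd(1)[unfolded lift_proj_def] c ij]
    by (rule G_sub(4)[OF x(5)[OF ij(1)] y(5)[OF ij(2)] c fd(2)[OF ij]])
qed

lemma component_neg:
  assumes A: "is_dec C A" and B: "is_dec C B" and f: "f \<in> mor C (tot A) (tot B)" and ij: "i < nsum A" "j < nsum B"
  shows "component C A B (\<ominus>\<^bsub>Hom C (tot A) (tot B)\<^esub> f) i j = \<ominus>\<^bsub>Hom C (smd A i) (smd B j)\<^esub> component C A B f i j"
proof -
  note t = is_dec_simps[OF A] is_dec_simps[OF B]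
  note o = t(1) t(6) t(3)[OF ij(1)] t(8)[OF ij(2)]
  show ?thesis unfolding component_def
    unfolding Comp_neg(1)[OF o(1,2,4) f t(10)[OF ij(2)]]
      Comp_neg(2)[OF o(3,1,4) t(4)[OF ij(1)] Comp_mor[OF f t(10)[OF ij(2)] o(1,2,4)]] ..
qed

lemma lift_mor_neg:
  assumes X: "X \<in> lift_Ob C \<phi>" and Y: "Y \<in> lift_Ob C \<phi>" and f: "f \<in> lift_mor C G X Y"
  shows "\<ominus>\<^bsub>Hom C (lift_proj X) (lift_proj Y)\<^esub> f \<in> lift_mor C G X Y"
proof (rule lift_morI)
  note x = lift_ObD[OF X] and y = lift_ObD[OF Y] and fd = lift_morD[OF f]
  show "\<ominus>\<^bsub>Hom C (lift_proj X) (lift_proj Y)\<^esub> f \<in> mor C (lift_proj X) (lift_proj Y)"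
    by (rule neg_mor[OF x(4) y(4) fd(1)])
  fix i j assume ij: "i < nsum (fst X)" "j < nsum (fst Y)"
  show "component C (fst X) (fst Y) (\<ominus>\<^bsub>Hom C (lift_proj X) (lift_proj Y)\<^esub> f) i j
      \<in> G (snd Y ! j - snd X ! i) (smd (fst X) i) (smd (fst Y) j)"
    unfolding lift_proj_def component_neg[OF x(1) y(1) fd(1)[unfolded lift_proj_def] ij]
    by (rule G_sub(3)[OF x(5)[OF ij(1)] y(5)[OF ij(2)] fd(2)[OF ij]])
qed

lemma lift_mor_Idm:
  assumes X: "X \<in> lift_Ob C \<phi>"
  shows "Idm C (lift_proj X) \<in> lift_mor C G X X"
proof (rule lift_morI)
  note x = lift_ObD[OF X]
  show "Idm C (lift_proj X) \<in> mor C (lift_proj X) (lift_proj X)" by (rule Idm_closed[OF x(4)])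
  fix i j assume ij: "i < nsum (fst X)" "j < nsum (fst X)"
  show "component C (fst X) (fst X) (Idm C (lift_proj X)) i j
      \<in> G (snd X ! j - snd X ! i) (smd (fst X) i) (smd (fst X) j)"
    unfolding lift_proj_def component_Idm[OF x(1) ij]
    using G_Idm[OF x(5)[OF ij(1)]] G_sub(1)[OF x(5)[OF ij(1)] x(5)[OF ij(2)]] by (cases "i = j") simp_all
qed

lemma lift_mor_Comp:
  assumes X: "X \<in> lift_Ob C \<phi>" and Y: "Y \<in> lift_Ob C \<phi>" and Z: "Z \<in> lift_Ob C \<phi>"
    and f: "f \<in> lift_mor C G X Y" and g: "g \<in> lift_mor C G Y Z"
  shows "Comp C g f \<in> lift_mor C G X Z"
proof (rule lift_morI)
  note x = lift_ObD[OF X] and y = lift_ObD[OF Y] and z = lift_ObD[OF Z] and fd = lift_morD[OF f] and gd = lift_morD[OF g]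
  show "Comp C g f \<in> mor C (lift_proj X) (lift_proj Z)" by (rule Comp_mor[OF fd(1) gd(1) x(4) y(4) z(4)])
  fix i l assume il: "i < nsum (fst X)" "l < nsum (fst Z)"
  show "component C (fst X) (fst Z) (Comp C g f) i l \<in> G (snd Z ! l - snd X ! i) (smd (fst X) i) (smd (fst Z) l)"
    unfolding component_Comp[OF x(1) y(1) z(1) fd(1)[unfolded lift_proj_def] gd(1)[unfolded lift_proj_def] il]
  proof (rule G_finsum[OF x(5)[OF il(1)] z(5)[OF il(2)]])
    fix j assume "j \<in> {..<nsum (fst Y)}"
    then have j: "j < nsum (fst Y)" by simp
    show "Comp C (component C (fst Y) (fst Z) g j l) (component C (fst X) (fst Y) f i j)
        \<in> G (snd Z ! l - snd X ! i) (smd (fst X) i) (smd (fst Z) l)"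
      using G_Comp[OF x(5)[OF il(1)] y(5)[OF j] z(5)[OF il(2)] fd(2)[OF il(1) j] gd(2)[OF j il(2)]] by simp
  qed simp
qed

lemma lift_part_mor:
  assumes X: "X \<in> lift_Ob C \<phi>" and Y: "Y \<in> lift_Ob C \<phi>" and f: "f \<in> mor C (lift_proj X) (lift_proj Y)"
  shows "lift_part C G X Y f \<in> lift_mor C G X Y"
    "i < nsum (fst X) \<Longrightarrow> j < nsum (fst Y) \<Longrightarrow> component C (fst X) (fst Y) (lift_part C G X Y f) i j =
      hpart C G (snd Y ! j - snd X ! i) (smd (fst X) i) (smd (fst Y) j) (component C (fst X) (fst Y) f i j)"
proof -
  note x = lift_ObD[OF X] and y = lift_ObD[OF Y]
  have m: "hpart C G (snd Y ! j - snd X ! i) (smd (fst X) i) (smd (fst Y) j) (component C (fst X) (fst Y) f i j)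
      \<in> mor C (smd (fst X) i) (smd (fst Y) j)" if ij: "i < nsum (fst X)" "j < nsum (fst Y)" for i j
    by (rule hpart_mor[OF x(5)[OF ij(1)] y(5)[OF ij(2)] component_mor[OF x(1) y(1) f[unfolded lift_proj_def] ij]])
  have c: "component C (fst X) (fst Y) (lift_part C G X Y f) i j =
      hpart C G (snd Y ! j - snd X ! i) (smd (fst X) i) (smd (fst Y) j) (component C (fst X) (fst Y) f i j)"
    if ij: "i < nsum (fst X)" "j < nsum (fst Y)" for i j
    unfolding lift_part_def by (rule component_of_mat[OF x(1) y(1) m ij])
  show "lift_part C G X Y f \<in> lift_mor C G X Y"
  proof (rule lift_morI)
    show "lift_part C G X Y f \<in> mor C (lift_proj X) (lift_proj Y)"
      unfolding lift_part_def lift_proj_def by (rule of_mat_mor[OF x(1) y(1) m])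
    fix i j assume ij: "i < nsum (fst X)" "j < nsum (fst Y)"
    show "component C (fst X) (fst Y) (lift_part C G X Y f) i j \<in> G (snd Y ! j - snd X ! i) (smd (fst X) i) (smd (fst Y) j)"
      unfolding c[OF ij]
      by (rule hpart_decomp(1)[OF x(5)[OF ij(1)] y(5)[OF ij(2)] component_mor[OF x(1) y(1) f[unfolded lift_proj_def] ij]])
  qed
  show "i < nsum (fst X) \<Longrightarrow> j < nsum (fst Y) \<Longrightarrow> component C (fst X) (fst Y) (lift_part C G X Y f) i j =
      hpart C G (snd Y ! j - snd X ! i) (smd (fst X) i) (smd (fst Y) j) (component C (fst X) (fst Y) f i j)"
    by (rule c)
qed

lemma lift_mor_ext:
  assumes X: "X \<in> lift_Ob C \<phi>" and Y: "Y \<in> lift_Ob C \<phi>"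
    and f: "f \<in> mor C (lift_proj X) (lift_proj Y)" "g \<in> mor C (lift_proj X) (lift_proj Y)"
    and "\<And>i j. i < nsum (fst X) \<Longrightarrow> j < nsum (fst Y) \<Longrightarrow> component C (fst X) (fst Y) f i j = component C (fst X) (fst Y) g i j"
  shows "f = g"
  by (rule mor_ext[OF lift_ObD(1)[OF X] lift_ObD(1)[OF Y] f[unfolded lift_proj_def]]) (rule assms)

lemma lift_part_id:
  assumes X: "X \<in> lift_Ob C \<phi>" and Y: "Y \<in> lift_Ob C \<phi>" and f: "f \<in> lift_mor C G X Y"
  shows "lift_part C G X Y f = f"
proof -
  note x = lift_ObD[OF X] and y = lift_ObD[OF Y] and fd = lift_morD[OF f]
  show ?thesis
  proof (rule lift_mor_ext[OF X Y lift_morD(1)[OF lift_part_mor(1)[OF X Y fd(1)]] fd(1)])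
    fix i j assume ij: "i < nsum (fst X)" "j < nsum (fst Y)"
    show "component C (fst X) (fst Y) (lift_part C G X Y f) i j = component C (fst X) (fst Y) f i j"
      unfolding lift_part_mor(2)[OF X Y fd(1) ij]
      by (simp add: hpart_homogeneous[OF x(5)[OF ij(1)] y(5)[OF ij(2)] fd(2)[OF ij]])
  qed
qed

text \<open>The degree from summand \<open>i\<close> to summand \<open>l\<close> is the sum of the
  degrees from \<open>i\<close> to \<open>j\<close> and from \<open>j\<close> to \<open>l\<close>
  for every intermediate \<open>j\<close>, so \<open>hpart_Comp_left\<close> applies to each term of
  the matrix product.\<close>

lemma lift_part_Comp_left:
  assumes X: "X \<in> lift_Ob C \<phi>" and Y: "Y \<in> lift_Ob C \<phi>" and Z: "Z \<in> lift_Ob C \<phi>"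
    and f: "f \<in> mor C (lift_proj X) (lift_proj Y)" and g: "g \<in> lift_mor C G Y Z"
  shows "lift_part C G X Z (Comp C g f) = Comp C g (lift_part C G X Y f)"
proof -
  note x = lift_ObD[OF X] and y = lift_ObD[OF Y] and z = lift_ObD[OF Z] and gd = lift_morD[OF g]
  have gf: "Comp C g f \<in> mor C (lift_proj X) (lift_proj Z)" by (rule Comp_mor[OF f gd(1) x(4) y(4) z(4)])
  note pf = lift_part_mor(1)[OF X Y f]
  note pfm = lift_morD(1)[OF pf]
  show ?thesis
  proof (rule lift_mor_ext[OF X Z lift_morD(1)[OF lift_part_mor(1)[OF X Z gf]] Comp_mor[OF pfm gd(1) x(4) y(4) z(4)]])
    fix i l assume il: "i < nsum (fst X)" "l < nsum (fst Z)"
    note xi = x(5)[OF il(1)] and zl = z(5)[OF il(2)]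
    let ?c = "\<lambda>j. component C (fst X) (fst Y) f i j" and ?d = "\<lambda>j. component C (fst Y) (fst Z) g j l"
    note cm = component_mor[OF x(1) y(1) f[unfolded lift_proj_def] il(1)]
      and dm = component_mor[OF y(1) z(1) gd(1)[unfolded lift_proj_def] _ il(2)]
    note ob = is_dec_smd_Ob[OF x(1) il(1)] is_dec_smd_Ob[OF y(1)] is_dec_smd_Ob[OF z(1) il(2)]
    have cdm: "Comp C (?d j) (?c j) \<in> mor C (smd (fst X) i) (smd (fst Z) l)" if "j < nsum (fst Y)" for j
      by (rule Comp_mor[OF cm[OF that] dm[OF that] ob(1) ob(2)[OF that] ob(3)])
    have "component C (fst X) (fst Z) (lift_part C G X Z (Comp C g f)) i l =
      hpart C G (snd Z ! l - snd X ! i) (smd (fst X) i) (smd (fst Z) l)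
        (finsum (Hom C (smd (fst X) i) (smd (fst Z) l)) (\<lambda>j. Comp C (?d j) (?c j)) {..<nsum (fst Y)})"
      unfolding lift_part_mor(2)[OF X Z gf il]
        component_Comp[OF x(1) y(1) z(1) f[unfolded lift_proj_def] gd(1)[unfolded lift_proj_def] il] ..
    also have "\<dots> = finsum (Hom C (smd (fst X) i) (smd (fst Z) l))
        (\<lambda>j. hpart C G (snd Z ! l - snd X ! i) (smd (fst X) i) (smd (fst Z) l) (Comp C (?d j) (?c j))) {..<nsum (fst Y)}"
      by (rule hpart_finsum[OF xi zl]) (simp_all add: cdm)
    also have "\<dots> = finsum (Hom C (smd (fst X) i) (smd (fst Z) l))
        (\<lambda>j. Comp C (?d j) (component C (fst X) (fst Y) (lift_part C G X Y f) i j)) {..<nsum (fst Y)}"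
    proof (rule finsum_mor_cong[OF ob(1) ob(3) refl])
      fix j assume "j \<in> {..<nsum (fst Y)}"
      then have j: "j < nsum (fst Y)" by simp
      show "hpart C G (snd Z ! l - snd X ! i) (smd (fst X) i) (smd (fst Z) l) (Comp C (?d j) (?c j)) =
          Comp C (?d j) (component C (fst X) (fst Y) (lift_part C G X Y f) i j)"
        unfolding lift_part_mor(2)[OF X Y f il(1) j]
        using hpart_Comp_left[OF xi y(5)[OF j] zl cm[OF j] gd(2)[OF j il(2)], of "snd Y ! j - snd X ! i"] by simp
      show "Comp C (?d j) (component C (fst X) (fst Y) (lift_part C G X Y f) i j) \<in> mor C (smd (fst X) i) (smd (fst Z) l)"
        by (rule Comp_mor[OF component_mor[OF x(1) y(1) pfm[unfolded lift_proj_def] il(1) j] dm[OF j] ob(1) ob(2)[OF j] ob(3)])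
    qed
    also have "\<dots> = component C (fst X) (fst Z) (Comp C g (lift_part C G X Y f)) i l"
      by (rule component_Comp[OF x(1) y(1) z(1) pfm[unfolded lift_proj_def] gd(1)[unfolded lift_proj_def] il, symmetric])
    finally show "component C (fst X) (fst Z) (lift_part C G X Z (Comp C g f)) i l =
        component C (fst X) (fst Z) (Comp C g (lift_part C G X Y f)) i l" .
  qed
qed

lemma lift_part_Comp_right:
  assumes X: "X \<in> lift_Ob C \<phi>" and Y: "Y \<in> lift_Ob C \<phi>" and Z: "Z \<in> lift_Ob C \<phi>"
    and f: "f \<in> lift_mor C G X Y" and g: "g \<in> mor C (lift_proj Y) (lift_proj Z)"
  shows "lift_part C G X Z (Comp C g f) = Comp C (lift_part C G Y Z g) f"
proof -
  note x = lift_ObD[OF X] and y = lift_ObD[OF Y] and z = lift_ObD[OF Z] and fd = lift_morD[OF f]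
  have gf: "Comp C g f \<in> mor C (lift_proj X) (lift_proj Z)" by (rule Comp_mor[OF fd(1) g x(4) y(4) z(4)])
  note pg = lift_part_mor(1)[OF Y Z g]
  note pgm = lift_morD(1)[OF pg]
  show ?thesis
  proof (rule lift_mor_ext[OF X Z lift_morD(1)[OF lift_part_mor(1)[OF X Z gf]] Comp_mor[OF fd(1) pgm x(4) y(4) z(4)]])
    fix i l assume il: "i < nsum (fst X)" "l < nsum (fst Z)"
    note xi = x(5)[OF il(1)] and zl = z(5)[OF il(2)]
    let ?c = "\<lambda>j. component C (fst X) (fst Y) f i j" and ?d = "\<lambda>j. component C (fst Y) (fst Z) g j l"
    note cm = component_mor[OF x(1) y(1) fd(1)[unfolded lift_proj_def] il(1)]
      and dm = component_mor[OF y(1) z(1) g[unfolded lift_proj_def] _ il(2)]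
    note ob = is_dec_smd_Ob[OF x(1) il(1)] is_dec_smd_Ob[OF y(1)] is_dec_smd_Ob[OF z(1) il(2)]
    have cdm: "Comp C (?d j) (?c j) \<in> mor C (smd (fst X) i) (smd (fst Z) l)" if "j < nsum (fst Y)" for j
      by (rule Comp_mor[OF cm[OF that] dm[OF that] ob(1) ob(2)[OF that] ob(3)])
    have "component C (fst X) (fst Z) (lift_part C G X Z (Comp C g f)) i l =
      hpart C G (snd Z ! l - snd X ! i) (smd (fst X) i) (smd (fst Z) l)
        (finsum (Hom C (smd (fst X) i) (smd (fst Z) l)) (\<lambda>j. Comp C (?d j) (?c j)) {..<nsum (fst Y)})"
      unfolding lift_part_mor(2)[OF X Z gf il]
        component_Comp[OF x(1) y(1) z(1) fd(1)[unfolded lift_proj_def] g[unfolded lift_proj_def] il] ..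
    also have "\<dots> = finsum (Hom C (smd (fst X) i) (smd (fst Z) l))
        (\<lambda>j. hpart C G (snd Z ! l - snd X ! i) (smd (fst X) i) (smd (fst Z) l) (Comp C (?d j) (?c j))) {..<nsum (fst Y)}"
      by (rule hpart_finsum[OF xi zl]) (simp_all add: cdm)
    also have "\<dots> = finsum (Hom C (smd (fst X) i) (smd (fst Z) l))
        (\<lambda>j. Comp C (component C (fst Y) (fst Z) (lift_part C G Y Z g) j l) (?c j)) {..<nsum (fst Y)}"
    proof (rule finsum_mor_cong[OF ob(1) ob(3) refl])
      fix j assume "j \<in> {..<nsum (fst Y)}"
      then have j: "j < nsum (fst Y)" by simp
      show "hpart C G (snd Z ! l - snd X ! i) (smd (fst X) i) (smd (fst Z) l) (Comp C (?d j) (?c j)) =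
          Comp C (component C (fst Y) (fst Z) (lift_part C G Y Z g) j l) (?c j)"
        unfolding lift_part_mor(2)[OF Y Z g j il(2)]
        using hpart_Comp_right[OF xi y(5)[OF j] zl fd(2)[OF il(1) j] dm[OF j], of "snd Z ! l - snd Y ! j"] by simp
      show "Comp C (component C (fst Y) (fst Z) (lift_part C G Y Z g) j l) (?c j) \<in> mor C (smd (fst X) i) (smd (fst Z) l)"
        by (rule Comp_mor[OF cm[OF j] component_mor[OF y(1) z(1) pgm[unfolded lift_proj_def] j il(2)] ob(1) ob(2)[OF j] ob(3)])
    qed
    also have "\<dots> = component C (fst X) (fst Z) (Comp C (lift_part C G Y Z g) f) i l"
      by (rule component_Comp[OF x(1) y(1) z(1) fd(1)[unfolded lift_proj_def] pgm[unfolded lift_proj_def] il, symmetric])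
    finally show "component C (fst X) (fst Z) (lift_part C G X Z (Comp C g f)) i l =
        component C (fst X) (fst Z) (Comp C (lift_part C G Y Z g) f) i l" .
  qed
qed

text \<open>The equations of an inverse are linear in it and their right-hand sides lie in the lift,
  so the degree \<open>0\<close> part of an inverse satisfies them too.\<close>

lemma lift_inverse:
  assumes X: "X \<in> lift_Ob C \<phi>" and Y: "Y \<in> lift_Ob C \<phi>" and f: "f \<in> lift_mor C G X Y"
    and iso: "is_isom C (lift_proj X) (lift_proj Y) f"
  shows "\<exists>g \<in> lift_mor C G Y X. Comp C g f = Idm C (lift_proj X) \<and> Comp C f g = Idm C (lift_proj Y)"
proof -
  obtain g where g: "is_isom C (lift_proj Y) (lift_proj X) g" "Comp C g f = Idm C (lift_proj X)" "Comp C f g = Idm C (lift_proj Y)"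
    using is_isom_inverse[OF iso] by blast
  note gm = is_isom_mor[OF g(1)]
  have "Comp C (lift_part C G Y X g) f = Idm C (lift_proj X)"
    unfolding lift_part_Comp_right[OF X Y X f gm, symmetric] g(2) by (rule lift_part_id[OF X X lift_mor_Idm[OF X]])
  moreover have "Comp C f (lift_part C G Y X g) = Idm C (lift_proj Y)"
    unfolding lift_part_Comp_left[OF Y X Y gm f, symmetric] g(3) by (rule lift_part_id[OF Y Y lift_mor_Idm[OF Y]])
  ultimately show ?thesis using lift_part_mor(1)[OF Y X gm] by blast
qed

lemma lift_mor_submodule:
  assumes X: "X \<in> lift_Ob C \<phi>" and Y: "Y \<in> lift_Ob C \<phi>"
  shows "Module.submodule (lift_mor C G X Y) K (Hom C (lift_proj X) (lift_proj Y))"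
proof (rule module.submoduleI[OF Hom_module[OF lift_ObD(4)[OF X] lift_ObD(4)[OF Y]]])
  show "lift_mor C G X Y \<subseteq> mor C (lift_proj X) (lift_proj Y)" using lift_morD(1) by blast
qed (simp_all add: lift_mor_zero[OF X Y] lift_mor_neg[OF X Y] lift_mor_add[OF X Y] lift_mor_smult[OF X Y])

section \<open>The lift as an additive category with shift\<close>

lemma T_linear: "linear_category K T"
proof (rule linear_category.intro; (simp only: T_sel)?)
  show "Ring.field K" by (rule field_K)
next
  fix X Y assume XY: "X \<in> lift_Ob C \<phi>" "Y \<in> lift_Ob C \<phi>"
  show "Module.module K (Hom T X Y)"
    using submodule.submodule_is_module[OF lift_mor_submodule[OF XY] Hom_module[OF lift_ObD(4)[OF XY(1)] lift_ObD(4)[OF XY(2)]]]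
    by (simp add: lift_category_def)
next
  fix X assume "X \<in> lift_Ob C \<phi>"
  then show "Idm C (lift_proj X) \<in> lift_mor C G X X" by (rule lift_mor_Idm)
next
  fix X Y Z f g assume "X \<in> lift_Ob C \<phi>" "Y \<in> lift_Ob C \<phi>" "Z \<in> lift_Ob C \<phi>" "f \<in> lift_mor C G X Y" "g \<in> lift_mor C G Y Z"
  then show "Comp C g f \<in> lift_mor C G X Z" by (rule lift_mor_Comp)
next
  fix W X Y Z f g h assume a: "W \<in> lift_Ob C \<phi>" "X \<in> lift_Ob C \<phi>" "Y \<in> lift_Ob C \<phi>" "Z \<in> lift_Ob C \<phi>"
    "f \<in> lift_mor C G W X" "g \<in> lift_mor C G X Y" "h \<in> lift_mor C G Y Z"
  show "Comp C h (Comp C g f) = Comp C (Comp C h g) f"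
    by (rule Comp_assoc'[OF a(5-7)[THEN lift_morD(1)] a(1-4)[THEN lift_ObD(4)]])
next
  fix X Y f assume a: "X \<in> lift_Ob C \<phi>" "Y \<in> lift_Ob C \<phi>" "f \<in> lift_mor C G X Y"
  show "Comp C f (Idm C (lift_proj X)) = f" "Comp C (Idm C (lift_proj Y)) f = f"
    by (rule Comp_Idm'[OF a(3)[THEN lift_morD(1)] a(1,2)[THEN lift_ObD(4)]] Idm_Comp'[OF a(3)[THEN lift_morD(1)] a(1,2)[THEN lift_ObD(4)]])+
next
  fix X Y Z f f' g assume a: "X \<in> lift_Ob C \<phi>" "Y \<in> lift_Ob C \<phi>" "Z \<in> lift_Ob C \<phi>"
    "f \<in> lift_mor C G X Y" "f' \<in> lift_mor C G X Y" "g \<in> lift_mor C G Y Z"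
  show "Comp C g (f \<oplus>\<^bsub>Hom C (lift_proj X) (lift_proj Y)\<^esub> f') =
      Comp C g f \<oplus>\<^bsub>Hom C (lift_proj X) (lift_proj Z)\<^esub> Comp C g f'"
    by (rule Comp_add_right[OF a(1-3)[THEN lift_ObD(4)] a(4-6)[THEN lift_morD(1)]])
next
  fix X Y Z f g g' assume a: "X \<in> lift_Ob C \<phi>" "Y \<in> lift_Ob C \<phi>" "Z \<in> lift_Ob C \<phi>"
    "f \<in> lift_mor C G X Y" "g \<in> lift_mor C G Y Z" "g' \<in> lift_mor C G Y Z"
  show "Comp C (g \<oplus>\<^bsub>Hom C (lift_proj Y) (lift_proj Z)\<^esub> g') f =
      Comp C g f \<oplus>\<^bsub>Hom C (lift_proj X) (lift_proj Z)\<^esub> Comp C g' f"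
    by (rule Comp_add_left[OF a(1-3)[THEN lift_ObD(4)] a(4-6)[THEN lift_morD(1)]])
next
  fix X Y Z c f g assume a: "X \<in> lift_Ob C \<phi>" "Y \<in> lift_Ob C \<phi>" "Z \<in> lift_Ob C \<phi>" "c \<in> carrier K"
    "f \<in> lift_mor C G X Y" "g \<in> lift_mor C G Y Z"
  show "Comp C g (c \<odot>\<^bsub>Hom C (lift_proj X) (lift_proj Y)\<^esub> f) = c \<odot>\<^bsub>Hom C (lift_proj X) (lift_proj Z)\<^esub> Comp C g f"
    "Comp C (c \<odot>\<^bsub>Hom C (lift_proj Y) (lift_proj Z)\<^esub> g) f = c \<odot>\<^bsub>Hom C (lift_proj X) (lift_proj Z)\<^esub> Comp C g f"
    by (rule Comp_smult_right[OF a(1-3)[THEN lift_ObD(4)] a(4) a(5,6)[THEN lift_morD(1)]]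
      Comp_smult_left[OF a(1-3)[THEN lift_ObD(4)] a(4) a(5,6)[THEN lift_morD(1)]])+
qed

lemma T_is_isom: "is_isom T X Y f \<Longrightarrow> is_isom C (lift_proj X) (lift_proj Y) f"
  unfolding is_isom_def T_sel using lift_morD(1) by blast

lemma T_zero_obj:
  assumes "zero_obj T N" shows "zero_obj C (lift_proj N)" "N \<in> lift_Ob C \<phi>"
proof -
  interpret T: linear_category K T by (rule T_linear)
  show N: "N \<in> lift_Ob C \<phi>" using assms unfolding zero_obj_def T_sel by simp
  have "Idm C (lift_proj N) = zerom C (lift_proj N) (lift_proj N)"
    using T.zero_obj_iff[of N] N assms unfolding T_sel by simp
  then show "zero_obj C (lift_proj N)" using zero_obj_iff[OF lift_ObD(4)[OF N]] by simp
qed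

lemma T_zero_objI:
  assumes N: "N \<in> lift_Ob C \<phi>" and z: "zero_obj C (lift_proj N)" shows "zero_obj T N"
proof -
  interpret T: linear_category K T by (rule T_linear)
  show ?thesis using T.zero_obj_iff[of N] N z zero_obj_iff[OF lift_ObD(4)[OF N]] unfolding T_sel by simp
qed

lemma T_biproduct_D: "biproduct T A B X i1 i2 p1 p2 \<Longrightarrow> biproduct C (lift_proj A) (lift_proj B) (lift_proj X) i1 i2 p1 p2"
  unfolding biproduct_def T_sel using lift_morD(1) lift_ObD(4) by blast

text \<open>The identities among the entries have the required degree \<open>0\<close>, because the
  phases agree along \<open>s\<close> and \<open>s'\<close>. The matrices are returned explicitly,
  so that \<open>T_split\<close> can read off their components.\<close>

lemma T_block_biproduct:
  assumes A: "A \<in> lift_Ob C \<phi>" and A': "A' \<in> lift_Ob C \<phi>" and B: "B \<in> lift_Ob C \<phi>"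
    and s: "\<And>i. i < nsum (fst A) \<Longrightarrow> s i < nsum (fst B) \<and> smd (fst B) (s i) = smd (fst A) i \<and> snd B ! (s i) = snd A ! i"
    and s': "\<And>i. i < nsum (fst A') \<Longrightarrow> s' i < nsum (fst B) \<and> smd (fst B) (s' i) = smd (fst A') i \<and> snd B ! (s' i) = snd A' ! i"
    and inj: "inj_on s {..<nsum (fst A)}" "inj_on s' {..<nsum (fst A')}"
    and cover: "s ` {..<nsum (fst A)} \<inter> s' ` {..<nsum (fst A')} = {}" "s ` {..<nsum (fst A)} \<union> s' ` {..<nsum (fst A')} = {..<nsum (fst B)}"
  shows "\<exists>i1 i2 p1 p2. biproduct T A A' B i1 i2 p1 p2 \<and>
    i1 = of_mat C (fst A) (fst B) (\<lambda>i j. if j = s i then Idm C (smd (fst A) i) else zerom C (smd (fst A) i) (smd (fst B) j)) \<and>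
    p1 = of_mat C (fst B) (fst A) (\<lambda>j i. if j = s i then Idm C (smd (fst A) i) else zerom C (smd (fst B) j) (smd (fst A) i)) \<and>
    i2 = of_mat C (fst A') (fst B) (\<lambda>i j. if j = s' i then Idm C (smd (fst A') i) else zerom C (smd (fst A') i) (smd (fst B) j)) \<and>
    p2 = of_mat C (fst B) (fst A') (\<lambda>j i. if j = s' i then Idm C (smd (fst A') i) else zerom C (smd (fst B) j) (smd (fst A') i))"
proof -
  note a = lift_ObD[OF A] and a' = lift_ObD[OF A'] and b = lift_ObD[OF B]
  let ?M = "\<lambda>A (s :: nat \<Rightarrow> nat) i j. if j = s i then Idm C (smd A i) else zerom C (smd A i) (smd (fst B) j)"
  let ?N = "\<lambda>A (s :: nat \<Rightarrow> nat) j i. if j = s i then Idm C (smd A i) else zerom C (smd (fst B) j) (smd A i)"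
  have bp: "biproduct C (tot (fst A)) (tot (fst A')) (tot (fst B)) (of_mat C (fst A) (fst B) (?M (fst A) s))
     (of_mat C (fst A') (fst B) (?M (fst A') s')) (of_mat C (fst B) (fst A) (?N (fst A) s)) (of_mat C (fst B) (fst A') (?N (fst A') s'))"
    by (rule block_biproduct[OF a(1) a'(1) b(1) _ _ inj cover]) (simp_all add: s s')
  have M: "of_mat C (fst X) (fst B) (?M (fst X) r) \<in> lift_mor C G X B"
    and N: "of_mat C (fst B) (fst X) (?N (fst X) r) \<in> lift_mor C G B X"
    if X: "X \<in> lift_Ob C \<phi>" and r: "\<And>i. i < nsum (fst X) \<Longrightarrow> r i < nsum (fst B) \<and> smd (fst B) (r i) = smd (fst X) i \<and> snd B ! (r i) = snd X ! i"
    for X r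
  proof -
    note x = lift_ObD[OF X]
    have g: "?M (fst X) r i j \<in> G (snd B ! j - snd X ! i) (smd (fst X) i) (smd (fst B) j)"
      "?N (fst X) r j i \<in> G (snd X ! i - snd B ! j) (smd (fst B) j) (smd (fst X) i)"
      if ij: "i < nsum (fst X)" "j < nsum (fst B)" for i j
      using r[OF ij(1)] G_Idm[OF x(5)[OF ij(1)]] G_sub(1)[OF x(5)[OF ij(1)] b(5)[OF ij(2)]] G_sub(1)[OF b(5)[OF ij(2)] x(5)[OF ij(1)]]
      by (cases "j = r i"; simp)+
    have m: "?M (fst X) r i j \<in> mor C (smd (fst X) i) (smd (fst B) j)" "?N (fst X) r j i \<in> mor C (smd (fst B) j) (smd (fst X) i)"
      if ij: "i < nsum (fst X)" "j < nsum (fst B)" for i j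
      using G_mor[OF g(1)[OF ij] x(5)[OF ij(1)] b(5)[OF ij(2)]] G_mor[OF g(2)[OF ij] b(5)[OF ij(2)] x(5)[OF ij(1)]] by simp_all
    show "of_mat C (fst X) (fst B) (?M (fst X) r) \<in> lift_mor C G X B"
    proof (rule lift_morI)
      show "of_mat C (fst X) (fst B) (?M (fst X) r) \<in> mor C (lift_proj X) (lift_proj B)"
        unfolding lift_proj_def by (rule of_mat_mor[OF x(1) b(1) m(1)])
      fix i j assume ij: "i < nsum (fst X)" "j < nsum (fst B)"
      show "component C (fst X) (fst B) (of_mat C (fst X) (fst B) (?M (fst X) r)) i j \<in> G (snd B ! j - snd X ! i) (smd (fst X) i) (smd (fst B) j)"
      proof -
        have "component C (fst X) (fst B) (of_mat C (fst X) (fst B) (?M (fst X) r)) i j = ?M (fst X) r i j"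
          by (rule component_of_mat[OF x(1) b(1) _ ij]) (rule m(1))
        then show ?thesis using g(1)[OF ij] by (simp only:)
      qed
    qed
    show "of_mat C (fst B) (fst X) (?N (fst X) r) \<in> lift_mor C G B X"
    proof (rule lift_morI)
      show "of_mat C (fst B) (fst X) (?N (fst X) r) \<in> mor C (lift_proj B) (lift_proj X)"
        unfolding lift_proj_def by (rule of_mat_mor[OF b(1) x(1) m(2)])
      fix j i assume ij: "j < nsum (fst B)" "i < nsum (fst X)"
      show "component C (fst B) (fst X) (of_mat C (fst B) (fst X) (?N (fst X) r)) j i \<in> G (snd X ! i - snd B ! j) (smd (fst B) j) (smd (fst X) i)"
      proof -
        have "component C (fst B) (fst X) (of_mat C (fst B) (fst X) (?N (fst X) r)) j i = ?N (fst X) r j i"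
          by (rule component_of_mat[OF b(1) x(1) _ ij]) (rule m(2))
        then show ?thesis using g(2)[OF ij(2,1)] by (simp only:)
      qed
    qed
  qed
  have "biproduct T A A' B (of_mat C (fst A) (fst B) (?M (fst A) s))
     (of_mat C (fst A') (fst B) (?M (fst A') s')) (of_mat C (fst B) (fst A) (?N (fst A) s)) (of_mat C (fst B) (fst A') (?N (fst A') s'))"
    unfolding biproduct_def T_sel using biproductD(8-12)[OF bp] M[OF A s] N[OF A s] M[OF A' s'] N[OF A' s'] A A' B
    by (simp add: lift_proj_def)
  then show ?thesis by (intro exI conjI) (rule refl | assumption)+
qed

text \<open>The summands and phases of \<open>B\<close> are recorded as concatenations; this is what
  shows later that a sum of semistable objects of one phase is semistable.\<close>

lemma T_direct_sum:
  assumes A: "A \<in> lift_Ob C \<phi>" and A': "A' \<in> lift_Ob C \<phi>"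
  shows "\<exists>B i1 i2 p1 p2. biproduct T A A' B i1 i2 p1 p2 \<and> map fst (snd (fst B)) = map fst (snd (fst A)) @ map fst (snd (fst A')) \<and>
    snd B = snd A @ snd A'"
proof -
  note a = lift_ObD[OF A] and a' = lift_ObD[OF A']
  let ?L = "map fst (snd (fst A)) @ map fst (snd (fst A'))"
  have nth: "map fst (snd D) ! i = smd D i" if "i < nsum D" for i and D :: "('o, 'm) dec"
    using that by (simp add: smd_def)
  have ind: "indecomposable C E" if E: "E \<in> set (map fst (snd X))" and X: "is_dec C X" for E and X :: "('o, 'm) dec"
  proof -
    obtain i where "i < length (map fst (snd X))" "map fst (snd X) ! i = E" using E by (meson in_set_conv_nth)
    then show ?thesis using nth[of i X] is_dec_smd[OF X, of i] by simp
  qed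
  have "indecomposable C E" if "E \<in> set ?L" for E
    using that ind[OF _ a(1)] ind[OF _ a'(1)] unfolding set_append by blast
  then obtain D where D: "is_dec C D" "map fst (snd D) = ?L" using ex_dec_of_list[of ?L] by blast
  have n: "nsum D = nsum (fst A) + nsum (fst A')" using arg_cong[OF D(2), of length] by simp
  have sm: "smd D i = smd (fst A) i" if "i < nsum (fst A)" for i
    using nth[of i D] nth[of i "fst A"] that n D(2) by (simp add: nth_append)
  have sm': "smd D (nsum (fst A) + i) = smd (fst A') i" if "i < nsum (fst A')" for i
    using nth[of "nsum (fst A) + i" D] nth[of i "fst A'"] that n D(2) by (simp add: nth_append)
  let ?B = "(D, snd A @ snd A')"
  have B: "?B \<in> lift_Ob C \<phi>"
  proof -
    have "[(snd A @ snd A') ! i = \<phi> (smd D i)] (rmod 2)" if i: "i < nsum D" for i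
    proof (cases "i < nsum (fst A)")
      case True
      then show ?thesis using a(2) a(3)[OF True] sm[OF True] by (simp add: nth_append)
    next
      case False
      then obtain k where k: "i = nsum (fst A) + k" "k < nsum (fst A')" using i n by (metis add_diff_inverse_nat nat_add_left_cancel_less)
      then show ?thesis using a(2) a'(3)[OF k(2)] sm'[OF k(2)] by (simp add: nth_append)
    qed
    then show ?thesis unfolding lift_Ob_def using D(1) a(2) a'(2) n by simp
  qed
  have s1: "i < nsum (fst ?B) \<and> smd (fst ?B) i = smd (fst A) i \<and> snd ?B ! i = snd A ! i" if "i < nsum (fst A)" for i
    using that n sm a(2) by (simp add: nth_append)
  have s2: "nsum (fst A) + i < nsum (fst ?B) \<and> smd (fst ?B) (nsum (fst A) + i) = smd (fst A') i \<and> snd ?B ! (nsum (fst A) + i) = snd A' ! i"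
    if "i < nsum (fst A')" for i
    using that n sm' a(2) by (simp add: nth_append)
  have im: "(+) (nsum (fst A)) ` {..<nsum (fst A')} = {nsum (fst A)..<nsum (fst A) + nsum (fst A')}"
    by (simp add: lessThan_atLeast0 add.commute)
  have "\<exists>i1 i2 p1 p2. biproduct T A A' ?B i1 i2 p1 p2"
    using T_block_biproduct[OF A A' B, of "\<lambda>i. i" "\<lambda>i. nsum (fst A) + i", OF s1 s2]
    unfolding im using n by (force simp: inj_on_def)
  then show ?thesis using D(2) by fastforce
qed

lemma T_zero_ex: "\<exists>N. zero_obj T N \<and> nsum (fst N) = 0"
proof -
  obtain N where N: "zero_obj C N" using ex_zero_obj by blast
  have "((N, []), []) \<in> lift_Ob C \<phi>" using is_dec_zero[OF N] by (simp add: lift_Ob_def)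
  then have "zero_obj T ((N, []), [])" by (rule T_zero_objI) (simp add: lift_proj_def N)
  then show ?thesis by (intro exI[of _ "((N, []), [])"]) simp
qed

lemma T_additive: "additive_category K T"
proof -
  interpret T: linear_category K T by (rule T_linear)
  show ?thesis
  proof
    show "\<exists>X. zero_obj T X" using T_zero_ex by blast
    fix A B assume "A \<in> Ob T" "B \<in> Ob T"
    then show "\<exists>X. direct_sum T A B X" using T_direct_sum unfolding T_sel direct_sum_def by blast
  qed
qed

lemma phi_shift_int: "indecomposable C E \<Longrightarrow> [\<phi> (Shift C d E) = \<phi> E + of_int d] (rmod 2)"
proof (induction d rule: int_induct[where k = 0])
  case base
  then show ?case using Shift_0[OF indecomposable_Ob[OF base]] by simp
next
  case (step1 i)
  have i: "i + 1 = 1 + i" by simp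
  have E: "E \<in> Ob C" by (rule indecomposable_Ob[OF step1(3)])
  have "[\<phi> (Shift C (i + 1) E) = \<phi> (Shift C i E) + 1] (rmod 2)"
    unfolding i Shift_add[OF E] by (rule phi_shift[OF indecomposable_Shift[OF step1(3)]])
  moreover have "[\<phi> (Shift C i E) + 1 = \<phi> E + of_int i + 1] (rmod 2)"
    by (rule rcong_add[OF step1(2)[OF step1(3)] rcong_refl])
  ultimately show ?case using rcong_trans by (simp add: add.assoc)
next
  case (step2 i)
  have i: "i = 1 + (i - 1)" by simp
  have E: "E \<in> Ob C" by (rule indecomposable_Ob[OF step2(3)])
  have "[\<phi> (Shift C i E) = \<phi> (Shift C (i - 1) E) + 1] (rmod 2)"
    by (subst i, subst Shift_add[OF E]) (rule phi_shift[OF indecomposable_Shift[OF step2(3)]])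
  then obtain n :: int where n: "\<phi> (Shift C i E) - (\<phi> (Shift C (i - 1) E) + 1) = 2 * of_int n" unfolding rcong2_iff by blast
  obtain m :: int where m: "\<phi> (Shift C i E) - (\<phi> E + of_int i) = 2 * of_int m" using step2(2)[OF step2(3)] unfolding rcong2_iff by blast
  have "\<phi> (Shift C (i - 1) E) - (\<phi> E + of_int (i - 1)) = 2 * of_int (m - n)" using n m by simp
  then show ?case unfolding rcong2_iff by blast
qed

lemma lift_shift_sel:
  assumes X: "X \<in> lift_Ob C \<phi>"
  shows "fst (lift_shift C d X) = shift_dec C d (fst X)" "i < nsum (fst X) \<Longrightarrow> snd (lift_shift C d X) ! i = snd X ! i + of_int d"
  using lift_ObD(2)[OF X] by (simp_all add: lift_shift_def)

lemma lift_shift_Ob: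
  assumes X: "X \<in> lift_Ob C \<phi>" shows "lift_shift C d X \<in> lift_Ob C \<phi>"
proof -
  note x = lift_ObD[OF X]
  have "[snd X ! i + of_int d = \<phi> (Shift C d (smd (fst X) i))] (rmod 2)" if i: "i < nsum (fst X)" for i
    using rcong_trans[OF rcong_add[OF x(3)[OF i] rcong_refl] rcong_sym[OF phi_shift_int[OF x(5)[OF i]]]] .
  then show ?thesis unfolding lift_Ob_def lift_shift_def using x(2) is_dec_shift[OF x(1)] by (simp add: shift_dec_nth)
qed

text \<open>The structure maps are shifted together with the summands, so the strict action of the
  integers on \<open>C\<close> gives a strict action on decomposed objects and thereby on the
  lift.\<close>

lemma shift_dec_eqs:
  assumes D: "is_dec C D"
  shows "shift_dec C 0 D = D" "shift_dec C (a + b) D = shift_dec C a (shift_dec C b D)"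
proof -
  note t = is_dec_simps[OF D]
  have p: "fst p \<in> Ob C" "fst (snd p) \<in> mor C (fst p) (tot D)" "snd (snd p) \<in> mor C (tot D) (fst p)" if "p \<in> set (snd D)" for p
    using that t(3-5) by (auto simp: in_set_conv_nth smd_def incl_def proj_def)
  have 0: "(\<lambda>(E, i, p). (Shift C 0 E, ShiftM C 0 i, ShiftM C 0 p)) q = q" if "q \<in> set (snd D)" for q
    using p[OF that] Shift_0[OF p(1)[OF that]] ShiftM_0[OF p(1)[OF that] t(1) p(2)[OF that]] ShiftM_0[OF t(1) p(1)[OF that] p(3)[OF that]]
    by (cases q) simp
  have "map (\<lambda>(E, i, p). (Shift C 0 E, ShiftM C 0 i, ShiftM C 0 p)) (snd D) = snd D"
    by (rule map_idI) (rule 0)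
  then show "shift_dec C 0 D = D" unfolding shift_dec_def using Shift_0[OF t(1)] by simp
  have ab: "(\<lambda>(E, i, p). (Shift C (a + b) E, ShiftM C (a + b) i, ShiftM C (a + b) p)) q =
     (\<lambda>(E, i, p). (Shift C a E, ShiftM C a i, ShiftM C a p)) ((\<lambda>(E, i, p). (Shift C b E, ShiftM C b i, ShiftM C b p)) q)"
    if "q \<in> set (snd D)" for q
    using p[OF that] Shift_add[OF p(1)[OF that]] ShiftM_add[OF p(1)[OF that] t(1) p(2)[OF that]] ShiftM_add[OF t(1) p(1)[OF that] p(3)[OF that]]
    by (cases q) simp
  show "shift_dec C (a + b) D = shift_dec C a (shift_dec C b D)"
    unfolding shift_dec_def using Shift_add[OF t(1)] ab by (simp only: fst_conv snd_conv map_map comp_def prod.inject map_eq_conv) blast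
qed

lemma lift_shift_mor:
  assumes X: "X \<in> lift_Ob C \<phi>" and Y: "Y \<in> lift_Ob C \<phi>" and f: "f \<in> lift_mor C G X Y"
  shows "ShiftM C d f \<in> lift_mor C G (lift_shift C d X) (lift_shift C d Y)"
proof (rule lift_morI)
  note x = lift_ObD[OF X] and y = lift_ObD[OF Y] and fd = lift_morD[OF f]
  show "ShiftM C d f \<in> mor C (lift_proj (lift_shift C d X)) (lift_proj (lift_shift C d Y))"
    unfolding T_sel by (rule ShiftM_closed[OF x(4) y(4) fd(1)])
  fix i j assume "i < nsum (fst (lift_shift C d X))" "j < nsum (fst (lift_shift C d Y))"
  then have ij: "i < nsum (fst X)" "j < nsum (fst Y)" by (simp_all add: lift_shift_sel(1)[OF X] lift_shift_sel(1)[OF Y])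
  have "snd Y ! j + of_int d - (snd X ! i + of_int d) = snd Y ! j - snd X ! i" by simp
  then show "component C (fst (lift_shift C d X)) (fst (lift_shift C d Y)) (ShiftM C d f) i j
      \<in> G (snd (lift_shift C d Y) ! j - snd (lift_shift C d X) ! i) (smd (fst (lift_shift C d X)) i) (smd (fst (lift_shift C d Y)) j)"
    unfolding lift_shift_sel(1)[OF X] lift_shift_sel(1)[OF Y] lift_shift_sel(2)[OF X ij(1)] lift_shift_sel(2)[OF Y ij(2)]
      component_shift[OF x(1) y(1) fd(1)[unfolded lift_proj_def] ij] shift_dec_nth(1)[OF ij(1)] shift_dec_nth(1)[OF ij(2)]
    using G_shift_int[OF x(5)[OF ij(1)] y(5)[OF ij(2)] fd(2)[OF ij]] by simp
qed

lemma T_shift: "category_with_shift K T"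
proof -
  interpret T: additive_category K T by (rule T_additive)
  show ?thesis
  proof (unfold_locales; (simp only: T_sel)?)
    fix X d assume X: "X \<in> lift_Ob C \<phi>"
    show "lift_shift C d X \<in> lift_Ob C \<phi>" by (rule lift_shift_Ob[OF X])
    show "lift_shift C 0 X = X" unfolding lift_shift_def shift_dec_eqs(1)[OF lift_ObD(1)[OF X]] by simp
    show "ShiftM C d (Idm C (lift_proj X)) = Idm C (Shift C d (lift_proj X))" by (rule ShiftM_Idm[OF lift_ObD(4)[OF X]])
  next
    fix X a b assume X: "X \<in> lift_Ob C \<phi>"
    show "lift_shift C (a + b) X = lift_shift C a (lift_shift C b X)"
      unfolding lift_shift_def shift_dec_eqs(2)[OF lift_ObD(1)[OF X]] by (simp add: ac_simps)
  next
    fix X Y f d assume a: "X \<in> lift_Ob C \<phi>" "Y \<in> lift_Ob C \<phi>" "f \<in> lift_mor C G X Y"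
    show "ShiftM C d f \<in> lift_mor C G (lift_shift C d X) (lift_shift C d Y)" by (rule lift_shift_mor[OF a])
    show "ShiftM C 0 f = f" by (rule ShiftM_0[OF a(1,2)[THEN lift_ObD(4)] a(3)[THEN lift_morD(1)]])
  next
    fix X Y f p q assume a: "X \<in> lift_Ob C \<phi>" "Y \<in> lift_Ob C \<phi>" "f \<in> lift_mor C G X Y"
    show "ShiftM C (p + q) f = ShiftM C p (ShiftM C q f)" by (rule ShiftM_add[OF a(1,2)[THEN lift_ObD(4)] a(3)[THEN lift_morD(1)]])
  next
    fix X Y Z f g d assume a: "X \<in> lift_Ob C \<phi>" "Y \<in> lift_Ob C \<phi>" "Z \<in> lift_Ob C \<phi>" "f \<in> lift_mor C G X Y" "g \<in> lift_mor C G Y Z"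
    show "ShiftM C d (Comp C g f) = Comp C (ShiftM C d g) (ShiftM C d f)"
      by (rule ShiftM_Comp[OF a(1-3)[THEN lift_ObD(4)] a(4,5)[THEN lift_morD(1)]])
  next
    fix X Y f g d assume a: "X \<in> lift_Ob C \<phi>" "Y \<in> lift_Ob C \<phi>" "f \<in> lift_mor C G X Y" "g \<in> lift_mor C G X Y"
    show "ShiftM C d (f \<oplus>\<^bsub>Hom C (lift_proj X) (lift_proj Y)\<^esub> g) =
        ShiftM C d f \<oplus>\<^bsub>Hom C (Shift C d (lift_proj X)) (Shift C d (lift_proj Y))\<^esub> ShiftM C d g"
      by (rule ShiftM_plus[OF a(1,2)[THEN lift_ObD(4)] a(3,4)[THEN lift_morD(1)]])
  next
    fix X Y c f d assume a: "X \<in> lift_Ob C \<phi>" "Y \<in> lift_Ob C \<phi>" "c \<in> carrier K" "f \<in> lift_mor C G X Y"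
    show "ShiftM C d (c \<odot>\<^bsub>Hom C (lift_proj X) (lift_proj Y)\<^esub> f) =
        c \<odot>\<^bsub>Hom C (Shift C d (lift_proj X)) (Shift C d (lift_proj Y))\<^esub> ShiftM C d f"
      by (rule ShiftM_smult[OF a(1,2)[THEN lift_ObD(4)] a(3) a(4)[THEN lift_morD(1)]])
  qed
qed

text \<open>A negative is defined by a description over the carrier, which is smaller in the lift;
  its agreement with the negative of \<open>C\<close> is therefore a fact to prove, whereas zero and
  sum are copied by the record update.\<close>

lemma T_neg:
  assumes X: "X \<in> lift_Ob C \<phi>" and Y: "Y \<in> lift_Ob C \<phi>" and f: "f \<in> lift_mor C G X Y"
  shows "\<ominus>\<^bsub>Hom T X Y\<^esub> f = \<ominus>\<^bsub>Hom C (lift_proj X) (lift_proj Y)\<^esub> f"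
proof -
  interpret T: linear_category K T by (rule T_linear)
  interpret TH: abelian_group "Hom T X Y" by (rule T.Hom_abelian) (simp_all only: T_sel X Y)
  interpret CH: abelian_group "Hom C (lift_proj X) (lift_proj Y)" by (rule Hom_abelian[OF lift_ObD(4)[OF X] lift_ObD(4)[OF Y]])
  show ?thesis
    by (rule TH.minus_equality) (simp_all only: T_sel f lift_mor_neg[OF X Y f] CH.l_neg[OF lift_morD(1)[OF f]])
qed

section \<open>Octahedra in the lift and the triangulated structure\<close>

lemma T_Tri_proj: "(X, Y, Z, f, g, h) \<in> Tri T \<Longrightarrow> (lift_proj X, lift_proj Y, lift_proj Z, f, g, h) \<in> Tri C"
  by (simp add: Tri_T)

text \<open>Here \<open>m\<close> and \<open>w\<close> lie in the lift but \<open>n\<close> does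
  not. A cone of \<open>m\<close> formed in the lift is compared with the given triangle by some
  \<open>b\<close> of \<open>C\<close>, and the degree \<open>0\<close> part of \<open>b\<close>
  plays the role of \<open>b\<^sub>0\<close> in \<open>Tri_replace_middle\<close>. The error,
  \<open>n\<close> minus its degree \<open>0\<close> part, kills \<open>m\<close> and also
  \<open>q\<close>, since \<open>n\<close> after \<open>q\<close> is already in the lift;
  \<open>fac\<close> says that such an error factors through \<open>u\<close> after
  \<open>n\<close>.\<close>

lemma lift_replace:
  assumes cone: "\<exists>A' n' w'. (Z, P, A', m, n', w') \<in> Tri T"
    and Tr: "(lift_proj Z, lift_proj P, lift_proj A, m, n, w) \<in> Tri C"
    and o: "Z \<in> lift_Ob C \<phi>" "P \<in> lift_Ob C \<phi>" "A \<in> lift_Ob C \<phi>" "S \<in> lift_Ob C \<phi>" "U \<in> lift_Ob C \<phi>"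
    and l: "m \<in> lift_mor C G Z P" "w \<in> lift_mor C G A (lift_shift C 1 Z)" "q \<in> lift_mor C G S P" "u \<in> lift_mor C G A U"
    and nq: "Comp C n q \<in> lift_mor C G S A" and un: "Comp C u n \<in> lift_mor C G P U"
    and fac: "\<And>e. e \<in> mor C (lift_proj P) (lift_proj A) \<Longrightarrow> Comp C e m = zerom C (lift_proj Z) (lift_proj A) \<Longrightarrow>
        Comp C e q = zerom C (lift_proj S) (lift_proj A) \<Longrightarrow> \<exists>y \<in> mor C (lift_proj U) (lift_proj A). e = Comp C y (Comp C u n)"
  shows "(Z, P, A, m, lift_part C G P A n, w) \<in> Tri T" "Comp C (lift_part C G P A n) q = Comp C n q"
    "Comp C u (lift_part C G P A n) = Comp C u n"
proof -
  obtain A' n' w' where T': "(Z, P, A', m, n', w') \<in> Tri T" using cone by blast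
  have A': "A' \<in> lift_Ob C \<phi>" and n': "n' \<in> lift_mor C G P A'" and w': "w' \<in> lift_mor C G A' (lift_shift C 1 Z)"
    and T'': "(lift_proj Z, lift_proj P, lift_proj A', m, n', w') \<in> Tri C"
    using T' unfolding Tri_T by simp_all
  note t = TriD[OF Tr] and t'' = TriD[OF T'']
  note po = o[THEN lift_ObD(4)]
  let ?n0 = "lift_part C G P A n"
  note n0 = lift_part_mor(1)[OF o(2,3) t(7)]
  note n0m = lift_morD(1)[OF n0]
  show nq0: "Comp C ?n0 q = Comp C n q"
    using lift_part_Comp_right[OF o(4,2,3) l(3) t(7)] lift_part_id[OF o(4,3) nq] by simp
  show un0: "Comp C u ?n0 = Comp C u n"
    using lift_part_Comp_left[OF o(2,3,5) t(7) l(4)] lift_part_id[OF o(2,5) un] by simp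
  have nm0: "Comp C n m = zerom C (lift_proj Z) (lift_proj A)" by (rule Tri_comp_zero[OF Tr])
  have n0m0: "Comp C ?n0 m = zerom C (lift_proj Z) (lift_proj A)"
    using lift_part_Comp_right[OF o(1,2,3) l(1) t(7)] lift_part_id[OF o(1,3) lift_mor_zero[OF o(1,3)]] nm0 by simp
  obtain b where b: "is_isom C (lift_proj A') (lift_proj A) b" "Comp C b n' = n" "Comp C w b = w'"
    using Tri_map_id[OF T'' Tr] by blast
  note bm = is_isom_mor[OF b(1)]
  let ?b0 = "lift_part C G A' A b"
  note b0 = lift_part_mor(1)[OF A' o(3) bm]
  have b0n: "Comp C ?b0 n' = ?n0"
    using lift_part_Comp_right[OF o(2) A' o(3) n' bm] b(2) by simp
  have Z1: "lift_shift C 1 Z \<in> lift_Ob C \<phi>" by (rule lift_shift_Ob[OF o(1)])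
  have wb0: "Comp C w ?b0 = w'"
    using lift_part_Comp_left[OF A' o(3) Z1 bm l(2)] lift_part_id[OF A' Z1 w'] b(3) by simp
  let ?e = "n \<ominus>\<^bsub>Hom C (lift_proj P) (lift_proj A)\<^esub> ?n0"
  have e: "?e \<in> mor C (lift_proj P) (lift_proj A)" by (rule diff_mor[OF po(2,3) t(7) n0m])
  have em: "Comp C ?e m = zerom C (lift_proj Z) (lift_proj A)"
    unfolding Comp_diff(2)[OF po(1,2,3) t(6,7) n0m] nm0 n0m0 by (rule add_zero(4)[OF po(1,3) zero_mor[OF po(1,3)]])
  have nqm: "Comp C n q \<in> mor C (lift_proj S) (lift_proj A)" by (rule lift_morD(1)[OF nq])
  have eq: "Comp C ?e q = zerom C (lift_proj S) (lift_proj A)"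
    unfolding Comp_diff(2)[OF po(4,2,3) lift_morD(1)[OF l(3)] t(7) n0m] nq0 by (rule add_zero(4)[OF po(4,3) nqm])
  obtain y where y: "y \<in> mor C (lift_proj U) (lift_proj A)" "?e = Comp C y (Comp C u n)" using fac[OF e em eq] by blast
  have "(lift_proj Z, lift_proj P, lift_proj A, m, ?n0, w) \<in> Tri C"
    by (rule Tri_replace_middle[OF Tr T'' b lift_morD(1)[OF b0] b0n wb0 po(5) lift_morD(1)[OF l(4)] y un0[symmetric]])
  then show "(Z, P, A, m, ?n0, w) \<in> Tri T" unfolding Tri_T using o l n0 by simp
qed

text \<open>\<open>P\<close>, the cone in the lift of the map from \<open>Y\<close> with entries
  \<open>j\<close> and \<open>v\<close>, is another model of the cone of \<open>v\<close> after
  \<open>u\<close>. Two cobase changes, of the triangle on \<open>j\<close> along \<open>v\<close>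
  and of the triangle on \<open>v\<close> along \<open>j\<close>, give triangles through
  \<open>P\<close> in which only the maps \<open>n'\<close> and \<open>g'\<close> out of
  \<open>P\<close> may fail to lie in the lift. Once these are corrected, \<open>P\<close> is
  identified with \<open>Y'\<close>.\<close>

lemma T_octahedron:
  assumes cone: "\<And>X Y f. \<lbrakk>X \<in> lift_Ob C \<phi>; Y \<in> lift_Ob C \<phi>; f \<in> lift_mor C G X Y\<rbrakk> \<Longrightarrow> \<exists>Z g h. (X, Y, Z, f, g, h) \<in> Tri T"
    and T1: "(X, Y, Z', u, j, k) \<in> Tri T" and T2: "(X, Z, Y', Comp C v u, m, n) \<in> Tri T"
    and T3: "(Y, Z, X', v, l, i) \<in> Tri T"
  shows "\<exists>f g. (Z', Y', X', f, g, Comp C (ShiftM C 1 j) i) \<in> Tri T \<and>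
                 Comp C f j = Comp C m v \<and> Comp C g m = l \<and>
                 Comp C n f = k \<and> Comp C i g = Comp C (ShiftM C 1 u) n"
proof -
  interpret LT: category_with_shift K T by (rule T_shift)
  have o: "X \<in> lift_Ob C \<phi>" "Y \<in> lift_Ob C \<phi>" "Z \<in> lift_Ob C \<phi>" "X' \<in> lift_Ob C \<phi>" "Y' \<in> lift_Ob C \<phi>" "Z' \<in> lift_Ob C \<phi>"
    and L: "u \<in> lift_mor C G X Y" "j \<in> lift_mor C G Y Z'" "k \<in> lift_mor C G Z' (lift_shift C 1 X)"
      "Comp C v u \<in> lift_mor C G X Z" "m \<in> lift_mor C G Z Y'" "n \<in> lift_mor C G Y' (lift_shift C 1 X)"
      "v \<in> lift_mor C G Y Z" "l \<in> lift_mor C G Z X'" "i \<in> lift_mor C G X' (lift_shift C 1 Y)"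
    using T1 T2 T3 unfolding Tri_T by simp_all
  note C1 = T_Tri_proj[OF T1] and C2 = T_Tri_proj[OF T2] and C3 = T_Tri_proj[OF T3]
  note t1 = TriD[OF C1] and t2 = TriD[OF C2] and t3 = TriD[OF C3]
  note po = o[THEN lift_ObD(4)]
  have S1: "lift_shift C 1 X \<in> lift_Ob C \<phi>" "lift_shift C 1 Y \<in> lift_Ob C \<phi>" "lift_shift C 1 Z \<in> lift_Ob C \<phi>" "lift_shift C 1 Z' \<in> lift_Ob C \<phi>"
    using lift_shift_Ob o by blast+
  note S1o = S1[THEN lift_ObD(4), unfolded T_sel(10)]
  have L1: "ShiftM C 1 u \<in> lift_mor C G (lift_shift C 1 X) (lift_shift C 1 Y)"
    "ShiftM C 1 v \<in> lift_mor C G (lift_shift C 1 Y) (lift_shift C 1 Z)"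
    "ShiftM C 1 j \<in> lift_mor C G (lift_shift C 1 Y) (lift_shift C 1 Z')"
    by (rule lift_shift_mor[OF o(1,2) L(1)] lift_shift_mor[OF o(2,3) L(7)] lift_shift_mor[OF o(2,6) L(2)])+
  note L1m = L1[THEN lift_morD(1), unfolded T_sel(10)]
  obtain S iA iB pA pB where bT: "biproduct T Z' Z S iA iB pA pB" using T_direct_sum[OF o(6,3)] by blast
  have S: "S \<in> lift_Ob C \<phi>" and Lb: "iA \<in> lift_mor C G Z' S" "iB \<in> lift_mor C G Z S" "pA \<in> lift_mor C G S Z'" "pB \<in> lift_mor C G S Z"
    using bT unfolding biproduct_def T_sel by simp_all
  note bC = T_biproduct_D[OF bT]
  note b = biproductD[OF bC]
  note So = lift_ObD(4)[OF S]
  \<comment> \<open>Both entries have sign plus, so the square at \<open>P\<close> anticommutes;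
    \<open>octahedron_transport\<close> makes up for it.\<close>
  define U where "U = Comp C iA j \<oplus>\<^bsub>Hom C (lift_proj Y) (lift_proj S)\<^esub> Comp C iB v"
  have m1: "Comp C iA j \<in> lift_mor C G Y S" "Comp C iB v \<in> lift_mor C G Y S"
    by (rule lift_mor_Comp[OF o(2,6) S L(2) Lb(1)] lift_mor_Comp[OF o(2,3) S L(7) Lb(2)])+
  note m1m = m1[THEN lift_morD(1)]
  have U: "U \<in> lift_mor C G Y S" unfolding U_def by (rule lift_mor_add[OF o(2) S m1])
  note Um = lift_morD(1)[OF U]
  have pU: "Comp C pA U = j" "Comp C pB U = v"
    unfolding U_def Comp_add_right[OF po(2) b(3,1) m1m b(6)] Comp_add_right[OF po(2) b(3,2) m1m b(7)]
      Comp_assoc'[OF t1(7) b(4,6) po(2) b(1,3,1)] Comp_assoc'[OF t3(6) b(5,6) po(2) b(2,3,1)]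
      Comp_assoc'[OF t1(7) b(4,7) po(2) b(1,3,2)] Comp_assoc'[OF t3(6) b(5,7) po(2) b(2,3,2)] b(8-11)
      Idm_Comp'[OF t1(7) po(2) b(1)] Idm_Comp'[OF t3(6) po(2) b(2)] Comp_zero_left[OF t1(7) po(2) b(1,2)] Comp_zero_left[OF t3(6) po(2) b(2,1)]
    by (rule add_zero(1)[OF po(2) b(1) t1(7)] add_zero(2)[OF po(2) b(2) t3(6)])+
  obtain P p c where TP: "(Y, S, P, U, p, c) \<in> Tri T" using cone[OF o(2) S U] by blast
  have P: "P \<in> lift_Ob C \<phi>" and Lp: "p \<in> lift_mor C G S P" "c \<in> lift_mor C G P (lift_shift C 1 Y)"
    using TP unfolding Tri_T by simp_all
  note CP = T_Tri_proj[OF TP]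
  note q = TriD[OF CP]
  note Po = lift_ObD(4)[OF P]
  let ?pA = "Comp C p iA" and ?pB = "Comp C p iB"
  have LpA: "?pA \<in> lift_mor C G Z' P" "?pB \<in> lift_mor C G Z P"
    by (rule lift_mor_Comp[OF o(6) S P Lb(1) Lp(1)] lift_mor_Comp[OF o(3) S P Lb(2) Lp(1)])+
  note pAm = LpA[THEN lift_morD(1)]
  \<comment> \<open>A map out of \<open>P\<close> that vanishes on \<open>Z'\<close> and on
    \<open>Z\<close> vanishes on \<open>S\<close>, hence factors through the connecting map
    \<open>c\<close>. The map \<open>c\<close> is at the same time the prescribed composite of
    \<open>n'\<close> with \<open>?u1\<close> and of \<open>g'\<close> with \<open>i\<close>, which
    is the form that \<open>lift_replace\<close> asks for.\<close>
  have fac: "\<exists>y \<in> mor C (Shift C 1 (lift_proj Y)) W. e = Comp C y c"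
    if W: "W \<in> Ob C" and e: "e \<in> mor C (lift_proj P) W" "Comp C e ?pA = zerom C (lift_proj Z') W" "Comp C e ?pB = zerom C (lift_proj Z) W" for e W
  proof -
    have "Comp C e p = zerom C (lift_proj S) W"
    proof (rule biproduct_coext[OF bC W Comp_mor[OF q(7) e(1) q(2,3) W] zero_mor[OF q(2) W]])
      show "Comp C (Comp C e p) iA = Comp C (zerom C (lift_proj S) W) iA"
        unfolding Comp_assoc'[OF b(4) q(7) e(1) b(1,3) q(3) W, symmetric] e(2) Comp_zero_left[OF b(4) b(1,3) W] ..
      show "Comp C (Comp C e p) iB = Comp C (zerom C (lift_proj S) W) iB"
        unfolding Comp_assoc'[OF b(5) q(7) e(1) b(2,3) q(3) W, symmetric] e(3) Comp_zero_left[OF b(5) b(2,3) W] ..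
    qed
    then show ?thesis using Tri_weak_cokernel[OF Tri_rotate[OF CP] W e(1)] by blast
  qed
  let ?u1 = "\<ominus>\<^bsub>Hom C (Shift C 1 (lift_proj X)) (Shift C 1 (lift_proj Y))\<^esub> ShiftM C 1 u"
  have Lu1: "?u1 \<in> lift_mor C G (lift_shift C 1 X) (lift_shift C 1 Y)"
    using lift_mor_neg[OF S1(1,2) L1(1)] unfolding T_sel(10) .
  note C1' = Tri_rotate[OF C1]
  \<comment> \<open>The sign of the rotated triangle on \<open>j\<close> and the sign in the
    conclusion of \<open>homotopy_pushout\<close> cancel, so that the third map is the shift of
    \<open>v\<close> after \<open>u\<close>.\<close>
  have v1u1: "\<ominus>\<^bsub>Hom C (Shift C 1 (lift_proj X)) (Shift C 1 (lift_proj Z))\<^esub> Comp C (ShiftM C 1 v) ?u1 = ShiftM C 1 (Comp C v u)"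
    unfolding Comp_neg(1)[OF S1o(1,2,3) L1m(1,2)] ShiftM_Comp[OF po(1,2,3) t1(6) t3(6)]
    by (rule neg_neg[OF Comp_mor[OF L1m(1,2) S1o(1,2,3)] S1o(1,3)])
  from homotopy_pushout[OF C1' t3(6) bC Um pU CP, unfolded v1u1]
  obtain n' where n'1: "n' \<in> mor C (lift_proj P) (Shift C 1 (lift_proj X))" and n'2: "Comp C n' ?pA = k \<and>
    Comp C n' ?pB = zerom C (lift_proj Z) (Shift C 1 (lift_proj X)) \<and> Comp C ?u1 n' = c \<and>
    (lift_proj Z, lift_proj P, Shift C 1 (lift_proj X), ?pB, n', ShiftM C 1 (Comp C v u)) \<in> Tri C"
    by (rule bexE)
  note n' = n'1 n'2[THEN conjunct1] n'2[THEN conjunct2, THEN conjunct1] n'2[THEN conjunct2, THEN conjunct2, THEN conjunct1]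
    n'2[THEN conjunct2, THEN conjunct2, THEN conjunct2]
  from homotopy_pushout[OF C3 t1(7) biproduct_sym[OF bC] Um pU(2,1) CP]
  obtain g' where g'1: "g' \<in> mor C (lift_proj P) (lift_proj X')" and g'2: "Comp C g' ?pB = l \<and>
    Comp C g' ?pA = zerom C (lift_proj Z') (lift_proj X') \<and> Comp C i g' = c \<and>
    (lift_proj Z', lift_proj P, lift_proj X', ?pA, g', \<ominus>\<^bsub>Hom C (lift_proj X') (Shift C 1 (lift_proj Z'))\<^esub> Comp C (ShiftM C 1 j) i) \<in> Tri C"
    by (rule bexE)
  note g' = g'1 g'2[THEN conjunct1] g'2[THEN conjunct2, THEN conjunct1] g'2[THEN conjunct2, THEN conjunct2, THEN conjunct1]
    g'2[THEN conjunct2, THEN conjunct2, THEN conjunct2]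
  have Lvu1: "ShiftM C 1 (Comp C v u) \<in> lift_mor C G (lift_shift C 1 X) (lift_shift C 1 Z)"
    by (rule lift_shift_mor[OF o(1,3) L(4)])
  have Lji: "\<ominus>\<^bsub>Hom C (lift_proj X') (Shift C 1 (lift_proj Z'))\<^esub> Comp C (ShiftM C 1 j) i \<in> lift_mor C G X' (lift_shift C 1 Z')"
    using lift_mor_neg[OF o(4) S1(4) lift_mor_Comp[OF o(4) S1(2,4) L(9) L1(3)]] unfolding T_sel(10) .
  let ?n0 = "lift_part C G P (lift_shift C 1 X) n'" and ?g0 = "lift_part C G P X' g'"
  \<comment> \<open>In \<open>lift_replace\<close> the test maps are \<open>?pA\<close> before
    \<open>n'\<close> and \<open>?u1\<close> after it: these composites are \<open>k\<close> and
    \<open>c\<close>, both of which lie in the lift.\<close>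
  have n0: "(Z, P, lift_shift C 1 X, ?pB, ?n0, ShiftM C 1 (Comp C v u)) \<in> Tri T" "Comp C ?n0 ?pA = k" "Comp C ?u1 ?n0 = c"
  proof -
    note r = lift_replace[OF cone[OF o(3) P LpA(2)] n'(5)[folded T_sel(10)] o(3) P S1(1) o(6) S1(2) LpA(2) Lvu1 LpA(1) Lu1]
    have f1: "\<exists>y \<in> mor C (lift_proj (lift_shift C 1 Y)) (lift_proj (lift_shift C 1 X)). e = Comp C y (Comp C ?u1 n')"
      if "e \<in> mor C (lift_proj P) (lift_proj (lift_shift C 1 X))" "Comp C e ?pB = zerom C (lift_proj Z) (lift_proj (lift_shift C 1 X))"
        "Comp C e ?pA = zerom C (lift_proj Z') (lift_proj (lift_shift C 1 X))" for e
      using fac[OF S1o(1) that(1,3,2)[unfolded T_sel(10)]] unfolding T_sel(10) n'(4) .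
    have k': "Comp C n' ?pA \<in> lift_mor C G Z' (lift_shift C 1 X)" unfolding n'(2) by (rule L(3))
    have c': "Comp C ?u1 n' \<in> lift_mor C G P (lift_shift C 1 Y)" unfolding n'(4) by (rule Lp(2))
    show "(Z, P, lift_shift C 1 X, ?pB, ?n0, ShiftM C 1 (Comp C v u)) \<in> Tri T" by (rule r(1)[OF k' c']) (erule (2) f1)
    show "Comp C ?n0 ?pA = k" unfolding n'(2)[symmetric] by (rule r(2)[OF k' c']) (erule (2) f1)
    show "Comp C ?u1 ?n0 = c" unfolding n'(4)[symmetric] by (rule r(3)[OF k' c']) (erule (2) f1)
  qed
  have g0: "(Z', P, X', ?pA, ?g0, \<ominus>\<^bsub>Hom C (lift_proj X') (Shift C 1 (lift_proj Z'))\<^esub> Comp C (ShiftM C 1 j) i) \<in> Tri T"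
    "Comp C ?g0 ?pB = l" "Comp C i ?g0 = c"
  proof -
    note r = lift_replace[OF cone[OF o(6) P LpA(1)] g'(5) o(6) P o(4) o(3) S1(2) LpA(1) Lji LpA(2) L(9)]
    have f1: "\<exists>y \<in> mor C (lift_proj (lift_shift C 1 Y)) (lift_proj X'). e = Comp C y (Comp C i g')"
      if "e \<in> mor C (lift_proj P) (lift_proj X')" "Comp C e ?pA = zerom C (lift_proj Z') (lift_proj X')"
        "Comp C e ?pB = zerom C (lift_proj Z) (lift_proj X')" for e
      using fac[OF po(4) that] unfolding T_sel(10) g'(4) .
    have l': "Comp C g' ?pB \<in> lift_mor C G Z X'" unfolding g'(2) by (rule L(8))
    have c': "Comp C i g' \<in> lift_mor C G P (lift_shift C 1 Y)" unfolding g'(4) by (rule Lp(2))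
    show "(Z', P, X', ?pA, ?g0, \<ominus>\<^bsub>Hom C (lift_proj X') (Shift C 1 (lift_proj Z'))\<^esub> Comp C (ShiftM C 1 j) i) \<in> Tri T"
      by (rule r(1)[OF l' c']) (erule (2) f1)
    show "Comp C ?g0 ?pB = l" unfolding g'(2)[symmetric] by (rule r(2)[OF l' c']) (erule (2) f1)
    show "Comp C i ?g0 = c" unfolding g'(4)[symmetric] by (rule r(3)[OF l' c']) (erule (2) f1)
  qed
  have Ln0: "?n0 \<in> lift_mor C G P (lift_shift C 1 X)" and Lg0: "?g0 \<in> lift_mor C G P X'"
    using n0(1) g0(1) unfolding Tri_T by simp_all
  note n0m = lift_morD(1)[OF Ln0, unfolded T_sel(10)] and g0m = lift_morD(1)[OF Lg0]
  let ?n1 = "\<ominus>\<^bsub>Hom C (lift_proj P) (Shift C 1 (lift_proj X))\<^esub> ?n0"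
  have n1: "?n1 \<in> lift_mor C G P (lift_shift C 1 X)" using lift_mor_neg[OF P S1(1) Ln0] unfolding T_sel(10) .
  note n1m = lift_morD(1)[OF n1, unfolded T_sel(10)]
  \<comment> \<open>Flipping the signs of the last two maps of \<open>n0(1)\<close> produces exactly
    the rotation of this triangle, so it can be rotated back.\<close>
  have CX: "(lift_proj X, lift_proj Z, lift_proj P, Comp C v u, ?pB, ?n1) \<in> Tri C"
    using Tri_neg_right[OF T_Tri_proj[OF n0(1), unfolded T_sel(10)]] TR2[OF po(1,3) Po t2(6) pAm(2) n1m] by simp
  obtain d' where d': "is_isom C (lift_proj P) (lift_proj Y') d'" "Comp C d' ?pB = m" "Comp C n d' = ?n1"
    using Tri_map_id[OF CX C2] by (elim exE conjE)
  note d'm = is_isom_mor[OF d'(1)]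
  let ?d = "lift_part C G P Y' d'"
  have Ld: "?d \<in> lift_mor C G P Y'" by (rule lift_part_mor(1)[OF P o(5) d'm])
  note dm = lift_morD(1)[OF Ld]
  have d: "Comp C ?d ?pB = m" "Comp C n ?d = ?n1"
    using lift_part_Comp_right[OF o(3) P o(5) LpA(2) d'm] lift_part_id[OF o(3,5) L(5)] d'(2)
      lift_part_Comp_left[OF P o(5) S1(1) d'm L(6)] lift_part_id[OF P S1(1) n1] d'(3) by simp_all
  \<comment> \<open>The degree \<open>0\<close> part of \<open>d'\<close> satisfies the same two
    equations as \<open>d'\<close>, and by the five lemma these alone force it to be
    invertible.\<close>
  have iso: "is_isom C (lift_proj P) (lift_proj Y') ?d" by (rule Tri_iso_unique[OF CX C2 dm d])
  obtain e where e: "e \<in> lift_mor C G Y' P" "Comp C e ?d = Idm C (lift_proj P)" "Comp C ?d e = Idm C (lift_proj Y')"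
    using lift_inverse[OF P o(5) Ld iso] by (elim bexE conjE)
  note em = lift_morD(1)[OF e(1)]
  have z: "Comp C ?pA j \<oplus>\<^bsub>Hom C (lift_proj Y) (lift_proj P)\<^esub> Comp C ?pB v = zerom C (lift_proj Y) (lift_proj P)"
    unfolding Comp_assoc'[OF t1(7) b(4) q(7) po(2) b(1,3) q(3), symmetric] Comp_assoc'[OF t3(6) b(5) q(7) po(2) b(2,3) q(3), symmetric]
      Comp_add_right[OF po(2) b(3) q(3) m1m q(7), symmetric] U_def[symmetric] by (rule Tri_comp_zero[OF CP])
  have ig: "Comp C i ?g0 = \<ominus>\<^bsub>Hom C (lift_proj P) (Shift C 1 (lift_proj Y))\<^esub> Comp C (ShiftM C 1 u) ?n0"
    unfolding g0(3) n0(3)[symmetric] by (rule Comp_neg(2)[OF Po S1o(1,2) n0m L1m(1)])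
  note oct = octahedron_transport[OF C1 C2 C3 Po pAm n0m g0m z n0(2) g0(2) ig T_Tri_proj[OF g0(1)] dm d em e(2,3)]
  let ?f = "Comp C ?d (\<ominus>\<^bsub>Hom C (lift_proj Z') (lift_proj P)\<^esub> ?pA)" and ?g = "Comp C ?g0 e"
  have "?f \<in> lift_mor C G Z' Y'" by (rule lift_mor_Comp[OF o(6) P o(5) lift_mor_neg[OF o(6) P LpA(1)] Ld])
  moreover have "?g \<in> lift_mor C G Y' X'" by (rule lift_mor_Comp[OF o(5) P o(4) e(1) Lg0])
  moreover have "Comp C (ShiftM C 1 j) i \<in> lift_mor C G X' (lift_shift C 1 Z')" by (rule lift_mor_Comp[OF o(4) S1(2,4) L(9) L1(3)])
  ultimately have "(Z', Y', X', ?f, ?g, Comp C (ShiftM C 1 j) i) \<in> Tri T" unfolding Tri_T using o oct(1) by simp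
  then show ?thesis using oct(2-5) by (intro exI conjI)
qed

text \<open>Apart from cones and octahedra everything is inherited: \<open>TR1_iso\<close> and
  \<open>TR2\<close> because a triangle of \<open>T\<close> is a triangle of \<open>C\<close> whose
  objects and maps lie in the lift, and \<open>TR3\<close> by taking the degree \<open>0\<close>
  part of a map found in \<open>C\<close>.\<close>

lemma T_triangulated:
  assumes cone: "\<And>X Y f. \<lbrakk>X \<in> lift_Ob C \<phi>; Y \<in> lift_Ob C \<phi>; f \<in> lift_mor C G X Y\<rbrakk> \<Longrightarrow> \<exists>Z g h. (X, Y, Z, f, g, h) \<in> Tri T"
  shows "triangulated_category K T"
proof -
  interpret LT: category_with_shift K T by (rule T_shift)
  show ?thesis
  proof (unfold_locales; (simp only: T_sel)?)
    fix X Y Z f g h assume "(X, Y, Z, f, g, h) \<in> Tri T"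
    then show "X \<in> lift_Ob C \<phi> \<and> Y \<in> lift_Ob C \<phi> \<and> Z \<in> lift_Ob C \<phi> \<and>
        f \<in> lift_mor C G X Y \<and> g \<in> lift_mor C G Y Z \<and> h \<in> lift_mor C G Z (lift_shift C 1 X)"
      unfolding Tri_T by simp
  next
    fix X Y Z f g h X' Y' Z' f' g' h' a b c
    assume t: "(X, Y, Z, f, g, h) \<in> Tri T" and o: "X' \<in> lift_Ob C \<phi>" "Y' \<in> lift_Ob C \<phi>" "Z' \<in> lift_Ob C \<phi>"
      and l: "f' \<in> lift_mor C G X' Y'" "g' \<in> lift_mor C G Y' Z'" "h' \<in> lift_mor C G Z' (lift_shift C 1 X')"
      and i: "is_isom T X X' a" "is_isom T Y Y' b" "is_isom T Z Z' c"
      and e: "Comp C b f = Comp C f' a" "Comp C c g = Comp C g' b" "Comp C (ShiftM C 1 a) h = Comp C h' c"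
    have "(lift_proj X', lift_proj Y', lift_proj Z', f', g', h') \<in> Tri C"
      by (rule TR1_iso[OF T_Tri_proj[OF t] o[THEN lift_ObD(4)] l[THEN lift_morD(1), unfolded T_sel(10)] i[THEN T_is_isom] e])
    then show "(X', Y', Z', f', g', h') \<in> Tri T" unfolding Tri_T using o l by simp
  next
    fix X N assume X: "X \<in> lift_Ob C \<phi>" and N: "zero_obj T N"
    note n = T_zero_obj[OF N]
    have X1: "lift_shift C 1 X \<in> lift_Ob C \<phi>" by (rule lift_shift_Ob[OF X])
    show "(X, X, N, Idm C (lift_proj X), zerom C (lift_proj X) (lift_proj N), zerom C (lift_proj N) (Shift C 1 (lift_proj X))) \<in> Tri T"
      unfolding Tri_T using X n(2) lift_mor_Idm[OF X] lift_mor_zero[OF X n(2)] lift_mor_zero[OF n(2) X1, unfolded T_sel(10)]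
        TR1_id[OF lift_ObD(4)[OF X] n(1)] by simp
  next
    fix X Y f assume "X \<in> lift_Ob C \<phi>" "Y \<in> lift_Ob C \<phi>" "f \<in> lift_mor C G X Y"
    then show "\<exists>Z g h. (X, Y, Z, f, g, h) \<in> Tri T" by (rule cone)
  next
    fix X Y Z f g h
    assume o: "X \<in> lift_Ob C \<phi>" "Y \<in> lift_Ob C \<phi>" "Z \<in> lift_Ob C \<phi>"
      and l: "f \<in> lift_mor C G X Y" "g \<in> lift_mor C G Y Z" "h \<in> lift_mor C G Z (lift_shift C 1 X)"
    have S1: "lift_shift C 1 X \<in> lift_Ob C \<phi>" "lift_shift C 1 Y \<in> lift_Ob C \<phi>" using lift_shift_Ob o by blast+
    note f1 = lift_shift_mor[OF o(1,2) l(1), of 1]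
    have n: "\<ominus>\<^bsub>Hom T (lift_shift C 1 X) (lift_shift C 1 Y)\<^esub> ShiftM C 1 f =
        \<ominus>\<^bsub>Hom C (Shift C 1 (lift_proj X)) (Shift C 1 (lift_proj Y))\<^esub> ShiftM C 1 f"
      using T_neg[OF S1 f1] unfolding T_sel(10) .
    have n': "\<ominus>\<^bsub>Hom C (Shift C 1 (lift_proj X)) (Shift C 1 (lift_proj Y))\<^esub> ShiftM C 1 f \<in> lift_mor C G (lift_shift C 1 X) (lift_shift C 1 Y)"
      using lift_mor_neg[OF S1 f1] unfolding T_sel(10) .
    show "((X, Y, Z, f, g, h) \<in> Tri T) = ((Y, Z, lift_shift C 1 X, g, h, \<ominus>\<^bsub>Hom T (lift_shift C 1 X) (lift_shift C 1 Y)\<^esub> ShiftM C 1 f) \<in> Tri T)"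
      unfolding n Tri_T T_sel(10) using o l S1 n' TR2[OF o[THEN lift_ObD(4)] l[THEN lift_morD(1), unfolded T_sel(10)]] by simp
  next
    fix X Y Z f g h X' Y' Z' f' g' h' a b
    assume t: "(X, Y, Z, f, g, h) \<in> Tri T" and t': "(X', Y', Z', f', g', h') \<in> Tri T"
      and a: "a \<in> lift_mor C G X X'" and b: "b \<in> lift_mor C G Y Y'" and e: "Comp C b f = Comp C f' a"
    have o: "X \<in> lift_Ob C \<phi>" "Y \<in> lift_Ob C \<phi>" "Z \<in> lift_Ob C \<phi>" "X' \<in> lift_Ob C \<phi>" "Y' \<in> lift_Ob C \<phi>" "Z' \<in> lift_Ob C \<phi>"
      and l: "g \<in> lift_mor C G Y Z" "h \<in> lift_mor C G Z (lift_shift C 1 X)" "g' \<in> lift_mor C G Y' Z'" "h' \<in> lift_mor C G Z' (lift_shift C 1 X')"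
      using t t' unfolding Tri_T by simp_all
    obtain c where c: "c \<in> mor C (lift_proj Z) (lift_proj Z')" "Comp C c g = Comp C g' b" "Comp C (ShiftM C 1 a) h = Comp C h' c"
      using TR3[OF T_Tri_proj[OF t] T_Tri_proj[OF t'] lift_morD(1)[OF a] lift_morD(1)[OF b] e] by blast
    let ?c = "lift_part C G Z Z' c"
    have S1: "lift_shift C 1 X \<in> lift_Ob C \<phi>" "lift_shift C 1 X' \<in> lift_Ob C \<phi>" using lift_shift_Ob o by blast+
    have "Comp C ?c g = Comp C g' b"
      using lift_part_Comp_right[OF o(2,3,6) l(1) c(1)] c(2) lift_part_id[OF o(2,6) lift_mor_Comp[OF o(2,5,6) b l(3)]] by simp
    moreover have "Comp C (ShiftM C 1 a) h = Comp C h' ?c"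
      using lift_part_Comp_left[OF o(3,6) S1(2) c(1) l(4)] c(3)
        lift_part_id[OF o(3) S1(2) lift_mor_Comp[OF o(3) S1 l(2) lift_shift_mor[OF o(1,4) a]]] by simp
    ultimately show "\<exists>c \<in> lift_mor C G Z Z'. Comp C c g = Comp C g' b \<and> Comp C (ShiftM C 1 a) h = Comp C h' c"
      using lift_part_mor(1)[OF o(3,6) c(1)] by blast
  next
    fix X Y Z' u j k Z Y' v m n X' l i
    assume a: "(X, Y, Z', u, j, k) \<in> Tri T" "(X, Z, Y', Comp C v u, m, n) \<in> Tri T" "(Y, Z, X', v, l, i) \<in> Tri T"
    show "\<exists>f g. (Z', Y', X', f, g, Comp C (ShiftM C 1 j) i) \<in> Tri T \<and> Comp C f j = Comp C m v \<and> Comp C g m = l \<and>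
        Comp C n f = k \<and> Comp C i g = Comp C (ShiftM C 1 u) n"
      by (rule T_octahedron[OF _ a]) (rule cone)
  qed
qed

end

section \<open>Potentials\<close>

text \<open>It is phrased by membership in a graded piece instead of by \<open>deg\<close>, so that
  zero components, which lie in every piece, impose no condition.\<close>

definition potential ::
    "('o, 'm, 'k) tricat \<Rightarrow> (real \<Rightarrow> 'o \<Rightarrow> 'o \<Rightarrow> 'm set) \<Rightarrow> ('v, 'o, 'm) diagram \<Rightarrow> ('v \<times> nat \<Rightarrow> real) \<Rightarrow> bool" where
  "potential C G D pot \<longleftrightarrow> (\<forall>a \<in> nodes D. \<forall>b \<in> nodes D. (fst a, fst b) \<in> edges D \<longrightarrow>
     arr_comp C D a b \<in> G (pot b - pot a) (node_obj D a) (node_obj D b))"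

definition connected_by ::
    "('o, 'm, 'k) tricat \<Rightarrow> (real \<Rightarrow> 'o \<Rightarrow> 'o \<Rightarrow> 'm set) \<Rightarrow> ('v, 'o, 'm) diagram \<Rightarrow>
     'v \<times> nat \<Rightarrow> 'v \<times> nat \<Rightarrow> real \<Rightarrow> bool" where
  "connected_by C G D a b r \<longleftrightarrow> (\<exists>ps. path_in C G D a ps b \<and> q_in C G D a ps = r)"

lemma node_indecomposable: "is_diagram C D \<Longrightarrow> a \<in> nodes D \<Longrightarrow> indecomposable C (node_obj D a)"
  unfolding is_diagram_def nodes_def node_obj_def using is_dec_smd by fastforce

lemma path_in_Nil: "path_in C G D a [] b \<longleftrightarrow> a \<in> nodes D \<and> a = b \<and> indecomposable C (node_obj D a)"
  unfolding path_in_def by auto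

lemma path_in_Cons: "path_in C G D a ((s, c) # ps) b \<longleftrightarrow> a \<in> nodes D \<and> indecomposable C (node_obj D a) \<and>
    (if s then (fst a, fst c) \<in> edges D \<and> homogeneous G (node_obj D a) (node_obj D c) (arr_comp C D a c) \<and>
       arr_comp C D a c \<noteq> zerom C (node_obj D a) (node_obj D c)
     else (fst c, fst a) \<in> edges D \<and> homogeneous G (node_obj D c) (node_obj D a) (arr_comp C D c a) \<and>
       arr_comp C D c a \<noteq> zerom C (node_obj D c) (node_obj D a)) \<and> path_in C G D c ps b"
  unfolding path_in_def by auto

lemma q_in_Nil: "q_in C G D a [] = 0"
  by (simp add: q_in_def)

lemma q_in_Cons: "q_in C G D a ((s, c) # ps) = (if s then deg G (node_obj D a) (node_obj D c) (arr_comp C D a c)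
    else - deg G (node_obj D c) (node_obj D a) (arr_comp C D c a)) + q_in C G D c ps"
  by (simp add: q_in_def)

lemma path_in_nodes: "path_in C G D a ps b \<Longrightarrow> a \<in> nodes D \<and> b \<in> nodes D"
proof (induction ps arbitrary: a)
  case Nil then show ?case unfolding path_in_Nil by blast
next
  case (Cons p ps)
  obtain s x i where "p = (s, (x, i))" by (cases p) auto
  then show ?case using Cons by (auto simp: path_in_Cons)
qed

lemma connected_by_refl: "is_diagram C D \<Longrightarrow> a \<in> nodes D \<Longrightarrow> connected_by C G D a a 0"
  unfolding connected_by_def by (rule exI[of _ "[]"]) (simp add: path_in_Nil q_in_Nil node_indecomposable)

lemma connected_by_step:
  assumes "is_diagram C D" "a \<in> nodes D" "c \<in> nodes D" "(fst a, fst c) \<in> edges D"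
    "homogeneous G (node_obj D a) (node_obj D c) (arr_comp C D a c)"
    "arr_comp C D a c \<noteq> zerom C (node_obj D a) (node_obj D c)"
  shows "connected_by C G D a c (deg G (node_obj D a) (node_obj D c) (arr_comp C D a c))"
    "connected_by C G D c a (- deg G (node_obj D a) (node_obj D c) (arr_comp C D a c))"
proof -
  note i = node_indecomposable[OF assms(1,2)] node_indecomposable[OF assms(1,3)]
  show "connected_by C G D a c (deg G (node_obj D a) (node_obj D c) (arr_comp C D a c))"
    unfolding connected_by_def
    by (rule exI[of _ "[(True, c)]"]) (simp add: path_in_Cons path_in_Nil q_in_Cons q_in_Nil assms i)
  show "connected_by C G D c a (- deg G (node_obj D a) (node_obj D c) (arr_comp C D a c))"
    unfolding connected_by_def
    by (rule exI[of _ "[(False, a)]"]) (simp add: path_in_Cons path_in_Nil q_in_Cons q_in_Nil assms i)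
qed

lemma path_in_append:
  "path_in C G D a ps b \<Longrightarrow> path_in C G D b qs c \<Longrightarrow>
    path_in C G D a (ps @ qs) c \<and> q_in C G D a (ps @ qs) = q_in C G D a ps + q_in C G D b qs"
proof (induction ps arbitrary: a)
  case Nil then show ?case by (simp add: path_in_Nil q_in_Nil)
next
  case (Cons p ps)
  obtain s d where p: "p = (s, d)" by (cases p)
  then have "path_in C G D d ps b" using Cons(2) by (simp add: path_in_Cons)
  from Cons(1)[OF this Cons(3)] show ?case using Cons(2) unfolding p by (simp add: path_in_Cons q_in_Cons)
qed

lemma connected_by_trans: "connected_by C G D a b r \<Longrightarrow> connected_by C G D b c s \<Longrightarrow> connected_by C G D a c (r + s)"
  unfolding connected_by_def using path_in_append by metis

lemma connected_by_sym:
  assumes D: "is_diagram C D" and c: "connected_by C G D a b r" shows "connected_by C G D b a (- r)"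
proof -
  obtain ps where "path_in C G D a ps b" "q_in C G D a ps = r" using c unfolding connected_by_def by blast
  then show ?thesis
  proof (induction ps arbitrary: a r)
    case Nil
    then have n: "a \<in> nodes D" and b: "b = a" and r: "r = 0" unfolding path_in_Nil q_in_Nil by blast+
    show ?case unfolding b r using connected_by_refl[OF D n] by simp
  next
    case (Cons p ps)
    obtain s d where p: "p = (s, d)" by (cases p)
    have d: "path_in C G D d ps b" using Cons(2) unfolding p by (simp add: path_in_Cons)
    have n: "a \<in> nodes D" "d \<in> nodes D" using path_in_nodes[OF Cons(2)] path_in_nodes[OF d] by simp_all
    note IH = Cons(1)[OF d refl]
    let ?q = "if s then deg G (node_obj D a) (node_obj D d) (arr_comp C D a d) else - deg G (node_obj D d) (node_obj D a) (arr_comp C D d a)"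
    have "connected_by C G D d a (- ?q)"
    proof (cases s)
      case True
      then show ?thesis using connected_by_step(2)[OF D n] Cons(2) unfolding p by (simp add: path_in_Cons)
    next
      case False
      then show ?thesis using connected_by_step(1)[OF D n(2,1)] Cons(2) unfolding p by (simp add: path_in_Cons)
    qed
    from connected_by_trans[OF IH this] have "connected_by C G D b a (- q_in C G D d ps + - ?q)" .
    moreover have "- q_in C G D d ps + - ?q = - r" using Cons(3) unfolding p by (simp add: q_in_Cons)
    ultimately show ?case by simp
  qed
qed

text \<open>With at most one outgoing edge at each vertex, two paths from the same start can differ
  only by one stopping earlier, and then the longer one would visit the common end twice.\<close>

lemma directed_path_unique:
  assumes f: "\<And>x y z. (x, y) \<in> edges D \<Longrightarrow> (x, z) \<in> edges D \<Longrightarrow> y = z"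
  shows "directed_path D xs \<Longrightarrow> directed_path D ys \<Longrightarrow> hd xs = hd ys \<Longrightarrow> last xs = last ys \<Longrightarrow> xs = ys"
proof (induction xs arbitrary: ys)
  case Nil then show ?case by (simp add: directed_path_def)
next
  case (Cons x xs)
  obtain ys' where y: "ys = x # ys'" using Cons(3,4) by (cases ys) (auto simp: directed_path_def)
  show ?case
  proof (cases xs)
    case Nil
    then have "ys' = []" using Cons(3,5) y by (cases ys' rule: rev_cases) (auto simp: directed_path_def)
    then show ?thesis using Nil y by simp
  next
    case xs: (Cons x' xs')
    have "ys' \<noteq> []"
    proof
      assume "ys' = []"
      then have "last xs = x" using Cons(5) y xs by simp
      moreover have "last xs \<in> set xs" unfolding xs by (rule last_in_set) simp
      ultimately show False using Cons(2) by (simp add: directed_path_def)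
    qed
    then obtain y' zs where y': "ys' = y' # zs" by (cases ys') auto
    have "y' = x'" using Cons(2,3) f[of x x' y'] unfolding y y' xs by (simp add: directed_path_def)
    then have "xs = ys'" using Cons(1)[of ys'] Cons(2,3,5) unfolding y y' xs by (simp add: directed_path_def)
    then show ?thesis using y by simp
  qed
qed

text \<open>This covers single arrows and all subgraphs of the hexagon including the full cycle;
  their commutativity is thus a matter of the shape of the graph.\<close>

lemma commutative_functional:
  assumes "is_diagram C D" "\<And>x y z. (x, y) \<in> edges D \<Longrightarrow> (x, z) \<in> edges D \<Longrightarrow> y = z"
  shows "commutative_diagram C D"
  unfolding commutative_diagram_def
proof (intro conjI allI impI)
  fix xs ys assume a: "directed_path D xs \<and> directed_path D ys \<and> hd xs = hd ys \<and> last xs = last ys"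
  have "xs = ys" by (rule directed_path_unique[of D]) (use assms(2) a in blast)+
  then show "composite C D xs = composite C D ys" by simp
qed (rule assms(1))

context graded_category
begin

text \<open>The increments telescope along the path; on loops they add up to zero, which is how
  potentials give liftability.\<close>

lemma potential_q:
  assumes D: "is_diagram C D" and pot: "potential C G D pot"
  shows "path_in C G D a ps b \<Longrightarrow> q_in C G D a ps = pot b - pot a"
proof (induction ps arbitrary: a)
  case Nil then show ?case by (simp add: path_in_Nil q_in_Nil)
next
  case (Cons p ps)
  obtain s d where p: "p = (s, d)" by (cases p)
  have d: "path_in C G D d ps b" using Cons(2) unfolding p by (simp add: path_in_Cons)
  have n: "a \<in> nodes D" "d \<in> nodes D" using path_in_nodes[OF Cons(2)] path_in_nodes[OF d] by simp_all
  note i = node_indecomposable[OF D n(1)] node_indecomposable[OF D n(2)]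
  show ?case
  proof (cases s)
    case True
    then have e: "(fst a, fst d) \<in> edges D" "arr_comp C D a d \<noteq> zerom C (node_obj D a) (node_obj D d)"
      using Cons(2) unfolding p by (simp_all add: path_in_Cons)
    have "arr_comp C D a d \<in> G (pot d - pot a) (node_obj D a) (node_obj D d)"
      using pot n e(1) unfolding potential_def by blast
    from deg_eq[OF i this e(2)] show ?thesis using Cons(1)[OF d] True unfolding p by (simp add: q_in_Cons)
  next
    case False
    then have e: "(fst d, fst a) \<in> edges D" "arr_comp C D d a \<noteq> zerom C (node_obj D d) (node_obj D a)"
      using Cons(2) unfolding p by (simp_all add: path_in_Cons)
    have "arr_comp C D d a \<in> G (pot a - pot d) (node_obj D d) (node_obj D a)"
      using pot n e(1) unfolding potential_def by blast
    from deg_eq[OF i(2,1) this e(2)] show ?thesis using Cons(1)[OF d] False unfolding p by (simp add: q_in_Cons)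
  qed
qed

lemma potential_liftable:
  assumes D: "commutative_diagram C D" and pot: "potential C G D pot"
  shows "liftable C G D"
proof -
  have dd: "is_diagram C D" using D unfolding commutative_diagram_def by blast
  have "quasi_homogeneous C G (vobj D x) (vobj D y) (arr D (x, y))" if e: "(x, y) \<in> edges D" for x y
  proof -
    have v: "x \<in> verts D" "y \<in> verts D" using dd e unfolding is_diagram_def by blast+
    have "arr D (x, y) \<in> mor C (tot (vobj D x)) (tot (vobj D y))" using dd e unfolding is_diagram_def by blast
    moreover have "homogeneous G (smd (vobj D x) i) (smd (vobj D y) j) (component C (vobj D x) (vobj D y) (arr D (x, y)) i j)"
      if "i < nsum (vobj D x)" "j < nsum (vobj D y)" for i j
    proof -
      have "(x, i) \<in> nodes D" "(y, j) \<in> nodes D" using v that unfolding nodes_def by simp_all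
      then have "arr_comp C D (x, i) (y, j) \<in> G (pot (y, j) - pot (x, i)) (node_obj D (x, i)) (node_obj D (y, j))"
        using pot e unfolding potential_def by fastforce
      then show ?thesis unfolding homogeneous_def arr_comp_def node_obj_def by auto
    qed
    ultimately show ?thesis unfolding quasi_homogeneous_def by blast
  qed
  then show ?thesis unfolding liftable_def using D potential_q[OF dd pot] by auto
qed

text \<open>Each connected component gets a base node \<open>rep\<close>, and the potential of a
  node is the degree of some path from there. A loop from the base node through \<open>a\<close> and
  \<open>b\<close> and back has degree zero, which fixes the increment between \<open>a\<close> and
  \<open>b\<close>.\<close>

lemma liftable_potential:
  assumes L: "liftable C G D"
  shows "\<exists>pot. potential C G D pot"
proof -
  have D: "is_diagram C D" using L unfolding liftable_def commutative_diagram_def by blast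
  let ?c = "connected_by C G D"
  define rep where "rep a = (SOME c. \<exists>r. ?c c a r)" for a
  define pot where "pot a = (SOME r. ?c (rep a) a r)" for a
  have rep: "?c (rep a) a (pot a)" if "a \<in> nodes D" for a
  proof -
    have "\<exists>c r. ?c c a r" using connected_by_refl[OF D that] by blast
    then have "\<exists>r. ?c (rep a) a r" unfolding rep_def by (rule someI_ex)
    then show ?thesis unfolding pot_def by (rule someI_ex)
  qed
  have "arr_comp C D a b \<in> G (pot b - pot a) (node_obj D a) (node_obj D b)"
    if n: "a \<in> nodes D" "b \<in> nodes D" and e: "(fst a, fst b) \<in> edges D" for a b
  proof (cases "arr_comp C D a b = zerom C (node_obj D a) (node_obj D b)")
    case True
    then show ?thesis using G_sub(1)[OF node_indecomposable[OF D n(1)] node_indecomposable[OF D n(2)]] by simp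
  next
    case False
    have "quasi_homogeneous C G (vobj D (fst a)) (vobj D (fst b)) (arr D (fst a, fst b))"
      using L e unfolding liftable_def by blast
    then have h: "homogeneous G (node_obj D a) (node_obj D b) (arr_comp C D a b)"
      unfolding quasi_homogeneous_def arr_comp_def node_obj_def using n unfolding nodes_def by auto
    note s = connected_by_step[OF D n e h False]
    let ?d = "deg G (node_obj D a) (node_obj D b) (arr_comp C D a b)"
    \<comment> \<open>The predicates from which the base nodes of \<open>a\<close> and
      \<open>b\<close> are chosen coincide, so the choices are equal.\<close>
    have "(\<exists>r. ?c x a r) = (\<exists>r. ?c x b r)" for x
      using connected_by_trans[OF _ s(1)] connected_by_trans[OF _ s(2)] by blast
    then have ab: "rep a = rep b" unfolding rep_def by simp
    have "?c (rep b) (rep b) (pot a + ?d + - pot b)"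
      using connected_by_trans[OF connected_by_trans[OF rep[OF n(1)] s(1)] connected_by_sym[OF D rep[OF n(2)]]] unfolding ab .
    moreover have "r = 0" if "?c (rep b) (rep b) r" for r using L that unfolding liftable_def connected_by_def by blast
    ultimately have "pot a + ?d + - pot b = 0" by blast
    then have d: "?d = pot b - pot a" by simp
    obtain x where x: "arr_comp C D a b \<in> G x (node_obj D a) (node_obj D b)" using h unfolding homogeneous_def by blast
    then have "x = ?d" using deg_eq[OF node_indecomposable[OF D n(1)] node_indecomposable[OF D n(2)] x False] by simp
    then show ?thesis using x d by simp
  qed
  then show ?thesis unfolding potential_def by blast
qed

end

section \<open>Triangle diagrams and fundamental hexagons\<close>

context phased_category
begin

lemma tri_obj_dec:
  assumes "is_dec C A" "is_dec C B" "is_dec C Q" shows "is_dec C (tri_obj C A B Q x)"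
  unfolding tri_obj_def by (rule is_dec_shift) (use assms in simp)

lemma tri_obj_eqs:
  assumes "is_dec C A" "is_dec C B" "is_dec C Q"
  shows "tri_obj C A B Q 0 = A" "tri_obj C A B Q 1 = B" "tri_obj C A B Q 2 = Q"
    "tri_obj C A B Q 3 = shift_dec C 1 A" "tri_obj C A B Q 4 = shift_dec C 1 B" "tri_obj C A B Q 5 = shift_dec C 1 Q"
    "tri_obj C A B Q 6 = shift_dec C 2 A"
    "tri_obj C A B Q (x + 6) = shift_dec C 2 (tri_obj C A B Q x)"
proof -
  have "(x + 6) div 3 = 2 + x div 3" "(x + 6) mod 3 = x mod 3" by presburger+
  then show "tri_obj C A B Q (x + 6) = shift_dec C 2 (tri_obj C A B Q x)"
    unfolding tri_obj_def using shift_dec_eqs(2)[OF assms(1)] shift_dec_eqs(2)[OF assms(2)] shift_dec_eqs(2)[OF assms(3)] by simp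
qed (simp_all add: tri_obj_def shift_dec_eqs(1)[OF assms(1)] shift_dec_eqs(1)[OF assms(2)] shift_dec_eqs(1)[OF assms(3)])

lemma tri_arr_mor:
  assumes A: "is_dec C A" and B: "is_dec C B" and Q: "is_dec C Q" and Tr: "(tot A, tot B, tot Q, f, g, h) \<in> Tri C"
  shows "tri_arr C f g h x \<in> mor C (tot (tri_obj C A B Q x)) (tot (tri_obj C A B Q (x + 1)))"
    "tri_arr C f g h (x + 6) = ShiftM C 2 (tri_arr C f g h x)"
proof -
  note t = TriD[OF Tr]
  have "x mod 3 = 0 \<or> x mod 3 = 1 \<or> x mod 3 = 2" by presburger
  then consider "x mod 3 = 0" | "x mod 3 = 1" | "x mod 3 = 2" by blast
  then show "tri_arr C f g h x \<in> mor C (tot (tri_obj C A B Q x)) (tot (tri_obj C A B Q (x + 1)))"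
  proof cases
    case 1
    then have "(x + 1) mod 3 = 1" "(x + 1) div 3 = x div 3" by presburger+
    then show ?thesis using 1 ShiftM_closed[OF t(1,2,6)] unfolding tri_arr_def tri_obj_def by simp
  next
    case 2
    then have "(x + 1) mod 3 = 2" "(x + 1) div 3 = x div 3" by presburger+
    then show ?thesis using 2 ShiftM_closed[OF t(2,3,7)] unfolding tri_arr_def tri_obj_def by simp
  next
    case 3
    then have e: "(x + 1) mod 3 = 0" "(x + 1) div 3 = x div 3 + 1" by presburger+
    show ?thesis using 3 ShiftM_closed[OF t(3,4,8)] unfolding tri_arr_def tri_obj_def e by (simp add: Shift_add[OF t(1)])
  qed
  have "(x + 6) div 3 = 2 + x div 3" "(x + 6) mod 3 = x mod 3" by presburger+
  then show "tri_arr C f g h (x + 6) = ShiftM C 2 (tri_arr C f g h x)"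
    unfolding tri_arr_def using ShiftM_add[OF t(1,2,6)] ShiftM_add[OF t(2,3,7)] ShiftM_add[OF t(3,4,8)] by simp
qed

lemma tri_potential_iff:
  "potential C G (tri_diagram C A B Q f g h V) pot \<longleftrightarrow> (\<forall>x i j. x \<in> V \<longrightarrow> x + 1 \<in> V \<longrightarrow> i < nsum (tri_obj C A B Q x) \<longrightarrow>
     j < nsum (tri_obj C A B Q (x + 1)) \<longrightarrow> component C (tri_obj C A B Q x) (tri_obj C A B Q (x + 1)) (tri_arr C f g h x) i j \<in>
       G (pot (x + 1, j) - pot (x, i)) (smd (tri_obj C A B Q x) i) (smd (tri_obj C A B Q (x + 1)) j))"
  unfolding potential_def nodes_def tri_diagram_def arr_comp_def node_obj_def by auto

lemma tri_diagram_is_diagram: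
  assumes "is_dec C A" "is_dec C B" "is_dec C Q" "(tot A, tot B, tot Q, f, g, h) \<in> Tri C"
  shows "is_diagram C (tri_diagram C A B Q f g h V)"
  unfolding is_diagram_def tri_diagram_def irrefl_def using tri_arr_mor(1)[OF assms] tri_obj_dec[OF assms(1-3)] by auto

text \<open>Naturality moves the isomorphism \<open>\<beta>\<close> past the projection to a
  summand. The components of the closing arrow are therefore those of \<open>h[1]\<close> followed
  by \<open>\<beta>\<close> of a summand, which has degree \<open>0\<close>.\<close>

lemma hexagon_back_component:
  assumes A: "is_dec C A" and Q: "is_dec C Q" and h: "h \<in> mor C (tot Q) (Shift C 1 (tot A))" and ij: "i < nsum Q" "j < nsum A"
    and x: "component C (shift_dec C 1 Q) (shift_dec C 2 A) (ShiftM C 1 h) i j \<in> G a (Shift C 1 (smd Q i)) (Shift C 2 (smd A j))"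
  shows "component C (shift_dec C 1 Q) A (Comp C (\<beta> (tot A)) (ShiftM C 1 h)) i j \<in> G a (Shift C 1 (smd Q i)) (smd A j)"
proof -
  note t = is_dec_simps[OF A] is_dec_simps[OF Q]
  let ?Aj = "smd A j" and ?Q1 = "shift_dec C 1 Q"
  have o: "tot A \<in> Ob C" "Shift C 2 (tot A) \<in> Ob C" "?Aj \<in> Ob C" "Shift C 2 ?Aj \<in> Ob C" "Shift C 1 (tot Q) \<in> Ob C" "Shift C 1 (smd Q i) \<in> Ob C"
    using t(1) t(3)[OF ij(2)] t(6) t(8)[OF ij(1)] Shift_closed by simp_all
  have A2: "Shift C 1 (Shift C 1 (tot A)) = Shift C 2 (tot A)" using Shift_add[OF o(1), of 1 1] by simp
  have h1: "ShiftM C 1 h \<in> mor C (Shift C 1 (tot Q)) (Shift C 2 (tot A))"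
    using ShiftM_closed[OF t(6) Shift_closed[OF o(1)] h, of 1] unfolding A2 .
  have b: "\<beta> (tot A) \<in> mor C (Shift C 2 (tot A)) (tot A)" "\<beta> ?Aj \<in> mor C (Shift C 2 ?Aj) ?Aj"
    using beta_iso[OF o(1)] beta_iso[OF o(3)] is_isom_mor by blast+
  note p = t(5)[OF ij(2)]
  have p2: "ShiftM C 2 (proj A j) \<in> mor C (Shift C 2 (tot A)) (Shift C 2 ?Aj)" by (rule ShiftM_closed[OF o(1,3) p])
  have i1: "ShiftM C 1 (incl Q i) \<in> mor C (Shift C 1 (smd Q i)) (Shift C 1 (tot Q))"
    by (rule ShiftM_closed[OF t(8)[OF ij(1)] t(6) t(9)[OF ij(1)]])
  have "Comp C (proj A j) (Comp C (\<beta> (tot A)) (ShiftM C 1 h)) = Comp C (\<beta> ?Aj) (Comp C (ShiftM C 2 (proj A j)) (ShiftM C 1 h))"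
    unfolding Comp_assoc'[OF h1 b(1) p o(5,2,1,3)] beta_natural[OF o(1,3) p] Comp_assoc'[OF h1 p2 b(2) o(5,2,4,3)] ..
  then have "component C ?Q1 A (Comp C (\<beta> (tot A)) (ShiftM C 1 h)) i j =
     Comp C (\<beta> ?Aj) (component C ?Q1 (shift_dec C 2 A) (ShiftM C 1 h) i j)"
    unfolding component_def shift_dec_nth(2)[OF ij(1)] shift_dec_nth(3)[OF ij(2)]
    using Comp_assoc'[OF i1 Comp_mor[OF h1 p2 o(5,2,4)] b(2) o(6,5,4,3)] by simp
  then show ?thesis
    using G_Comp[OF indecomposable_Shift[OF t(7)[OF ij(1)]] indecomposable_Shift[OF t(2)[OF ij(2)]] t(2)[OF ij(2)] x G_beta[OF t(2)[OF ij(2)]]] by simp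
qed

text \<open>A simply connected subgraph of the six-cycle misses one of its edges. Cut there, the
  cycle unrolls into a segment of the infinite diagram, and the potential of the latter restricts to
  it.\<close>

lemma tri_potential_hexagon:
  assumes A: "is_dec C A" and B: "is_dec C B" and Q: "is_dec C Q" and Tr: "(tot A, tot B, tot Q, f, g, h) \<in> Tri C"
    and pot: "potential C G (tri_diagram C A B Q f g h UNIV) pot"
  shows "fundamental_hexagon C \<beta> G A B Q f g h"
proof -
  note t = TriD[OF Tr]
  let ?H = "hexagon C \<beta> A B Q f g h" and ?o = "tri_obj C A B Q" and ?a = "tri_arr C f g h"
  note eqs = tri_obj_eqs[OF A B Q]
  have P: "component C (?o x) (?o y) (?a x) i j \<in> G (pot (y, j) - pot (x, i)) (smd (?o x) i) (smd (?o y) j)"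
    if "y = x + 1" "i < nsum (?o x)" "j < nsum (?o y)" for x y i j
    using pot that unfolding tri_potential_iff by simp
  \<comment> \<open>The values of \<open>pot\<close> one period later need not be the original ones
    plus a constant, but they grade the same components: the arrow six places further is the shift
    by \<open>[2]\<close>, and \<open>[-2]\<close> preserves degrees.\<close>
  have P6: "component C (?o x) (?o (x + 1)) (?a x) i j \<in> G (pot (x + 7, j) - pot (x + 6, i)) (smd (?o x) i) (smd (?o (x + 1)) j)"
    if ij: "i < nsum (?o x)" "j < nsum (?o (x + 1))" for x i j
  proof -
    have e6: "?o (x + 6) = shift_dec C 2 (?o x)" "?o (x + 7) = shift_dec C 2 (?o (x + 1))"
      using eqs(8)[of x] eqs(8)[of "x + 1"] by (simp_all add: add.assoc)
    note ax = tri_arr_mor[OF A B Q Tr, of x]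
    note dx = tri_obj_dec[OF A B Q]
    have ind: "indecomposable C (smd (?o x) i)" "indecomposable C (smd (?o (x + 1)) j)"
      by (rule is_dec_smd[OF dx ij(1)] is_dec_smd[OF dx ij(2)])+
    note ob = ind[THEN indecomposable_Ob]
    have c: "component C (?o x) (?o (x + 1)) (?a x) i j \<in> mor C (smd (?o x) i) (smd (?o (x + 1)) j)"
      by (rule component_mor[OF dx dx ax(1) ij])
    have "component C (?o (x + 6)) (?o (x + 7)) (?a (x + 6)) i j \<in> G (pot (x + 7, j) - pot (x + 6, i)) (smd (?o (x + 6)) i) (smd (?o (x + 7)) j)"
      by (rule P) (use ij in \<open>simp_all add: e6\<close>)
    then have "ShiftM C 2 (component C (?o x) (?o (x + 1)) (?a x) i j) \<in> G (pot (x + 7, j) - pot (x + 6, i)) (Shift C 2 (smd (?o x) i)) (Shift C 2 (smd (?o (x + 1)) j))"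
      unfolding e6 ax(2) component_shift[OF dx dx ax(1) ij] shift_dec_nth(1)[OF ij(1)] shift_dec_nth(1)[OF ij(2)] .
    from G_shift_int[OF indecomposable_Shift[OF ind(1)] indecomposable_Shift[OF ind(2)] this, of "-2"]
    show ?thesis
      unfolding ShiftM_neg_cancel(2)[OF c ob, of 2] Shift_neg_cancel(2)[OF ob(1), of 2] Shift_neg_cancel(2)[OF ob(2), of 2] .
  qed
  have A2: "Shift C 1 (Shift C 1 (tot A)) = Shift C 2 (tot A)" using Shift_add[OF t(1), of 1 1] by simp
  have bh: "Comp C (\<beta> (tot A)) (ShiftM C 1 h) \<in> mor C (Shift C 1 (tot Q)) (tot A)"
    using Comp_mor[OF ShiftM_closed[OF t(3,4,8), of 1, unfolded A2] is_isom_mor[OF beta_iso[OF t(1)]] Shift_closed[OF t(3)] Shift_closed[OF t(1)] t(1)] .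
  have He: "edges ?H = {(x, x + 1) | x. 0 \<le> x \<and> x < 5} \<union> {(5, 0)}" and Hv: "verts ?H = {0..5}" and Ho: "vobj ?H = ?o"
    and Ha: "\<And>x. x < 5 \<Longrightarrow> arr ?H (x, x + 1) = ?a x" "arr ?H (5, 0) = Comp C (\<beta> (tot A)) (ShiftM C 1 h)"
    unfolding hexagon_def by simp_all
  have am: "arr ?H (x, y) \<in> mor C (tot (?o x)) (tot (?o y))" if "(x, y) \<in> edges ?H" for x y
  proof -
    have "(y = x + 1 \<and> x < 5) \<or> (x = 5 \<and> y = 0)" using that unfolding He by auto
    then show ?thesis
    proof
      assume "y = x + 1 \<and> x < 5"
      then show ?thesis using Ha(1)[of x] tri_arr_mor(1)[OF A B Q Tr, of x] by simp
    next
      assume "x = 5 \<and> y = 0"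
      then show ?thesis using Ha(2) bh eqs(1,6) by simp
    qed
  qed
  have func: "y = z" if "(x, y) \<in> edges ?H" "(x, z) \<in> edges ?H" for x y z using that unfolding He by auto
  have sub: "commutative_diagram C (?H\<lparr>verts := V, edges := E\<rparr>)" if "V \<subseteq> verts ?H" "E \<subseteq> edges ?H \<inter> V \<times> V" for V E
  proof (rule commutative_functional)
    show "is_diagram C (?H\<lparr>verts := V, edges := E\<rparr>)"
      unfolding is_diagram_def
    proof (intro conjI ballI)
      show "irrefl (edges (?H\<lparr>verts := V, edges := E\<rparr>))" using that(2) unfolding irrefl_def He by auto
      show "case e of (x, y) \<Rightarrow> arr (?H\<lparr>verts := V, edges := E\<rparr>) (x, y) \<in> mor C (tot (vobj (?H\<lparr>verts := V, edges := E\<rparr>) x)) (tot (vobj (?H\<lparr>verts := V, edges := E\<rparr>) y))"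
        if "e \<in> edges (?H\<lparr>verts := V, edges := E\<rparr>)" for e
      proof -
        obtain x y where xy: "e = (x, y)" by (cases e)
        then have "(x, y) \<in> edges ?H" using that \<open>E \<subseteq> edges ?H \<inter> V \<times> V\<close> by auto
        then show ?thesis using am unfolding xy by (simp add: Ho)
      qed
    qed (use that(2) tri_obj_dec[OF A B Q] in \<open>auto simp: Ho\<close>)
    show "y = z" if "(x, y) \<in> edges (?H\<lparr>verts := V, edges := E\<rparr>)" "(x, z) \<in> edges (?H\<lparr>verts := V, edges := E\<rparr>)" for x y z
      by (rule func[of x]) (use that \<open>E \<subseteq> edges ?H \<inter> V \<times> V\<close> in auto)
  qed
  have "edges ?H \<subseteq> edges ?H \<inter> verts ?H \<times> verts ?H" unfolding He Hv by auto
  from sub[OF subset_refl this] have comm: "commutative_diagram C ?H" by simp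
  have "liftable C G (?H\<lparr>verts := V, edges := E\<rparr>)"
    if V: "V \<subseteq> verts ?H" and E: "E \<subseteq> edges ?H \<inter> V \<times> V" and sc: "simply_connected V E" for V E
  proof -
    \<comment> \<open>Otherwise all six edges are present and form a cycle of length six.\<close>
    have "\<exists>x0. x0 \<in> {0..5} \<and> (if x0 = 5 then (5, 0) \<notin> E else (x0, x0 + 1) \<notin> E)"
    proof (rule ccontr)
      assume n: "\<not> ?thesis"
      have "(0, 1) \<in> E" "(1, 2) \<in> E" "(2, 3) \<in> E" "(3, 4) \<in> E" "(4, 5) \<in> E" "(5, 0) \<in> E"
        using n[simplified, rule_format, of 0] n[simplified, rule_format, of 1] n[simplified, rule_format, of 2]
          n[simplified, rule_format, of 3] n[simplified, rule_format, of 4] n[simplified, rule_format, of 5] by simp_all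
      then have "3 \<le> length [0, 1, 2, 3, 4, 5 :: int] \<and> distinct [0, 1, 2, 3, 4, 5 :: int] \<and>
          successively (\<lambda>x y. (x, y) \<in> E \<union> E\<inverse>) [0, 1, 2, 3, 4, 5] \<and> (last [0, 1, 2, 3, 4, 5], hd [0, 1, 2, 3, 4, 5]) \<in> E \<union> E\<inverse>"
        by simp
      then show False using sc unfolding simply_connected_def by blast
    qed
    then obtain x0 where x0: "x0 \<in> {0..5}" "if x0 = 5 then (5, 0) \<notin> E else (x0, x0 + 1) \<notin> E" by blast
    \<comment> \<open>Vertices up to the cut are read one period later. The closing arrow then runs
      from place \<open>5\<close> to place \<open>6\<close>, and only the missing edge would see the
      jump.\<close>
    define pt where "pt = (\<lambda>(x, i). pot (if x \<le> x0 then x + 6 else x, i :: nat))"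
    have "potential C G (?H\<lparr>verts := V, edges := E\<rparr>) pt"
      unfolding potential_def
    proof (intro ballI impI)
      fix a b assume n: "a \<in> nodes (?H\<lparr>verts := V, edges := E\<rparr>)" "b \<in> nodes (?H\<lparr>verts := V, edges := E\<rparr>)"
        and "(fst a, fst b) \<in> edges (?H\<lparr>verts := V, edges := E\<rparr>)"
      then have e: "(fst a, fst b) \<in> E" by simp
      obtain x i y j where ab: "a = (x, i)" "b = (y, j)" by (cases a; cases b) auto
      have ij: "i < nsum (?o x)" "j < nsum (?o y)" using n unfolding ab nodes_def Ho[symmetric] by simp_all
      have xy: "(y = x + 1 \<and> 0 \<le> x \<and> x < 5 \<and> x \<noteq> x0) \<or> (x = 5 \<and> y = 0 \<and> x0 \<noteq> 5)"
        using e E x0(2) unfolding ab He by (auto split: if_splits)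
      have "component C (?o x) (?o y) (arr ?H (x, y)) i j \<in> G (pt (y, j) - pt (x, i)) (smd (?o x) i) (smd (?o y) j)"
        using xy
      proof
        assume x: "y = x + 1 \<and> 0 \<le> x \<and> x < 5 \<and> x \<noteq> x0"
        then have xy: "y = x + 1" "x < 5" by simp_all
        note ij' = ij[unfolded xy(1)]
        show ?thesis
        proof (cases "x < x0")
          case True
          then have "pt (y, j) = pot (x + 7, j)" "pt (x, i) = pot (x + 6, i)" unfolding pt_def xy(1) by (simp_all add: add.commute)
          then show ?thesis using P6[OF ij'] unfolding xy(1) Ha(1)[OF xy(2)] by simp
        next
          case False
          then have "pt (y, j) = pot (y, j)" "pt (x, i) = pot (x, i)" using x unfolding pt_def by simp_all
          then show ?thesis using P[OF xy(1) ij] unfolding xy(1) Ha(1)[OF xy(2)] by simp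
        qed
      next
        assume x: "x = 5 \<and> y = 0 \<and> x0 \<noteq> 5"
        then have xy: "x = 5" "y = 0" by simp_all
        have ij': "i < nsum Q" "j < nsum A" using ij unfolding xy eqs by simp_all
        have "component C (?o 5) (?o 6) (?a 5) i j \<in> G (pot (6, j) - pot (5, i)) (smd (?o 5) i) (smd (?o 6) j)"
          by (rule P) (use ij' in \<open>simp_all add: eqs(6,7)\<close>)
        then have "component C (shift_dec C 1 Q) (shift_dec C 2 A) (ShiftM C 1 h) i j \<in> G (pot (6, j) - pot (5, i)) (Shift C 1 (smd Q i)) (Shift C 2 (smd A j))"
          unfolding eqs(6,7) shift_dec_nth(1)[OF ij'(1)] shift_dec_nth(1)[OF ij'(2)] by (simp add: tri_arr_def)
        from hexagon_back_component[OF A Q t(8) ij' this]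
        have "component C (shift_dec C 1 Q) A (Comp C (\<beta> (tot A)) (ShiftM C 1 h)) i j \<in> G (pot (6, j) - pot (5, i)) (Shift C 1 (smd Q i)) (smd A j)" .
        moreover have "pt (0, j) = pot (6, j)" "pt (5, i) = pot (5, i)" using x x0(1) unfolding pt_def by simp_all
        ultimately show ?thesis unfolding xy eqs(1,6) Ha(2) shift_dec_nth(1)[OF ij'(1)] by simp
      qed
      then show "arr_comp C (?H\<lparr>verts := V, edges := E\<rparr>) a b \<in>
          G (pt b - pt a) (node_obj (?H\<lparr>verts := V, edges := E\<rparr>) a) (node_obj (?H\<lparr>verts := V, edges := E\<rparr>) b)"
        unfolding arr_comp_def node_obj_def ab by (simp add: Ho)
    qed
    then show ?thesis by (rule potential_liftable[OF sub[OF V E]])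
  qed
  then show ?thesis unfolding fundamental_hexagon_def locally_liftable_def using A B Q Tr comm by blast
qed

end

section \<open>Lifting cones\<close>

locale maslov_category = phased_category K C \<beta> G \<phi> + pre_liftable C G
  for K :: "'k ring" and C :: "('o, 'm, 'k) tricat" and \<beta> :: "'o \<Rightarrow> 'm" and G :: "real \<Rightarrow> 'o \<Rightarrow> 'o \<Rightarrow> 'm set"
    and \<phi> :: "'o \<Rightarrow> real" +
  assumes degree_phase: "\<lbrakk>indecomposable C E; indecomposable C F; f \<in> G a E F; f \<noteq> zerom C E F\<rbrakk>
      \<Longrightarrow> [a = \<phi> F - \<phi> E] (rmod 2)"
    and maslov_zero: "basic_loop C \<beta> G E p l \<Longrightarrow> maslov_index G E p = 0"
begin

text \<open>The potential makes the hexagon locally liftable, so a connecting path from a summand of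
  \<open>A\<close> to its shift is half of a basic loop, and Maslov index zero says that its degree
  is \<open>1\<close>.\<close>

lemma maslov_path:
  assumes A: "is_dec C A" and B: "is_dec C B" and Q: "is_dec C Q" and Tr: "(tot A, tot B, tot Q, f, g, h) \<in> Tri C"
    and pot: "potential C G (tri_diagram C A B Q f g h UNIV) pot"
    and r: "r < nsum A" and c: "connected_by C G (tri_diagram C A B Q f g h {0..3}) (0, r) (3, r) x"
  shows "x = 1" "pot (3, r) - pot (0, r) = 1"
proof -
  let ?D = "tri_diagram C A B Q f g h {0..3}"
  obtain ps where ps: "path_in C G ?D (0, r) ps (3, r)" "q_in C G ?D (0, r) ps = x" using c unfolding connected_by_def by blast
  have E: "node_obj ?D (0, r) = smd A r"
    unfolding node_obj_def by (simp add: tri_diagram_def tri_obj_eqs[OF A B Q])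
  let ?p = "realise C ?D (0, r) ps"
  have "basic_loop C \<beta> G (smd A r) ?p (?p @ shift_path C 1 ?p @ [(True, \<beta> (smd A r), smd A r)])"
    unfolding basic_loop_def using tri_potential_hexagon[OF A B Q Tr pot] r ps(1) by blast
  from maslov_zero[OF this] have "qpath G (smd A r) ?p = 1" by (simp add: maslov_index_def)
  then show x: "x = 1" using ps(2) unfolding q_in_def E by simp
  have "potential C G ?D pot" using pot unfolding tri_potential_iff by simp
  from potential_q[OF tri_diagram_is_diagram[OF A B Q Tr] this ps(1)] show "pot (3, r) - pot (0, r) = 1" using ps(2) x by simp
qed

text \<open>The shifts by \<open>0\<close> come from \<open>tri_arr\<close>; they disappear where
  \<open>f\<close>, \<open>g\<close> and \<open>h\<close> are known to be the maps of a
  triangle.\<close>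

lemma tri_potentialD:
  assumes A: "is_dec C A" and B: "is_dec C B" and Q: "is_dec C Q"
    and pot: "potential C G (tri_diagram C A B Q f g h UNIV) pot"
  shows "i < nsum A \<Longrightarrow> j < nsum B \<Longrightarrow> component C A B (ShiftM C 0 f) i j \<in> G (pot (1, j) - pot (0, i)) (smd A i) (smd B j)"
    "j < nsum B \<Longrightarrow> s < nsum Q \<Longrightarrow> component C B Q (ShiftM C 0 g) j s \<in> G (pot (2, s) - pot (1, j)) (smd B j) (smd Q s)"
    "s < nsum Q \<Longrightarrow> i < nsum A \<Longrightarrow> component C Q (shift_dec C 1 A) (ShiftM C 0 h) s i \<in> G (pot (3, i) - pot (2, s)) (smd Q s) (Shift C 1 (smd A i))"
    "i < nsum A \<Longrightarrow> j < nsum B \<Longrightarrow> component C (shift_dec C 1 A) (shift_dec C 1 B) (ShiftM C 1 f) i j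
      \<in> G (pot (4, j) - pot (3, i)) (Shift C 1 (smd A i)) (Shift C 1 (smd B j))"
proof -
  note eqs = tri_obj_eqs[OF A B Q]
  have P: "component C (tri_obj C A B Q x) (tri_obj C A B Q y) (tri_arr C f g h x) i j \<in>
      G (pot (y, j) - pot (x, i)) (smd (tri_obj C A B Q x) i) (smd (tri_obj C A B Q y) j)"
    if "y = x + 1" "i < nsum (tri_obj C A B Q x)" "j < nsum (tri_obj C A B Q y)" for x y i j
    using pot that unfolding tri_potential_iff by simp
  show "i < nsum A \<Longrightarrow> j < nsum B \<Longrightarrow> component C A B (ShiftM C 0 f) i j \<in> G (pot (1, j) - pot (0, i)) (smd A i) (smd B j)"
    using P[of 1 0 i j] unfolding eqs by (simp add: tri_arr_def)
  show "j < nsum B \<Longrightarrow> s < nsum Q \<Longrightarrow> component C B Q (ShiftM C 0 g) j s \<in> G (pot (2, s) - pot (1, j)) (smd B j) (smd Q s)"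
    using P[of 2 1 j s] unfolding eqs by (simp add: tri_arr_def)
  show "s < nsum Q \<Longrightarrow> i < nsum A \<Longrightarrow> component C Q (shift_dec C 1 A) (ShiftM C 0 h) s i \<in> G (pot (3, i) - pot (2, s)) (smd Q s) (Shift C 1 (smd A i))"
    using P[of 3 2 s i] unfolding eqs by (simp add: tri_arr_def shift_dec_nth)
  show "i < nsum A \<Longrightarrow> j < nsum B \<Longrightarrow> component C (shift_dec C 1 A) (shift_dec C 1 B) (ShiftM C 1 f) i j
      \<in> G (pot (4, j) - pot (3, i)) (Shift C 1 (smd A i)) (Shift C 1 (smd B j))"
    using P[of 4 3 i j] unfolding eqs by (simp add: tri_arr_def shift_dec_nth)
qed

text \<open>Connectedness of the bipartite graph on the summands of \<open>A\<close> and
  \<open>B\<close> whose edges are the nonzero components of \<open>f\<close>, stated by means of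
  the vertex sets that are unions of components. The empty graph counts as connected.\<close>

definition inseparable :: "('o, 'm) dec \<Rightarrow> ('o, 'm) dec \<Rightarrow> 'm \<Rightarrow> bool" where
  "inseparable A B f \<longleftrightarrow> (\<forall>S R. S \<subseteq> {..<nsum A} \<longrightarrow> R \<subseteq> {..<nsum B} \<longrightarrow>
     (\<forall>i < nsum A. \<forall>j < nsum B. component C A B f i j \<noteq> zerom C (smd A i) (smd B j) \<longrightarrow> (i \<in> S \<longleftrightarrow> j \<in> R)) \<longrightarrow>
     S = {} \<and> R = {} \<or> S = {..<nsum A} \<and> R = {..<nsum B})"

text \<open>Level sets of a function that is constant along edges are unions of components.\<close>

lemma inseparable_constant:
  assumes I: "inseparable A B f"
    and d: "\<And>i j. i < nsum A \<Longrightarrow> j < nsum B \<Longrightarrow> component C A B f i j \<noteq> zerom C (smd A i) (smd B j) \<Longrightarrow> d i = e j"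
  shows "\<exists>k :: real. (\<forall>i < nsum A. d i = k) \<and> (\<forall>j < nsum B. e j = k)"
proof (cases "nsum A = 0 \<and> nsum B = 0")
  case True then show ?thesis by simp
next
  case False
  \<comment> \<open>The value at some vertex that exists: one of the two objects may have no
    summands.\<close>
  define k where "k = (if nsum A = 0 then e 0 else d 0)"
  let ?S = "{i. i < nsum A \<and> d i = k}" and ?R = "{j. j < nsum B \<and> e j = k}"
  have "\<forall>i < nsum A. \<forall>j < nsum B. component C A B f i j \<noteq> zerom C (smd A i) (smd B j) \<longrightarrow> (i \<in> ?S \<longleftrightarrow> j \<in> ?R)"
    using d by auto
  then have "?S = {} \<and> ?R = {} \<or> ?S = {..<nsum A} \<and> ?R = {..<nsum B}"
    using I[unfolded inseparable_def, rule_format, of ?S ?R] by blast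
  moreover have "\<not> (?S = {} \<and> ?R = {})"
  proof (cases "nsum A = 0")
    case True
    then have "0 \<in> ?R" using False unfolding k_def by simp
    then show ?thesis by blast
  next
    case False
    then have "0 \<in> ?S" unfolding k_def by simp
    then show ?thesis by blast
  qed
  ultimately have "?S = {..<nsum A} \<and> ?R = {..<nsum B}" by blast
  then show ?thesis by (intro exI[of _ k]) auto
qed

text \<open>The phases carried by the objects of the lift are a potential on the arrow.\<close>

lemma arrow_liftable:
  assumes X: "X \<in> lift_Ob C \<phi>" and Y: "Y \<in> lift_Ob C \<phi>" and f: "f \<in> lift_mor C G X Y"
  shows "liftable C G (arrow_diagram (fst X) (fst Y) f)"
proof (rule potential_liftable)
  let ?D = "arrow_diagram (fst X) (fst Y) f"
  note fd = lift_morD[OF f]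
  show "commutative_diagram C ?D"
  proof (rule commutative_functional)
    show "is_diagram C ?D" unfolding is_diagram_def arrow_diagram_def irrefl_def
      using lift_ObD(1)[OF X] lift_ObD(1)[OF Y] fd(1) by (simp add: lift_proj_def)
  qed (simp add: arrow_diagram_def)
  show "potential C G ?D (\<lambda>(b, i). if b then snd Y ! i else snd X ! i)"
    unfolding potential_def nodes_def arrow_diagram_def arr_comp_def node_obj_def using fd(2) by auto
qed

text \<open>The potential on the diagram of the triangle has two unknown constants: its offset
  \<open>k0\<close> against the given phases, and the excess \<open>k1\<close> of the shifted source
  over the source, which has to be \<open>1\<close> in the lift. The Maslov condition yields
  \<open>k1 = 1\<close> when a summand of the cone links target and shifted source; when none does,
  the phases of the cone can be corrected separately on the two sides.\<close>

lemma connected_cone: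
  assumes X: "X \<in> lift_Ob C \<phi>" and Y: "Y \<in> lift_Ob C \<phi>" and f: "f \<in> lift_mor C G X Y"
    and I: "inseparable (fst X) (fst Y) f"
  shows "\<exists>Z g h. (X, Y, Z, f, g, h) \<in> Tri T"
proof -
  let ?A = "fst X" and ?B = "fst Y"
  note x = lift_ObD[OF X] and y = lift_ObD[OF Y] and fd = lift_morD[OF f]
  note A = x(1) and B = y(1)
  obtain Q g h where Q: "is_dec C Q" and Tr: "(tot ?A, tot ?B, tot Q, f, g, h) \<in> Tri C"
    and L: "liftable C G (tri_diagram C ?A ?B Q f g h UNIV)"
    using pre_lift_cone[OF A B fd(1)[unfolded lift_proj_def] arrow_liftable[OF X Y f]] by blast
  obtain pot where pot: "potential C G (tri_diagram C ?A ?B Q f g h UNIV) pot" using liftable_potential[OF L] by blast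
  note t = TriD[OF Tr]
  note P = tri_potentialD[OF A B Q pot, unfolded ShiftM_0[OF t(1,2,6)] ShiftM_0[OF t(2,3,7)] ShiftM_0[OF t(3,4,8)]]
  note eqs = tri_obj_eqs[OF A B Q]
  have A1: "is_dec C (shift_dec C 1 ?A)" by (rule is_dec_shift[OF A])
  \<comment> \<open>The phases and the potential both grade the nonzero components of
    \<open>f\<close>, so their difference is constant along edges.\<close>
  obtain k0 where k0: "\<And>i. i < nsum ?A \<Longrightarrow> snd X ! i - pot (0, i) = k0" "\<And>j. j < nsum ?B \<Longrightarrow> snd Y ! j - pot (1, j) = k0"
  proof -
    have "snd X ! i - pot (0, i) = snd Y ! j - pot (1, j)"
      if ij: "i < nsum ?A" "j < nsum ?B" and z: "component C ?A ?B f i j \<noteq> zerom C (smd ?A i) (smd ?B j)" for i j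
      using G_unique[OF x(5)[OF ij(1)] y(5)[OF ij(2)] fd(2)[OF ij] P(1)[OF ij] z] by simp
    from inseparable_constant[OF I, of "\<lambda>i. snd X ! i - pot (0, i)" "\<lambda>j. snd Y ! j - pot (1, j)", OF this] that show ?thesis by blast
  qed
  \<comment> \<open>A component of \<open>f\<close> and its shift have the same degree, so the
    excess on the source equals the excess on the target along edges.\<close>
  obtain k1 where k1: "\<And>i. i < nsum ?A \<Longrightarrow> pot (3, i) - pot (0, i) = k1"
  proof -
    have "pot (3, i) - pot (0, i) = pot (4, j) - pot (1, j)"
      if ij: "i < nsum ?A" "j < nsum ?B" and z: "component C ?A ?B f i j \<noteq> zerom C (smd ?A i) (smd ?B j)" for i j
    proof -
      note ind = x(5)[OF ij(1)] y(5)[OF ij(2)]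
      note o = ind[THEN indecomposable_Ob]
      note cm = component_mor[OF A B t(6) ij]
      have "ShiftM C 1 (component C ?A ?B f i j) \<in> G (pot (4, j) - pot (3, i)) (Shift C 1 (smd ?A i)) (Shift C 1 (smd ?B j))"
        using P(4)[OF ij] unfolding component_shift[OF A B t(6) ij] .
      moreover have "ShiftM C 1 (component C ?A ?B f i j) \<in> G (pot (1, j) - pot (0, i)) (Shift C 1 (smd ?A i)) (Shift C 1 (smd ?B j))"
        by (rule G_shift_int[OF ind P(1)[OF ij]])
      moreover have "ShiftM C 1 (component C ?A ?B f i j) \<noteq> zerom C (Shift C 1 (smd ?A i)) (Shift C 1 (smd ?B j))"
        using ShiftM_inj[OF cm zero_mor[OF o] o, of 1] z ShiftM_zero[OF o, of 1] by metis
      ultimately have "pot (4, j) - pot (3, i) = pot (1, j) - pot (0, i)"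
        by (rule G_unique[OF indecomposable_Shift[OF ind(1)] indecomposable_Shift[OF ind(2)]])
      then show ?thesis by simp
    qed
    from inseparable_constant[OF I, of "\<lambda>i. pot (3, i) - pot (0, i)" "\<lambda>j. pot (4, j) - pot (1, j)", OF this] that show ?thesis by blast
  qed
  let ?D = "tri_diagram C ?A ?B Q f g h {0..3}"
  let ?c = "connected_by C G ?D"
  have D: "is_diagram C ?D" by (rule tri_diagram_is_diagram[OF A B Q Tr])
  have nd: "(0, i) \<in> nodes ?D \<longleftrightarrow> i < nsum ?A" "(1, i) \<in> nodes ?D \<longleftrightarrow> i < nsum ?B" "(2, i) \<in> nodes ?D \<longleftrightarrow> i < nsum Q"
    "(3, i) \<in> nodes ?D \<longleftrightarrow> i < nsum ?A" for i
    unfolding nodes_def tri_diagram_def by (simp_all add: eqs)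
  have no: "node_obj ?D (0, i) = smd ?A i" "node_obj ?D (1, i) = smd ?B i" "node_obj ?D (2, i) = smd Q i"
    "i < nsum ?A \<Longrightarrow> node_obj ?D (3, i) = Shift C 1 (smd ?A i)" for i
    unfolding node_obj_def tri_diagram_def by (simp_all add: eqs shift_dec_nth)
  have ac: "arr_comp C ?D (0, i) (1, j) = component C ?A ?B f i j" "arr_comp C ?D (1, j) (2, s) = component C ?B Q g j s"
    "arr_comp C ?D (2, s) (3, i) = component C Q (shift_dec C 1 ?A) h s i" for i j s
    unfolding arr_comp_def tri_diagram_def
    using ShiftM_0[OF t(1,2,6)] ShiftM_0[OF t(2,3,7)] ShiftM_0[OF t(3,4,8)] by (simp_all add: eqs tri_arr_def)
  have ed: "(0, 1) \<in> edges ?D" "(1, 2) \<in> edges ?D" "(2, 3) \<in> edges ?D" unfolding tri_diagram_def by simp_all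
  have step: "?c a b (deg G (node_obj ?D a) (node_obj ?D b) (arr_comp C ?D a b)) \<and> ?c b a (- deg G (node_obj ?D a) (node_obj ?D b) (arr_comp C ?D a b))"
    if "a \<in> nodes ?D" "b \<in> nodes ?D" "(fst a, fst b) \<in> edges ?D" "arr_comp C ?D a b \<in> G w (node_obj ?D a) (node_obj ?D b)"
      "arr_comp C ?D a b \<noteq> zerom C (node_obj ?D a) (node_obj ?D b)" for a b w
    using connected_by_step[OF D that(1,2,3) _ that(5)] that(4) unfolding homogeneous_def by blast
  \<comment> \<open>The nodes reachable from \<open>(0, i)\<close> form a union of components; by
    inseparability it is everything.\<close>
  have AB: "\<exists>r. ?c (0, i) (1, j) r" if i: "i < nsum ?A" and j: "j < nsum ?B" for i j
  proof -
    let ?S = "{i'. i' < nsum ?A \<and> (\<exists>r. ?c (0, i) (0, i') r)}" and ?R = "{j'. j' < nsum ?B \<and> (\<exists>r. ?c (0, i) (1, j') r)}"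
    have "i' \<in> ?S \<longleftrightarrow> j' \<in> ?R" if ij: "i' < nsum ?A" "j' < nsum ?B" and z: "component C ?A ?B f i' j' \<noteq> zerom C (smd ?A i') (smd ?B j')" for i' j'
    proof -
      have "\<exists>r. ?c (0, i') (1, j') r \<and> ?c (1, j') (0, i') (- r)"
        using step[of "(0, i')" "(1, j')" "pot (1, j') - pot (0, i')"] ij z P(1)[OF ij] ed unfolding ac nd no by auto
      then show ?thesis using connected_by_trans ij by blast
    qed
    then have "?S = {} \<and> ?R = {} \<or> ?S = {..<nsum ?A} \<and> ?R = {..<nsum ?B}"
      using I[unfolded inseparable_def, rule_format, of ?S ?R] by blast
    moreover have "i \<in> ?S" using i connected_by_refl[OF D, of "(0, i)"] nd by blast
    ultimately have "j \<in> ?R" using j by blast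
    then show ?thesis by blast
  qed
  \<comment> \<open>A summand of the cone that is seen by \<open>g\<close> and by \<open>h\<close>
    completes a path from a summand of the source to the same summand of its shift.\<close>
  have k1_1: "k1 = 1" if s: "s < nsum Q" and j: "j < nsum ?B" and i: "i < nsum ?A"
    and gz: "component C ?B Q g j s \<noteq> zerom C (smd ?B j) (smd Q s)"
    and hz: "component C Q (shift_dec C 1 ?A) h s i \<noteq> zerom C (smd Q s) (Shift C 1 (smd ?A i))" for s j i
  proof -
    obtain r1 where 1: "?c (0, i) (1, j) r1" using AB[OF i j] by blast
    obtain r2 where 2: "?c (1, j) (2, s) r2"
      using step[of "(1, j)" "(2, s)" "pot (2, s) - pot (1, j)"] s j gz P(2)[OF j s] ed unfolding ac nd no by auto
    obtain r3 where 3: "?c (2, s) (3, i) r3"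
      using step[of "(2, s)" "(3, i)" "pot (3, i) - pot (2, s)"] s i hz P(3)[OF s i] ed unfolding ac nd no(3) no(4)[OF i] by auto
    from maslov_path(2)[OF A B Q Tr pot i connected_by_trans[OF connected_by_trans[OF 1 2] 3]] k1[OF i] show ?thesis by simp
  qed
  let ?gz = "\<lambda>s. \<exists>j < nsum ?B. component C ?B Q g j s \<noteq> zerom C (smd ?B j) (smd Q s)"
  let ?hz = "\<lambda>s. \<exists>i < nsum ?A. component C Q (shift_dec C 1 ?A) h s i \<noteq> zerom C (smd Q s) (Shift C 1 (smd ?A i))"
  \<comment> \<open>A summand seen by \<open>g\<close> is normalised against the target. One seen
    only by \<open>h\<close> is normalised against the shifted source, whose phases in the lift
    exceed those of the source by \<open>1\<close> and not by \<open>k1\<close>, hence the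
    correction \<open>1 - k1\<close>. One seen by neither is unconstrained and gets its own phase as
    a default value.\<close>
  define th where "th s = (if ?gz s then pot (2, s) + k0 else if ?hz s then pot (2, s) + k0 + 1 - k1 else \<phi> (smd Q s))" for s
  have th_g: "th s = pot (2, s) + k0" if "s < nsum Q" "j < nsum ?B" "component C ?B Q g j s \<noteq> zerom C (smd ?B j) (smd Q s)" for s j
    using that unfolding th_def by auto
  have th_h: "th s = pot (2, s) + k0 + 1 - k1" if h: "s < nsum Q" "i < nsum ?A" "component C Q (shift_dec C 1 ?A) h s i \<noteq> zerom C (smd Q s) (Shift C 1 (smd ?A i))" for s i
  proof (cases "?gz s")
    case True
    then have "k1 = 1" using k1_1[OF h(1) _ h(2) _ h(3)] by blast
    then show ?thesis using True unfolding th_def by simp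
  next
    case False
    then show ?thesis using h unfolding th_def by auto
  qed
  have Qi: "indecomposable C (smd Q s)" if "s < nsum Q" for s by (rule is_dec_smd[OF Q that])
  \<comment> \<open>The congruence is carried over from the neighbour that was used for the
    normalisation, by \<open>degree_phase\<close>.\<close>
  have ph: "[th s = \<phi> (smd Q s)] (rmod 2)" if s: "s < nsum Q" for s
  proof -
    consider (g) "?gz s" | (h) "\<not> ?gz s" "?hz s" | (n) "\<not> ?gz s" "\<not> ?hz s" by blast
    then show ?thesis
    proof cases
      case g
      then obtain j where j: "j < nsum ?B" "component C ?B Q g j s \<noteq> zerom C (smd ?B j) (smd Q s)" by blast
      obtain n :: int where n: "pot (2, s) - pot (1, j) - (\<phi> (smd Q s) - \<phi> (smd ?B j)) = 2 * of_int n"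
        using degree_phase[OF y(5)[OF j(1)] Qi[OF s] P(2)[OF j(1) s] j(2)] unfolding rcong2_iff by blast
      obtain m :: int where m: "snd Y ! j - \<phi> (smd ?B j) = 2 * of_int m" using y(3)[OF j(1)] unfolding rcong2_iff by blast
      have "th s - \<phi> (smd Q s) = 2 * of_int (n + m)" using n m th_g[OF s j] k0(2)[OF j(1)] by simp
      then show ?thesis unfolding rcong2_iff by blast
    next
      case h
      then obtain i where i: "i < nsum ?A" "component C Q (shift_dec C 1 ?A) h s i \<noteq> zerom C (smd Q s) (Shift C 1 (smd ?A i))" by blast
      obtain n :: int where n: "pot (3, i) - pot (2, s) - (\<phi> (Shift C 1 (smd ?A i)) - \<phi> (smd Q s)) = 2 * of_int n"
        using degree_phase[OF Qi[OF s] indecomposable_Shift[OF x(5)[OF i(1)]] P(3)[OF s i(1)] i(2)] unfolding rcong2_iff by blast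
      obtain m :: int where m: "snd X ! i - \<phi> (smd ?A i) = 2 * of_int m" using x(3)[OF i(1)] unfolding rcong2_iff by blast
      obtain l :: int where l: "\<phi> (Shift C 1 (smd ?A i)) - (\<phi> (smd ?A i) + 1) = 2 * of_int l" using phi_shift[OF x(5)[OF i(1)]] unfolding rcong2_iff by blast
      have "th s - \<phi> (smd Q s) = 2 * of_int (m - n - l)" using n m l th_h[OF s i] k0(1)[OF i(1)] k1[OF i(1)] by simp
      then show ?thesis unfolding rcong2_iff by blast
    next
      case n
      then have "th s = \<phi> (smd Q s)" unfolding th_def by (simp only: if_False)
      then show ?thesis by simp
    qed
  qed
  define Z where "Z = (Q, map th [0..<nsum Q])"
  have Zs: "fst Z = Q" "s < nsum Q \<Longrightarrow> snd Z ! s = th s" for s unfolding Z_def by simp_all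
  have Z: "Z \<in> lift_Ob C \<phi>" unfolding lift_Ob_def Z_def using Q ph by simp
  have "g \<in> lift_mor C G Y Z"
  proof (rule lift_morI)
    show "g \<in> mor C (lift_proj Y) (lift_proj Z)" unfolding lift_proj_def Zs by (rule t(7))
    fix j s assume js: "j < nsum ?B" "s < nsum (fst Z)"
    then have s: "s < nsum Q" by (simp add: Zs)
    show "component C ?B (fst Z) g j s \<in> G (snd Z ! s - snd Y ! j) (smd ?B j) (smd (fst Z) s)"
    proof (cases "component C ?B Q g j s = zerom C (smd ?B j) (smd Q s)")
      case True
      then show ?thesis unfolding Zs using G_sub(1)[OF y(5)[OF js(1)] Qi[OF s]] by simp
    next
      case False
      have "snd Z ! s - snd Y ! j = pot (2, s) - pot (1, j)" using th_g[OF s js(1) False] k0(2)[OF js(1)] Zs(2)[OF s] by simp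
      then show ?thesis unfolding Zs(1) using P(2)[OF js(1) s] by simp
    qed
  qed
  moreover have "h \<in> lift_mor C G Z (lift_shift C 1 X)"
  proof (rule lift_morI)
    show "h \<in> mor C (lift_proj Z) (lift_proj (lift_shift C 1 X))" unfolding T_sel(10) unfolding lift_proj_def Zs by (rule t(8))
    fix s i assume si: "s < nsum (fst Z)" "i < nsum (fst (lift_shift C 1 X))"
    then have s: "s < nsum Q" and i: "i < nsum ?A" by (simp_all add: Zs lift_shift_sel(1)[OF X])
    show "component C (fst Z) (fst (lift_shift C 1 X)) h s i \<in> G (snd (lift_shift C 1 X) ! i - snd Z ! s) (smd (fst Z) s) (smd (fst (lift_shift C 1 X)) i)"
      unfolding lift_shift_sel(1)[OF X] lift_shift_sel(2)[OF X i] shift_dec_nth(1)[OF i] Zs(1)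
    proof (cases "component C Q (shift_dec C 1 ?A) h s i = zerom C (smd Q s) (Shift C 1 (smd ?A i))")
      case True
      then show "component C Q (shift_dec C 1 ?A) h s i \<in> G (snd X ! i + of_int 1 - snd Z ! s) (smd Q s) (Shift C 1 (smd ?A i))"
        using G_sub(1)[OF Qi[OF s] indecomposable_Shift[OF x(5)[OF i]]] by simp
    next
      case False
      have "snd X ! i + of_int 1 - snd Z ! s = pot (3, i) - pot (2, s)"
        using th_h[OF s i False] k0(1)[OF i] k1[OF i] Zs(2)[OF s] by simp
      then show "component C Q (shift_dec C 1 ?A) h s i \<in> G (snd X ! i + of_int 1 - snd Z ! s) (smd Q s) (Shift C 1 (smd ?A i))"
        using P(3)[OF s i] by simp
    qed
  qed
  ultimately have "(X, Y, Z, f, g, h) \<in> Tri T" unfolding Tri_T using X Y Z f Tr by (simp add: lift_proj_def Zs)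
  then show ?thesis by blast
qed

end

section \<open>Block decompositions of objects and morphisms of the lift\<close>

context phased_category
begin

lemma T_subobject:
  assumes X: "X \<in> lift_Ob C \<phi>" and ks: "\<And>k. k \<in> set ks \<Longrightarrow> k < nsum (fst X)"
  shows "\<exists>A \<in> lift_Ob C \<phi>. nsum (fst A) = length ks \<and>
    (\<forall>i < length ks. smd (fst A) i = smd (fst X) (ks ! i) \<and> snd A ! i = snd X ! (ks ! i))"
proof -
  note x = lift_ObD[OF X]
  have "indecomposable C E" if "E \<in> set (map (smd (fst X)) ks)" for E
    using that ks x(5) by auto
  then obtain D where D: "is_dec C D" "map fst (snd D) = map (smd (fst X)) ks"
    using ex_dec_of_list[of "map (smd (fst X)) ks"] by blast
  have n: "nsum D = length ks" using arg_cong[OF D(2), of length] by simp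
  have s: "smd D i = smd (fst X) (ks ! i)" if "i < length ks" for i
    using arg_cong[OF D(2), of "\<lambda>l. l ! i"] that n by (simp add: smd_def)
  let ?A = "(D, map (\<lambda>k. snd X ! k) ks)"
  have "?A \<in> lift_Ob C \<phi>" unfolding lift_Ob_def using D(1) n s x(3) ks by simp
  then show ?thesis using n s by (intro bexI[of _ ?A]) simp_all
qed

text \<open>The components of the structure maps belong to the conclusion, because off-diagonal
  blocks of a morphism are shown to vanish entry by entry.\<close>

lemma T_split:
  assumes X: "X \<in> lift_Ob C \<phi>" and S: "S \<subseteq> {..<nsum (fst X)}"
  obtains A B i1 i2 p1 p2 s s' where "A \<in> lift_Ob C \<phi>" "B \<in> lift_Ob C \<phi>" "biproduct T A B X i1 i2 p1 p2"
    "nsum (fst A) = card S" "nsum (fst B) = nsum (fst X) - card S"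
    "\<And>k. k < nsum (fst A) \<Longrightarrow> s k \<in> S \<and> smd (fst X) (s k) = smd (fst A) k \<and> snd X ! (s k) = snd A ! k"
    "\<And>k. k < nsum (fst B) \<Longrightarrow> s' k \<in> {..<nsum (fst X)} - S \<and> smd (fst X) (s' k) = smd (fst B) k \<and> snd X ! (s' k) = snd B ! k"
    "\<And>k j. k < nsum (fst A) \<Longrightarrow> j < nsum (fst X) \<Longrightarrow> component C (fst A) (fst X) i1 k j =
      (if j = s k then Idm C (smd (fst A) k) else zerom C (smd (fst A) k) (smd (fst X) j))"
    "\<And>k j. k < nsum (fst A) \<Longrightarrow> j < nsum (fst X) \<Longrightarrow> component C (fst X) (fst A) p1 j k =
      (if j = s k then Idm C (smd (fst A) k) else zerom C (smd (fst X) j) (smd (fst A) k))"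
    "\<And>k j. k < nsum (fst B) \<Longrightarrow> j < nsum (fst X) \<Longrightarrow> component C (fst B) (fst X) i2 k j =
      (if j = s' k then Idm C (smd (fst B) k) else zerom C (smd (fst B) k) (smd (fst X) j))"
    "\<And>k j. k < nsum (fst B) \<Longrightarrow> j < nsum (fst X) \<Longrightarrow> component C (fst X) (fst B) p2 j k =
      (if j = s' k then Idm C (smd (fst B) k) else zerom C (smd (fst X) j) (smd (fst B) k))"
proof -
  let ?n = "nsum (fst X)"
  have fS: "finite S" "finite ({..<?n} - S)" using S finite_subset by auto
  define ks where "ks = sorted_list_of_set S"
  define ls where "ls = sorted_list_of_set ({..<?n} - S)"
  have ks: "set ks = S" "distinct ks" "length ks = card S" and ls: "set ls = {..<?n} - S" "distinct ls" "length ls = ?n - card S"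
    unfolding ks_def ls_def using fS S by (simp_all add: card_Diff_subset)
  obtain A where A: "A \<in> lift_Ob C \<phi>" "nsum (fst A) = length ks"
      "\<And>i. i < length ks \<Longrightarrow> smd (fst A) i = smd (fst X) (ks ! i) \<and> snd A ! i = snd X ! (ks ! i)"
    using T_subobject[OF X, of ks] ks(1) S by blast
  obtain B where B: "B \<in> lift_Ob C \<phi>" "nsum (fst B) = length ls"
      "\<And>i. i < length ls \<Longrightarrow> smd (fst B) i = smd (fst X) (ls ! i) \<and> snd B ! i = snd X ! (ls ! i)"
    using T_subobject[OF X, of ls] ls(1) by blast
  have im: "(!) ks ` {..<nsum (fst A)} = S" "(!) ls ` {..<nsum (fst B)} = {..<?n} - S"
  proof -
    have nth: "(!) xs ` {..<length xs} = set xs" for xs :: "nat list" by (auto simp: set_conv_nth)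
    show "(!) ks ` {..<nsum (fst A)} = S" "(!) ls ` {..<nsum (fst B)} = {..<?n} - S"
      unfolding A(2) B(2) nth by (rule ks(1) ls(1))+
  qed
  have s: "ks ! k \<in> S \<and> smd (fst X) (ks ! k) = smd (fst A) k \<and> snd X ! (ks ! k) = snd A ! k" if "k < nsum (fst A)" for k
    using that A(3) ks(1) nth_mem[of k ks] unfolding A(2) by simp
  have s': "ls ! k \<in> {..<?n} - S \<and> smd (fst X) (ls ! k) = smd (fst B) k \<and> snd X ! (ls ! k) = snd B ! k" if "k < nsum (fst B)" for k
    using that B(3) ls(1) nth_mem[of k ls] unfolding B(2) by simp
  have s1: "ks ! k < ?n \<and> smd (fst X) (ks ! k) = smd (fst A) k \<and> snd X ! (ks ! k) = snd A ! k" if "k < nsum (fst A)" for k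
    using s[OF that] S by blast
  have s1': "ls ! k < ?n \<and> smd (fst X) (ls ! k) = smd (fst B) k \<and> snd X ! (ls ! k) = snd B ! k" if "k < nsum (fst B)" for k
    using s'[OF that] by blast
  have inj: "inj_on ((!) ks) {..<nsum (fst A)}" "inj_on ((!) ls) {..<nsum (fst B)}"
    unfolding A(2) B(2) using ks(2) ls(2) by (simp_all add: inj_on_nth)
  let ?M = "\<lambda>A (s :: nat \<Rightarrow> nat) i j. if j = s i then Idm C (smd A i) else zerom C (smd A i) (smd (fst X) j)"
  let ?N = "\<lambda>A (s :: nat \<Rightarrow> nat) j i. if j = s i then Idm C (smd A i) else zerom C (smd (fst X) j) (smd A i)"
  obtain i1 i2 p1 p2 where bp: "biproduct T A B X i1 i2 p1 p2"
     and e: "i1 = of_mat C (fst A) (fst X) (?M (fst A) ((!) ks))" "p1 = of_mat C (fst X) (fst A) (?N (fst A) ((!) ks))"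
      "i2 = of_mat C (fst B) (fst X) (?M (fst B) ((!) ls))" "p2 = of_mat C (fst X) (fst B) (?N (fst B) ((!) ls))"
    using T_block_biproduct[OF A(1) B(1) X s1 s1' inj] unfolding im using S by blast
  have mor: "?M (fst Y) r k j \<in> mor C (smd (fst Y) k) (smd (fst X) j)" "?N (fst Y) r j k \<in> mor C (smd (fst X) j) (smd (fst Y) k)"
    if "Y \<in> lift_Ob C \<phi>" "k < nsum (fst Y)" "j < ?n" "smd (fst X) (r k) = smd (fst Y) k" for Y r k j
    using that is_dec_smd_Ob[OF lift_ObD(1)[OF X] that(3)] is_dec_smd_Ob[OF lift_ObD(1)[OF that(1)] that(2)] Idm_closed[of "smd (fst Y) k"]
    by auto
  note a = lift_ObD(1)[OF A(1)] and b = lift_ObD(1)[OF B(1)] and x = lift_ObD(1)[OF X]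
  show ?thesis
  proof (rule that[OF A(1) B(1) bp _ _ s s'])
    show "nsum (fst A) = card S" "nsum (fst B) = ?n - card S" using A(2) B(2) ks(3) ls(3) by simp_all
    show "component C (fst A) (fst X) i1 k j = ?M (fst A) ((!) ks) k j" if "k < nsum (fst A)" "j < ?n" for k j
      unfolding e by (rule component_of_mat[OF a x _ that]) (rule mor(1)[OF A(1)], use s in simp_all)
    show "component C (fst X) (fst A) p1 j k = ?N (fst A) ((!) ks) j k" if "k < nsum (fst A)" "j < ?n" for k j
      unfolding e by (rule component_of_mat[OF x a _ that(2,1)]) (rule mor(2)[OF A(1)], use s in simp_all)
    show "component C (fst B) (fst X) i2 k j = ?M (fst B) ((!) ls) k j" if "k < nsum (fst B)" "j < ?n" for k j
      unfolding e by (rule component_of_mat[OF b x _ that]) (rule mor(1)[OF B(1)], use s' in simp_all)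
    show "component C (fst X) (fst B) p2 j k = ?N (fst B) ((!) ls) j k" if "k < nsum (fst B)" "j < ?n" for k j
      unfolding e by (rule component_of_mat[OF x b _ that(2,1)]) (rule mor(2)[OF B(1)], use s' in simp_all)
  qed
qed

text \<open>Multiplication by 0-1 matrices on both sides selects the entry of \<open>f\<close> at
  \<open>(u, w)\<close>.\<close>

lemma component_block:
  assumes X: "X \<in> lift_Ob C \<phi>" and Y: "Y \<in> lift_Ob C \<phi>" and A: "A \<in> lift_Ob C \<phi>" and B: "B \<in> lift_Ob C \<phi>"
    and f: "f \<in> mor C (lift_proj X) (lift_proj Y)" and i: "i \<in> mor C (lift_proj A) (lift_proj X)" and p: "p \<in> mor C (lift_proj Y) (lift_proj B)"
    and kl: "k < nsum (fst A)" "l < nsum (fst B)"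
    and s: "u < nsum (fst X)" "smd (fst X) u = smd (fst A) k" and r: "w < nsum (fst Y)" "smd (fst Y) w = smd (fst B) l"
    and ci: "\<And>j. j < nsum (fst X) \<Longrightarrow> component C (fst A) (fst X) i k j =
      (if j = u then Idm C (smd (fst A) k) else zerom C (smd (fst A) k) (smd (fst X) j))"
    and cp: "\<And>j. j < nsum (fst Y) \<Longrightarrow> component C (fst Y) (fst B) p j l =
      (if j = w then Idm C (smd (fst B) l) else zerom C (smd (fst Y) j) (smd (fst B) l))"
  shows "component C (fst A) (fst B) (Comp C p (Comp C f i)) k l = component C (fst X) (fst Y) f u w"
proof -
  note x = lift_ObD[OF X] and y = lift_ObD[OF Y] and a = lift_ObD[OF A] and b = lift_ObD[OF B]
  have fi: "Comp C f i \<in> mor C (lift_proj A) (lift_proj Y)" by (rule Comp_mor[OF i f a(4) x(4) y(4)])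
  have 1: "component C (fst A) (fst Y) (Comp C f i) k j = component C (fst X) (fst Y) f u j" if j: "j < nsum (fst Y)" for j
  proof -
    have "component C (fst A) (fst Y) (Comp C f i) k j = Comp C (component C (fst X) (fst Y) f u j) (component C (fst A) (fst X) i k u)"
      by (rule component_delta_Comp[OF a(1) x(1) y(1) i[unfolded lift_proj_def] f[unfolded lift_proj_def] kl(1) j s(1)]) (simp add: ci)
    also have "\<dots> = component C (fst X) (fst Y) f u j"
      unfolding ci[OF s(1)] using Comp_Idm'[OF component_mor[OF x(1) y(1) f[unfolded lift_proj_def] s(1) j]
        is_dec_smd_Ob[OF x(1) s(1)] is_dec_smd_Ob[OF y(1) j]] s(2) by simp
    finally show ?thesis .
  qed
  have "component C (fst A) (fst B) (Comp C p (Comp C f i)) k l =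
      Comp C (component C (fst Y) (fst B) p w l) (component C (fst A) (fst Y) (Comp C f i) k w)"
    by (rule component_delta_Comp[OF a(1) y(1) b(1) fi[unfolded lift_proj_def] p[unfolded lift_proj_def] kl r(1)]) (simp add: cp)
  also have "\<dots> = component C (fst X) (fst Y) f u w"
    unfolding cp[OF r(1)] 1[OF r(1)] using Idm_Comp'[OF component_mor[OF x(1) y(1) f[unfolded lift_proj_def] s(1) r(1)]
        is_dec_smd_Ob[OF x(1) s(1)] is_dec_smd_Ob[OF y(1) r(1)]] r(2) by simp
  finally show ?thesis .
qed

end

section \<open>Cones of arbitrary morphisms of the lift\<close>

context maslov_category
begin

text \<open>Induction on the total number of summands. A pair \<open>(S, R)\<close> that violates
  inseparability makes \<open>f\<close> block diagonal with respect to \<open>S\<close>,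
  \<open>R\<close> and their complements, and the sum of the cones of the two blocks is a cone of
  \<open>f\<close>. The recursion ends at inseparable maps, among them the map between objects
  without summands.\<close>

lemma cone_exists:
  "\<lbrakk>X \<in> lift_Ob C \<phi>; Y \<in> lift_Ob C \<phi>; f \<in> lift_mor C G X Y\<rbrakk> \<Longrightarrow> \<exists>Z g h. (X, Y, Z, f, g, h) \<in> Tri T"
proof (induction "nsum (fst X) + nsum (fst Y)" arbitrary: X Y f rule: less_induct)
  case less
  note X = less(2) and Y = less(3) and f = less(4)
  show ?case
  proof (cases "inseparable (fst X) (fst Y) f")
    case True
    then show ?thesis by (rule connected_cone[OF X Y f])
  next
    case False
    then obtain S R where S: "S \<subseteq> {..<nsum (fst X)}" and R: "R \<subseteq> {..<nsum (fst Y)}"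
      and sep: "\<forall>i < nsum (fst X). \<forall>j < nsum (fst Y). component C (fst X) (fst Y) f i j \<noteq> zerom C (smd (fst X) i) (smd (fst Y) j) \<longrightarrow> (i \<in> S \<longleftrightarrow> j \<in> R)"
      and ne: "\<not> (S = {} \<and> R = {})" and nf: "\<not> (S = {..<nsum (fst X)} \<and> R = {..<nsum (fst Y)})"
      unfolding inseparable_def by blast
    interpret LT: category_with_shift K T by (rule T_shift)
    note x = lift_ObD[OF X] and y = lift_ObD[OF Y] and fm = lift_morD(1)[OF f]
    obtain X1 X2 i1 i2 p1 p2 s s' where X1: "X1 \<in> lift_Ob C \<phi>" and X2: "X2 \<in> lift_Ob C \<phi>" and bX: "biproduct T X1 X2 X i1 i2 p1 p2"
      and nX: "nsum (fst X1) = card S" "nsum (fst X2) = nsum (fst X) - card S"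
      and s: "\<And>k. k < nsum (fst X1) \<Longrightarrow> s k \<in> S \<and> smd (fst X) (s k) = smd (fst X1) k \<and> snd X ! (s k) = snd X1 ! k"
      and s': "\<And>k. k < nsum (fst X2) \<Longrightarrow> s' k \<in> {..<nsum (fst X)} - S \<and> smd (fst X) (s' k) = smd (fst X2) k \<and> snd X ! (s' k) = snd X2 ! k"
      and ci1: "\<And>k j. k < nsum (fst X1) \<Longrightarrow> j < nsum (fst X) \<Longrightarrow> component C (fst X1) (fst X) i1 k j =
        (if j = s k then Idm C (smd (fst X1) k) else zerom C (smd (fst X1) k) (smd (fst X) j))"
      and ci2: "\<And>k j. k < nsum (fst X2) \<Longrightarrow> j < nsum (fst X) \<Longrightarrow> component C (fst X2) (fst X) i2 k j =
        (if j = s' k then Idm C (smd (fst X2) k) else zerom C (smd (fst X2) k) (smd (fst X) j))"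
      by (rule T_split[OF X S]) (rule that, assumption+)
    obtain Y1 Y2 j1 j2 q1 q2 r r' where Y1: "Y1 \<in> lift_Ob C \<phi>" and Y2: "Y2 \<in> lift_Ob C \<phi>" and bY: "biproduct T Y1 Y2 Y j1 j2 q1 q2"
      and nY: "nsum (fst Y1) = card R" "nsum (fst Y2) = nsum (fst Y) - card R"
      and r: "\<And>k. k < nsum (fst Y1) \<Longrightarrow> r k \<in> R \<and> smd (fst Y) (r k) = smd (fst Y1) k \<and> snd Y ! (r k) = snd Y1 ! k"
      and r': "\<And>k. k < nsum (fst Y2) \<Longrightarrow> r' k \<in> {..<nsum (fst Y)} - R \<and> smd (fst Y) (r' k) = smd (fst Y2) k \<and> snd Y ! (r' k) = snd Y2 ! k"
      and cq1: "\<And>k j. k < nsum (fst Y1) \<Longrightarrow> j < nsum (fst Y) \<Longrightarrow> component C (fst Y) (fst Y1) q1 j k =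
        (if j = r k then Idm C (smd (fst Y1) k) else zerom C (smd (fst Y) j) (smd (fst Y1) k))"
      and cq2: "\<And>k j. k < nsum (fst Y2) \<Longrightarrow> j < nsum (fst Y) \<Longrightarrow> component C (fst Y) (fst Y2) q2 j k =
        (if j = r' k then Idm C (smd (fst Y2) k) else zerom C (smd (fst Y) j) (smd (fst Y2) k))"
      by (rule T_split[OF Y R]) (rule that, assumption+)
    note bXC = T_biproduct_D[OF bX] and bYC = T_biproduct_D[OF bY]
    note bx = biproductD[OF bXC] and by' = biproductD[OF bYC]
    have lX: "i1 \<in> lift_mor C G X1 X" "i2 \<in> lift_mor C G X2 X" "p1 \<in> lift_mor C G X X1" "p2 \<in> lift_mor C G X X2"
      using bX unfolding biproduct_def T_sel by simp_all
    have lY: "j1 \<in> lift_mor C G Y1 Y" "j2 \<in> lift_mor C G Y2 Y" "q1 \<in> lift_mor C G Y Y1" "q2 \<in> lift_mor C G Y Y2"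
      using bY unfolding biproduct_def T_sel by simp_all
    have fi: "Comp C f i1 \<in> lift_mor C G X1 Y" "Comp C f i2 \<in> lift_mor C G X2 Y"
      by (rule lift_mor_Comp[OF X1 X Y lX(1) f] lift_mor_Comp[OF X2 X Y lX(2) f])+
    note fim = fi[THEN lift_morD(1)]
    let ?f1 = "Comp C q1 (Comp C f i1)" and ?f2 = "Comp C q2 (Comp C f i2)"
    have lf: "?f1 \<in> lift_mor C G X1 Y1" "?f2 \<in> lift_mor C G X2 Y2"
      by (rule lift_mor_Comp[OF X1 Y Y1 fi(1) lY(3)] lift_mor_Comp[OF X2 Y Y2 fi(2) lY(4)])+
    note lfm = lf[THEN lift_morD(1)]
    \<comment> \<open>An entry from \<open>S\<close> to the complement of \<open>R\<close> vanishes,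
      because a nonzero component joins \<open>S\<close> to \<open>R\<close> or the complement of
      \<open>S\<close> to the complement of \<open>R\<close>.\<close>
    have z1: "Comp C q2 (Comp C f i1) = zerom C (lift_proj X1) (lift_proj Y2)"
    proof (rule lift_mor_ext[OF X1 Y2 Comp_mor[OF fim(1) by'(7) bx(1) by'(3,2)] zero_mor[OF bx(1) by'(2)]])
      fix k l assume kl: "k < nsum (fst X1)" "l < nsum (fst Y2)"
      have sk: "s k < nsum (fst X)" "smd (fst X) (s k) = smd (fst X1) k" "s k \<in> S" using s[OF kl(1)] S by auto
      have rl: "r' l < nsum (fst Y)" "smd (fst Y) (r' l) = smd (fst Y2) l" "r' l \<notin> R" using r'[OF kl(2)] by auto
      have "component C (fst X1) (fst Y2) (Comp C q2 (Comp C f i1)) k l = component C (fst X) (fst Y) f (s k) (r' l)"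
        by (rule component_block[OF X Y X1 Y2 fm bx(4) by'(7) kl sk(1,2) rl(1,2) ci1[OF kl(1)] cq2[OF kl(2)]])
      also have "\<dots> = zerom C (smd (fst X) (s k)) (smd (fst Y) (r' l))" using sep sk rl by blast
      also have "\<dots> = component C (fst X1) (fst Y2) (zerom C (lift_proj X1) (lift_proj Y2)) k l"
        unfolding lift_proj_def component_zero[OF lift_ObD(1)[OF X1] lift_ObD(1)[OF Y2] kl] sk(2) rl(2) ..
      finally show "component C (fst X1) (fst Y2) (Comp C q2 (Comp C f i1)) k l = component C (fst X1) (fst Y2) (zerom C (lift_proj X1) (lift_proj Y2)) k l" .
    qed
    have z2: "Comp C q1 (Comp C f i2) = zerom C (lift_proj X2) (lift_proj Y1)"
    proof (rule lift_mor_ext[OF X2 Y1 Comp_mor[OF fim(2) by'(6) bx(2) by'(3,1)] zero_mor[OF bx(2) by'(1)]])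
      fix k l assume kl: "k < nsum (fst X2)" "l < nsum (fst Y1)"
      have sk: "s' k < nsum (fst X)" "smd (fst X) (s' k) = smd (fst X2) k" "s' k \<notin> S" using s'[OF kl(1)] by auto
      have rl: "r l < nsum (fst Y)" "smd (fst Y) (r l) = smd (fst Y1) l" "r l \<in> R" using r[OF kl(2)] R by auto
      have "component C (fst X2) (fst Y1) (Comp C q1 (Comp C f i2)) k l = component C (fst X) (fst Y) f (s' k) (r l)"
        by (rule component_block[OF X Y X2 Y1 fm bx(5) by'(6) kl sk(1,2) rl(1,2) ci2[OF kl(1)] cq1[OF kl(2)]])
      also have "\<dots> = zerom C (smd (fst X) (s' k)) (smd (fst Y) (r l))" using sep sk rl by blast
      also have "\<dots> = component C (fst X2) (fst Y1) (zerom C (lift_proj X2) (lift_proj Y1)) k l"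
        unfolding lift_proj_def component_zero[OF lift_ObD(1)[OF X2] lift_ObD(1)[OF Y1] kl] sk(2) rl(2) ..
      finally show "component C (fst X2) (fst Y1) (Comp C q1 (Comp C f i2)) k l = component C (fst X2) (fst Y1) (zerom C (lift_proj X2) (lift_proj Y1)) k l" .
    qed
    let ?F = "sum_mor C (lift_proj X) (lift_proj Y) j1 ?f1 p1 j2 ?f2 p2"
    note F = sum_mor_mor[OF bXC bYC lfm] and Fi = sum_mor_Comp_incl[OF bXC bYC lfm]
    have jf: "Comp C j1 ?f1 \<in> mor C (lift_proj X1) (lift_proj Y)" "Comp C j2 ?f2 \<in> mor C (lift_proj X2) (lift_proj Y)"
      by (rule Comp_mor[OF lfm(1) by'(4) bx(1) by'(1,3)] Comp_mor[OF lfm(2) by'(5) bx(2) by'(2,3)])+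
    have fF: "f = ?F"
    proof (rule biproduct_coext[OF bXC by'(3) fm F])
      show "Comp C f i1 = Comp C ?F i1"
        unfolding Fi using biproduct_decomp(1)[OF bYC bx(1) fim(1)] unfolding z1 Comp_zero_right[OF by'(5) bx(1) by'(2,3)]
        using add_zero(1)[OF bx(1) by'(3) jf(1)] by simp
      show "Comp C f i2 = Comp C ?F i2"
        unfolding Fi using biproduct_decomp(1)[OF bYC bx(2) fim(2)] unfolding z2 Comp_zero_right[OF by'(4) bx(2) by'(1,3)]
        using add_zero(2)[OF bx(2) by'(3) jf(2)] by simp
    qed
    have cS: "card S \<le> nsum (fst X)" "card R \<le> nsum (fst Y)"
      using card_mono[OF finite_lessThan S] card_mono[OF finite_lessThan R] by simp_all
    have fin: "finite S" "finite R" using S R finite_subset by auto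
    \<comment> \<open>One of \<open>S\<close> and \<open>R\<close> may be empty or full by itself,
      so only the total number of summands is sure to drop.\<close>
    have "card S < nsum (fst X) \<or> card R < nsum (fst Y)"
      using nf cS card_subset_eq[OF finite_lessThan S] card_subset_eq[OF finite_lessThan R] by fastforce
    then have l1: "nsum (fst X1) + nsum (fst Y1) < nsum (fst X) + nsum (fst Y)" using nX nY cS by linarith
    have "0 < card S \<or> 0 < card R" using ne fin by (auto simp: card_gt_0_iff)
    then have l2: "nsum (fst X2) + nsum (fst Y2) < nsum (fst X) + nsum (fst Y)" using nX nY cS by linarith
    obtain Z1 g1 h1 where T1: "(X1, Y1, Z1, ?f1, g1, h1) \<in> Tri T" using less(1)[OF l1 X1 Y1 lf(1)] by blast
    obtain Z2 g2 h2 where T2: "(X2, Y2, Z2, ?f2, g2, h2) \<in> Tri T" using less(1)[OF l2 X2 Y2 lf(2)] by blast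
    have Z: "Z1 \<in> lift_Ob C \<phi>" "Z2 \<in> lift_Ob C \<phi>" and lg: "g1 \<in> lift_mor C G Y1 Z1" "g2 \<in> lift_mor C G Y2 Z2"
      and lh: "h1 \<in> lift_mor C G Z1 (lift_shift C 1 X1)" "h2 \<in> lift_mor C G Z2 (lift_shift C 1 X2)"
      using T1 T2 unfolding Tri_T by simp_all
    obtain Z l1 l2 r1 r2 where bZ: "biproduct T Z1 Z2 Z l1 l2 r1 r2" using T_direct_sum[OF Z] by blast
    have Zo: "Z \<in> lift_Ob C \<phi>" using bZ unfolding biproduct_def T_sel by simp
    let ?g = "sum_mor C (lift_proj Y) (lift_proj Z) l1 g1 q1 l2 g2 q2"
      and ?h = "sum_mor C (lift_proj Z) (Shift C 1 (lift_proj X)) (ShiftM C 1 i1) h1 r1 (ShiftM C 1 i2) h2 r2"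
    have st: "sum_mor T A B = sum_mor C (lift_proj A) (lift_proj B)" for A B
      unfolding sum_mor_def T_sel by simp
    have "?g \<in> lift_mor C G Y Z" using LT.sum_mor_mor[OF bY bZ, unfolded T_sel, OF lg] unfolding st .
    moreover have "?h \<in> lift_mor C G Z (lift_shift C 1 X)"
      using LT.sum_mor_mor[OF bZ LT.biproduct_Shift[OF bX, of 1, unfolded T_sel(5,6)], unfolded T_sel(2), OF lh] unfolding st T_sel(10) .
    moreover have "(lift_proj X, lift_proj Y, lift_proj Z, f, ?g, ?h) \<in> Tri C"
      using Tri_sum[OF T_Tri_proj[OF T1] T_Tri_proj[OF T2] bXC bYC T_biproduct_D[OF bZ]] unfolding fF[symmetric] .
    ultimately have "(X, Y, Z, f, ?g, ?h) \<in> Tri T" unfolding Tri_T using X Y Zo f by simp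
    then show ?thesis by blast
  qed
qed

lemma lift_triangulated: "triangulated_category K T"
  by (rule T_triangulated) (rule cone_exists)

end

section \<open>Grothendieck groups and filtrations\<close>

text \<open>
  The phases are listed from the top factor of the filtration downwards, so they are increasing in a
  Harder-Narasimhan filtration.  Factors may vanish, which makes it possible to refine two
  filtrations to a common list of phases before adding them.
\<close>
primrec hn_list :: "('o, 'm, 'k) tricat \<Rightarrow> (real \<Rightarrow> 'o set) \<Rightarrow> real list \<Rightarrow> 'o \<Rightarrow> bool" where
  "hn_list T P [] X = zero_obj T X"
| "hn_list T P (\<theta> # \<theta>s) X = (\<exists>E A f g h. hn_list T P \<theta>s E \<and> A \<in> P \<theta> \<and> (E, X, A, f, g, h) \<in> Tri T)"

lemma (in linear_category) biproduct_zero_obj: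
  assumes b: "biproduct C A B X i1 i2 p1 p2" and z: "zero_obj C A" "zero_obj C B"
  shows "zero_obj C X"
proof -
  note d = biproductD[OF b]
  have "p1 = zerom C X A" "p2 = zerom C X B" using zero_obj_mor(2)[OF z(1) d(3,6)] zero_obj_mor(2)[OF z(2) d(3,7)] .
  then have "Comp C i1 p1 = zerom C X X" "Comp C i2 p2 = zerom C X X"
    using Comp_zero_right[OF d(4) d(3,1,3)] Comp_zero_right[OF d(5) d(3,2,3)] by simp_all
  then have "Idm C X = zerom C X X" using d(12) add_zero(1)[OF d(3,3) zero_mor[OF d(3,3)]] by simp
  then show ?thesis using zero_obj_iff[OF d(3)] by simp
qed

section \<open>Additivity of the central charge; refinement and addition of filtrations\<close>

context triangulated_category
begin

lemma K0_normal: "K0_kernel C \<lhd> free_Abelian_group (Ob C)"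
proof -
  have "K0_relations C \<subseteq> carrier (free_Abelian_group (Ob C))"
  proof
    fix r assume "r \<in> K0_relations C"
    then obtain X Y Z f g h where r: "r = frag_of Y - frag_of X - frag_of Z" and T: "(X, Y, Z, f, g, h) \<in> Tri C"
      unfolding K0_relations_def by blast
    have "Poly_Mapping.keys r \<subseteq> {Y, X, Z}"
      unfolding r using keys_diff[of "frag_of Y - frag_of X" "frag_of Z"] keys_diff[of "frag_of Y" "frag_of X"] by auto
    then show "r \<in> carrier (free_Abelian_group (Ob C))" using TriD(1-3)[OF T] by auto
  qed
  then show ?thesis unfolding K0_kernel_def
    by (intro comm_group.subgroup_imp_normal[OF abelian_free_Abelian_group] group.generate_is_subgroup[OF group_free_Abelian_group])
qed

lemma K0_class_carrier: "X \<in> Ob C \<Longrightarrow> K0_class C X \<in> carrier (K0 C)"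
  unfolding K0_def carrier_FactGroup K0_class_def by (rule imageI) simp

lemma K0_class_Tri:
  assumes T: "(X, Y, Z, f, g, h) \<in> Tri C"
  shows "K0_class C Y = K0_class C X \<otimes>\<^bsub>K0 C\<^esub> K0_class C Z"
proof -
  let ?F = "free_Abelian_group (Ob C)" and ?N = "K0_kernel C"
  note o = TriD(1-3)[OF T]
  have c: "frag_of X \<in> carrier ?F" "frag_of Y \<in> carrier ?F" "frag_of Z \<in> carrier ?F" using o by simp_all
  have "K0_class C X \<otimes>\<^bsub>K0 C\<^esub> K0_class C Z = ?N #>\<^bsub>?F\<^esub> (frag_of X + frag_of Z)"
    unfolding K0_def K0_class_def using normal.rcos_sum[OF K0_normal c(1,3)] by simp
  moreover have "?N #>\<^bsub>?F\<^esub> (frag_of X + frag_of Z) = ?N #>\<^bsub>?F\<^esub> frag_of Y"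
  proof (rule group.repr_independence[OF group_free_Abelian_group])
    have "frag_of Y - frag_of X - frag_of Z \<in> ?N" unfolding K0_kernel_def K0_relations_def using T by (intro generate.incl) blast
    then have "(frag_of Y - frag_of X - frag_of Z) \<otimes>\<^bsub>?F\<^esub> (frag_of X + frag_of Z) \<in> ?N #>\<^bsub>?F\<^esub> (frag_of X + frag_of Z)"
      unfolding r_coset_def by blast
    then show "frag_of Y \<in> ?N #>\<^bsub>?F\<^esub> (frag_of X + frag_of Z)" by (simp add: algebra_simps)
    show "frag_of X + frag_of Z \<in> carrier ?F" using o keys_add[of "frag_of X" "frag_of Z"] by auto
    show "subgroup ?N ?F" using K0_normal by (rule normal_imp_subgroup)
  qed
  ultimately show ?thesis by (simp add: K0_class_def)
qed

lemma charge_Tri: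
  assumes Z: "Z \<in> hom (K0 C) complex_group" and T: "(X, Y, W, f, g, h) \<in> Tri C"
  shows "Z (K0_class C Y) = Z (K0_class C X) + Z (K0_class C W)"
  unfolding K0_class_Tri[OF T]
  using hom_mult[OF Z K0_class_carrier[OF TriD(1)[OF T]] K0_class_carrier[OF TriD(3)[OF T]]] by (simp add: complex_group_def)

lemma charge_biproduct:
  assumes Z: "Z \<in> hom (K0 C) complex_group" and b: "biproduct C A B X i1 i2 p1 p2"
  shows "Z (K0_class C X) = Z (K0_class C A) + Z (K0_class C B)"
  by (rule charge_Tri[OF Z Tri_split[OF biproduct_sym[OF b]], unfolded add.commute[of "Z (K0_class C B)"]])

text \<open>The identity triangle of \<open>N\<close> has \<open>N\<close> in all three places, so
  the charge equals twice itself.\<close>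

lemma charge_zero:
  assumes Z: "Z \<in> hom (K0 C) complex_group" and N: "zero_obj C N"
  shows "Z (K0_class C N) = 0"
  using charge_Tri[OF Z TR1_id[OF _ N, of N]] zero_shift_obj[OF N] by simp

text \<open>An extra phase is inserted with a zero factor, by means of an identity triangle.\<close>

lemma hn_list_mono:
  assumes P0: "\<And>\<theta> N. zero_obj C N \<Longrightarrow> N \<in> P \<theta>"
    and s: "subseq xs ys" and X: "X \<in> Ob C"
  shows "hn_list C P xs X \<Longrightarrow> hn_list C P ys X"
proof -
  obtain N where N: "zero_obj C N" using ex_zero_obj by blast
  have add: "hn_list C P (y # ys) X" if "hn_list C P ys X" "X \<in> Ob C" for y ys X
    unfolding hn_list.simps by (intro exI conjI) (rule that(1), rule P0[OF N], rule TR1_id[OF that(2) N])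
  have nil: "hn_list C P ys X" if "zero_obj C X" for ys X
  proof (induction ys)
    case Nil then show ?case using that by simp
  next
    case (Cons y ys)
    then show ?case by (rule add) (use that in \<open>simp add: zero_obj_def\<close>)
  qed
  from s X show "hn_list C P xs X \<Longrightarrow> hn_list C P ys X"
  proof (induction xs ys arbitrary: X rule: list_emb.induct)
    case (list_emb_Nil ys) then show ?case using nil by simp
  next
    case (list_emb_Cons xs ys y)
    show ?case by (rule add[OF list_emb_Cons.IH[OF list_emb_Cons.prems] list_emb_Cons.prems(2)])
  next
    case (list_emb_Cons2 x y xs ys)
    obtain E A f g h where e: "hn_list C P xs E" "A \<in> P x" "(E, X, A, f, g, h) \<in> Tri C"
      using list_emb_Cons2.prems(1) unfolding hn_list.simps by (elim exE conjE)
    have "hn_list C P ys E" by (rule list_emb_Cons2.IH[OF e(1) TriD(1)[OF e(3)]])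
    moreover have "A \<in> P y" using e(2) list_emb_Cons2.hyps(1) by simp
    ultimately show ?case unfolding hn_list.simps using e(3) by (intro exI conjI)
  qed
qed

text \<open>With a common list of phases the filtrations add one factor at a time, by
  \<open>Tri_sum\<close>. A particular sum of the factors is chosen, because \<open>P\<close> need
  not be closed under isomorphism here.\<close>

lemma hn_list_sum:
  assumes P_sum: "\<And>\<theta> A B. A \<in> P \<theta> \<Longrightarrow> B \<in> P \<theta> \<Longrightarrow> \<exists>X i1 i2 p1 p2. biproduct C A B X i1 i2 p1 p2 \<and> X \<in> P \<theta>"
  shows "hn_list C P \<theta>s X1 \<Longrightarrow> hn_list C P \<theta>s X2 \<Longrightarrow> biproduct C X1 X2 X i1 i2 p1 p2 \<Longrightarrow> hn_list C P \<theta>s X"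
proof (induction \<theta>s arbitrary: X1 X2 X i1 i2 p1 p2)
  case Nil
  then show ?case using biproduct_zero_obj by simp
next
  case (Cons \<theta> \<theta>s)
  obtain E1 A1 f1 g1 h1 where 1: "hn_list C P \<theta>s E1" "A1 \<in> P \<theta>" "(E1, X1, A1, f1, g1, h1) \<in> Tri C"
    using Cons.prems(1) unfolding hn_list.simps by (elim exE conjE)
  obtain E2 A2 f2 g2 h2 where 2: "hn_list C P \<theta>s E2" "A2 \<in> P \<theta>" "(E2, X2, A2, f2, g2, h2) \<in> Tri C"
    using Cons.prems(2) unfolding hn_list.simps by (elim exE conjE)
  obtain E j1 j2 q1 q2 where E: "biproduct C E1 E2 E j1 j2 q1 q2"
    using ex_direct_sum[OF TriD(1)[OF 1(3)] TriD(1)[OF 2(3)]] unfolding direct_sum_def by blast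
  obtain A k1 k2 r1 r2 where A: "biproduct C A1 A2 A k1 k2 r1 r2" "A \<in> P \<theta>"
    using P_sum[OF 1(2) 2(2)] by (elim exE conjE)
  have "hn_list C P \<theta>s E" by (rule Cons.IH[OF 1(1) 2(1) E])
  then show ?case unfolding hn_list.simps using A(2) Tri_sum[OF 1(3) 2(3) E Cons.prems(3) A(1)] by (intro exI conjI)
qed

text \<open>\<open>hn_list\<close> counts factors from the top and \<open>bridgeland_HN\<close>
  counts them from the bottom, hence the index \<open>length \<theta>s - j\<close>; an increasing
  list becomes a decreasing sequence of phases.\<close>

lemma hn_list_bridgeland:
  "hn_list C P \<theta>s X \<Longrightarrow> sorted_wrt (<) \<theta>s \<Longrightarrow>
    \<exists>E. bridgeland_HN C P X (length \<theta>s) E (\<lambda>j. \<theta>s ! (length \<theta>s - j))"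
proof (induction \<theta>s arbitrary: X)
  case Nil
  then show ?case by (intro exI[of _ "\<lambda>_. X"]) (simp add: bridgeland_HN_def)
next
  case (Cons \<theta> \<theta>s)
  obtain E' A f g h where e: "hn_list C P \<theta>s E'" "A \<in> P \<theta>" "(E', X, A, f, g, h) \<in> Tri C" using Cons.prems(1) by auto
  obtain F where F: "bridgeland_HN C P E' (length \<theta>s) F (\<lambda>j. \<theta>s ! (length \<theta>s - j))"
    using Cons.IH[OF e(1)] Cons.prems(2) by auto
  let ?n = "length \<theta>s" and ?E = "F(Suc (length \<theta>s) := X)"
  have th: "(\<theta> # \<theta>s) ! (Suc ?n - j) = \<theta>s ! (?n - j)" if "j \<le> ?n" for j using that by (simp add: Suc_diff_le)
  have F': "zero_obj C (F 0)" "F ?n = E'" "\<And>j. j \<in> {1..?n} \<Longrightarrow> \<exists>A \<in> P (\<theta>s ! (?n - j)). \<exists>f g h. (F (j - 1), F j, A, f, g, h) \<in> Tri C"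
    using F unfolding bridgeland_HN_def by blast+
  have "bridgeland_HN C P X (Suc ?n) ?E (\<lambda>j. (\<theta> # \<theta>s) ! (Suc ?n - j))"
    unfolding bridgeland_HN_def
  proof (intro conjI ballI impI)
    show "zero_obj C (?E 0)" "?E (Suc ?n) = X" using F'(1) by simp_all
    fix j assume j: "j \<in> {1..Suc ?n}"
    show "\<exists>A \<in> P ((\<theta> # \<theta>s) ! (Suc ?n - j)). \<exists>f g h. (?E (j - 1), ?E j, A, f, g, h) \<in> Tri C"
    proof (cases "j = Suc ?n")
      case True
      then show ?thesis using e F'(2) by auto
    next
      case False
      then have "j \<in> {1..?n}" using j by simp
      moreover from this have "j \<noteq> Suc ?n" "j - 1 \<noteq> Suc ?n" "j \<le> ?n" by auto
      ultimately show ?thesis using F'(3)[of j] th[of j] by simp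
    qed
    fix j' assume j': "j' \<in> {1..Suc ?n}" "j < j'"
    have "Suc ?n - j' < Suc ?n - j" "Suc ?n - j < length (\<theta> # \<theta>s)" using j j' by auto
    from sorted_wrt_nth_less[OF Cons.prems(2) this]
    show "(\<theta> # \<theta>s) ! (Suc ?n - j') < (\<theta> # \<theta>s) ! (Suc ?n - j)" .
  qed
  then show ?case by auto
qed

text \<open>Both filtrations are refined to \<open>zs\<close>, the increasing enumeration of all
  phases that occur in either of them, and added there.\<close>

lemma hn_list_biproduct_ex:
  assumes P0: "\<And>\<theta> N. zero_obj C N \<Longrightarrow> N \<in> P \<theta>"
    and P_sum: "\<And>\<theta> A B. A \<in> P \<theta> \<Longrightarrow> B \<in> P \<theta> \<Longrightarrow> \<exists>X i1 i2 p1 p2. biproduct C A B X i1 i2 p1 p2 \<and> X \<in> P \<theta>"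
    and b: "biproduct C A B X i1 i2 p1 p2"
    and A: "\<exists>\<theta>s. sorted_wrt (<) \<theta>s \<and> hn_list C P \<theta>s A" and B: "\<exists>\<theta>s. sorted_wrt (<) \<theta>s \<and> hn_list C P \<theta>s B"
  shows "\<exists>\<theta>s. sorted_wrt (<) \<theta>s \<and> hn_list C P \<theta>s X"
proof -
  obtain xs where xs: "sorted_wrt (<) xs" "hn_list C P xs A" using A by blast
  obtain ys where ys: "sorted_wrt (<) ys" "hn_list C P ys B" using B by blast
  define zs where "zs = sorted_list_of_set (set xs \<union> set ys)"
  have zs: "sorted_wrt (<) zs" "set zs = set xs \<union> set ys" unfolding zs_def by simp_all
  \<comment> \<open>A strictly increasing list is determined by its set, so filtering
    \<open>zs\<close> by the members of \<open>ws\<close> returns \<open>ws\<close> itself.\<close>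
  have sub: "subseq ws zs" if ws: "sorted_wrt (<) ws" "set ws \<subseteq> set zs" for ws
  proof -
    let ?f = "filter (\<lambda>z. z \<in> set ws) zs"
    have "sorted_wrt (<) ?f" by (rule sorted_wrt_filter[OF zs(1)])
    moreover have "set ?f = set ws" using ws(2) by auto
    ultimately have "?f = ws" using ws(1) strict_sorted_equal by blast
    then show ?thesis using subseq_filter_left[of "\<lambda>z. z \<in> set ws" zs] by simp
  qed
  note d = biproductD[OF b]
  have "subseq xs zs" by (rule sub[OF xs(1)]) (simp add: zs(2))
  have hA: "hn_list C P zs A" by (rule hn_list_mono[OF _ \<open>subseq xs zs\<close> d(1) xs(2)]) (rule P0)
  have "subseq ys zs" by (rule sub[OF ys(1)]) (simp add: zs(2))
  have hB: "hn_list C P zs B" by (rule hn_list_mono[OF _ \<open>subseq ys zs\<close> d(2) ys(2)]) (rule P0)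
  have "hn_list C P zs X" by (rule hn_list_sum[OF _ hA hB b]) (rule P_sum)
  then show ?thesis using zs(1) by blast
qed

end

section \<open>Reduction to pairs of an indecomposable object and a phase\<close>

context phased_category
begin

text \<open>An object with one summand \<open>E\<close> may have a total object that is only
  isomorphic to \<open>E\<close>. Writing it as the sum of the pair and a zero object lets closure
  under biproducts account for the difference.\<close>

lemma T_single:
  assumes X: "X \<in> lift_Ob C \<phi>" and n: "nsum (fst X) = 1"
  shows "(single_dec C (smd (fst X) 0), [snd X ! 0]) \<in> lift_Ob C \<phi>"
    "\<exists>N i1 i2 p1 p2. zero_obj T N \<and> biproduct T (single_dec C (smd (fst X) 0), [snd X ! 0]) N X i1 i2 p1 p2"
proof -
  note x = lift_ObD[OF X]
  have i: "0 < nsum (fst X)" using n by simp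
  let ?A = "(single_dec C (smd (fst X) 0), [snd X ! 0])"
  show A: "?A \<in> lift_Ob C \<phi>"
    unfolding lift_Ob_def using is_dec_single[OF x(5)[OF i]] x(3)[OF i] by simp
  obtain N where N: "zero_obj T N" "nsum (fst N) = 0" using T_zero_ex by blast
  have "\<exists>i1 i2 p1 p2. biproduct T ?A N X i1 i2 p1 p2"
    using T_block_biproduct[OF A T_zero_obj(2)[OF N(1)] X, of "\<lambda>i. i" "\<lambda>i. i"] N(2) n by (simp add: lessThan_Suc) blast
  then show "\<exists>N i1 i2 p1 p2. zero_obj T N \<and> biproduct T ?A N X i1 i2 p1 p2" using N(1) by blast
qed

text \<open>In the case \<open>single\<close> only the summands of \<open>X\<close> with their
  phases occur, so that knowledge about \<open>X\<close>, such as membership in a slice, is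
  available there.\<close>

lemma lift_induct [consumes 1, case_names zero single sum]:
  assumes X: "X \<in> lift_Ob C \<phi>"
    and zero: "\<And>N. zero_obj T N \<Longrightarrow> R N"
    and single: "\<And>i. i < nsum (fst X) \<Longrightarrow> (single_dec C (smd (fst X) i), [snd X ! i]) \<in> lift_Ob C \<phi> \<Longrightarrow> R (single_dec C (smd (fst X) i), [snd X ! i])"
    and sum: "\<And>A B Y i1 i2 p1 p2. biproduct T A B Y i1 i2 p1 p2 \<Longrightarrow> R A \<Longrightarrow> R B \<Longrightarrow> R Y"
  shows "R X"
  using X single
proof (induction "nsum (fst X)" arbitrary: X)
  case 0
  have "zero_obj C (lift_proj X)" unfolding lift_proj_def
    using is_dec_nsum_0[OF lift_ObD(1)[OF 0(2)]] 0(1) by simp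
  then show ?case by (intro zero T_zero_objI[OF 0(2)])
next
  case (Suc n)
  have S: "{0} \<subseteq> {..<nsum (fst X)}" unfolding Suc(2)[symmetric] by simp
  obtain A B i1 i2 p1 p2 s s' where A: "A \<in> lift_Ob C \<phi>" and B: "B \<in> lift_Ob C \<phi>" and b: "biproduct T A B X i1 i2 p1 p2"
    and n: "nsum (fst A) = card {0 :: nat}" "nsum (fst B) = nsum (fst X) - card {0 :: nat}"
    and s: "\<And>k. k < nsum (fst A) \<Longrightarrow> s k \<in> {0} \<and> smd (fst X) (s k) = smd (fst A) k \<and> snd X ! (s k) = snd A ! k"
    and s': "\<And>k. k < nsum (fst B) \<Longrightarrow> s' k \<in> {..<nsum (fst X)} - {0} \<and> smd (fst X) (s' k) = smd (fst B) k \<and> snd X ! (s' k) = snd B ! k"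
    by (rule T_split[OF Suc(3) S]) (rule that, assumption+)
  have nA: "nsum (fst A) = 1" and nB: "n = nsum (fst B)" using n Suc(2) by simp_all
  obtain N j1 j2 q1 q2 where N: "zero_obj T N" "biproduct T (single_dec C (smd (fst A) 0), [snd A ! 0]) N A j1 j2 q1 q2"
    using T_single(2)[OF A nA] by blast
  have "smd (fst A) 0 = smd (fst X) 0" "snd A ! 0 = snd X ! 0" using s[of 0] nA by auto
  then have "R (single_dec C (smd (fst A) 0), [snd A ! 0])" using Suc(4)[of 0] T_single(1)[OF A nA] Suc(2)[symmetric] by simp
  then have RA: "R A" by (rule sum[OF N(2) _ zero[OF N(1)]])
  have "R B"
  proof (rule Suc(1)[OF nB B])
    fix k assume k: "k < nsum (fst B)" and l: "(single_dec C (smd (fst B) k), [snd B ! k]) \<in> lift_Ob C \<phi>"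
    have "s' k < nsum (fst X)" "smd (fst X) (s' k) = smd (fst B) k" "snd X ! (s' k) = snd B ! k" using s'[OF k] by auto
    then show "R (single_dec C (smd (fst B) k), [snd B ! k])" using Suc(4)[of "s' k"] l by simp
  qed
  then show ?case by (rule sum[OF b RA])
qed

end

context maslov_category
begin

text \<open>The map of free abelian groups that sends a generator \<open>X\<close> to
  \<open>lift_proj X\<close> carries the relations of \<open>T\<close> to relations of
  \<open>C\<close>, because triangles of \<open>T\<close> are triangles of \<open>C\<close>; so it
  descends to the quotients.\<close>

lemma K0_projection:
  "\<exists>\<pi>\<^sub>0. \<pi>\<^sub>0 \<in> hom (K0 T) (K0 C) \<and> (\<forall>X \<in> lift_Ob C \<phi>. \<pi>\<^sub>0 (K0_class T X) = K0_class C (lift_proj X))"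
proof -
  interpret LT: triangulated_category K T by (rule lift_triangulated)
  let ?FT = "free_Abelian_group (Ob T)" and ?FC = "free_Abelian_group (Ob C)"
  define F where "F = frag_extend (\<lambda>X :: ('o, 'm) lobj. frag_of (lift_proj X))"
  have F_add: "F (x + y) = F x + F y" and F_neg: "F (- x) = - F x" and F_diff: "F (x - y) = F x - F y" and F_of: "F (frag_of X) = frag_of (lift_proj X)" for x y :: "('o, 'm) lobj \<Rightarrow>\<^sub>0 int" and X
    unfolding F_def by (simp_all add: frag_extend_add frag_extend_minus frag_extend_diff)
  have Fc: "F x \<in> carrier ?FC" if "x \<in> carrier ?FT" for x
  proof -
    have "Poly_Mapping.keys (F x) \<subseteq> (\<Union>X \<in> Poly_Mapping.keys x. Poly_Mapping.keys (frag_of (lift_proj X)))"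
      unfolding F_def by (rule keys_frag_extend)
    also have "\<dots> \<subseteq> Ob C" using that lift_ObD(4) unfolding T_sel carrier_free_Abelian_group_iff by (auto simp: keys_frag_of)
    finally show ?thesis by simp
  qed
  interpret NC: normal "K0_kernel C" ?FC by (rule K0_normal)
  have FN: "F x \<in> K0_kernel C" if "x \<in> K0_kernel T" for x
    using that unfolding K0_kernel_def[of T]
  proof (induction rule: generate.induct)
    case one
    then show ?case using subgroup.one_closed[OF normal_imp_subgroup[OF K0_normal]] unfolding one_free_Abelian_group F_def by simp
  next
    case (incl r)
    then obtain X Y Z f g h where r: "r = frag_of Y - frag_of X - frag_of Z" "(X, Y, Z, f, g, h) \<in> Tri T" unfolding K0_relations_def by blast
    show ?case unfolding r(1) F_diff F_of K0_kernel_def K0_relations_def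
      by (rule generate.incl) (use T_Tri_proj[OF r(2)] in blast)
  next
    case (inv r)
    then have r': "r \<in> K0_kernel T" unfolding K0_kernel_def by (rule generate.incl)
    from inv obtain X Y Z f g h where r: "r = frag_of Y - frag_of X - frag_of Z" "(X, Y, Z, f, g, h) \<in> Tri T" unfolding K0_relations_def by blast
    have k: "r \<in> carrier ?FT" using subgroup.mem_carrier[OF normal_imp_subgroup[OF LT.K0_normal] r'] .
    have Fr: "F r \<in> K0_kernel C" unfolding r(1) F_diff F_of K0_kernel_def K0_relations_def
      by (rule generate.incl) (use T_Tri_proj[OF r(2)] in blast)
    have "inv\<^bsub>?FT\<^esub> r = - r" using k by (intro inv_free_Abelian_group) simp
    moreover have "inv\<^bsub>?FC\<^esub> F r = - F r" using Fc[OF k] by (intro inv_free_Abelian_group) simp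
    ultimately show ?case using NC.m_inv_closed[OF Fr] F_neg[of r] by simp
  next
    case (eng x y)
    then show ?case using subgroup.m_closed[OF normal_imp_subgroup[OF K0_normal], of "F x" "F y"] F_add[of x y] by simp
  qed
  define h where "h = (\<lambda>x. K0_kernel C #>\<^bsub>?FC\<^esub> F x)"
  have hh: "h \<in> hom ?FT (K0 C)"
  proof (rule homI)
    show "h x \<in> carrier (K0 C)" if "x \<in> carrier ?FT" for x
      unfolding h_def K0_def carrier_FactGroup using Fc[OF that] by (rule imageI)
    show "h (x \<otimes>\<^bsub>?FT\<^esub> y) = h x \<otimes>\<^bsub>K0 C\<^esub> h y" if "x \<in> carrier ?FT" "y \<in> carrier ?FT" for x y
      unfolding h_def K0_def mult_FactGroup NC.rcos_sum[OF Fc[OF that(1)] Fc[OF that(2)]] by (simp add: F_add)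
  qed
  have eq: "h x = h y" if xy: "x \<in> carrier ?FT" "y \<in> carrier ?FT" "K0_kernel T #>\<^bsub>?FT\<^esub> x = K0_kernel T #>\<^bsub>?FT\<^esub> y" for x y
  proof -
    have "x \<in> K0_kernel T #>\<^bsub>?FT\<^esub> y"
      using group.rcos_self[OF group_free_Abelian_group xy(1) normal_imp_subgroup[OF LT.K0_normal]] xy(3) by simp
    then obtain k where k: "k \<in> K0_kernel T" "x = k + y" unfolding r_coset_def by auto
    have "F x \<in> K0_kernel C #>\<^bsub>?FC\<^esub> F y" unfolding k(2) F_add r_coset_def using FN[OF k(1)] by auto
    from group.repr_independence[OF group_free_Abelian_group this Fc[OF xy(2)] normal_imp_subgroup[OF K0_normal]]
    show ?thesis unfolding h_def by simp
  qed
  obtain \<pi>\<^sub>0 where p: "\<pi>\<^sub>0 \<in> hom (?FT Mod K0_kernel T) (K0 C)" "\<And>x. x \<in> carrier ?FT \<Longrightarrow> \<pi>\<^sub>0 (K0_kernel T #>\<^bsub>?FT\<^esub> x) = h x"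
    using FactGroup_universal[OF hh LT.K0_normal eq] by blast
  have "\<pi>\<^sub>0 (K0_class T X) = K0_class C (lift_proj X)" if "X \<in> lift_Ob C \<phi>" for X
    using p(2)[of "frag_of X"] that unfolding K0_class_def h_def F_of by (simp add: T_sel)
  then show ?thesis using p(1) unfolding K0_def[of T] by blast
qed

end

section \<open>Semistable objects of the lift\<close>

locale maslov_stable = cyclic_category K C \<beta> + stability_condition K C \<beta> \<Lambda> v \<sigma>
  for K :: "'k ring" and C :: "('o, 'm, 'k) tricat" and \<beta> :: "'o \<Rightarrow> 'm"
    and \<Lambda> :: "'l monoid" and v :: "('o \<Rightarrow>\<^sub>0 int) set \<Rightarrow> 'l" and \<sigma> :: "('o, 'm) stability" +
  assumes maslov_trivial: "basic_loop C \<beta> (grading \<sigma>) E p l \<Longrightarrow> maslov_index (grading \<sigma>) E p = 0"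

sublocale maslov_stable \<subseteq> graded_category K C \<beta> "grading \<sigma>" ..

sublocale maslov_stable \<subseteq> maslov_category K C \<beta> "grading \<sigma>" "phase \<sigma>"
proof (unfold_locales)
  show "[phase \<sigma> (Shift C 1 E) = phase \<sigma> E + 1] (rmod 2)" if "indecomposable C E" for E
    by (rule phase_shift[OF that])
  show "[a = phase \<sigma> F - phase \<sigma> E] (rmod 2)"
    if E: "indecomposable C E" "indecomposable C F" and f: "f \<in> grading \<sigma> a E F" "f \<noteq> zerom C E F" for E F f a
  proof -
    have "homogeneous (grading \<sigma>) E F f" unfolding homogeneous_def using f(1) by blast
    from deg_phase[OF E this f(2)] show ?thesis unfolding deg_eq[OF E f] .
  qed
  show "maslov_index (grading \<sigma>) E p = 0" if "basic_loop C \<beta> (grading \<sigma>) E p l" for E p l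
    by (rule maslov_trivial[OF that])
qed

context maslov_stable
begin

text \<open>Closure of slices under summands is stated for binary sums. Equipped with the phases of
  its own summands, \<open>D\<close> becomes an object of the lift, and there \<open>T_split\<close>
  isolates the \<open>i\<close>-th summand.\<close>

lemma slice_smd:
  assumes psi: "\<psi> \<in> {0<..2}" and D: "is_dec C D" and X: "tot D \<in> slice \<sigma> \<psi>" and i: "i < nsum D"
  shows "smd D i \<in> slice \<sigma> \<psi>"
proof -
  let ?X = "(D, map (\<lambda>k. phase \<sigma> (smd D k)) [0..<nsum D])"
  have LX: "?X \<in> lift_Ob C (phase \<sigma>)" unfolding lift_Ob_def using D by simp
  have S: "{i} \<subseteq> {..<nsum (fst ?X)}" using i by simp
  obtain A B i1 i2 p1 p2 s s' where A: "A \<in> lift_Ob C (phase \<sigma>)" and b: "biproduct T A B ?X i1 i2 p1 p2"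
    and n: "nsum (fst A) = card {i}"
    and s: "\<And>k. k < nsum (fst A) \<Longrightarrow> s k \<in> {i} \<and> smd (fst ?X) (s k) = smd (fst A) k \<and> snd ?X ! (s k) = snd A ! k"
    by (rule T_split[OF LX S]) (rule that, assumption+)
  have nA: "nsum (fst A) = 1" using n by simp
  have "direct_sum C (lift_proj A) (lift_proj B) (lift_proj ?X)"
    using T_biproduct_D[OF b] unfolding direct_sum_def by blast
  moreover have "lift_proj ?X = tot D" by (simp add: lift_proj_def)
  ultimately have PA: "lift_proj A \<in> slice \<sigma> \<psi>" using slice_summand[OF psi, of "lift_proj A" "lift_proj B" "tot D"] X by simp
  obtain N j1 j2 q1 q2 where N: "biproduct T (single_dec C (smd (fst A) 0), [snd A ! 0]) N A j1 j2 q1 q2"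
    using T_single(2)[OF A nA] by blast
  have "direct_sum C (smd (fst A) 0) (lift_proj N) (lift_proj A)"
    using T_biproduct_D[OF N] unfolding direct_sum_def by (simp add: lift_proj_def) blast
  moreover have "s 0 = i" "smd D i = smd (fst A) 0" using s[of 0] nA by auto
  ultimately show ?thesis using slice_summand[OF psi _ PA] by metis
qed

lemma lift_slice_Ob: "X \<in> lift_slice C \<sigma> \<theta> \<Longrightarrow> X \<in> lift_Ob C (phase \<sigma>)"
  unfolding lift_slice_def by simp

lemma lift_slice_D:
  assumes X: "X \<in> lift_slice C \<sigma> \<theta>" and i: "i < nsum (fst X)"
  shows "snd X ! i = \<theta>" "\<exists>\<psi> \<in> {0<..2}. [\<psi> = \<theta>] (rmod 2) \<and> smd (fst X) i \<in> slice \<sigma> \<psi>"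
  using X i unfolding lift_slice_def by simp_all

lemma lift_slice_zero:
  assumes "zero_obj T N" shows "N \<in> lift_slice C \<sigma> \<theta>"
proof -
  note N = T_zero_obj[OF assms]
  have "nsum (fst N) = 0" using is_dec_nsum_0[OF lift_ObD(1)[OF N(2)]] N(1) unfolding lift_proj_def by simp
  then show ?thesis unfolding lift_slice_def using N(2) by simp
qed

lemma lift_slice_sum:
  assumes A: "A \<in> lift_slice C \<sigma> \<theta>" and B: "B \<in> lift_slice C \<sigma> \<theta>"
  shows "\<exists>X i1 i2 p1 p2. biproduct T A B X i1 i2 p1 p2 \<and> X \<in> lift_slice C \<sigma> \<theta>"
proof -
  note oA = lift_slice_Ob[OF A] and oB = lift_slice_Ob[OF B]
  obtain X i1 i2 p1 p2 where b: "biproduct T A B X i1 i2 p1 p2"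
    and m: "map fst (snd (fst X)) = map fst (snd (fst A)) @ map fst (snd (fst B))" and th: "snd X = snd A @ snd B"
    using T_direct_sum[OF oA oB] by (elim exE conjE)
  have oX: "X \<in> lift_Ob C (phase \<sigma>)" using b unfolding biproduct_def T_sel by (elim conjE)
  let ?a = "nsum (fst A)" and ?b = "nsum (fst B)"
  have la: "length (snd A) = ?a" "length (snd B) = ?b" using lift_ObD(2)[OF oA] lift_ObD(2)[OF oB] .
  have nX: "nsum (fst X) = ?a + ?b" using arg_cong[OF m, of length] by simp
  have smd_nth: "smd D i = map fst (snd D) ! i" if "i < nsum D" for i and D :: "('o, 'm) dec"
    using that by (simp add: smd_def)
  have "snd X ! i = \<theta> \<and> (\<exists>\<psi> \<in> {0<..2}. [\<psi> = \<theta>] (rmod 2) \<and> smd (fst X) i \<in> slice \<sigma> \<psi>)" if i: "i < nsum (fst X)" for i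
  proof (cases "i < ?a")
    case True
    have "smd (fst X) i = smd (fst A) i" "snd X ! i = snd A ! i"
      unfolding smd_nth[OF i] smd_nth[OF True] m th using True la by (simp_all add: nth_append)
    then show ?thesis using lift_slice_D[OF A True] by simp
  next
    case False
    then have j: "i - ?a < ?b" using i nX by simp
    have "smd (fst X) i = smd (fst B) (i - ?a)" "snd X ! i = snd B ! (i - ?a)"
      unfolding smd_nth[OF i] smd_nth[OF j] m th using False la by (simp_all add: nth_append)
    then show ?thesis using lift_slice_D[OF B j] by simp
  qed
  then have "X \<in> lift_slice C \<sigma> \<theta>" unfolding lift_slice_def using oX by simp
  then show ?thesis using b by blast
qed

text \<open>A nonzero component would be homogeneous of the negative degree
  \<open>\<theta>2 - \<theta>1\<close> between semistable objects, against
  \<open>deg_nonneg\<close>.\<close>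

lemma lift_slice_Hom:
  assumes A: "A \<in> lift_slice C \<sigma> \<theta>1" and B: "B \<in> lift_slice C \<sigma> \<theta>2" and th: "\<theta>1 > \<theta>2"
  shows "mor T A B = {zerom T A B}"
proof -
  note oA = lift_slice_Ob[OF A] and oB = lift_slice_Ob[OF B]
  note z = lift_mor_zero[OF oA oB]
  have "f = zerom C (lift_proj A) (lift_proj B)" if f: "f \<in> lift_mor C (grading \<sigma>) A B" for f
  proof (rule lift_mor_ext[OF oA oB lift_morD(1)[OF f] lift_morD(1)[OF z]])
    fix i j assume i: "i < nsum (fst A)" and j: "j < nsum (fst B)"
    note ind = lift_ObD(5)[OF oA i] lift_ObD(5)[OF oB j]
    obtain \<psi>1 where p1: "\<psi>1 \<in> {0<..2}" "smd (fst A) i \<in> slice \<sigma> \<psi>1" using lift_slice_D(2)[OF A i] by (elim bexE conjE)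
    obtain \<psi>2 where p2: "\<psi>2 \<in> {0<..2}" "smd (fst B) j \<in> slice \<sigma> \<psi>2" using lift_slice_D(2)[OF B j] by (elim bexE conjE)
    let ?c = "component C (fst A) (fst B) f i j"
    have c: "?c \<in> grading \<sigma> (\<theta>2 - \<theta>1) (smd (fst A) i) (smd (fst B) j)"
      using lift_morD(2)[OF f i j] lift_slice_D(1)[OF A i] lift_slice_D(1)[OF B j] by simp
    have "?c = zerom C (smd (fst A) i) (smd (fst B) j)"
    proof (rule ccontr)
      assume nz: "?c \<noteq> zerom C (smd (fst A) i) (smd (fst B) j)"
      have "homogeneous (grading \<sigma>) (smd (fst A) i) (smd (fst B) j) ?c" unfolding homogeneous_def using c by blast
      from deg_nonneg[OF p1(1) p2(1) ind p1(2) p2(2) this nz] show False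
        unfolding deg_eq[OF ind c nz] using th by simp
    qed
    also have "\<dots> = component C (fst A) (fst B) (zerom C (lift_proj A) (lift_proj B)) i j"
      unfolding lift_proj_def by (rule component_zero[OF lift_ObD(1)[OF oA] lift_ObD(1)[OF oB] i j, symmetric])
    finally show "?c = component C (fst A) (fst B) (zerom C (lift_proj A) (lift_proj B)) i j" .
  qed
  then show ?thesis unfolding T_sel using z by blast
qed

lemma normalize_phase: "\<exists>\<psi> \<in> {0<..2}. [\<psi> = \<theta>] (rmod 2)" for \<theta> :: real
proof -
  \<comment> \<open>The interval is open at \<open>0\<close> and closed at \<open>2\<close>, so the
    ceiling minus one takes the place of the floor.\<close>
  obtain n :: int where n: "of_int n < \<theta> / 2" "\<theta> / 2 \<le> of_int n + 1"
    by (rule that[of "\<lceil>\<theta> / 2\<rceil> - 1"]) linarith+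
  then have "\<theta> - 2 * of_int n \<in> {0<..2}" by simp
  moreover have "[\<theta> - 2 * of_int n = \<theta>] (rmod 2)" unfolding rcong2_iff by (rule exI[of _ "- n"]) simp
  ultimately show ?thesis by blast
qed

text \<open>\<open>slice_shift\<close> is an equality of sets, so every semistable summand is the
  shift of a semistable object and can be shifted back by \<open>[-1]\<close>; this gives the
  inclusion from left to right.\<close>

lemma lift_slice_shift: "lift_slice C \<sigma> (\<theta> + 1) = Shift T 1 ` lift_slice C \<sigma> \<theta>"
proof -
  interpret TS: category_with_shift K T by (rule T_shift)
  have up: "lift_shift C 1 X \<in> lift_slice C \<sigma> (\<theta> + 1)" if X: "X \<in> lift_slice C \<sigma> \<theta>" for X
  proof -
    note o = lift_slice_Ob[OF X]
    have "snd (lift_shift C 1 X) ! i = \<theta> + 1 \<and>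
        (\<exists>\<psi> \<in> {0<..2}. [\<psi> = \<theta> + 1] (rmod 2) \<and> smd (shift_dec C 1 (fst X)) i \<in> slice \<sigma> \<psi>)" if i: "i < nsum (fst X)" for i
    proof -
      obtain \<psi> where p: "\<psi> \<in> {0<..2}" "[\<psi> = \<theta>] (rmod 2)" "smd (fst X) i \<in> slice \<sigma> \<psi>" using lift_slice_D(2)[OF X i] by (elim bexE conjE)
      obtain \<psi>' where p': "\<psi>' \<in> {0<..2}" "[\<psi>' = \<psi> + 1] (rmod 2)" using normalize_phase by blast
      have "Shift C 1 (smd (fst X) i) \<in> slice \<sigma> \<psi>'" using slice_shift[OF p(1) p'] p(3) by blast
      moreover have "[\<psi>' = \<theta> + 1] (rmod 2)"
      proof -
        obtain m n :: int where "\<psi> - \<theta> = 2 * of_int m" "\<psi>' - (\<psi> + 1) = 2 * of_int n" using p(2) p'(2) unfolding rcong2_iff by blast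
        then have "\<psi>' - (\<theta> + 1) = 2 * of_int (m + n)" by simp
        then show ?thesis unfolding rcong2_iff by blast
      qed
      ultimately show ?thesis using p'(1) lift_shift_sel(2)[OF o i, of 1] lift_slice_D(1)[OF X i] shift_dec_nth(1)[OF i, of C 1] by auto
    qed
    then show ?thesis unfolding lift_slice_def using lift_shift_Ob[OF o, of 1] by (simp add: lift_shift_sel(1)[OF o])
  qed
  have down: "lift_shift C (-1) X \<in> lift_slice C \<sigma> \<theta>" if X: "X \<in> lift_slice C \<sigma> (\<theta> + 1)" for X
  proof -
    note o = lift_slice_Ob[OF X]
    have "snd (lift_shift C (-1) X) ! i = \<theta> \<and>
        (\<exists>\<psi> \<in> {0<..2}. [\<psi> = \<theta>] (rmod 2) \<and> smd (shift_dec C (-1) (fst X)) i \<in> slice \<sigma> \<psi>)" if i: "i < nsum (fst X)" for i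
    proof -
      obtain \<psi>' where p': "\<psi>' \<in> {0<..2}" "[\<psi>' = \<theta> + 1] (rmod 2)" "smd (fst X) i \<in> slice \<sigma> \<psi>'" using lift_slice_D(2)[OF X i] by (elim bexE conjE)
      obtain \<psi> where p: "\<psi> \<in> {0<..2}" "[\<psi> = \<theta>] (rmod 2)" using normalize_phase by blast
      have c: "[\<psi>' = \<psi> + 1] (rmod 2)"
      proof -
        obtain m n :: int where "\<psi> - \<theta> = 2 * of_int m" "\<psi>' - (\<theta> + 1) = 2 * of_int n" using p(2) p'(2) unfolding rcong2_iff by blast
        then have "\<psi>' - (\<psi> + 1) = 2 * of_int (n - m)" by simp
        then show ?thesis unfolding rcong2_iff by blast
      qed
      have "smd (fst X) i \<in> Shift C 1 ` slice \<sigma> \<psi>" unfolding slice_shift[OF p(1) p'(1) c] by (rule p'(3))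
      then obtain Y where Y: "Y \<in> slice \<sigma> \<psi>" "smd (fst X) i = Shift C 1 Y" by (elim imageE)
      have YO: "Y \<in> Ob C" using slice_Ob[OF p(1)] Y(1) by blast
      have "Shift C (-1) (smd (fst X) i) = Y" unfolding Y(2) using Shift_add[OF YO, of "-1" 1] Shift_0[OF YO] by simp
      then have "smd (shift_dec C (-1) (fst X)) i \<in> slice \<sigma> \<psi>" using Y(1) shift_dec_nth(1)[OF i, of C "-1"] by simp
      moreover have "snd (lift_shift C (-1) X) ! i = \<theta>" using lift_shift_sel(2)[OF o i, of "-1"] lift_slice_D(1)[OF X i] by simp
      ultimately show ?thesis using p by blast
    qed
    then show ?thesis unfolding lift_slice_def using lift_shift_Ob[OF o, of "-1"] by (simp add: lift_shift_sel(1)[OF o])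
  qed
  have "X \<in> lift_shift C 1 ` lift_slice C \<sigma> \<theta>" if X: "X \<in> lift_slice C \<sigma> (\<theta> + 1)" for X
  proof (rule image_eqI[OF _ down[OF X]])
    have o: "X \<in> Ob T" unfolding T_sel by (rule lift_slice_Ob[OF X])
    show "X = lift_shift C 1 (lift_shift C (-1) X)" using TS.Shift_add[OF o, of 1 "-1"] TS.Shift_0[OF o] unfolding T_sel by simp
  qed
  then show ?thesis unfolding T_sel using up by blast
qed

text \<open>All summands have their charge on the same ray, so masses add without cancellation. The
  clause on \<open>m = 0\<close> is carried through the induction in order to obtain positive mass
  for nonzero objects.\<close>

lemma lift_slice_charge:
  assumes X: "X \<in> lift_slice C \<sigma> \<theta>"
  shows "\<exists>m \<ge> 0. charge \<sigma> (K0_class C (lift_proj X)) = of_real m * exp (\<i> * of_real pi * of_real \<theta>) \<and>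
    (m = 0 \<longrightarrow> zero_obj C (lift_proj X))"
  using lift_slice_Ob[OF X]
proof (induction X rule: lift_induct)
  have Z: "charge \<sigma> \<in> hom (K0 C) complex_group" using charge unfolding central_charge_def by blast
  {
    case (zero N)
    show ?case using charge_zero[OF Z T_zero_obj(1)[OF zero]] T_zero_obj(1)[OF zero] by (intro exI[of _ 0]) simp
  next
    case (single i)
    let ?E = "smd (fst X) i"
    note ind = lift_ObD(5)[OF lift_slice_Ob[OF X] single(1)]
    obtain \<psi> where p: "\<psi> \<in> {0<..2}" "[\<psi> = \<theta>] (rmod 2)" "?E \<in> slice \<sigma> \<psi>" using lift_slice_D(2)[OF X single(1)] by (elim bexE conjE)
    note ph = slice_phase[OF p(1) ind p(3)]
    \<comment> \<open>Phases that are congruent modulo \<open>2\<close> define the same ray.\<close>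
    obtain n :: int where "\<psi> - \<theta> = 2 * of_int n" using p(2) unfolding rcong2_iff by blast
    then have "pi * \<psi> = pi * \<theta> + 2 * pi * of_int n" by (simp add: algebra_simps)
    then have "cis (pi * \<psi>) = cis (pi * \<theta>)" using cis_multiple_2pi[of "of_int n"] by (simp flip: cis_mult)
    then have "exp (\<i> * of_real pi * of_real \<psi>) = exp (\<i> * of_real pi * of_real \<theta>)"
      by (simp add: cis_conv_exp mult.assoc)
    then have "charge \<sigma> (K0_class C ?E) = of_real (mass C \<sigma> ?E) * exp (\<i> * of_real pi * of_real \<theta>)"
      using charge_phase[OF ind] ph by simp
    then show ?case using ph by (intro exI[of _ "mass C \<sigma> ?E"]) (simp add: lift_proj_def)
  next
    case (sum A B Y i1 i2 p1 p2)
    note b = T_biproduct_D[OF sum(1)]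
    obtain m where m: "m \<ge> 0" "charge \<sigma> (K0_class C (lift_proj A)) = of_real m * exp (\<i> * of_real pi * of_real \<theta>)"
      "m = 0 \<longrightarrow> zero_obj C (lift_proj A)" using sum(2) by (elim exE conjE)
    obtain n where n: "n \<ge> 0" "charge \<sigma> (K0_class C (lift_proj B)) = of_real n * exp (\<i> * of_real pi * of_real \<theta>)"
      "n = 0 \<longrightarrow> zero_obj C (lift_proj B)" using sum(3) by (elim exE conjE)
    show ?case
    proof (intro exI[of _ "m + n"] conjI impI)
      show "0 \<le> m + n" using m(1) n(1) by simp
      show "charge \<sigma> (K0_class C (lift_proj Y)) = of_real (m + n) * exp (\<i> * of_real pi * of_real \<theta>)"
        unfolding charge_biproduct[OF Z b] m(2) n(2) by (simp add: algebra_simps)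
      assume "m + n = 0"
      then have "m = 0" "n = 0" using m(1) n(1) by simp_all
      then show "zero_obj C (lift_proj Y)" using biproduct_zero_obj[OF b] m(3) n(3) by simp
    qed
  }
qed

end

section \<open>Filtrations of indecomposable objects\<close>

text \<open>Connectivity as a proof principle: a property that passes along nonzero components in
  both directions is constant on connected nodes.\<close>

lemma path_in_closed:
  assumes S: "\<And>a b. a \<in> nodes D \<Longrightarrow> b \<in> nodes D \<Longrightarrow> (fst a, fst b) \<in> edges D \<Longrightarrow>
      arr_comp C D a b \<noteq> zerom C (node_obj D a) (node_obj D b) \<Longrightarrow> a \<in> S \<longleftrightarrow> b \<in> S"
  shows "path_in C G D a ps b \<Longrightarrow> a \<in> S \<longleftrightarrow> b \<in> S"
proof (induction ps arbitrary: a)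
  case Nil then show ?case by (simp add: path_in_Nil)
next
  case (Cons p ps)
  obtain s c where p: "p = (s, c)" by (cases p) blast
  have q: "path_in C G D c ps b" using Cons.prems unfolding p path_in_Cons by blast
  have a: "a \<in> nodes D" using path_in_nodes[OF Cons.prems] by blast
  have c: "c \<in> nodes D" using path_in_nodes[OF q] by blast
  have "a \<in> S \<longleftrightarrow> c \<in> S"
  proof (cases s)
    case True
    then show ?thesis using Cons.prems S[OF a c] unfolding p path_in_Cons by simp
  next
    case False
    then show ?thesis using Cons.prems S[OF c a] unfolding p path_in_Cons by simp
  qed
  then show ?case using Cons.IH[OF q] by simp
qed

lemma potentialD:
  assumes "potential C G D pot" "a \<in> nodes D" "b \<in> nodes D" "(fst a, fst b) \<in> edges D"
  shows "arr_comp C D a b \<in> G (pot b - pot a) (node_obj D a) (node_obj D b)"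
  using assms unfolding potential_def by blast

text \<open>In the local ring of endomorphisms of \<open>X\<close>, the idempotent \<open>?e\<close>
  or its complement is invertible. The complement kills the nonzero map \<open>u\<close>, so it is
  not. Hence \<open>?e\<close> is invertible, \<open>u\<close> has a right inverse besides its left
  inverse \<open>s\<close>, and the two agree.\<close>

lemma (in krull_schmidt_category) local_retraction:
  assumes X: "indecomposable C X" and W: "W \<in> Ob C" "\<not> zero_obj C W"
    and u: "u \<in> mor C W X" and s: "s \<in> mor C X W" and su: "Comp C s u = Idm C W"
  shows "is_isom C W X u"
proof -
  have XO: "X \<in> Ob C" by (rule indecomposable_Ob[OF X])
  let ?e = "Comp C u s"
  have e: "?e \<in> mor C X X" by (rule Comp_mor[OF s u XO W(1) XO])
  have I: "Idm C X \<in> mor C X X" by (rule Idm_closed[OF XO])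
  have d: "Idm C X \<ominus>\<^bsub>Hom C X X\<^esub> ?e \<in> mor C X X" by (rule diff_mor[OF XO XO I e])
  have eu: "Comp C ?e u = u" unfolding Comp_assoc'[OF u s u W(1) XO W(1) XO, symmetric] su by (rule Comp_Idm[OF W(1) XO u])
  have "\<not> is_isom C X X (Idm C X \<ominus>\<^bsub>Hom C X X\<^esub> ?e)"
  proof
    assume "is_isom C X X (Idm C X \<ominus>\<^bsub>Hom C X X\<^esub> ?e)"
    then obtain g where g: "is_isom C X X g" "Comp C g (Idm C X \<ominus>\<^bsub>Hom C X X\<^esub> ?e) = Idm C X"
      by (rule is_isom_inverse)
    note gm = is_isom_mor[OF g(1)]
    have "Comp C (Idm C X \<ominus>\<^bsub>Hom C X X\<^esub> ?e) u = zerom C W X"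
      unfolding Comp_diff(2)[OF W(1) XO XO u I e] eu Idm_Comp[OF W(1) XO u] by (rule add_zero(4)[OF W(1) XO u])
    then have "Comp C g (Comp C (Idm C X \<ominus>\<^bsub>Hom C X X\<^esub> ?e) u) = zerom C W X"
      using Comp_zero(1)[OF W(1) XO XO gm] by simp
    then have "u = zerom C W X"
      unfolding Comp_assoc'[OF u d gm W(1) XO XO XO] g(2) Idm_Comp[OF W(1) XO u] .
    then have "Idm C W = zerom C W W" using su Comp_zero(1)[OF W(1) XO W(1) s] by simp
    then show False using zero_obj_iff[OF W(1)] W(2) by blast
  qed
  moreover have "Idm C X = (Idm C X \<ominus>\<^bsub>Hom C X X\<^esub> ?e) \<oplus>\<^bsub>Hom C X X\<^esub> ?e"
    by (rule diff_add_cancel(1)[OF XO XO I e, symmetric])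
  ultimately have "is_isom C X X ?e" using End_local[OF X d e] is_isom_Idm[OF XO] by metis
  then obtain g where g: "is_isom C X X g" "Comp C ?e g = Idm C X" by (rule is_isom_inverse)
  note gm = is_isom_mor[OF g(1)]
  have sg: "Comp C s g \<in> mor C X W" by (rule Comp_mor[OF gm s XO XO W(1)])
  have r: "Comp C u (Comp C s g) = Idm C X" unfolding Comp_assoc'[OF gm s u XO XO W(1) XO] by (rule g(2))
  have "Comp C s g = Comp C (Comp C s u) (Comp C s g)" unfolding su by (rule Idm_Comp[OF XO W(1) sg, symmetric])
  also have "\<dots> = s" unfolding Comp_assoc'[OF sg u s XO W(1) XO W(1), symmetric] r by (rule Comp_Idm[OF XO W(1) s])
  finally have "Comp C u s = Idm C X" using r by simp
  then show ?thesis unfolding is_isom_def using u s su by blast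
qed

context phased_category
begin

text \<open>Three places further the diagram is its own shift by \<open>[1]\<close>, and
  \<open>[-1]\<close> preserves degrees. The potential read there is therefore a second potential on
  the same diagram.\<close>

lemma tri_potential_shift:
  assumes A: "is_dec C A" and B: "is_dec C B" and Q: "is_dec C Q" and Tr: "(tot A, tot B, tot Q, f, g, h) \<in> Tri C"
    and pot: "potential C G (tri_diagram C A B Q f g h UNIV) pot"
  shows "potential C G (tri_diagram C A B Q f g h UNIV) (\<lambda>(x, k). pot (x + 3, k))"
  unfolding tri_potential_iff
proof (intro allI impI)
  fix x i j
  let ?o = "tri_obj C A B Q" and ?a = "tri_arr C f g h"
  have dv: "(x + 3) div 3 = 1 + x div 3" "(x + 3) mod 3 = x mod 3" for x :: int by simp_all
  have os: "?o (x + 3) = shift_dec C 1 (?o x)" for x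
    unfolding tri_obj_def dv by (rule shift_dec_eqs(2)) (use A B Q in simp)
  have am: "?a (x + 3) = ShiftM C 1 (?a x)" for x
  proof -
    note t = TriD[OF Tr]
    have "ShiftM C (1 + x div 3) (if x mod 3 = 0 then f else if x mod 3 = 1 then g else h) =
        ShiftM C 1 (ShiftM C (x div 3) (if x mod 3 = 0 then f else if x mod 3 = 1 then g else h))"
      using ShiftM_add[OF t(1,2,6), of 1 "x div 3"] ShiftM_add[OF t(2,3,7), of 1 "x div 3"] ShiftM_add[OF t(3,4,8), of 1 "x div 3"] by simp
    then show ?thesis unfolding tri_arr_def dv .
  qed
  note d = tri_obj_dec[OF A B Q]
  assume "i < nsum (?o x)" "j < nsum (?o (x + 1))"
  note i = this(1) and j = this(2)
  have x4: "x + 1 + 3 = x + 3 + 1" by simp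
  let ?c = "component C (?o x) (?o (x + 1)) (?a x) i j"
  have ind: "indecomposable C (smd (?o x) i)" "indecomposable C (smd (?o (x + 1)) j)"
    by (rule is_dec_smd[OF d i], rule is_dec_smd[OF d j])
  have c: "?c \<in> mor C (smd (?o x) i) (smd (?o (x + 1)) j)"
    by (rule component_mor[OF d d tri_arr_mor(1)[OF A B Q Tr] i j])
  have o4: "?o (x + 3 + 1) = shift_dec C 1 (?o (x + 1))" using os[of "x + 1"] by (simp only: x4)
  have "component C (?o (x + 3)) (?o (x + 3 + 1)) (?a (x + 3)) i j \<in>
      G (pot (x + 3 + 1, j) - pot (x + 3, i)) (smd (?o (x + 3)) i) (smd (?o (x + 3 + 1)) j)"
    by (rule pot[unfolded tri_potential_iff, rule_format]) (use i j in \<open>simp_all only: os o4 shift_dec_sel UNIV_I\<close>)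
  then have "ShiftM C 1 ?c \<in> G (pot (x + 3 + 1, j) - pot (x + 3, i)) (Shift C 1 (smd (?o x) i)) (Shift C 1 (smd (?o (x + 1)) j))"
    unfolding os o4 am component_shift[OF d d tri_arr_mor(1)[OF A B Q Tr] i j] shift_dec_nth(1)[OF i] shift_dec_nth(1)[OF j] .
  from G_shift_int[OF indecomposable_Shift[OF ind(1)] indecomposable_Shift[OF ind(2)] this, of "-1"]
  have "?c \<in> G (pot (x + 3 + 1, j) - pot (x + 3, i)) (smd (?o x) i) (smd (?o (x + 1)) j)"
    unfolding ShiftM_neg_cancel(2)[OF c indecomposable_Ob[OF ind(1)] indecomposable_Ob[OF ind(2)]]
      Shift_neg_cancel(2)[OF indecomposable_Ob[OF ind(1)]] Shift_neg_cancel(2)[OF indecomposable_Ob[OF ind(2)]] .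
  then show "?c \<in> G ((case (x + 1, j) of (x, k) \<Rightarrow> pot (x + 3, k)) - (case (x, i) of (x, k) \<Rightarrow> pot (x + 3, k))) (smd (?o x) i) (smd (?o (x + 1)) j)"
    unfolding prod.case x4 .
qed

end

section \<open>A fixed Harder-Narasimhan diagram with a potential\<close>

locale harder_narasimhan = maslov_stable K C \<beta> \<Lambda> v \<sigma>
  for K :: "'k ring" and C :: "('o, 'm, 'k) tricat" and \<beta> :: "'o \<Rightarrow> 'm"
    and \<Lambda> :: "'l monoid" and v :: "('o \<Rightarrow>\<^sub>0 int) set \<Rightarrow> 'l" and \<sigma> :: "('o, 'm) stability" +
  fixes X :: 'o and n :: nat and E Q :: "nat \<Rightarrow> ('o, 'm) dec" and f p t :: "nat \<Rightarrow> 'm" and pot :: "(nat \<times> int) \<times> nat \<Rightarrow> real"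
  assumes indX: "indecomposable C X"
    and filtration: "HN_filtration C \<sigma> X n E Q f p t"
    and pot: "potential C (grading \<sigma>) (HN_diagram C n E Q f p t UNIV) pot"
begin

abbreviation H where "H V \<equiv> HN_diagram C n E Q f p t V"

lemma dec_E: "i \<le> n \<Longrightarrow> is_dec C (E i)"
  and dec_Q: "i \<in> {1..n} \<Longrightarrow> is_dec C (Q i)"
  and zero_E0: "zero_obj C (tot (E 0))"
  and E_top: "E n = single_dec C X"
  and Q_nonzero: "i \<in> {1..n} \<Longrightarrow> \<not> zero_obj C (tot (Q i))"
  and Q_slice: "i \<in> {1..n} \<Longrightarrow> \<exists>\<psi> \<in> {0<..2}. tot (Q i) \<in> slice \<sigma> \<psi>"
  and conn: "connective C (grading \<sigma>) (H {0, 1, 2})"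
  and column: "i \<in> {1..n} \<Longrightarrow> (tot (E (i - 1)), tot (E i), tot (Q i), f i, p i, t i) \<in> Tri C"
  and drop: "i \<in> {2..n} \<Longrightarrow> \<exists>c < 0. \<forall>a < nsum (Q (i - 1)). \<forall>b < nsum (Q i).
        (\<exists>ps. simple_path_in C (grading \<sigma>) (H {0, 1, 2}) ((i - 1, 2), a) ps ((i, 2), b)) \<and>
        (\<forall>ps. simple_path_in C (grading \<sigma>) (H {0, 1, 2}) ((i - 1, 2), a) ps ((i, 2), b) \<longrightarrow>
              q_in C (grading \<sigma>) (H {0, 1, 2}) ((i - 1, 2), a) ps = c)"
  using filtration unfolding HN_filtration_def by simp_all

lemma nsum_E0: "nsum (E 0) = 0"
  using is_dec_nsum_0[OF dec_E[of 0]] zero_E0 by simp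

lemma n_pos: "0 < n"
proof (rule ccontr)
  assume "\<not> 0 < n"
  then have "E 0 = single_dec C X" using E_top by simp
  then show False using nsum_E0 by simp
qed

lemma nsum_Q: "i \<in> {1..n} \<Longrightarrow> 0 < nsum (Q i)"
  using is_dec_nsum_0[OF dec_Q] Q_nonzero by blast

lemma column_dec:
  assumes "i \<in> {1..n}" shows "is_dec C (E (i - 1))" "is_dec C (E i)" "is_dec C (Q i)"
  using assms by (auto intro: dec_E dec_Q)

lemma vobj_H:
  assumes "1 \<le> i" shows "vobj (H V) (i, x) = tri_obj C (E (i - 1)) (E i) (Q i) x"
  using assms by (simp add: HN_diagram_def)

lemma nodes_H:
  "((i, x), k) \<in> nodes (H V) \<longleftrightarrow> x \<in> V \<and> i \<in> {1..n} \<and> k < nsum (tri_obj C (E (i - 1)) (E i) (Q i) x)"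
proof (cases "i = 0")
  case True
  then show ?thesis unfolding nodes_def HN_diagram_def using nsum_E0 by simp
next
  case False
  then show ?thesis unfolding nodes_def HN_diagram_def by auto
qed

lemma small_nodes:
  assumes i: "i \<in> {1..n}"
  shows "((i, 0), k) \<in> nodes (H {0, 1, 2}) \<longleftrightarrow> k < nsum (E (i - 1))"
    "((i, 1), k) \<in> nodes (H {0, 1, 2}) \<longleftrightarrow> k < nsum (E i)"
    "((i, 2), k) \<in> nodes (H {0, 1, 2}) \<longleftrightarrow> k < nsum (Q i)"
  unfolding nodes_H tri_obj_eqs(1-3)[OF column_dec[OF i]] using i by simp_all

text \<open>Rows \<open>0\<close>, \<open>1\<close>, \<open>2\<close> of a column hold
  \<open>E (i - 1)\<close>, \<open>E i\<close> and \<open>Q i\<close>; identity arrows lead from row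
  \<open>1\<close> to row \<open>0\<close> of the next column. Column \<open>0\<close> has no
  summands, so every edge between nodes starts in column \<open>1\<close> or later.\<close>

lemma small_edges:
  assumes a: "a \<in> nodes (H {0, 1, 2})" and b: "b \<in> nodes (H {0, 1, 2})" and e: "(fst a, fst b) \<in> edges (H {0, 1, 2})"
  obtains (f) i k l where "i \<in> {1..n}" "a = ((i, 0), k)" "b = ((i, 1), l)" "k < nsum (E (i - 1))" "l < nsum (E i)"
  | (p) i k l where "i \<in> {1..n}" "a = ((i, 1), k)" "b = ((i, 2), l)" "k < nsum (E i)" "l < nsum (Q i)"
  | (Idm) i k l where "i \<in> {1..n}" "i + 1 \<in> {1..n}" "a = ((i, 1), k)" "b = ((i + 1, 0), l)" "k < nsum (E i)" "l < nsum (E i)"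
proof -
  obtain i x k where a': "a = ((i, x), k)" by (metis prod.collapse)
  obtain j y l where b': "b = ((j, y), l)" by (metis prod.collapse)
  have i: "i \<in> {1..n}" and j: "j \<in> {1..n}" using a b unfolding a' b' nodes_H by blast+
  have "((i, x), (j, y)) \<in> edges (H {0, 1, 2})" using e unfolding a' b' by simp
  then have "j = i \<and> y = x + 1 \<and> x \<in> {0, 1, 2} \<and> x + 1 \<in> {0, 1, 2} \<or> j = i + 1 \<and> y = x - 1 \<and> x mod 3 = 1 \<and> x \<in> {0, 1, 2}"
    unfolding HN_diagram_def by auto
  then consider "j = i" "x = 0" "y = 1" | "j = i" "x = 1" "y = 2" | "j = i + 1" "x = 1" "y = 0" by auto
  then show ?thesis
  proof cases
    case 1 then show ?thesis using f[OF i, of k l] a b unfolding a' b' using small_nodes[OF i] by simp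
  next
    case 2 then show ?thesis using p[OF i, of k l] a b unfolding a' b' using small_nodes[OF i] by simp
  next
    case 3 then show ?thesis using Idm[OF i, of k l] j a b unfolding a' b' using small_nodes[OF i] small_nodes[OF j] by simp
  qed
qed

lemma small_arr:
  assumes i: "i \<in> {1..n}"
  shows "arr_comp C (H V) ((i, 0), k) ((i, 1), l) = component C (E (i - 1)) (E i) (f i) k l"
    "arr_comp C (H V) ((i, 1), k) ((i, 2), l) = component C (E i) (Q i) (p i) k l"
    "i + 1 \<in> {1..n} \<Longrightarrow> arr_comp C (H V) ((i, 1), k) ((i + 1, 0), l) = component C (E i) (E i) (Idm C (tot (E i))) k l"
    "node_obj (H V) ((i, 0), k) = smd (E (i - 1)) k" "node_obj (H V) ((i, 1), k) = smd (E i) k" "node_obj (H V) ((i, 2), k) = smd (Q i) k"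
proof -
  have i1: "1 \<le> i" using i by simp
  note eqs = tri_obj_eqs(1-3)[OF column_dec[OF i]] and c = TriD[OF column[OF i]]
  show "arr_comp C (H V) ((i, 0), k) ((i, 1), l) = component C (E (i - 1)) (E i) (f i) k l"
    "arr_comp C (H V) ((i, 1), k) ((i, 2), l) = component C (E i) (Q i) (p i) k l"
    "node_obj (H V) ((i, 0), k) = smd (E (i - 1)) k" "node_obj (H V) ((i, 1), k) = smd (E i) k" "node_obj (H V) ((i, 2), k) = smd (Q i) k"
    unfolding arr_comp_def node_obj_def fst_conv snd_conv vobj_H[OF i1] eqs
    by (simp_all add: HN_diagram_def tri_arr_def ShiftM_0[OF c(1,2,6)] ShiftM_0[OF c(2,3,7)])
  assume j: "i + 1 \<in> {1..n}"
  then have j1: "1 \<le> i + 1" by simp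
  show "arr_comp C (H V) ((i, 1), k) ((i + 1, 0), l) = component C (E i) (E i) (Idm C (tot (E i))) k l"
    unfolding arr_comp_def fst_conv snd_conv vobj_H[OF i1] vobj_H[OF j1] eqs tri_obj_eqs(1-3)[OF column_dec[OF j]]
    by (simp add: HN_diagram_def Shift_0[OF c(2)])
qed

lemma column_potential:
  assumes i: "i \<in> {1..n}"
  shows "potential C (grading \<sigma>) (tri_diagram C (E (i - 1)) (E i) (Q i) (f i) (p i) (t i) UNIV) (\<lambda>(x, k). pot ((i, x), k))"
  unfolding tri_potential_iff
proof (intro allI impI)
  fix x k l
  have i1: "1 \<le> i" using i by simp
  let ?o = "tri_obj C (E (i - 1)) (E i) (Q i)"
  assume k: "k < nsum (?o x)" and l: "l < nsum (?o (x + 1))"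
  have "((i, x), k) \<in> nodes (H UNIV)" "((i, x + 1), l) \<in> nodes (H UNIV)" using i k l unfolding nodes_H by simp_all
  moreover have "(fst ((i, x), k), fst ((i, x + 1), l)) \<in> edges (H UNIV)" using i unfolding HN_diagram_def by simp
  ultimately have "arr_comp C (H UNIV) ((i, x), k) ((i, x + 1), l) \<in>
      grading \<sigma> (pot ((i, x + 1), l) - pot ((i, x), k)) (node_obj (H UNIV) ((i, x), k)) (node_obj (H UNIV) ((i, x + 1), l))"
    by (rule potentialD[OF pot])
  moreover have "arr (H UNIV) ((i, x), (i, x + 1)) = tri_arr C (f i) (p i) (t i) x" unfolding HN_diagram_def by simp
  ultimately show "component C (?o x) (?o (x + 1)) (tri_arr C (f i) (p i) (t i) x) k l \<in>
      grading \<sigma> ((case (x + 1, l) of (x, k) \<Rightarrow> pot ((i, x), k)) - (case (x, k) of (x, k) \<Rightarrow> pot ((i, x), k))) (smd (?o x) k) (smd (?o (x + 1)) l)"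
    unfolding arr_comp_def node_obj_def fst_conv snd_conv vobj_H[OF i1] prod.case by simp
qed

text \<open>The identity of an indecomposable object is nonzero and has degree \<open>0\<close> and
  no other degree, so the potential agrees at both ends of an identity arrow.\<close>

lemma identity_potential:
  assumes i: "i \<in> {1..n}" "i + 1 \<in> {1..n}" and k: "k < nsum (E i)"
  shows "pot ((i + 1, 0), k) = pot ((i, 1), k)" "pot ((i + 1, 3), k) = pot ((i, 4), k)"
proof -
  have i1: "1 \<le> i" "1 \<le> i + 1" using i by simp_all
  note eqs = tri_obj_eqs(1-6)[OF column_dec[OF i(1)]] and eqs' = tri_obj_eqs(1-6)[OF column_dec[OF i(2)]]
  have E: "is_dec C (E i)" using i by (intro dec_E) simp
  have key: "r = s" if D: "is_dec C D" and k: "k < nsum D" and c: "component C D D (Idm C (tot D)) k k \<in> grading \<sigma> (r - s) (smd D k) (smd D k)" for D r s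
  proof -
    note ind = is_dec_smd[OF D k]
    have "Idm C (smd D k) \<in> grading \<sigma> (r - s) (smd D k) (smd D k)" using c component_Idm[OF D k k] by simp
    moreover have "Idm C (smd D k) \<noteq> zerom C (smd D k) (smd D k)"
      using ind zero_obj_iff[OF indecomposable_Ob[OF ind]] unfolding indecomposable_def by simp
    ultimately have "r - s = 0" using G_unique[OF ind ind _ G_Idm[OF ind]] by blast
    then show ?thesis by simp
  qed
  have edge: "component C (vobj (H UNIV) (i, x)) (vobj (H UNIV) (i + 1, x - 1)) (Idm C (Shift C (x div 3) (tot (E i)))) k k \<in>
      grading \<sigma> (pot ((i + 1, x - 1), k) - pot ((i, x), k)) (smd (vobj (H UNIV) (i, x)) k) (smd (vobj (H UNIV) (i + 1, x - 1)) k)"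
    if x: "x mod 3 = 1" "k < nsum (tri_obj C (E (i - 1)) (E i) (Q i) x)" "k < nsum (tri_obj C (E (i + 1 - 1)) (E (i + 1)) (Q (i + 1)) (x - 1))" for x
  proof -
    have "((i, x), k) \<in> nodes (H UNIV)" "((i + 1, x - 1), k) \<in> nodes (H UNIV)" using i x unfolding nodes_H by blast+
    moreover have "(fst ((i, x), k), fst ((i + 1, x - 1), k)) \<in> edges (H UNIV)" using i x unfolding HN_diagram_def by simp
    ultimately have "arr_comp C (H UNIV) ((i, x), k) ((i + 1, x - 1), k) \<in>
        grading \<sigma> (pot ((i + 1, x - 1), k) - pot ((i, x), k)) (node_obj (H UNIV) ((i, x), k)) (node_obj (H UNIV) ((i + 1, x - 1), k))"
      by (rule potentialD[OF pot])
    moreover have "arr (H UNIV) ((i, x), (i + 1, x - 1)) = Idm C (Shift C (x div 3) (tot (E i)))" unfolding HN_diagram_def by simp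
    ultimately show ?thesis unfolding arr_comp_def node_obj_def fst_conv snd_conv by simp
  qed
  have v: "vobj (H UNIV) (i, 1) = E i" "vobj (H UNIV) (i + 1, 0) = E i" "vobj (H UNIV) (i, 4) = shift_dec C 1 (E i)" "vobj (H UNIV) (i + 1, 3) = shift_dec C 1 (E i)"
    unfolding vobj_H[OF i1(1)] vobj_H[OF i1(2)] eqs eqs' by simp_all
  show "pot ((i + 1, 0), k) = pot ((i, 1), k)"
  proof (rule key[OF E k])
    show "component C (E i) (E i) (Idm C (tot (E i))) k k \<in> grading \<sigma> (pot ((i + 1, 0), k) - pot ((i, 1), k)) (smd (E i) k) (smd (E i) k)"
      using edge[of 1] k eqs(2) eqs'(1) Shift_0[OF is_dec_tot[OF E]] v by simp
  qed
  show "pot ((i + 1, 3), k) = pot ((i, 4), k)"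
  proof (rule key[OF is_dec_shift[OF E]])
    show "k < nsum (shift_dec C 1 (E i))" using k by simp
    show "component C (shift_dec C 1 (E i)) (shift_dec C 1 (E i)) (Idm C (tot (shift_dec C 1 (E i)))) k k \<in>
        grading \<sigma> (pot ((i + 1, 3), k) - pot ((i, 4), k)) (smd (shift_dec C 1 (E i)) k) (smd (shift_dec C 1 (E i)) k)"
      using edge[of 4] k eqs(5) eqs'(4) v by simp
  qed
qed

lemma small_potential: "potential C (grading \<sigma>) (H {0, 1, 2}) pot"
  unfolding potential_def
proof (intro ballI impI)
  fix a b assume a: "a \<in> nodes (H {0, 1, 2})" "b \<in> nodes (H {0, 1, 2})" "(fst a, fst b) \<in> edges (H {0, 1, 2})"
  have "a \<in> nodes (H UNIV)" "b \<in> nodes (H UNIV)" using a(1,2) unfolding nodes_def HN_diagram_def by auto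
  moreover have "(fst a, fst b) \<in> edges (H UNIV)" using a(3) unfolding HN_diagram_def by auto
  ultimately have "arr_comp C (H UNIV) a b \<in> grading \<sigma> (pot b - pot a) (node_obj (H UNIV) a) (node_obj (H UNIV) b)"
    by (rule potentialD[OF pot])
  then show "arr_comp C (H {0, 1, 2}) a b \<in> grading \<sigma> (pot b - pot a) (node_obj (H {0, 1, 2}) a) (node_obj (H {0, 1, 2}) b)"
    unfolding arr_comp_def node_obj_def HN_diagram_def by simp
qed

text \<open>With \<open>small_potential\<close> this makes two potentials on one connective diagram;
  \<open>raise_constant\<close> concludes that they differ by a constant.\<close>

lemma small_potential_shift: "potential C (grading \<sigma>) (H {0, 1, 2}) (\<lambda>((i, x), k). pot ((i, x + 3), k))" (is "potential _ _ _ ?pot")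
  unfolding potential_def
proof (intro ballI impI)
  fix a b assume a: "a \<in> nodes (H {0, 1, 2})" "b \<in> nodes (H {0, 1, 2})" "(fst a, fst b) \<in> edges (H {0, 1, 2})"
  from a show "arr_comp C (H {0, 1, 2}) a b \<in> grading \<sigma> (?pot b - ?pot a) (node_obj (H {0, 1, 2}) a) (node_obj (H {0, 1, 2}) b)"
  proof (cases rule: small_edges)
    case (f i k l)
    note tp = tri_potentialD[OF column_dec[OF f(1)] tri_potential_shift[OF column_dec[OF f(1)] column[OF f(1)] column_potential[OF f(1)]]]
    note c = TriD[OF column[OF f(1)]]
    show ?thesis unfolding f(2,3) small_arr[OF f(1)] using tp(1)[OF f(4,5)] unfolding ShiftM_0[OF c(1,2,6)] by simp
  next
    case (p i k l)
    note tp = tri_potentialD[OF column_dec[OF p(1)] tri_potential_shift[OF column_dec[OF p(1)] column[OF p(1)] column_potential[OF p(1)]]]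
    note c = TriD[OF column[OF p(1)]]
    show ?thesis unfolding p(2,3) small_arr[OF p(1)] using tp(2)[OF p(4,5)] unfolding ShiftM_0[OF c(2,3,7)] by simp
  next
    case (Idm i k l)
    have E: "is_dec C (E i)" using Idm(1) by (intro dec_E) simp
    note ind = is_dec_smd[OF E]
    have "component C (E i) (E i) (Idm C (tot (E i))) k l \<in> grading \<sigma> (pot ((i + 1, 3), l) - pot ((i, 4), k)) (smd (E i) k) (smd (E i) l)"
    proof (cases "k = l")
      case True
      then show ?thesis unfolding component_Idm[OF E Idm(5,6)] using identity_potential(2)[OF Idm(1,2,5)] G_Idm[OF ind[OF Idm(5)]] by simp
    next
      case False
      then show ?thesis unfolding component_Idm[OF E Idm(5,6)] using G_sub(1)[OF ind[OF Idm(5)] ind[OF Idm(6)]] by simp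
    qed
    then show ?thesis unfolding Idm(3,4) small_arr(3)[OF Idm(1,2)] small_arr(5)[OF Idm(1)] small_arr(4)[OF Idm(2)] by simp
  qed
qed

lemma small_diagram: "is_diagram C (H {0, 1, 2})"
  using conn unfolding connective_def liftable_def commutative_diagram_def by blast

lemma small_closed:
  assumes S: "\<And>a b. a \<in> nodes (H {0, 1, 2}) \<Longrightarrow> b \<in> nodes (H {0, 1, 2}) \<Longrightarrow> (fst a, fst b) \<in> edges (H {0, 1, 2}) \<Longrightarrow>
      arr_comp C (H {0, 1, 2}) a b \<noteq> zerom C (node_obj (H {0, 1, 2}) a) (node_obj (H {0, 1, 2}) b) \<Longrightarrow> a \<in> S \<longleftrightarrow> b \<in> S"
    and a: "a \<in> nodes (H {0, 1, 2})" "a \<in> S" and b: "b \<in> nodes (H {0, 1, 2})"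
  shows "b \<in> S"
proof -
  obtain ps where "path_in C (grading \<sigma>) (H {0, 1, 2}) a ps b" using conn a(1) b unfolding connective_def by blast
  from path_in_closed[where S = S, OF S this] show ?thesis using a(2) by blast
qed

lemma top_node: "((n, 1), 0) \<in> nodes (H {0, 1, 2})" and top_obj: "node_obj (H {0, 1, 2}) ((n, 1), 0) = X"
proof -
  have n: "n \<in> {1..n}" using n_pos by simp
  show "((n, 1), 0) \<in> nodes (H {0, 1, 2})" "node_obj (H {0, 1, 2}) ((n, 1), 0) = X"
    unfolding small_nodes(2)[OF n] small_arr(5)[OF n] E_top by simp_all
qed

text \<open>Both sides change by congruent amounts along a nonzero component, by
  \<open>degree_phase\<close>, and they agree at the top object; connectivity spreads this to all
  nodes.\<close>

lemma small_congruent: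
  assumes a: "a \<in> nodes (H {0, 1, 2})"
  shows "[pot a - pot ((n, 1), 0) = phase \<sigma> (node_obj (H {0, 1, 2}) a) - phase \<sigma> X] (rmod 2)"
proof -
  let ?o = "node_obj (H {0, 1, 2})"
  let ?S = "{a. [pot a - pot ((n, 1), 0) = phase \<sigma> (?o a) - phase \<sigma> X] (rmod 2)}"
  have "a \<in> ?S"
  proof (rule small_closed[OF _ top_node _ a])
    show "((n, 1), 0) \<in> ?S" unfolding mem_Collect_eq top_obj rcong2_iff by (rule exI[of _ 0]) simp
    fix a b assume ab: "a \<in> nodes (H {0, 1, 2})" "b \<in> nodes (H {0, 1, 2})" "(fst a, fst b) \<in> edges (H {0, 1, 2})"
      and nz: "arr_comp C (H {0, 1, 2}) a b \<noteq> zerom C (?o a) (?o b)"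
    obtain m :: int where m: "(pot b - pot a) - (phase \<sigma> (?o b) - phase \<sigma> (?o a)) = 2 * of_int m"
      using degree_phase[OF node_indecomposable[OF small_diagram ab(1)] node_indecomposable[OF small_diagram ab(2)] potentialD[OF small_potential ab] nz]
      unfolding rcong2_iff by blast
    show "a \<in> ?S \<longleftrightarrow> b \<in> ?S"
    proof
      assume "a \<in> ?S"
      then obtain k :: int where "(pot a - pot ((n, 1), 0)) - (phase \<sigma> (?o a) - phase \<sigma> X) = 2 * of_int k" unfolding mem_Collect_eq rcong2_iff by blast
      then have "(pot b - pot ((n, 1), 0)) - (phase \<sigma> (?o b) - phase \<sigma> X) = 2 * of_int (k + m)" using m by simp
      then show "b \<in> ?S" unfolding mem_Collect_eq rcong2_iff by blast
    next
      assume "b \<in> ?S"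
      then obtain k :: int where "(pot b - pot ((n, 1), 0)) - (phase \<sigma> (?o b) - phase \<sigma> X) = 2 * of_int k" unfolding mem_Collect_eq rcong2_iff by blast
      then have "(pot a - pot ((n, 1), 0)) - (phase \<sigma> (?o a) - phase \<sigma> X) = 2 * of_int (k - m)" using m by simp
      then show "a \<in> ?S" unfolding mem_Collect_eq rcong2_iff by blast
    qed
  qed
  then show ?thesis by simp
qed

abbreviation raise :: "(nat \<times> int) \<times> nat \<Rightarrow> real" where
  "raise a \<equiv> pot ((fst (fst a), snd (fst a) + 3), snd a) - pot a"

text \<open>A nonzero component has only one degree, so both potentials have the same increment
  along it. The excess under \<open>[1]\<close> is therefore the same at all nodes.\<close>

lemma raise_constant:
  assumes a: "a \<in> nodes (H {0, 1, 2})" and b: "b \<in> nodes (H {0, 1, 2})"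
  shows "raise a = raise b"
proof -
  let ?o = "node_obj (H {0, 1, 2})"
  have "b \<in> {c. raise a = raise c}"
  proof (rule small_closed[OF _ a _ b])
    show "a \<in> {c. raise a = raise c}" by simp
    fix c d assume cd: "c \<in> nodes (H {0, 1, 2})" "d \<in> nodes (H {0, 1, 2})" "(fst c, fst d) \<in> edges (H {0, 1, 2})"
      and nz: "arr_comp C (H {0, 1, 2}) c d \<noteq> zerom C (?o c) (?o d)"
    have "raise c = raise d"
      using G_unique[OF node_indecomposable[OF small_diagram cd(1)] node_indecomposable[OF small_diagram cd(2)]
          potentialD[OF small_potential cd] potentialD[OF small_potential_shift cd] nz] by (simp add: case_prod_beta)
    then show "c \<in> {c. raise a = raise c} \<longleftrightarrow> d \<in> {c. raise a = raise c}" by simp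
  qed
  then show ?thesis by simp
qed

text \<open>In rows \<open>0\<close> to \<open>2\<close> a summand of \<open>Q n\<close> meets only
  components of \<open>p n\<close>, and \<open>E n\<close> has the single summand \<open>X\<close>.
  If that one component vanished, the node of the summand would be isolated.\<close>

lemma p_nonzero:
  assumes b: "b < nsum (Q n)"
  shows "component C (E n) (Q n) (p n) 0 b \<noteq> zerom C (smd (E n) 0) (smd (Q n) b)"
proof
  have n: "n \<in> {1..n}" using n_pos by simp
  assume z: "component C (E n) (Q n) (p n) 0 b = zerom C (smd (E n) 0) (smd (Q n) b)"
  have "((n, 1), 0) \<in> {((n, 2 :: int), b)}"
  proof (rule small_closed[OF _ _ _ top_node])
    show "((n, 2), b) \<in> nodes (H {0, 1, 2})" unfolding small_nodes(3)[OF n] by (rule b)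
    fix c d assume cd: "c \<in> nodes (H {0, 1, 2})" "d \<in> nodes (H {0, 1, 2})" "(fst c, fst d) \<in> edges (H {0, 1, 2})"
      and nz: "arr_comp C (H {0, 1, 2}) c d \<noteq> zerom C (node_obj (H {0, 1, 2}) c) (node_obj (H {0, 1, 2}) d)"
    from cd show "c \<in> {((n, 2), b)} \<longleftrightarrow> d \<in> {((n, 2), b)}"
    proof (cases rule: small_edges)
      case (f i k l) then show ?thesis by simp
    next
      case (p i k l)
      have "\<not> (i = n \<and> l = b)"
      proof
        assume il: "i = n \<and> l = b"
        then have "k = 0" using p(4) E_top by simp
        then show False using nz z il unfolding p(2,3) small_arr(2)[OF p(1)] small_arr(5)[OF p(1)] small_arr(6)[OF p(1)] by simp
      qed
      then show ?thesis unfolding p(2,3) by simp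
    next
      case (Idm i k l) then show ?thesis by simp
    qed
  qed simp
  then show False by simp
qed

text \<open>Without a nonzero component of \<open>f n\<close> the last column would be cut off from
  the earlier ones.\<close>

lemma f_nonzero:
  assumes n: "n \<noteq> 1"
  obtains a where "a < nsum (E (n - 1))" "component C (E (n - 1)) (E n) (f n) a 0 \<noteq> zerom C (smd (E (n - 1)) a) (smd (E n) 0)"
proof (rule ccontr)
  assume "\<not> thesis"
  then have z: "component C (E (n - 1)) (E n) (f n) a 0 = zerom C (smd (E (n - 1)) a) (smd (E n) 0)" if "a < nsum (E (n - 1))" for a
    using that(1) \<open>\<And>a. a < nsum (E (n - 1)) \<Longrightarrow> component C (E (n - 1)) (E n) (f n) a 0 \<noteq> zerom C (smd (E (n - 1)) a) (smd (E n) 0) \<Longrightarrow> thesis\<close> by blast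
  have nn: "n \<in> {1..n}" and n1: "n - 1 \<in> {1..n}" using n_pos n by simp_all
  \<comment> \<open>The last column without its row \<open>0\<close>. Identity arrows start in
    earlier columns and end in row \<open>0\<close>, so within these rows the set is joined to its
    complement by components of \<open>f n\<close> only.\<close>
  let ?S = "{((i, x), k :: nat). i = n \<and> x \<noteq> (0 :: int)}"
  have "((n - 1, 2), 0) \<in> ?S"
  proof (rule small_closed[OF _ top_node])
    show "((n - 1, 2), 0) \<in> nodes (H {0, 1, 2})" unfolding small_nodes(3)[OF n1] by (rule nsum_Q[OF n1])
    show "((n, 1), 0) \<in> ?S" by simp
    fix c d assume cd: "c \<in> nodes (H {0, 1, 2})" "d \<in> nodes (H {0, 1, 2})" "(fst c, fst d) \<in> edges (H {0, 1, 2})"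
      and nz: "arr_comp C (H {0, 1, 2}) c d \<noteq> zerom C (node_obj (H {0, 1, 2}) c) (node_obj (H {0, 1, 2}) d)"
    from cd show "c \<in> ?S \<longleftrightarrow> d \<in> ?S"
    proof (cases rule: small_edges)
      case (f i k l)
      have "i \<noteq> n"
      proof
        assume i: "i = n"
        then have "l = 0" using f(5) E_top by simp
        then show False using nz z f(4) i unfolding f(2,3) small_arr(1)[OF f(1)] small_arr(4)[OF f(1)] small_arr(5)[OF f(1)] by simp
      qed
      then show ?thesis unfolding f(2,3) by simp
    next
      case (p i k l) then show ?thesis by simp
    next
      case (Idm i k l)
      then have "i \<noteq> n" by simp
      then show ?thesis unfolding Idm(3,4) by simp
    qed
  qed
  then show False using n_pos by simp
qed

text \<open>Suppose that no component of \<open>t n\<close> reaches the shift of the summand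
  \<open>?W\<close>. Then the projection to \<open>?W\<close> extends along \<open>f n\<close> to a
  map \<open>s\<close> on \<open>X\<close>, so \<open>f n\<close> embeds \<open>?W\<close> as a
  retract of the indecomposable \<open>X\<close>. Thus \<open>?W\<close> is all of \<open>X\<close>,
  and \<open>p n\<close>, which kills the image of \<open>f n\<close>, vanishes; this contradicts
  \<open>p_nonzero\<close>.\<close>

lemma t_nonzero:
  assumes a: "a < nsum (E (n - 1))" and fa: "component C (E (n - 1)) (E n) (f n) a 0 \<noteq> zerom C (smd (E (n - 1)) a) (smd (E n) 0)"
  obtains b where "b < nsum (Q n)" "component C (Q n) (shift_dec C 1 (E (n - 1))) (t n) b a \<noteq> zerom C (smd (Q n) b) (Shift C 1 (smd (E (n - 1)) a))"
proof (rule ccontr)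
  assume nt: "\<not> thesis"
  have nn: "n \<in> {1..n}" using n_pos by simp
  note A = column_dec(1)[OF nn] and Q = column_dec(3)[OF nn] and T = column[OF nn]
  note o = TriD[OF T]
  let ?A = "E (n - 1)"
  let ?W = "smd ?A a" and ?\<pi> = "proj ?A a" and ?\<iota> = "incl ?A a"
  have W: "?W \<in> Ob C" and pi: "?\<pi> \<in> mor C (tot ?A) ?W" and io: "?\<iota> \<in> mor C ?W (tot ?A)"
    by (rule is_dec_smd_Ob[OF A a], rule is_dec_proj[OF A a], rule is_dec_incl[OF A a])
  have W1: "Shift C 1 ?W \<in> Ob C" by (rule Shift_closed[OF W])
  have pi1: "ShiftM C 1 ?\<pi> \<in> mor C (Shift C 1 (tot ?A)) (Shift C 1 ?W)" by (rule ShiftM_closed[OF o(1) W pi])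
  have iW: "indecomposable C ?W" by (rule is_dec_smd[OF A a])
  let ?W1 = "single_dec C (Shift C 1 ?W)"
  have dW1: "is_dec C ?W1" by (rule is_dec_single[OF indecomposable_Shift[OF iW]])
  have pt: "Comp C (ShiftM C 1 ?\<pi>) (t n) \<in> mor C (tot (Q n)) (Shift C 1 ?W)" by (rule Comp_mor[OF o(8) pi1 o(3,4) W1])
  have "Comp C (ShiftM C 1 ?\<pi>) (t n) = zerom C (tot (Q n)) (Shift C 1 ?W)"
  proof (rule mor_ext[OF Q dW1, unfolded single_dec_sel])
    fix b j assume b: "b < nsum (Q n)" and j: "j < (1 :: nat)"
    have io': "incl (Q n) b \<in> mor C (smd (Q n) b) (tot (Q n))" by (rule is_dec_incl[OF Q b])
    have bO: "smd (Q n) b \<in> Ob C" by (rule is_dec_smd_Ob[OF Q b])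
    have j0: "j = 0" using j by simp
    have "component C (Q n) ?W1 (Comp C (ShiftM C 1 ?\<pi>) (t n)) b j = component C (Q n) (shift_dec C 1 ?A) (t n) b a"
      unfolding component_def j0 single_dec_sel shift_dec_nth(3)[OF a] Idm_Comp[OF o(3) W1 pt] ..
    also have "\<dots> = zerom C (smd (Q n) b) (Shift C 1 ?W)" using that[OF b] nt by blast
    also have "\<dots> = component C (Q n) ?W1 (zerom C (tot (Q n)) (Shift C 1 ?W)) b j"
      using component_zero[OF Q dW1 b, of j] j0 by simp
    finally show "component C (Q n) ?W1 (Comp C (ShiftM C 1 ?\<pi>) (t n)) b j = component C (Q n) ?W1 (zerom C (tot (Q n)) (Shift C 1 ?W)) b j" .
  qed (rule pt, rule zero_mor[OF o(3) W1])
  \<comment> \<open>In the twice rotated triangle the map after \<open>t n\<close> is minus the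
    shift of \<open>f n\<close>; the sign is absorbed into \<open>s\<close>.\<close>
  from Tri_weak_cokernel[OF Tri_rotate[OF Tri_rotate[OF T]] W1 pi1 this]
  obtain e where e: "e \<in> mor C (Shift C 1 (tot (E n))) (Shift C 1 ?W)"
    "ShiftM C 1 ?\<pi> = Comp C e (\<ominus>\<^bsub>Hom C (Shift C 1 (tot ?A)) (Shift C 1 (tot (E n)))\<^esub> ShiftM C 1 (f n))" by blast
  have f1: "ShiftM C 1 (f n) \<in> mor C (Shift C 1 (tot ?A)) (Shift C 1 (tot (E n)))" by (rule ShiftM_closed[OF o(1,2,6)])
  define s where "s = ShiftM C (-1) (\<ominus>\<^bsub>Hom C (Shift C 1 (tot (E n))) (Shift C 1 ?W)\<^esub> e)"
  have ne: "\<ominus>\<^bsub>Hom C (Shift C 1 (tot (E n))) (Shift C 1 ?W)\<^esub> e \<in> mor C (Shift C 1 (tot (E n))) (Shift C 1 ?W)" by (rule neg_mor[OF o(5) W1 e(1)])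
  have s: "s \<in> mor C (tot (E n)) ?W"
    using ShiftM_closed[OF o(5) W1 ne, of "-1"] unfolding s_def Shift_neg_cancel(2)[OF o(2)] Shift_neg_cancel(2)[OF W] .
  have s1: "ShiftM C 1 s = \<ominus>\<^bsub>Hom C (Shift C 1 (tot (E n))) (Shift C 1 ?W)\<^esub> e"
    unfolding s_def by (rule ShiftM_neg_cancel(1)[OF ne o(5) W1])
  have sf: "Comp C s (f n) = ?\<pi>"
  proof (rule ShiftM_inj)
    show "ShiftM C 1 (Comp C s (f n)) = ShiftM C 1 ?\<pi>"
      unfolding ShiftM_Comp[OF o(1,2) W o(6) s] s1 e(2) Comp_neg(1)[OF o(4,5) W1 f1 e(1)] Comp_neg(2)[OF o(4,5) W1 f1 e(1)] ..
  qed (rule Comp_mor[OF o(6) s o(1,2) W] pi o(1) W)+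
  let ?u = "Comp C (f n) ?\<iota>"
  have u: "?u \<in> mor C ?W (tot (E n))" by (rule Comp_mor[OF io o(6) W o(1,2)])
  have su: "Comp C s ?u = Idm C ?W"
    unfolding Comp_assoc'[OF io o(6) s W o(1,2) W] sf using is_dec_proj_incl[OF A a a] by simp
  have top: "tot (E n) = X" unfolding E_top by simp
  have "is_isom C ?W (tot (E n)) ?u"
    unfolding top using local_retraction[OF indX W _ u[unfolded top] s[unfolded top] su] iW unfolding indecomposable_def by blast
  then obtain g where g: "is_isom C (tot (E n)) ?W g" "Comp C ?u g = Idm C (tot (E n))" by (rule is_isom_inverse)
  note gm = is_isom_mor[OF g(1)]
  have "Comp C (p n) ?u = zerom C ?W (tot (Q n))"
    unfolding Comp_assoc'[OF io o(6,7) W o(1,2,3)] Tri_comp_zero[OF T] by (rule Comp_zero(2)[OF W o(1,3) io])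
  then have "Comp C (Comp C (p n) ?u) g = zerom C (tot (E n)) (tot (Q n))" using Comp_zero(2)[OF o(2) W o(3) gm] by simp
  then have "p n = zerom C (tot (E n)) (tot (Q n))"
    unfolding Comp_assoc'[OF gm u o(7) o(2) W o(2,3), symmetric] g(2) Comp_Idm[OF o(2,3,7)] .
  then have "component C (E n) (Q n) (p n) 0 0 = zerom C (smd (E n) 0) (smd (Q n) 0)"
    using component_zero[OF column_dec(2)[OF nn] Q _ nsum_Q[OF nn], of 0] E_top by simp
  then show False using p_nonzero[OF nsum_Q[OF nn]] by blast
qed

text \<open>The nonzero components of \<open>f n\<close>, \<open>p n\<close> and \<open>t n\<close>
  at a suitable summand \<open>u\<close> form a connecting path from \<open>u\<close> to its shift,
  to which \<open>maslov_path\<close> applies. This gives excess \<open>1\<close> at one node, hence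
  at all of them.\<close>

lemma raise_one:
  assumes i: "i \<in> {1..n}" and a: "a < nsum (E (i - 1))"
  shows "pot ((i, 3), a) = pot ((i, 0), a) + 1"
proof -
  have nn: "n \<in> {1..n}" using n_pos by simp
  \<comment> \<open>For \<open>n = 1\<close> the column starts at the zero object
    \<open>E 0\<close>, and there is no summand \<open>a\<close> to consider.\<close>
  have n1: "n \<noteq> 1"
  proof
    assume "n = 1"
    then have "i - 1 = 0" using i by simp
    then show False using a nsum_E0 by simp
  qed
  obtain u where u: "u < nsum (E (n - 1))" and fu: "component C (E (n - 1)) (E n) (f n) u 0 \<noteq> zerom C (smd (E (n - 1)) u) (smd (E n) 0)"
    by (rule f_nonzero[OF n1])
  obtain b where b: "b < nsum (Q n)" and tb: "component C (Q n) (shift_dec C 1 (E (n - 1))) (t n) b u \<noteq> zerom C (smd (Q n) b) (Shift C 1 (smd (E (n - 1)) u))"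
    by (rule t_nonzero[OF u fu])
  note pb = p_nonzero[OF b]
  have En: "0 < nsum (E n)" using E_top by simp
  note d = column_dec[OF nn] and T = column[OF nn] and P = column_potential[OF nn]
  note o = TriD[OF T] and tp = tri_potentialD[OF d P]
  let ?D = "tri_diagram C (E (n - 1)) (E n) (Q n) (f n) (p n) (t n) {0..3}"
  note eqs = tri_obj_eqs(1-4)[OF d]
  have dD: "is_diagram C ?D" by (rule tri_diagram_is_diagram[OF d T])
  have vs: "vobj ?D 0 = E (n - 1)" "vobj ?D 1 = E n" "vobj ?D 2 = Q n" "vobj ?D 3 = shift_dec C 1 (E (n - 1))"
    by (simp_all only: tri_diagram_def diagram.simps eqs)
  have as: "arr ?D (0, 1) = f n" "arr ?D (1, 2) = p n" "arr ?D (2, 3) = t n"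
    by (simp_all add: tri_diagram_def tri_arr_def ShiftM_0[OF o(1,2,6)] ShiftM_0[OF o(2,3,7)] ShiftM_0[OF o(3,4,8)])
  have vD: "verts ?D = {0..3}" by (simp add: tri_diagram_def)
  have nd: "(0, u) \<in> nodes ?D" "(1, 0) \<in> nodes ?D" "(2, b) \<in> nodes ?D" "(3, u) \<in> nodes ?D"
    unfolding nodes_def mem_Collect_eq prod.case vs vD using u b En by simp_all
  have es: "(0, 1) \<in> edges ?D" "(1, 2) \<in> edges ?D" "(2, 3) \<in> edges ?D" by (simp_all add: tri_diagram_def)
  note defs = node_obj_def arr_comp_def fst_conv snd_conv vs as shift_dec_nth(1)[OF u]
  have c1: "connected_by C (grading \<sigma>) ?D (0, u) (1, 0) (deg (grading \<sigma>) (node_obj ?D (0, u)) (node_obj ?D (1, 0)) (arr_comp C ?D (0, u) (1, 0)))"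
  proof (rule connected_by_step(1)[OF dD nd(1,2)])
    show "homogeneous (grading \<sigma>) (node_obj ?D (0, u)) (node_obj ?D (1, 0)) (arr_comp C ?D (0, u) (1, 0))"
      unfolding defs homogeneous_def using tp(1)[OF u En] unfolding ShiftM_0[OF o(1,2,6)] by blast
    show "arr_comp C ?D (0, u) (1, 0) \<noteq> zerom C (node_obj ?D (0, u)) (node_obj ?D (1, 0))" unfolding defs by (rule fu)
  qed (use es in simp)
  have c2: "connected_by C (grading \<sigma>) ?D (1, 0) (2, b) (deg (grading \<sigma>) (node_obj ?D (1, 0)) (node_obj ?D (2, b)) (arr_comp C ?D (1, 0) (2, b)))"
  proof (rule connected_by_step(1)[OF dD nd(2,3)])
    show "homogeneous (grading \<sigma>) (node_obj ?D (1, 0)) (node_obj ?D (2, b)) (arr_comp C ?D (1, 0) (2, b))"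
      unfolding defs homogeneous_def using tp(2)[OF En b] unfolding ShiftM_0[OF o(2,3,7)] by blast
    show "arr_comp C ?D (1, 0) (2, b) \<noteq> zerom C (node_obj ?D (1, 0)) (node_obj ?D (2, b))" unfolding defs by (rule pb)
  qed (use es in simp)
  have c3: "connected_by C (grading \<sigma>) ?D (2, b) (3, u) (deg (grading \<sigma>) (node_obj ?D (2, b)) (node_obj ?D (3, u)) (arr_comp C ?D (2, b) (3, u)))"
  proof (rule connected_by_step(1)[OF dD nd(3,4)])
    show "homogeneous (grading \<sigma>) (node_obj ?D (2, b)) (node_obj ?D (3, u)) (arr_comp C ?D (2, b) (3, u))"
      unfolding defs homogeneous_def using tp(3)[OF b u] unfolding ShiftM_0[OF o(3,4,8)] by blast
    show "arr_comp C ?D (2, b) (3, u) \<noteq> zerom C (node_obj ?D (2, b)) (node_obj ?D (3, u))" unfolding defs by (rule tb)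
  qed (use es in simp)
  from maslov_path(2)[OF d T P u connected_by_trans[OF c1 connected_by_trans[OF c2 c3]]] have "raise ((n, 0), u) = 1" by simp
  moreover have "raise ((i, 0), a) = raise ((n, 0), u)"
    by (rule raise_constant) (simp_all only: small_nodes(1)[OF i] small_nodes(1)[OF nn] a u)
  ultimately show ?thesis by simp
qed

text \<open>With a single column there is no neighbouring factor to compare with. Then
  \<open>Q n\<close> is isomorphic to \<open>X\<close> and has one summand by uniqueness of
  decompositions.\<close>

lemma Q_one:
  assumes "n = 1" shows "nsum (Q n) = 1"
proof -
  have nn: "n \<in> {1..n}" using n_pos by simp
  note T = column[OF nn] and o = TriD[OF column[OF nn]] and Q = column_dec(3)[OF nn]
  have top: "tot (E n) = X" unfolding E_top by simp
  have N: "zero_obj C (tot (E (n - 1)))" using zero_E0 assms by simp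
  have fz: "f n = zerom C (tot (E (n - 1))) X" using zero_obj_mor(1)[OF N o(2,6)] unfolding top .
  have XO: "X \<in> Ob C" by (rule indecomposable_Ob[OF indX])
  obtain c where c: "is_isom C X (tot (Q n)) c" using Tri_map_id[OF Tri_zero_left[OF XO N] T[unfolded fz top]] by blast
  then obtain g where g: "is_isom C (tot (Q n)) X g" "Comp C g c = Idm C X" "Comp C c g = Idm C (tot (Q n))"
    by (rule is_isom_inverse)
  have "is_dec C (tot (Q n), [(X, c, g)])"
    by (rule is_dec_iso[OF indX o(3) is_isom_mor[OF c] is_isom_mor[OF g(1)] g(2,3)])
  from dec_unique[OF Q this] obtain \<tau> where "bij_betw \<tau> {..<nsum (Q n)} {..<nsum (tot (Q n), [(X, c, g)])}" by auto
  from bij_betw_same_card[OF this] show ?thesis by simp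
qed

text \<open>The degree of a path is the increment of the potential, and the constant
  \<open>c\<close> is common to all pairs of summands; comparing two sources with the same target
  gives the second claim.\<close>

lemma Q_drop:
  assumes i: "i \<in> {2..n}" and a: "a < nsum (Q (i - 1))"
  shows "\<exists>c < 0. \<forall>b < nsum (Q i). pot ((i, 2), b) = pot ((i - 1, 2), a) + c"
    and "\<And>a'. a' < nsum (Q (i - 1)) \<Longrightarrow> pot ((i - 1, 2), a') = pot ((i - 1, 2), a)"
proof -
  have i': "i \<in> {1..n}" using i by simp
  obtain c where c: "c < 0" and q: "\<And>a b. a < nsum (Q (i - 1)) \<Longrightarrow> b < nsum (Q i) \<Longrightarrow>
        (\<exists>ps. simple_path_in C (grading \<sigma>) (H {0, 1, 2}) ((i - 1, 2), a) ps ((i, 2), b)) \<and>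
        (\<forall>ps. simple_path_in C (grading \<sigma>) (H {0, 1, 2}) ((i - 1, 2), a) ps ((i, 2), b) \<longrightarrow>
              q_in C (grading \<sigma>) (H {0, 1, 2}) ((i - 1, 2), a) ps = c)"
    using drop[OF i] by blast
  have e: "pot ((i, 2), b) = pot ((i - 1, 2), a) + c" if ab: "a < nsum (Q (i - 1))" "b < nsum (Q i)" for a b
  proof -
    obtain ps where ps: "simple_path_in C (grading \<sigma>) (H {0, 1, 2}) ((i - 1, 2), a) ps ((i, 2), b)" using q[OF ab] by blast
    then have "q_in C (grading \<sigma>) (H {0, 1, 2}) ((i - 1, 2), a) ps = c" using q[OF ab] by blast
    moreover have "path_in C (grading \<sigma>) (H {0, 1, 2}) ((i - 1, 2), a) ps ((i, 2), b)" using ps unfolding simple_path_in_def by blast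
    ultimately show ?thesis using potential_q[OF small_diagram small_potential] by fastforce
  qed
  show "\<exists>c < 0. \<forall>b < nsum (Q i). pot ((i, 2), b) = pot ((i - 1, 2), a) + c" using c e[OF a] by blast
  show "pot ((i - 1, 2), a') = pot ((i - 1, 2), a)" if "a' < nsum (Q (i - 1))" for a'
    using e[OF a nsum_Q[OF i']] e[OF that nsum_Q[OF i']] by simp
qed

text \<open>Constancy comes from the comparison with the next factor, for the last factor from the
  comparison with the previous one, and for a single factor from \<open>Q_one\<close>.\<close>

lemma Q_constant:
  assumes i: "i \<in> {1..n}" and a: "a < nsum (Q i)"
  shows "pot ((i, 2), a) = pot ((i, 2), 0)"
proof (cases "i < n")
  case True
  then have j: "i + 1 \<in> {2..n}" using i by simp
  show ?thesis using Q_drop(2)[OF j, of 0 a] nsum_Q[OF i] a by simp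
next
  case False
  then have n: "i = n" using i by simp
  show ?thesis
  proof (cases "n = 1")
    case True
    then show ?thesis using Q_one a n by simp
  next
    case False
    then have j: "i \<in> {2..n}" and i1: "i - 1 \<in> {1..n}" using n n_pos by simp_all
    show ?thesis using Q_drop(1)[OF j nsum_Q[OF i1]] a nsum_Q[OF i] by auto
  qed
qed

lemma Q_decreasing:
  "1 \<le> i \<Longrightarrow> i < j \<Longrightarrow> j \<le> n \<Longrightarrow> pot ((j, 2), 0) < pot ((i, 2), 0)"
proof (induction j)
  case 0 then show ?case by simp
next
  case (Suc j)
  have j: "Suc j \<in> {2..n}" "j \<in> {1..n}" "Suc j \<in> {1..n}" using Suc.prems by simp_all
  have "0 < nsum (Q (Suc j - 1))" using nsum_Q[OF j(2)] by simp
  from Q_drop(1)[OF j(1) this] have "pot ((Suc j, 2), 0) < pot ((j, 2), 0)" using nsum_Q[OF j(3)] by auto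
  moreover have "pot ((j, 2), 0) \<le> pot ((i, 2), 0)" using Suc by (cases "i = j") auto
  ultimately show ?case by simp
qed

text \<open>The potential is translated so that the top object \<open>X\<close>, at the node
  \<open>((n, 1), 0)\<close>, gets the prescribed phase.\<close>

definition lifted_E :: "real \<Rightarrow> nat \<Rightarrow> ('o, 'm) lobj" where
  "lifted_E \<theta> i = (E i, map (\<lambda>k. pot ((i, 1), k) - pot ((n, 1), 0) + \<theta>) [0..<nsum (E i)])"

definition lifted_Q :: "real \<Rightarrow> nat \<Rightarrow> ('o, 'm) lobj" where
  "lifted_Q \<theta> i = (Q i, map (\<lambda>k. pot ((i, 2), k) - pot ((n, 1), 0) + \<theta>) [0..<nsum (Q i)])"

lemma congruent_phase:
  assumes \<theta>: "[\<theta> = phase \<sigma> X] (rmod 2)" and a: "a \<in> nodes (H {0, 1, 2})"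
  shows "[pot a - pot ((n, 1), 0) + \<theta> = phase \<sigma> (node_obj (H {0, 1, 2}) a)] (rmod 2)"
proof -
  obtain k m :: int where "\<theta> - phase \<sigma> X = 2 * of_int k"
      "(pot a - pot ((n, 1), 0)) - (phase \<sigma> (node_obj (H {0, 1, 2}) a) - phase \<sigma> X) = 2 * of_int m"
    using \<theta> small_congruent[OF a] unfolding rcong2_iff by blast
  then have "pot a - pot ((n, 1), 0) + \<theta> - phase \<sigma> (node_obj (H {0, 1, 2}) a) = 2 * of_int (k + m)" by simp
  then show ?thesis unfolding rcong2_iff by blast
qed

lemma lifted_E_Ob:
  assumes \<theta>: "[\<theta> = phase \<sigma> X] (rmod 2)" and i: "i \<le> n"
  shows "lifted_E \<theta> i \<in> lift_Ob C (phase \<sigma>)"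
proof -
  have "[pot ((i, 1), k) - pot ((n, 1), 0) + \<theta> = phase \<sigma> (smd (E i) k)] (rmod 2)" if k: "k < nsum (E i)" for k
  proof -
    have i': "i \<in> {1..n}" using i k nsum_E0 by (cases "i = 0") simp_all
    have "((i, 1), k) \<in> nodes (H {0, 1, 2})" unfolding small_nodes(2)[OF i'] by (rule k)
    from congruent_phase[OF \<theta> this] show ?thesis unfolding small_arr(5)[OF i'] .
  qed
  then show ?thesis unfolding lifted_E_def lift_Ob_def using dec_E[OF i] by simp
qed

lemma lifted_Q_phase:
  assumes \<theta>: "[\<theta> = phase \<sigma> X] (rmod 2)" and i: "i \<in> {1..n}" and k: "k < nsum (Q i)"
  shows "[pot ((i, 2), k) - pot ((n, 1), 0) + \<theta> = phase \<sigma> (smd (Q i) k)] (rmod 2)"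
proof -
  have "((i, 2), k) \<in> nodes (H {0, 1, 2})" unfolding small_nodes(3)[OF i] by (rule k)
  from congruent_phase[OF \<theta> this] show ?thesis unfolding small_arr(6)[OF i] .
qed

lemma lifted_Q_Ob:
  assumes \<theta>: "[\<theta> = phase \<sigma> X] (rmod 2)" and i: "i \<in> {1..n}"
  shows "lifted_Q \<theta> i \<in> lift_Ob C (phase \<sigma>)"
  unfolding lifted_Q_def lift_Ob_def using dec_Q[OF i] lifted_Q_phase[OF \<theta> i] by simp

lemma lifted_Q_slice:
  assumes \<theta>: "[\<theta> = phase \<sigma> X] (rmod 2)" and i: "i \<in> {1..n}"
  shows "lifted_Q \<theta> i \<in> lift_slice C \<sigma> (pot ((i, 2), 0) - pot ((n, 1), 0) + \<theta>)"
proof -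
  obtain \<psi> where psi: "\<psi> \<in> {0<..2}" "tot (Q i) \<in> slice \<sigma> \<psi>" using Q_slice[OF i] by (elim bexE)
  have "snd (lifted_Q \<theta> i) ! k = pot ((i, 2), 0) - pot ((n, 1), 0) + \<theta> \<and>
      (\<exists>\<psi> \<in> {0<..2}. [\<psi> = pot ((i, 2), 0) - pot ((n, 1), 0) + \<theta>] (rmod 2) \<and> smd (Q i) k \<in> slice \<sigma> \<psi>)" if k: "k < nsum (Q i)" for k
  proof
    show "snd (lifted_Q \<theta> i) ! k = pot ((i, 2), 0) - pot ((n, 1), 0) + \<theta>" unfolding lifted_Q_def using k Q_constant[OF i k] by simp
    have s: "smd (Q i) k \<in> slice \<sigma> \<psi>" by (rule slice_smd[OF psi(1) dec_Q[OF i] psi(2) k])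
    have "phase \<sigma> (smd (Q i) k) = \<psi>" using slice_phase[OF psi(1) is_dec_smd[OF dec_Q[OF i] k] s] by simp
    then have "[\<psi> = pot ((i, 2), 0) - pot ((n, 1), 0) + \<theta>] (rmod 2)"
      using lifted_Q_phase[OF \<theta> i k] Q_constant[OF i k] by (simp add: rcong_sym)
    then show "\<exists>\<psi> \<in> {0<..2}. [\<psi> = pot ((i, 2), 0) - pot ((n, 1), 0) + \<theta>] (rmod 2) \<and> smd (Q i) k \<in> slice \<sigma> \<psi>" using psi(1) s by blast
  qed
  then show ?thesis unfolding lift_slice_def using lifted_Q_Ob[OF \<theta> i] by (simp add: lifted_Q_def)
qed

lemma E_step:
  assumes i: "i \<in> {1..n}" and a: "a < nsum (E (i - 1))"
  shows "pot ((i, 0), a) = pot ((i - 1, 1), a)"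
proof -
  have "i - 1 \<noteq> 0" using a nsum_E0 by (intro notI) simp
  then have "i - 1 \<in> {1..n}" "i - 1 + 1 \<in> {1..n}" "i - 1 + 1 = i" using i by auto
  from identity_potential(1)[OF this(1,2) a] this(3) show ?thesis by simp
qed

text \<open>For \<open>f i\<close> and \<open>p i\<close> the degrees match because phases are
  values of one potential, with \<open>E_step\<close> identifying the two copies of
  \<open>E (i - 1)\<close>. For \<open>t i\<close> the target is a shift, whose phases are one more
  by definition; \<open>raise_one\<close> says that the potential does the same.\<close>

lemma lift_column:
  assumes \<theta>: "[\<theta> = phase \<sigma> X] (rmod 2)" and i: "i \<in> {1..n}"
  shows "(lifted_E \<theta> (i - 1), lifted_E \<theta> i, lifted_Q \<theta> i, f i, p i, t i) \<in> Tri T"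
proof -
  note d = column_dec[OF i] and T = column[OF i] and P = column_potential[OF i]
  note o = TriD[OF T] and tp = tri_potentialD[OF d P]
  have E1: "lifted_E \<theta> (i - 1) \<in> lift_Ob C (phase \<sigma>)" and E: "lifted_E \<theta> i \<in> lift_Ob C (phase \<sigma>)" using i by (auto intro: lifted_E_Ob[OF \<theta>])
  note Q = lifted_Q_Ob[OF \<theta> i]
  have pr: "lift_proj (lifted_E \<theta> j) = tot (E j)" "lift_proj (lifted_Q \<theta> j) = tot (Q j)" for j unfolding lift_proj_def lifted_E_def lifted_Q_def by simp_all
  have "f i \<in> lift_mor C (grading \<sigma>) (lifted_E \<theta> (i - 1)) (lifted_E \<theta> i)"
  proof (rule lift_morI)
    show "f i \<in> mor C (lift_proj (lifted_E \<theta> (i - 1))) (lift_proj (lifted_E \<theta> i))" unfolding pr by (rule o(6))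
    fix a b assume "a < nsum (fst (lifted_E \<theta> (i - 1)))" "b < nsum (fst (lifted_E \<theta> i))"
    then have ab: "a < nsum (E (i - 1))" "b < nsum (E i)" by (simp_all add: lifted_E_def)
    show "component C (fst (lifted_E \<theta> (i - 1))) (fst (lifted_E \<theta> i)) (f i) a b
        \<in> grading \<sigma> (snd (lifted_E \<theta> i) ! b - snd (lifted_E \<theta> (i - 1)) ! a) (smd (fst (lifted_E \<theta> (i - 1))) a) (smd (fst (lifted_E \<theta> i)) b)"
      using tp(1)[OF ab] unfolding ShiftM_0[OF o(1,2,6)] using ab E_step[OF i ab(1)] by (simp add: lifted_E_def)
  qed
  moreover have "p i \<in> lift_mor C (grading \<sigma>) (lifted_E \<theta> i) (lifted_Q \<theta> i)"
  proof (rule lift_morI)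
    show "p i \<in> mor C (lift_proj (lifted_E \<theta> i)) (lift_proj (lifted_Q \<theta> i))" unfolding pr by (rule o(7))
    fix a b assume "a < nsum (fst (lifted_E \<theta> i))" "b < nsum (fst (lifted_Q \<theta> i))"
    then have ab: "a < nsum (E i)" "b < nsum (Q i)" by (simp_all add: lifted_E_def lifted_Q_def)
    show "component C (fst (lifted_E \<theta> i)) (fst (lifted_Q \<theta> i)) (p i) a b
        \<in> grading \<sigma> (snd (lifted_Q \<theta> i) ! b - snd (lifted_E \<theta> i) ! a) (smd (fst (lifted_E \<theta> i)) a) (smd (fst (lifted_Q \<theta> i)) b)"
      using tp(2)[OF ab] unfolding ShiftM_0[OF o(2,3,7)] using ab by (simp add: lifted_E_def lifted_Q_def)
  qed
  moreover have "t i \<in> lift_mor C (grading \<sigma>) (lifted_Q \<theta> i) (lift_shift C 1 (lifted_E \<theta> (i - 1)))"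
  proof (rule lift_morI)
    show "t i \<in> mor C (lift_proj (lifted_Q \<theta> i)) (lift_proj (lift_shift C 1 (lifted_E \<theta> (i - 1))))" unfolding T_sel(10) pr by (rule o(8))
    fix b a assume "b < nsum (fst (lifted_Q \<theta> i))" "a < nsum (fst (lift_shift C 1 (lifted_E \<theta> (i - 1))))"
    then have ab: "b < nsum (Q i)" "a < nsum (E (i - 1))" unfolding lift_shift_sel(1)[OF E1] by (simp_all add: lifted_E_def lifted_Q_def)
    have a': "a < nsum (fst (lifted_E \<theta> (i - 1)))" using ab by (simp add: lifted_E_def)
    show "component C (fst (lifted_Q \<theta> i)) (fst (lift_shift C 1 (lifted_E \<theta> (i - 1)))) (t i) b a
        \<in> grading \<sigma> (snd (lift_shift C 1 (lifted_E \<theta> (i - 1))) ! a - snd (lifted_Q \<theta> i) ! b) (smd (fst (lifted_Q \<theta> i)) b) (smd (fst (lift_shift C 1 (lifted_E \<theta> (i - 1)))) a)"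
      unfolding lift_shift_sel(1)[OF E1] lift_shift_sel(2)[OF E1 a'] shift_dec_nth(1)[OF a']
      using tp(3)[OF ab] unfolding ShiftM_0[OF o(3,4,8)] using ab raise_one[OF i ab(2)] E_step[OF i ab(2)]
      by (simp add: lifted_E_def lifted_Q_def algebra_simps)
  qed
  ultimately show ?thesis unfolding Tri_T pr using E1 E Q T by simp
qed

text \<open>Each column puts its factor in front of the list; the reversal places the last factor,
  which has the smallest phase, at the head.\<close>

lemma hn_list_lifted_E:
  assumes \<theta>: "[\<theta> = phase \<sigma> X] (rmod 2)"
  shows "i \<le> n \<Longrightarrow> hn_list T (lift_slice C \<sigma>) (rev (map (\<lambda>j. pot ((j, 2), 0) - pot ((n, 1), 0) + \<theta>) [1..<Suc i])) (lifted_E \<theta> i)"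
proof (induction i)
  case 0
  have "zero_obj T (lifted_E \<theta> 0)"
    by (rule T_zero_objI[OF lifted_E_Ob[OF \<theta>]]) (use zero_E0 in \<open>simp_all add: lifted_E_def lift_proj_def\<close>)
  then show ?case by simp
next
  case (Suc i)
  have i: "Suc i \<in> {1..n}" using Suc.prems by simp
  let ?h = "\<lambda>j. pot ((j, 2), 0) - pot ((n, 1), 0) + \<theta>"
  have l: "rev (map ?h [1..<Suc (Suc i)]) = ?h (Suc i) # rev (map ?h [1..<Suc i])" by simp
  have IH: "hn_list T (lift_slice C \<sigma>) (rev (map ?h [1..<Suc i])) (lifted_E \<theta> i)" by (rule Suc.IH) (use Suc.prems in simp)
  have tr: "(lifted_E \<theta> i, lifted_E \<theta> (Suc i), lifted_Q \<theta> (Suc i), f (Suc i), p (Suc i), t (Suc i)) \<in> Tri T"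
    using lift_column[OF \<theta> i] by simp
  show ?case unfolding l hn_list.simps by (intro exI conjI) (rule IH, rule lifted_Q_slice[OF \<theta> i], rule tr)
qed

lemma hn_list_indecomposable:
  assumes \<theta>: "[\<theta> = phase \<sigma> X] (rmod 2)"
  shows "\<exists>\<theta>s. sorted_wrt (<) \<theta>s \<and> hn_list T (lift_slice C \<sigma>) \<theta>s (single_dec C X, [\<theta>])"
proof -
  have "lifted_E \<theta> n = (single_dec C X, [\<theta>])" unfolding lifted_E_def E_top by simp
  moreover have "sorted_wrt (<) (rev (map (\<lambda>j. pot ((j, 2), 0) - pot ((n, 1), 0) + \<theta>) [1..<Suc n]))"
    unfolding sorted_wrt_rev sorted_wrt_map
    by (rule sorted_wrt_mono_rel[OF _ sorted_wrt_upt]) (auto intro: Q_decreasing)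
  ultimately show ?thesis using hn_list_lifted_E[OF \<theta> order_refl] by metis
qed

end

section \<open>Assembling the Bridgeland stability condition\<close>

context maslov_stable
begin

text \<open>For a pair of an indecomposable object and a phase, the filtration of the object and any
  potential on its full diagram instantiate the locale above. Other objects are reached by adding
  filtrations.\<close>

lemma ex_hn_list:
  assumes "X \<in> lift_Ob C (phase \<sigma>)"
  shows "\<exists>\<theta>s. sorted_wrt (<) \<theta>s \<and> hn_list T (lift_slice C \<sigma>) \<theta>s X"
  using assms
proof (induction X rule: lift_induct)
  case (zero N)
  then show ?case by (intro exI[of _ "[]"]) simp
next
  case (single i)
  note ind = lift_ObD(5)[OF assms single(1)] and \<theta> = lift_ObD(3)[OF assms single(1)]
  obtain n E Q f p t where F: "HN_filtration C \<sigma> (smd (fst X) i) n E Q f p t" using ex_HN[OF ind] by (elim exE)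
  then have "liftable C (grading \<sigma>) (HN_diagram C n E Q f p t UNIV)" unfolding HN_filtration_def by (elim conjE)
  then obtain pot where "potential C (grading \<sigma>) (HN_diagram C n E Q f p t UNIV) pot" using liftable_potential by blast
  with ind F interpret HN: harder_narasimhan K C \<beta> \<Lambda> v \<sigma> "smd (fst X) i" n E Q f p t pot
    by unfold_locales
  show ?case by (rule HN.hn_list_indecomposable[OF \<theta>])
next
  case (sum A B Y i1 i2 p1 p2)
  interpret LT: triangulated_category K T by (rule lift_triangulated)
  show ?case
    by (rule LT.hn_list_biproduct_ex[OF _ _ sum]) (erule lift_slice_zero, erule (1) lift_slice_sum)
qed

lemma lift_bridgeland:
  assumes v: "v \<in> hom (K0 C) \<Lambda>" and ind: "induced_by_lift_proj C \<sigma> \<pi>\<^sub>0"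
  shows "bridgeland_stability_condition T \<Lambda> (v \<circ> \<pi>\<^sub>0) (lift_slice C \<sigma>) (charge \<sigma> \<circ> \<pi>\<^sub>0)"
proof -
  interpret LT: triangulated_category K T by (rule lift_triangulated)
  have h: "\<pi>\<^sub>0 \<in> hom (K0 T) (K0 C)" and c: "\<And>X. X \<in> lift_Ob C (phase \<sigma>) \<Longrightarrow> \<pi>\<^sub>0 (K0_class T X) = K0_class C (lift_proj X)"
    using ind unfolding induced_by_lift_proj_def by simp_all
  obtain Z' where Z: "charge \<sigma> \<in> hom (K0 C) complex_group" and Z': "Z' \<in> hom \<Lambda> complex_group" "\<And>x. x \<in> carrier (K0 C) \<Longrightarrow> charge \<sigma> x = Z' (v x)"
    using charge unfolding central_charge_def by blast
  show ?thesis
  proof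
    show "v \<circ> \<pi>\<^sub>0 \<in> hom (K0 T) \<Lambda>" by (rule Group.hom_compose[OF h v])
    show "central_charge T \<Lambda> (v \<circ> \<pi>\<^sub>0) (charge \<sigma> \<circ> \<pi>\<^sub>0)"
      unfolding central_charge_def using Group.hom_compose[OF h Z] Z' hom_in_carrier[OF h] by auto
    show "lift_slice C \<sigma> \<theta> \<subseteq> Ob T" for \<theta> using lift_slice_Ob unfolding T_sel by blast
    show "\<exists>m > 0. (charge \<sigma> \<circ> \<pi>\<^sub>0) (K0_class T X) = of_real m * exp (\<i> * of_real pi * of_real \<theta>)"
      if X: "X \<in> lift_slice C \<sigma> \<theta>" "\<not> zero_obj T X" for X \<theta>
    proof -
      obtain m where m: "m \<ge> 0" "charge \<sigma> (K0_class C (lift_proj X)) = of_real m * exp (\<i> * of_real pi * of_real \<theta>)"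
        "m = 0 \<longrightarrow> zero_obj C (lift_proj X)" using lift_slice_charge[OF X(1)] by (elim exE conjE)
      have "m \<noteq> 0" using m(3) X(2) T_zero_objI[OF lift_slice_Ob[OF X(1)]] by blast
      then show ?thesis using m(1,2) c[OF lift_slice_Ob[OF X(1)]] by (intro exI[of _ m]) simp
    qed
    show "lift_slice C \<sigma> (\<theta> + 1) = Shift T 1 ` lift_slice C \<sigma> \<theta>" for \<theta> by (rule lift_slice_shift)
    show "mor T A1 A2 = {zerom T A1 A2}" if "A1 \<in> lift_slice C \<sigma> \<theta>1" "A2 \<in> lift_slice C \<sigma> \<theta>2" "\<theta>1 > \<theta>2" for A1 A2 \<theta>1 \<theta>2
      by (rule lift_slice_Hom[OF that])
    show "\<exists>n E \<theta>. bridgeland_HN T (lift_slice C \<sigma>) X n E \<theta>" if X: "X \<in> Ob T" for X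
    proof -
      obtain \<theta>s where "sorted_wrt (<) \<theta>s" "hn_list T (lift_slice C \<sigma>) \<theta>s X" using ex_hn_list X unfolding T_sel by blast
      from LT.hn_list_bridgeland[OF this(2,1)] show ?thesis by blast
    qed
  qed
qed

end

theorem theorem1p1:
  fixes K :: "'k ring" and C :: "('o, 'm, 'k) tricat" and \<beta> :: "'o \<Rightarrow> 'm"
    and \<Lambda> :: "'l monoid" and v :: "('o \<Rightarrow>\<^sub>0 int) set \<Rightarrow> 'l"
    and \<sigma> :: "('o, 'm) stability"
  assumes "cyclic_category K C \<beta>"
    and "finite_rank_lattice \<Lambda>" and "v \<in> hom (K0 C) \<Lambda>"
    and "stability_condition K C \<beta> \<Lambda> v \<sigma>"
    and "\<And>E p l. basic_loop C \<beta> (grading \<sigma>) E p l \<Longrightarrow> maslov_index (grading \<sigma>) E p = 0"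
  shows "triangulated_category K (lift_category C (phase \<sigma>) (grading \<sigma>)) \<and>
    (\<exists>\<pi>\<^sub>0. induced_by_lift_proj C \<sigma> \<pi>\<^sub>0 \<and>
       bridgeland_stability_condition (lift_category C (phase \<sigma>) (grading \<sigma>)) \<Lambda>
         (v \<circ> \<pi>\<^sub>0) (lift_slice C \<sigma>) (charge \<sigma> \<circ> \<pi>\<^sub>0))"
proof -
  interpret maslov_stable K C \<beta> \<Lambda> v \<sigma>
    using assms(1,4,5) by (intro maslov_stable.intro maslov_stable_axioms.intro)
  obtain \<pi>\<^sub>0 where "induced_by_lift_proj C \<sigma> \<pi>\<^sub>0"
    using K0_projection unfolding induced_by_lift_proj_def by blast
  then show ?thesis using lift_triangulated lift_bridgeland[OF assms(3)] by blast
qed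

end
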